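(* Let $X$ be a general curve of genus $g\ge 2$, let $s\ge 3$ and $d$ be integers with $d<s+2g-\frac{4g}{s+2}$. If $G_0(2,d,2+s)$ is non-empty, then $G(\alpha:2,d,2+s)$ is non-empty for all $\alpha>0$. Moreover, $U^s(2,d,2+s)\neq\emptyset$.
   Context: $X$ is a smooth irreducible projective curve of genus $g\ge 2$ over $\mathbb{C}$; "general" means that $X$ is a Petri curve, i.e. for every line bundle $L$ on $X$ the multiplication map $H^0(L)\otimes H^0(L^*\otimes K)\to H^0(K)$ is injective, where $K$ is the canonical bundle. A coherent system of type $(n,d,k)$ is a pair $(E,V)$ with $E$ a vector bundle on $X$ of rank $n$ and degree $d$ and $V\subseteq H^0(X,E)$ a linear subspace of dimension $k$. A coherent subsystem $(F,W)\subseteq (E,V)$ is a coherent system with $F\subseteq E$ and $W\subseteq V\cap H^0(F)$. For $\alpha\in\mathbb{R}$ put $\mu_\alpha(E,V)=\frac{d}{n}+\alpha\frac{k}{n}$; $(E,V)$ is $\alpha$-stable if $\mu_\alpha(F,W)<\mu_\alpha(E,V)$ for all proper (nonzero, $\ne(E,V)$) coherent subsystems $(F,W)$. $G(\alpha:n,d,k)$ is the moduli space of $\alpha$-stable coherent systems of type $(n,d,k)$. It is independent of $\alpha$ for all sufficiently small $\alpha>0$ (between $0$ and the first positive virtual critical point), and $G_0(n,d,k)$ denotes $G(\alpha:n,d,k)$ for such small $\alpha>0$. $U^s(n,d,k)$ is the set of coherent systems of type $(n,d,k)$ that are $\alpha$-stable for all $\alpha>0$. *)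

theory Defs
  imports
    "HOL-Analysis.Analysis"
    "HOL-Library.Poly_Mapping"
    "HOL-Library.Function_Algebras"
    "Jordan_Normal_Form.Determinant"
begin

section \<open>Projective varieties over the complex numbers\<close>

text \<open>
  A point of projective space is an orbit of nonzero coordinate vectors under scaling by nonzero
  complex numbers. The space \<open>\<P>\<^sup>N\<close> uses the coordinates \<open>0, \<dots>, N\<close>; the remaining
  coordinates are \<open>0\<close>, so that \<open>\<P>\<^sup>N \<subseteq> \<P>\<^sup>M\<close> for \<open>N \<le> M\<close>, and a polynomial involving further
  variables acts on \<open>\<P>\<^sup>N\<close> as the polynomial in which these variables are set to \<open>0\<close>.
\<close>

type_synonym point = "(nat \<Rightarrow> complex) set"
type_synonym mpoly = "(nat \<Rightarrow>\<^sub>0 nat) \<Rightarrow>\<^sub>0 complex"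

definition proj_space :: "nat \<Rightarrow> point set" where
  "proj_space N = {{\<lambda>i. c * v i | c. c \<noteq> 0} | v. v \<noteq> (\<lambda>_. 0) \<and> (\<forall>i>N. v i = 0)}"

definition eval_mpoly :: "mpoly \<Rightarrow> (nat \<Rightarrow> complex) \<Rightarrow> complex" where
  "eval_mpoly F v =
     (\<Sum>m\<in>Poly_Mapping.keys F. Poly_Mapping.lookup F m *
        (\<Prod>i\<in>Poly_Mapping.keys m. v i ^ Poly_Mapping.lookup m i))"

definition homogeneous :: "nat \<Rightarrow> mpoly \<Rightarrow> bool" where
  "homogeneous e F \<longleftrightarrow>
     (\<forall>m\<in>Poly_Mapping.keys F. (\<Sum>i\<in>Poly_Mapping.keys m. Poly_Mapping.lookup m i) = e)"

text \<open>
  The topology on \<open>A\<close> induced by the Zariski topology of projective space; its basic open sets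
  are the non-vanishing loci of homogeneous polynomials.
\<close>

definition zariski :: "point set \<Rightarrow> point topology" where
  "zariski A = topology_generated_by
     {{p \<in> A. \<forall>v\<in>p. eval_mpoly F v \<noteq> 0} | F. \<exists>e. homogeneous e F}"

definition irreducible_closed :: "'a topology \<Rightarrow> 'a set \<Rightarrow> bool" where
  "irreducible_closed T Z \<longleftrightarrow> closedin T Z \<and> Z \<noteq> {} \<and>
     (\<forall>A B. closedin T A \<and> closedin T B \<and> Z \<subseteq> A \<union> B \<longrightarrow> Z \<subseteq> A \<or> Z \<subseteq> B)"

definition krull_dim :: "'a topology \<Rightarrow> enat" where
  "krull_dim T = Sup {enat n | n. \<exists>Z :: nat \<Rightarrow> 'a set.
     (\<forall>i\<le>n. irreducible_closed T (Z i)) \<and> (\<forall>i<n. Z i \<subset> Z (Suc i))}"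

definition projective_variety :: "point set \<Rightarrow> bool" where
  "projective_variety X \<longleftrightarrow> (\<exists>N. irreducible_closed (zariski (proj_space N)) X)"


section \<open>Regular functions and tangent spaces\<close>

text \<open>
  Functions and sections over an open set \<open>U\<close> are total functions that vanish outside \<open>U\<close>.
\<close>

definition restr :: "'a set \<Rightarrow> ('a \<Rightarrow> 'b::zero) \<Rightarrow> 'a \<Rightarrow> 'b" where
  "restr U f = (\<lambda>p. if p \<in> U then f p else 0)"

definition reg :: "point set \<Rightarrow> point set \<Rightarrow> (point \<Rightarrow> complex) set" where
  "reg X U = {f. (\<forall>p. p \<notin> U \<longrightarrow> f p = 0) \<and>
     (\<forall>p\<in>U. \<exists>W e F G. openin (zariski X) W \<and> p \<in> W \<and> W \<subseteq> U \<and>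
        homogeneous e F \<and> homogeneous e G \<and>
        (\<forall>q\<in>W. \<forall>v\<in>q. eval_mpoly G v \<noteq> 0 \<and> f q = eval_mpoly F v / eval_mpoly G v))}"

definition reg_at :: "point set \<Rightarrow> point \<Rightarrow> (point \<Rightarrow> complex) set" where
  "reg_at X p = {f. \<exists>U. openin (zariski X) U \<and> p \<in> U \<and> restr U f \<in> reg X U}"

definition scale_fun :: "complex \<Rightarrow> ('a \<Rightarrow> complex) \<Rightarrow> 'a \<Rightarrow> complex" where
  "scale_fun c f = (\<lambda>x. c * f x)"

global_interpretation cfun: vector_space "scale_fun :: complex \<Rightarrow> ('a \<Rightarrow> complex) \<Rightarrow> 'a \<Rightarrow> complex"
  by standard (auto simp: scale_fun_def fun_eq_iff algebra_simps)

text \<open>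
  The Zariski tangent space at \<open>p\<close>: the derivations of the local ring at \<open>p\<close> with values in
  \<open>\<complex>\<close>. The Leibniz rule forces \<open>D f\<close> to depend only on the germ of \<open>f\<close>: if \<open>f\<close> vanishes
  on a neighbourhood \<open>U\<close> of \<open>p\<close>, then \<open>f = f \<cdot> \<chi>\<close> for the indicator function \<open>\<chi>\<close> of the
  complement of \<open>U\<close>, and \<open>f p = \<chi> p = 0\<close>.
\<close>

type_synonym tangent = "(point \<Rightarrow> complex) \<Rightarrow> complex"

definition tangent_space :: "point set \<Rightarrow> point \<Rightarrow> tangent set" where
  "tangent_space X p = {D.
     (\<forall>f. f \<notin> reg_at X p \<longrightarrow> D f = 0) \<and>
     (\<forall>f\<in>reg_at X p. \<forall>c. D (scale_fun c f) = c * D f) \<and>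
     (\<forall>f\<in>reg_at X p. \<forall>g\<in>reg_at X p.
        D (\<lambda>q. f q + g q) = D f + D g \<and>
        D (\<lambda>q. f q * g q) = f p * D g + g p * D f)}"

definition smooth :: "point set \<Rightarrow> bool" where
  "smooth X \<longleftrightarrow> (\<forall>p\<in>X. enat (cfun.dim (tangent_space X p)) = krull_dim (zariski X))"

definition smooth_projective_curve :: "point set \<Rightarrow> bool" where
  "smooth_projective_curve X \<longleftrightarrow>
     projective_variety X \<and> krull_dim (zariski X) = 1 \<and> smooth X"


section \<open>Vector bundles\<close>

text \<open>
  Sections of a sheaf are functions on \<open>X\<close> with values in \<open>\<complex>\<^sup>I\<close>, for an index type \<open>I\<close>, that
  vanish outside the open set in question; restriction is restriction of functions. Choosing a
  basis in each fibre of a vector bundle of rank \<open>n\<close> turns its sections into such functions, with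
  values in \<open>\<complex>\<^sup>n \<subseteq> \<complex>\<^sup>I\<close> for \<open>I\<close> the natural numbers; hence every vector bundle
  is isomorphic to a sheaf of type \<open>nat sheaf\<close>. By convention a sheaf is empty at sets that
  are not open, so that equality of sheaves is equality of functions.
\<close>

type_synonym 'i sec = "point \<Rightarrow> 'i \<Rightarrow> complex"
type_synonym 'i sheaf = "point set \<Rightarrow> 'i sec set"

definition smul :: "(point \<Rightarrow> complex) \<Rightarrow> 'i sec \<Rightarrow> 'i sec" where
  "smul f s = (\<lambda>p i. f p * s p i)"

definition scale_sec :: "complex \<Rightarrow> 'i sec \<Rightarrow> 'i sec" where
  "scale_sec c s = smul (\<lambda>_. c) s"

global_interpretation sec: vector_space "scale_sec :: complex \<Rightarrow> 'i sec \<Rightarrow> 'i sec"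
  by standard (auto simp: scale_sec_def smul_def fun_eq_iff algebra_simps)

definition module_sheaf :: "point set \<Rightarrow> 'i sheaf \<Rightarrow> bool" where
  "module_sheaf X E \<longleftrightarrow>
     (\<forall>U. \<not> openin (zariski X) U \<longrightarrow> E U = {}) \<and>
     (\<forall>U. openin (zariski X) U \<longrightarrow>
        0 \<in> E U \<and>
        (\<forall>s\<in>E U. \<forall>t\<in>E U. s + t \<in> E U) \<and>
        (\<forall>f\<in>reg X U. \<forall>s\<in>E U. smul f s \<in> E U) \<and>
        (\<forall>s\<in>E U. \<forall>p. p \<notin> U \<longrightarrow> s p = 0) \<and>
        (\<forall>V s. openin (zariski X) V \<and> V \<subseteq> U \<and> s \<in> E U \<longrightarrow> restr V s \<in> E V)) \<and>
     (\<forall>\<U> s. (\<forall>U\<in>\<U>. openin (zariski X) U \<and> restr U s \<in> E U) \<and> (\<forall>p. p \<notin> \<Union>\<U> \<longrightarrow> s p = 0)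
        \<longrightarrow> s \<in> E (\<Union>\<U>))"

definition frame_on :: "point set \<Rightarrow> 'i sheaf \<Rightarrow> nat \<Rightarrow> point set \<Rightarrow> (nat \<Rightarrow> 'i sec) \<Rightarrow> bool" where
  "frame_on X E n U e \<longleftrightarrow> (\<forall>i<n. e i \<in> E U) \<and>
     (\<forall>V s. openin (zariski X) V \<and> V \<subseteq> U \<and> s \<in> E V \<longrightarrow>
        (\<exists>!a. a \<in> {..<n} \<rightarrow>\<^sub>E reg X V \<and> s = (\<Sum>i<n. smul (a i) (e i))))"

definition vector_bundle :: "point set \<Rightarrow> nat \<Rightarrow> 'i sheaf \<Rightarrow> bool" where
  "vector_bundle X n E \<longleftrightarrow> module_sheaf X E \<and>
     (\<forall>p\<in>X. \<exists>U e. openin (zariski X) U \<and> p \<in> U \<and> frame_on X E n U e)"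

definition sheaf_hom ::
  "point set \<Rightarrow> 'i sheaf \<Rightarrow> 'j sheaf \<Rightarrow> (point set \<Rightarrow> 'i sec \<Rightarrow> 'j sec) set" where
  "sheaf_hom X E F = {\<phi>.
     (\<forall>U s. s \<notin> E U \<longrightarrow> \<phi> U s = 0) \<and>
     (\<forall>U. openin (zariski X) U \<longrightarrow>
        (\<forall>s\<in>E U. \<phi> U s \<in> F U) \<and>
        (\<forall>s\<in>E U. \<forall>t\<in>E U. \<phi> U (s + t) = \<phi> U s + \<phi> U t) \<and>
        (\<forall>f\<in>reg X U. \<forall>s\<in>E U. \<phi> U (smul f s) = smul f (\<phi> U s)) \<and>
        (\<forall>V s. openin (zariski X) V \<and> V \<subseteq> U \<and> s \<in> E U \<longrightarrow>
           \<phi> V (restr V s) = restr V (\<phi> U s)))}"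


section \<open>The degree of a vector bundle\<close>

definition uniformizer :: "point set \<Rightarrow> point \<Rightarrow> (point \<Rightarrow> complex) \<Rightarrow> bool" where
  "uniformizer X p t \<longleftrightarrow> t \<in> reg_at X p \<and> t p = 0 \<and>
     (\<forall>f\<in>reg_at X p. f p = 0 \<longrightarrow>
        (\<exists>h\<in>reg_at X p. \<exists>W. openin (zariski X) W \<and> p \<in> W \<and> (\<forall>q\<in>W. f q = t q * h q)))"

text \<open>
  The function \<open>f\<close>, of which only the values on a punctured neighbourhood of \<open>p\<close> matter, has
  order \<open>k\<close> at \<open>p\<close>.
\<close>

definition has_order :: "point set \<Rightarrow> point \<Rightarrow> (point \<Rightarrow> complex) \<Rightarrow> int \<Rightarrow> bool" where
  "has_order X p f k \<longleftrightarrow> (\<exists>W t u. openin (zariski X) W \<and> p \<in> W \<and> uniformizer X p t \<and>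
     u \<in> reg X W \<and> (\<forall>q\<in>W. u q \<noteq> 0) \<and>
     (\<forall>q\<in>W - {p}. t q \<noteq> 0 \<and> f q = t q powi k * u q))"

text \<open>
  The degree of \<open>E\<close> is the degree of the line bundle \<open>det E\<close>, that is, the degree of the divisor
  of a nonzero rational section of \<open>det E\<close>. For the rational section take
  \<open>s\<^sub>0 \<and> \<dots> \<and> s\<^sub>n\<^sub>-\<^sub>1\<close>, for a frame \<open>s\<close> of \<open>E\<close> over a nonempty open set \<open>U\<close>.
  In terms of a frame \<open>e\<close> of \<open>E\<close> near \<open>p\<close> with \<open>s\<^sub>j = \<Sum>\<^sub>i a\<^sub>i\<^sub>j e\<^sub>i\<close>, this section
  is the multiple of \<open>e\<^sub>0 \<and> \<dots> \<and> e\<^sub>n\<^sub>-\<^sub>1\<close> by \<open>det (a\<^sub>i\<^sub>j)\<close>.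
\<close>

definition det_order ::
  "point set \<Rightarrow> nat \<Rightarrow> 'i sheaf \<Rightarrow> point set \<Rightarrow> (nat \<Rightarrow> 'i sec) \<Rightarrow> point \<Rightarrow> int \<Rightarrow> bool" where
  "det_order X n E U s p k \<longleftrightarrow>
     (\<exists>W e a. openin (zariski X) W \<and> p \<in> W \<and> frame_on X E n W e \<and>
        (\<forall>i<n. \<forall>j<n. a i j \<in> reg X (U \<inter> W)) \<and>
        (\<forall>j<n. restr (U \<inter> W) (s j) = (\<Sum>i<n. smul (a i j) (e i))) \<and>
        has_order X p (\<lambda>q. Determinant.det (Matrix.mat n n (\<lambda>(i, j). a i j q))) k)"

definition degree :: "point set \<Rightarrow> nat \<Rightarrow> 'i sheaf \<Rightarrow> int" where
  "degree X n E = (THE d. \<exists>U s k. openin (zariski X) U \<and> U \<noteq> {} \<and> frame_on X E n U s \<and>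
     (\<forall>p\<in>X. det_order X n E U s p (k p)) \<and> d = (\<Sum>p | p \<in> X \<and> k p \<noteq> 0. k p))"


section \<open>The canonical bundle, the genus and Petri curves\<close>

text \<open>
  A regular differential form assigns to each point \<open>p\<close> of \<open>U\<close> a cotangent vector at \<open>p\<close>, that
  is, a linear form on \<open>tangent_space X p\<close>, extended by \<open>0\<close> to all of \<^typ>\<open>tangent\<close>. Locally it
  has the form \<open>\<Sum>\<^sub>i f\<^sub>i dg\<^sub>i\<close> with \<open>f\<^sub>i\<close>, \<open>g\<^sub>i\<close> regular.
\<close>

definition canonical :: "point set \<Rightarrow> tangent sheaf" where
  "canonical X U = {\<omega>. openin (zariski X) U \<and>
     (\<forall>p D. p \<notin> U \<or> D \<notin> tangent_space X p \<longrightarrow> \<omega> p D = 0) \<and>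
     (\<forall>p\<in>U. \<exists>W (m::nat) f g. openin (zariski X) W \<and> p \<in> W \<and> W \<subseteq> U \<and>
        (\<forall>i<m. f i \<in> reg X W \<and> g i \<in> reg X W) \<and>
        (\<forall>q\<in>W. \<forall>D\<in>tangent_space X q. \<omega> q D = (\<Sum>i<m. f i q * D (g i))))}"

definition genus :: "point set \<Rightarrow> nat" where
  "genus X = sec.dim (canonical X X)"

text \<open>
  The tensor product over \<open>\<complex>\<close> of subspaces \<open>A\<close> and \<open>B\<close> is the free abelian group on
  \<open>A \<times> B\<close> modulo the subgroup \<open>tensor_rel\<close>, where \<open>sA\<close> and \<open>sB\<close> denote multiplication by scalars.
\<close>

inductive_set tensor_rel ::
  "(complex \<Rightarrow> 'a \<Rightarrow> 'a) \<Rightarrow> (complex \<Rightarrow> 'b \<Rightarrow> 'b) \<Rightarrow> 'a set \<Rightarrow> 'b set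
     \<Rightarrow> ('a::plus \<times> 'b::plus \<Rightarrow>\<^sub>0 int) set"
  for sA sB A B where
  zero: "0 \<in> tensor_rel sA sB A B"
| diff: "\<lbrakk>x \<in> tensor_rel sA sB A B; y \<in> tensor_rel sA sB A B\<rbrakk> \<Longrightarrow> x - y \<in> tensor_rel sA sB A B"
| add_left: "\<lbrakk>a \<in> A; a' \<in> A; b \<in> B\<rbrakk> \<Longrightarrow>
    frag_of (a + a', b) - frag_of (a, b) - frag_of (a', b) \<in> tensor_rel sA sB A B"
| add_right: "\<lbrakk>a \<in> A; b \<in> B; b' \<in> B\<rbrakk> \<Longrightarrow>
    frag_of (a, b + b') - frag_of (a, b) - frag_of (a, b') \<in> tensor_rel sA sB A B"
| balanced: "\<lbrakk>a \<in> A; b \<in> B\<rbrakk> \<Longrightarrow>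
    frag_of (sA c a, b) - frag_of (a, sB c b) \<in> tensor_rel sA sB A B"

text \<open>
  The linear map from the tensor product to sections induced by a bilinear map \<open>m\<close> has trivial
  kernel.
\<close>

definition tensor_injective ::
  "(complex \<Rightarrow> 'a \<Rightarrow> 'a) \<Rightarrow> (complex \<Rightarrow> 'b \<Rightarrow> 'b) \<Rightarrow> 'a::plus set \<Rightarrow> 'b::plus set
     \<Rightarrow> ('a \<Rightarrow> 'b \<Rightarrow> 'i sec) \<Rightarrow> bool" where
  "tensor_injective sA sB A B m \<longleftrightarrow>
     (\<forall>x. Poly_Mapping.keys x \<subseteq> A \<times> B \<and>
        (\<Sum>(a, b)\<in>Poly_Mapping.keys x.
           scale_sec (of_int (Poly_Mapping.lookup x (a, b))) (m a b)) = 0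
        \<longrightarrow> x \<in> tensor_rel sA sB A B)"

definition scale_hom ::
  "complex \<Rightarrow> (point set \<Rightarrow> 'i sec \<Rightarrow> 'j sec) \<Rightarrow> point set \<Rightarrow> 'i sec \<Rightarrow> 'j sec" where
  "scale_hom c \<phi> = (\<lambda>U s. scale_sec c (\<phi> U s))"

text \<open>
  With \<open>L\<^sup>* \<otimes> K = Hom(L, K)\<close>, the global sections of \<open>L\<^sup>* \<otimes> K\<close> are the sheaf homomorphisms
  from \<open>L\<close> to \<open>K\<close>, and multiplication is evaluation on global sections.
\<close>

definition petri :: "point set \<Rightarrow> bool" where
  "petri X \<longleftrightarrow> (\<forall>L :: nat sheaf. vector_bundle X 1 L \<longrightarrow>
     tensor_injective scale_sec scale_hom (L X) (sheaf_hom X L (canonical X)) (\<lambda>s \<phi>. \<phi> X s))"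


section \<open>Coherent systems\<close>

type_synonym coh_sys = "nat sheaf \<times> nat sec set"

definition coherent_system :: "point set \<Rightarrow> nat \<Rightarrow> int \<Rightarrow> nat \<Rightarrow> coh_sys \<Rightarrow> bool" where
  "coherent_system X n d k = (\<lambda>(E, V).
     vector_bundle X n E \<and> degree X n E = d \<and>
     sec.subspace V \<and> V \<subseteq> E X \<and> sec.dim V = k)"

definition slope :: "real \<Rightarrow> nat \<Rightarrow> int \<Rightarrow> nat \<Rightarrow> real" where
  "slope \<alpha> n d k = of_int d / of_nat n + \<alpha> * (of_nat k / of_nat n)"

text \<open>
  A subsystem is nonzero iff its bundle is, since global sections of the zero bundle vanish; this
  is the condition \<open>n' \<noteq> 0\<close> below. The inclusion \<open>F \<subseteq> E\<close> is an inclusion of sheaves, so \<open>F\<close> need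
  not be a saturated subbundle.
\<close>

definition stable :: "point set \<Rightarrow> real \<Rightarrow> nat \<Rightarrow> int \<Rightarrow> nat \<Rightarrow> coh_sys \<Rightarrow> bool" where
  "stable X \<alpha> n d k = (\<lambda>(E, V).
     coherent_system X n d k (E, V) \<and>
     (\<forall>n' d' k' F W. coherent_system X n' d' k' (F, W) \<and> n' \<noteq> 0 \<and>
        (\<forall>U. F U \<subseteq> E U) \<and> W \<subseteq> V \<and> (F, W) \<noteq> (E, V)
        \<longrightarrow> slope \<alpha> n' d' k' < slope \<alpha> n d k))"

definition isomorphic :: "point set \<Rightarrow> coh_sys \<Rightarrow> coh_sys \<Rightarrow> bool" where
  "isomorphic X = (\<lambda>(E, V) (F, W).
     \<exists>\<phi>\<in>sheaf_hom X E F. \<exists>\<psi>\<in>sheaf_hom X F E.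
       (\<forall>U. \<forall>s\<in>E U. \<psi> U (\<phi> U s) = s) \<and> (\<forall>U. \<forall>t\<in>F U. \<phi> U (\<psi> U t) = t) \<and>
       \<phi> X ` V = W)"

text \<open>
  The set of points of the moduli space: isomorphism classes of \<open>\<alpha>\<close>-stable coherent systems.
\<close>

definition moduli :: "point set \<Rightarrow> real \<Rightarrow> nat \<Rightarrow> int \<Rightarrow> nat \<Rightarrow> coh_sys set set" where
  "moduli X \<alpha> n d k = {A. stable X \<alpha> n d k A} //
     {(A, B). stable X \<alpha> n d k A \<and> stable X \<alpha> n d k B \<and> isomorphic X A B}"

definition moduli_0 :: "point set \<Rightarrow> nat \<Rightarrow> int \<Rightarrow> nat \<Rightarrow> coh_sys set set" where
  "moduli_0 X n d k = (THE S. \<forall>\<^sub>F \<alpha> in at_right 0. moduli X \<alpha> n d k = S)"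

definition stable_all :: "point set \<Rightarrow> nat \<Rightarrow> int \<Rightarrow> nat \<Rightarrow> coh_sys set" where
  "stable_all X n d k = {A. \<forall>\<alpha>>0. stable X \<alpha> n d k A}"

end

theory Submission
  imports Defs "HOL-Complex_Analysis.Complex_Analysis"
begin

text \<open>
  For a line bundle \<open>L\<close> and a subspace \<open>W\<close> of \<open>L X\<close> of dimension \<open>k' > 0\<close>, choose a nonzero
  \<open>s\<^sub>0 \<in> W\<close> with divisor \<open>D\<close>. Raise \<open>E\<close> from \<open>0\<close> to \<open>D\<close> one point at a time: each step enlarges
  the space of \<open>s \<in> W\<close> such that \<open>s/s\<^sub>0\<close> has poles at most \<open>E\<close> by at most one dimension, shrinks
  the space of differentials vanishing on \<open>E\<close> by at most one dimension, and never does both, because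
  \<open>(s/s\<^sub>0) \<omega>\<close> cannot have exactly one simple pole. Hence the differentials vanishing on \<open>D\<close> form
  a space of dimension at least \<open>k' - 1 - deg L + g\<close>. Each of them defines a homomorphism
  \<open>s \<mapsto> (s/s\<^sub>0) \<omega>\<close> from \<open>L\<close> to the canonical bundle, and the Petri condition gives
  \<open>k' (k' - 1 - deg L + g) \<le> g\<close>. A line subsystem that destabilises a system that is stable for small
  \<open>\<alpha>\<close> satisfies \<open>2 deg L < d\<close> and \<open>2 k' > s + 2\<close>, which contradicts this bound.

  Degrees of principal divisors and sums of residues vanish by Liouville's theorem: for a rational
  function \<open>x\<close> on \<open>X\<close>, viewed as a compact surface with holomorphic charts, the sum of a function
  over the fibres of \<open>x\<close> is a bounded entire function, and its value at \<open>0\<close> is compared with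
  its limit at infinity.
\<close>

section \<open>Orders of meromorphic germs\<close>

text \<open>Riemann-Roch would give the number of differentials vanishing on D as an equality, but
  the Petri bound uses only one inequality, and it is the one that residues give without any
  existence theorem for functions. Degrees and residues come from a single statement,
  \<open>sum_ord_mult_limit_eq_0\<close>: if w has limits Y at the zeros and poles of x, the orders
  of x weighted by Y sum to 0. With w = 1 this concerns principal divisors; with w = x f \<omega> /
  dx the weights cancel the orders and the residues of f \<omega> remain. The obstacle is to reach
  analysis from an algebraic curve: smoothness, which only says that derivations form a line, is
  turned into a principal maximal ideal, whose equations are then solved by a contraction. For
  coherent systems, integral degrees leave no critical value below 1/(k+1), so that smallness of
  \<alpha> is a concrete inequality, and 4g/(s+2) is the term that makes more than (s+2)/2 sections
  violate the Petri bound. One and the same system is then stable for every \<alpha>, which gives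
  both claims.\<close>

definition has_ord :: "(complex \<Rightarrow> complex) \<Rightarrow> int \<Rightarrow> bool" where
  "has_ord f k \<longleftrightarrow>
     (\<exists>u. u analytic_on {0} \<and> u 0 \<noteq> 0 \<and> (\<forall>\<^sub>F z in at 0. f z = z powi k * u z))"

lemma has_ordI:
  assumes "u analytic_on {0}" "u 0 \<noteq> 0" "\<forall>\<^sub>F z in at 0. f z = z powi k * u z"
  shows "has_ord f k"
  using assms unfolding has_ord_def by blast

lemma has_ordE:
  assumes "has_ord f k"
  obtains u R where "R > 0" "u holomorphic_on ball 0 R" "\<And>z. z \<in> ball 0 R \<Longrightarrow> u z \<noteq> 0"
    "\<And>z. z \<in> ball 0 R \<Longrightarrow> z \<noteq> 0 \<Longrightarrow> f z = z powi k * u z"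
proof -
  obtain u where u: "u analytic_on {0}" "u 0 \<noteq> 0" "\<forall>\<^sub>F z in at 0. f z = z powi k * u z"
    using assms unfolding has_ord_def by blast
  from u(1) obtain r1 where r1: "r1 > 0" "u holomorphic_on ball 0 r1"
    unfolding analytic_on_def by auto
  have "continuous (at 0) u"
    using u(1) analytic_at_imp_isCont by blast
  then have "\<forall>\<^sub>F z in at 0. u z \<noteq> 0"
    using u(2) by (simp add: continuous_within tendsto_imp_eventually_ne)
  with u(3) have "\<forall>\<^sub>F z in at 0. f z = z powi k * u z \<and> u z \<noteq> 0"
    by eventually_elim auto
  then obtain r2 where r2: "r2 > 0"
    "\<And>z. z \<noteq> 0 \<Longrightarrow> dist z 0 < r2 \<Longrightarrow> f z = z powi k * u z \<and> u z \<noteq> 0"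
    unfolding eventually_at by blast
  show thesis
  proof (rule that[of "min r1 r2" u])
    show "u holomorphic_on ball 0 (min r1 r2)"
      by (rule holomorphic_on_subset[OF r1(2)]) auto
    show "u z \<noteq> 0" if "z \<in> ball 0 (min r1 r2)" for z
      using that r2(2)[of z] u(2) by (cases "z = 0") (auto simp: dist_commute)
  qed (use r1 r2 in \<open>auto simp: dist_commute\<close>)
qed

lemma analytic_near_0: "f holomorphic_on ball 0 R \<Longrightarrow> R > 0 \<Longrightarrow> f analytic_on {0}"
  by (metis analytic_on_def ball_subset_cball centre_in_ball singletonD)

lemma eventually_at_0_ball: "R > 0 \<Longrightarrow> \<forall>\<^sub>F z in at (0::complex). z \<in> ball 0 R \<and> z \<noteq> 0"
  by (auto simp: eventually_at dist_commute intro!: exI[of _ R])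

text \<open>Orders see only a punctured neighbourhood of 0, so the value that a total function
  happens to take at a pole, for instance through division by zero, never matters.\<close>

lemma has_ord_cong:
  assumes "has_ord f k" "\<forall>\<^sub>F z in at 0. f z = g z"
  shows "has_ord g k"
proof -
  obtain u where u: "u analytic_on {0}" "u 0 \<noteq> 0" "\<forall>\<^sub>F z in at 0. f z = z powi k * u z"
    using assms unfolding has_ord_def by blast
  from u(3) assms(2) have "\<forall>\<^sub>F z in at 0. g z = z powi k * u z"
    by eventually_elim auto
  with u show ?thesis by (auto intro: has_ordI)
qed

lemma has_ord_mult:
  assumes "has_ord f k" "has_ord g l"
  shows "has_ord (\<lambda>z. f z * g z) (k + l)"
proof -
  obtain u where u: "u analytic_on {0}" "u 0 \<noteq> 0" "\<forall>\<^sub>F z in at 0. f z = z powi k * u z"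
    using assms unfolding has_ord_def by blast
  obtain v where v: "v analytic_on {0}" "v 0 \<noteq> 0" "\<forall>\<^sub>F z in at 0. g z = z powi l * v z"
    using assms unfolding has_ord_def by blast
  have "\<forall>\<^sub>F z in at 0. z \<noteq> (0::complex)" by (simp add: eventually_at_filter)
  with u(3) v(3) have "\<forall>\<^sub>F z in at 0. f z * g z = z powi (k + l) * (u z * v z)"
    by eventually_elim (auto simp: power_int_add)
  then show ?thesis
    using u v by (intro has_ordI[of "\<lambda>z. u z * v z"]) (auto intro!: analytic_intros)
qed

lemma has_ord_inverse:
  assumes "has_ord f k"
  shows "has_ord (\<lambda>z. 1 / f z) (- k)"
proof -
  obtain u where u: "u analytic_on {0}" "u 0 \<noteq> 0" "\<forall>\<^sub>F z in at 0. f z = z powi k * u z"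
    using assms unfolding has_ord_def by blast
  from u(3) have "\<forall>\<^sub>F z in at 0. 1 / f z = z powi (- k) * (1 / u z)"
    by eventually_elim (auto simp: power_int_minus field_simps)
  then show ?thesis
    using u by (intro has_ordI[of "\<lambda>z. 1 / u z"]) (auto intro!: analytic_intros)
qed

lemma has_ord_divide:
  assumes "has_ord f k" "has_ord g l"
  shows "has_ord (\<lambda>z. f z / g z) (k - l)"
  using has_ord_mult[OF assms(1) has_ord_inverse[OF assms(2)]] by simp

lemma has_ord_analytic_0:
  assumes "f analytic_on {0}" "f 0 \<noteq> 0"
  shows "has_ord f 0"
  using assms by (intro has_ordI[of f]) auto

lemma has_ord_id: "has_ord (\<lambda>z. z) 1"
  by (intro has_ordI[of "\<lambda>_. 1"]) (auto intro!: analytic_intros)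

lemma has_ord_power: "has_ord (\<lambda>z. z ^ n) (int n)"
  by (intro has_ordI[of "\<lambda>_. 1"]) (auto intro!: analytic_intros)

lemma has_ord_limit_0:
  assumes "has_ord f k" "k > 0"
  shows "(f \<longlongrightarrow> 0) (at 0)"
proof -
  obtain u where u: "u analytic_on {0}" "u 0 \<noteq> 0" "\<forall>\<^sub>F z in at 0. f z = z powi k * u z"
    using assms unfolding has_ord_def by blast
  have "(u \<longlongrightarrow> u 0) (at 0)"
    using analytic_at_imp_isCont[OF u(1)] by (simp add: isCont_def)
  moreover have "((\<lambda>z::complex. z ^ nat k) \<longlongrightarrow> 0 ^ nat k) (at 0)"
    by (intro tendsto_intros)
  ultimately have "((\<lambda>z. z ^ nat k * u z) \<longlongrightarrow> 0 ^ nat k * u 0) (at 0)"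
    by (intro tendsto_intros)
  then have "((\<lambda>z. z ^ nat k * u z) \<longlongrightarrow> 0) (at 0)"
    using assms(2) by (simp add: power_0_left)
  then show ?thesis
    by (rule Lim_transform_eventually)
      (use u(3) assms(2) in \<open>auto simp: power_int_def elim!: eventually_mono\<close>)
qed

lemma has_ord_limit_nz:
  assumes "has_ord f 0"
  obtains c where "c \<noteq> 0" "(f \<longlongrightarrow> c) (at 0)"
proof -
  obtain u where u: "u analytic_on {0}" "u 0 \<noteq> 0" "\<forall>\<^sub>F z in at 0. f z = z powi 0 * u z"
    using assms unfolding has_ord_def by blast
  have "(u \<longlongrightarrow> u 0) (at 0)"
    using analytic_at_imp_isCont[OF u(1)] by (simp add: isCont_def)
  then have "(f \<longlongrightarrow> u 0) (at 0)"
    by (rule Lim_transform_eventually) (use u(3) in \<open>auto elim!: eventually_mono\<close>)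
  with u(2) that show ?thesis by blast
qed

lemma has_ord_eventually_nz:
  assumes "has_ord f k" shows "\<forall>\<^sub>F z in at 0. f z \<noteq> 0"
proof -
  from assms obtain u R where u: "R > 0" "u holomorphic_on ball 0 R" "\<And>z. z \<in> ball 0 R \<Longrightarrow> u z \<noteq> 0"
    "\<And>z. z \<in> ball 0 R \<Longrightarrow> z \<noteq> 0 \<Longrightarrow> f z = z powi k * u z"
    by (rule has_ordE) blast
  from eventually_at_0_ball[OF u(1)] show ?thesis
    by eventually_elim (use u(3,4) in auto)
qed

lemma has_ord_unique:
  assumes "has_ord f k" "has_ord f l"
  shows "k = l"
proof -
  have *: False if "has_ord f k" "has_ord f l" "k < l" for k l
  proof -
    have "\<forall>\<^sub>F z in at 0. f z \<noteq> 0"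
      using that(1) by (rule has_ord_eventually_nz)
    then have ev: "\<forall>\<^sub>F z in at 0. f z / f z = 1"
      by eventually_elim auto
    have "((\<lambda>z. f z / f z) \<longlongrightarrow> 0) (at 0)"
      using has_ord_limit_0[OF has_ord_divide[OF that(2,1)]] that(3) by simp
    moreover have "((\<lambda>z. f z / f z) \<longlongrightarrow> 1) (at 0)"
      by (rule tendsto_eventually[OF ev])
    ultimately show False
      using tendsto_unique[of "at (0::complex)"] by fastforce
  qed
  show ?thesis using *[OF assms] *[OF assms(2,1)] by (meson linorder_neqE)
qed

lemma analytic_has_ord:
  assumes "f analytic_on {0}" "\<not> (\<forall>\<^sub>F z in at 0. f z = 0)"
  obtains n where "has_ord f (int n)"
proof (cases "f 0 = 0")
  case False
  then show ?thesis using has_ord_analytic_0[OF assms(1)] that[of 0] by simp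
next
  case True
  from assms(1) obtain R where R: "R > 0" "f holomorphic_on ball 0 R"
    unfolding analytic_on_def by auto
  have "\<not> f constant_on ball 0 R"
  proof
    assume "f constant_on ball 0 R"
    then have "f z = 0" if "z \<in> ball 0 R" for z
      using that True R(1) unfolding constant_on_def by (metis centre_in_ball)
    then have "\<forall>\<^sub>F z in at 0. f z = 0"
      using eventually_at_0_ball[OF R(1)] by (auto elim!: eventually_mono)
    with assms(2) show False by blast
  qed
  show ?thesis
  proof (rule holomorphic_factor_zero_nonconstant[OF R(2) open_ball connected_ball _ True \<open>\<not> f constant_on ball 0 R\<close>])
    fix g r and n :: nat
    assume g: "0 < n" "0 < r" "ball 0 r \<subseteq> ball 0 R" "g holomorphic_on ball 0 r"
      "\<And>w. w \<in> ball 0 r \<Longrightarrow> f w = (w - 0) ^ n * g w" "\<And>w. w \<in> ball 0 r \<Longrightarrow> g w \<noteq> 0"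
    have "has_ord f (int n)"
    proof (rule has_ordI[of g])
      show "g analytic_on {0}" using analytic_near_0[OF g(4,2)] .
      show "\<forall>\<^sub>F z in at 0. f z = z powi int n * g z"
        using eventually_at_0_ball[OF g(2)] by eventually_elim (use g(5) in auto)
    qed (use g in auto)
    then show ?thesis by (rule that)
  qed (use R in auto)
qed

text \<open>The logarithmic derivative of z^k u is k/z + u'/u. The limit is how residues enter: when
  w = x f \<omega> / dx is examined at a zero or pole of x of order k, the quotient x/dx behaves
  like z/k.\<close>

lemma has_ord_deriv:
  assumes "has_ord f k" "k \<noteq> 0"
  shows "\<forall>\<^sub>F z in at 0. deriv f z \<noteq> 0"
    and "((\<lambda>z. f z / (z * deriv f z)) \<longlongrightarrow> 1 / of_int k) (at 0)"
proof -
  obtain u R where u: "R > 0" "u holomorphic_on ball 0 R" "\<And>z. z \<in> ball 0 R \<Longrightarrow> u z \<noteq> 0"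
    "\<And>z. z \<in> ball 0 R \<Longrightarrow> z \<noteq> 0 \<Longrightarrow> f z = z powi k * u z"
    using assms(1) by (rule has_ordE) blast
  \<comment> \<open>The derivative of f is z^(k-1) v, and v tends to k u(0), which is
    nonzero.\<close>
  define v where "v = (\<lambda>z. of_int k * u z + z * deriv u z)"
  have d: "deriv f z = z powi (k - 1) * v z" if "z \<in> ball 0 R" "z \<noteq> 0" for z
  proof -
    have "(u has_field_derivative deriv u z) (at z)"
      using holomorphic_derivI[OF u(2)] that by simp
    then have "((\<lambda>z. z powi k * u z) has_field_derivative z powi (k - 1) * v z) (at z)"
      using that(2)
      by (auto intro!: derivative_eq_intros simp: v_def algebra_simps power_int_diff)
    moreover have "\<forall>\<^sub>F w in nhds z. w \<in> ball 0 R - {0}"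
      by (rule eventually_nhds_in_open) (use that in \<open>auto simp: open_delete\<close>)
    then have "\<forall>\<^sub>F w in nhds z. f w = w powi k * u w"
      by eventually_elim (use u(4) in auto)
    ultimately have "(f has_field_derivative z powi (k - 1) * v z) (at z)"
      by (subst DERIV_cong_ev[OF refl _ refl]) auto
    then show ?thesis by (rule DERIV_imp_deriv)
  qed
  have "(u \<longlongrightarrow> u 0) (at 0)" "(deriv u \<longlongrightarrow> deriv u 0) (at 0)"
    using analytic_at_imp_isCont[OF analytic_near_0[OF u(2,1)]]
      analytic_at_imp_isCont[OF analytic_near_0[OF holomorphic_deriv[OF u(2)] u(1)]]
    by (auto simp: isCont_def)
  note u0 = this(1)
  have v: "(v \<longlongrightarrow> of_int k * u 0 + 0 * deriv u 0) (at 0)"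
    unfolding v_def by (intro tendsto_intros) fact+
  have nz: "of_int k * u 0 \<noteq> 0" using assms(2) u(1,3) by auto
  then have vnz: "\<forall>\<^sub>F z in at 0. v z \<noteq> 0"
    using tendsto_imp_eventually_ne[OF v, of 0] by simp
  with eventually_at_0_ball[OF u(1)] show "\<forall>\<^sub>F z in at 0. deriv f z \<noteq> 0"
    by eventually_elim (auto simp: d)
  have "((\<lambda>z. u z / v z) \<longlongrightarrow> u 0 / (of_int k * u 0 + 0 * deriv u 0)) (at 0)"
    by (intro tendsto_intros u0 v) (use nz in auto)
  then have "((\<lambda>z. u z / v z) \<longlongrightarrow> 1 / of_int k) (at 0)"
    using u(1,3) by simp
  moreover have "\<forall>\<^sub>F z in at 0. u z / v z = f z / (z * deriv f z)"
    using vnz eventually_at_0_ball[OF u(1)]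
    by eventually_elim (auto simp: d u(4) power_int_diff field_simps)
  ultimately show "((\<lambda>z. f z / (z * deriv f z)) \<longlongrightarrow> 1 / of_int k) (at 0)"
    by (rule Lim_transform_eventually)
qed

text \<open>A k-th root of u writes f - c0 as \<phi>^k with \<phi> injective near 0, so the
  solutions of f = c correspond to the k-th roots of c - c0. The count is asserted for every
  sufficiently small radius, because the limit of sums below compares two radii.\<close>

lemma card_local_fibre:
  assumes "has_ord (\<lambda>z. f z - c0) k" "k > 0"
  shows "\<exists>\<rho>0>0. \<forall>\<rho>. 0 < \<rho> \<and> \<rho> \<le> \<rho>0 \<longrightarrow> (\<forall>\<^sub>F c in at c0.
    finite {z \<in> ball 0 \<rho> - {0}. f z = c} \<and> card {z \<in> ball 0 \<rho> - {0}. f z = c} = nat k)"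
proof -
  obtain u R where u: "R > 0" "u holomorphic_on ball 0 R" "\<And>z. z \<in> ball 0 R \<Longrightarrow> u z \<noteq> 0"
    "\<And>z. z \<in> ball 0 R \<Longrightarrow> z \<noteq> 0 \<Longrightarrow> f z - c0 = z powi k * u z"
    using assms(1) by (rule has_ordE) blast
  define n where "n = nat k"
  have n: "n > 0" "k = int n" using assms(2) by (auto simp: n_def)
  have "isCont u 0"
    using analytic_at_imp_isCont[OF analytic_near_0[OF u(2,1)]] .
  moreover have u00: "u 0 \<noteq> 0" using u(1,3) by auto
  ultimately obtain R' where R': "R' > 0" "\<And>z. dist z 0 < R' \<Longrightarrow> dist (u z) (u 0) < norm (u 0)"
    unfolding continuous_at_eps_delta using zero_less_norm_iff[of "u 0"] by blast
  define R1 where "R1 = min R R'"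
  have R1: "R1 > 0" using R'(1) u(1) by (simp add: R1_def)
  \<comment> \<open>Within distance |u 0| of u 0 the quotient u z / u 0 stays off the branch cut of
    \<open>Ln\<close>, so the principal branch yields a holomorphic root.\<close>
  have re: "u z / u 0 \<notin> \<real>\<^sub>\<le>\<^sub>0" if "z \<in> ball 0 R1" for z
  proof
    assume "u z / u 0 \<in> \<real>\<^sub>\<le>\<^sub>0"
    then obtain x where x: "u z / u 0 = of_real x" "x \<le> 0"
      unfolding nonpos_Reals_def by auto
    then have "u z = of_real x * u 0" using u00 by (simp add: field_simps)
    then have "dist (u z) (u 0) = norm ((of_real x - 1) * u 0)"
      by (simp add: dist_norm algebra_simps)
    also have "\<dots> = norm (complex_of_real (x - 1)) * norm (u 0)"
      by (simp add: norm_mult)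
    also have "\<dots> = (1 - x) * norm (u 0)"
      using x(2) unfolding norm_of_real by simp
    finally have "dist (u z) (u 0) \<ge> norm (u 0)" 
      using x(2) by (simp add: mult_le_cancel_right1)
    with R'(2)[of z] that show False by (auto simp: R1_def dist_commute)
  qed
  obtain a where a: "u 0 = a ^ n"
    using n(1) exists_complex_root_nonzero[OF u00, of n] by blast
  define g where "g = (\<lambda>z. a * exp (Ln (u z / u 0) / of_nat n))"
  have hu: "u holomorphic_on ball 0 R1"
    by (rule holomorphic_on_subset[OF u(2)]) (auto simp: R1_def)
  have g: "g holomorphic_on ball 0 R1"
    unfolding g_def using re u00 n(1) by (intro holomorphic_intros hu) auto
  have gn: "g z ^ n = u z" if "z \<in> ball 0 R1" for z
    using that u00 n(1) u(3)[of z] a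
    by (simp add: g_def power_mult_distrib R1_def flip: exp_of_nat_mult)
  define \<phi> where "\<phi> = (\<lambda>z. z * g z)"
  have \<phi>: "\<phi> holomorphic_on ball 0 R1"
    unfolding \<phi>_def by (intro holomorphic_intros g)
  have \<phi>n: "f z = c0 + \<phi> z ^ n" if "z \<in> ball 0 R1" "z \<noteq> 0" for z
    using u(4)[of z] gn[of z] that n by (simp add: \<phi>_def power_mult_distrib R1_def algebra_simps)
  have "(g has_field_derivative deriv g 0) (at 0)"
    using holomorphic_derivI[OF g open_ball, of 0] R1 by simp
  then have "(\<phi> has_field_derivative g 0) (at 0)"
    unfolding \<phi>_def by (auto intro!: derivative_eq_intros)
  then have "deriv \<phi> 0 = g 0" by (rule DERIV_imp_deriv)
  moreover have "g 0 \<noteq> 0" using gn[of 0] R1 u00 n(1) by (auto simp: zero_power)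
  ultimately have dnz: "deriv \<phi> 0 \<noteq> 0" by simp
  have "\<exists>\<rho>0>0. ball (0::complex) \<rho>0 \<subseteq> ball 0 R1 \<and> inj_on \<phi> (ball 0 \<rho>0)"
    by (rule has_complex_derivative_locally_injective[OF \<phi> _ open_ball dnz]) (use R1 in \<open>auto simp del: ball_subset_ball_iff\<close>)
  then obtain \<rho>0 where \<rho>0: "\<rho>0 > 0" "ball (0::complex) \<rho>0 \<subseteq> ball 0 R1" "inj_on \<phi> (ball 0 \<rho>0)"
    by blast
  have main: "\<forall>\<^sub>F c in at c0. finite {z \<in> ball 0 \<rho> - {0}. f z = c} \<and> card {z \<in> ball 0 \<rho> - {0}. f z = c} = nat k"
    if \<rho>: "0 < \<rho>" "\<rho> \<le> \<rho>0" for \<rho>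
  proof -
    have sub: "ball 0 \<rho> \<subseteq> ball (0::complex) \<rho>0" using \<rho> by auto
    have subR: "z \<in> ball 0 R1" if "z \<in> ball 0 \<rho>" for z :: complex using subsetD[OF \<rho>0(2) subsetD[OF sub that]] .
    have injr: "inj_on \<phi> (ball 0 \<rho>)" using \<rho>0(3) sub by (rule inj_on_subset)
    have "open (\<phi> ` ball 0 \<rho>)"
      by (rule open_mapping_thm3[OF _ open_ball injr])
        (use subR in \<open>blast intro: holomorphic_on_subset[OF \<phi>]\<close>)
    moreover have "0 \<in> \<phi> ` ball 0 \<rho>" using \<rho>(1) by (auto simp: \<phi>_def intro!: image_eqI[of _ _ 0])
    ultimately obtain \<eta> where \<eta>: "\<eta> > 0" "ball 0 \<eta> \<subseteq> \<phi> ` ball 0 \<rho>"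
      using open_contains_ball by blast
    \<comment> \<open>The radius \<eta>^n for c makes every n-th root of c - c0 shorter than \<eta>,
      hence a value of \<phi> on the ball.\<close>
    have "card {z \<in> ball 0 \<rho> - {0}. f z = c} = nat k \<and> finite {z \<in> ball 0 \<rho> - {0}. f z = c}"
      if c: "c \<noteq> c0" "dist c c0 < \<eta> ^ n" for c
    proof -
      have "bij_betw \<phi> {z \<in> ball 0 \<rho> - {0}. f z = c} {w. w ^ n = c - c0}"
        unfolding bij_betw_def
      proof
        show "inj_on \<phi> {z \<in> ball 0 \<rho> - {0}. f z = c}"
          by (rule inj_on_subset[OF injr]) auto
        show "\<phi> ` {z \<in> ball 0 \<rho> - {0}. f z = c} = {w. w ^ n = c - c0}"
        proof (intro equalityI subsetI)
          fix w assume "w \<in> \<phi> ` {z \<in> ball 0 \<rho> - {0}. f z = c}"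
          then obtain z where "z \<in> ball 0 \<rho>" "z \<noteq> 0" "f z = c" "w = \<phi> z" by auto
          then show "w \<in> {w. w ^ n = c - c0}" using \<phi>n[OF subR] by auto
        next
          fix w assume "w \<in> {w. w ^ n = c - c0}"
          then have w: "w ^ n = c - c0" by simp
          then have "norm w ^ n < \<eta> ^ n"
            using c(2) by (metis dist_norm norm_power)
          then have "norm w < \<eta>" using \<eta>(1) power_less_imp_less_base by (metis less_eq_real_def)
          then have "w \<in> \<phi> ` ball 0 \<rho>" using \<eta>(2) by auto
          then obtain z where z: "z \<in> ball 0 \<rho>" "w = \<phi> z" by auto
          have "z \<noteq> 0" using w z(2) c(1) n(1) by (auto simp: \<phi>_def zero_power)
          moreover have "f z = c" using \<phi>n[OF subR] z w \<open>z \<noteq> 0\<close> by auto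
          ultimately show "w \<in> \<phi> ` {z \<in> ball 0 \<rho> - {0}. f z = c}" using z by auto
        qed
      qed
      moreover have "card {w. w ^ n = c - c0} = n"
        using card_nth_roots[of "c - c0" n] c(1) n(1) by simp
      moreover have "finite {w::complex. w ^ n = c - c0}"
        using finite_nth_roots[of n "c - c0"] n(1) by simp
      ultimately show ?thesis
        by (auto simp: bij_betw_same_card bij_betw_finite n_def)
    qed
    then show "\<forall>\<^sub>F c in at c0. finite {z \<in> ball 0 \<rho> - {0}. f z = c} \<and> card {z \<in> ball 0 \<rho> - {0}. f z = c} = nat k"
      unfolding eventually_at using \<eta>(1) by (intro exI[of _ "\<eta> ^ n"]) auto
  qed
  show ?thesis using \<rho>0(1) main by blast
qed

text \<open>All k solutions near 0 tend to 0 as c tends to c0, so each of them contributes Y to the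
  limit.\<close>

lemma tendsto_local_fibre_sum:
  assumes "has_ord (\<lambda>z. f z - c0) k" "k > 0"
  shows "\<exists>\<rho>0>0. \<forall>\<rho> (h :: complex \<Rightarrow> complex) Y. 0 < \<rho> \<and> \<rho> \<le> \<rho>0 \<and> (h \<longlongrightarrow> Y) (at 0) \<longrightarrow>
       ((\<lambda>c. \<Sum>z | z \<in> ball 0 \<rho> - {0} \<and> f z = c. h z) \<longlongrightarrow> of_int k * Y) (at c0)"
proof -
  obtain \<rho>0 where \<rho>0: "\<rho>0 > 0" "\<And>\<rho>. 0 < \<rho> \<Longrightarrow> \<rho> \<le> \<rho>0 \<Longrightarrow>
    \<forall>\<^sub>F c in at c0. finite {z \<in> ball 0 \<rho> - {0}. f z = c} \<and> card {z \<in> ball 0 \<rho> - {0}. f z = c} = nat k"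
    using card_local_fibre[OF assms] by blast
  have main: "((\<lambda>c. \<Sum>z | z \<in> ball 0 \<rho> - {0} \<and> f z = c. h z) \<longlongrightarrow> of_int k * Y) (at c0)"
    if \<rho>: "0 < \<rho>" "\<rho> \<le> \<rho>0" and h: "(h \<longlongrightarrow> Y) (at 0)"
    for \<rho> :: real and h :: "complex \<Rightarrow> complex" and Y :: complex
  proof -
    show "((\<lambda>c. \<Sum>z | z \<in> ball 0 \<rho> - {0} \<and> f z = c. h z) \<longlongrightarrow> of_int k * Y) (at c0)"
    proof (rule tendstoI)
      fix e :: real assume e: "e > 0"
      define e' where "e' = e / (2 * of_int k)"
      have e': "e' > 0" using e assms(2) by (simp add: e'_def)
      from tendstoD[OF h e'] obtain d where d: "d > 0" "\<And>z. z \<noteq> 0 \<Longrightarrow> dist z 0 < d \<Longrightarrow> dist (h z) Y < e'"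
        unfolding eventually_at by blast
      define \<rho>1 where "\<rho>1 = min \<rho> d"
      have \<rho>1: "0 < \<rho>1" "\<rho>1 \<le> \<rho>0" "\<rho>1 \<le> \<rho>" using \<rho> d(1) by (auto simp: \<rho>1_def)
      from \<rho>0(2)[OF \<rho>] \<rho>0(2)[OF \<rho>1(1,2)]
      show "\<forall>\<^sub>F c in at c0. dist (\<Sum>z | z \<in> ball 0 \<rho> - {0} \<and> f z = c. h z) (of_int k * Y) < e"
      proof eventually_elim
        case (elim c)
        \<comment> \<open>Both balls contain exactly k solutions, so none lies in the larger ball
          outside the smaller one. Counting thus replaces following the individual solutions as c
          moves.\<close>
        have "{z \<in> ball 0 \<rho>1 - {0}. f z = c} = {z \<in> ball 0 \<rho> - {0}. f z = c}"
          by (rule card_subset_eq) (use elim \<rho>1(3) in auto)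
        then have Z: "{z \<in> ball 0 \<rho> - {0}. f z = c} \<subseteq> ball 0 \<rho>1 - {0}" by blast
        have "(\<Sum>z | z \<in> ball 0 \<rho> - {0} \<and> f z = c. h z) - of_int k * Y
          = (\<Sum>z | z \<in> ball 0 \<rho> - {0} \<and> f z = c. h z - Y)"
          using elim assms(2) by (simp add: sum_subtractf)
        also have "norm \<dots> \<le> (\<Sum>z | z \<in> ball 0 \<rho> - {0} \<and> f z = c. e')"
        proof (rule sum_norm_le)
          fix z assume "z \<in> {z \<in> ball 0 \<rho> - {0}. f z = c}"
          then have "z \<noteq> 0" "dist z 0 < d" using Z by (auto simp: \<rho>1_def)
          then show "norm (h z - Y) \<le> e'" using d(2)[of z] by (simp add: dist_norm)
        qed
        also have "\<dots> = of_int k * e'" using elim assms(2) by simp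
        also have "\<dots> < e" using e assms(2) by (simp add: e'_def)
        finally show ?case by (simp add: dist_norm)
      qed
    qed
  qed
  show ?thesis using \<rho>0(1) main by blast
qed

section \<open>A residue theorem for compact surfaces with charts\<close>

text \<open>X carries no topology here. \<open>cover\<close> is compactness in the form in which it
  is used, with a disc of prescribed radius about each point, and \<open>separated\<close> is the
  Hausdorff property. Every point has a chart centred at it, so analyticity is always tested at 0 in
  the chart of the point itself.\<close>

locale charted_surface =
  fixes X :: "'p set" and \<gamma> :: "'p \<Rightarrow> complex \<Rightarrow> 'p" and r :: "'p \<Rightarrow> real"
  assumes r_pos: "p \<in> X \<Longrightarrow> r p > 0"
    and chart_0: "p \<in> X \<Longrightarrow> \<gamma> p 0 = p"
    and chart_in: "p \<in> X \<Longrightarrow> z \<in> ball 0 (r p) \<Longrightarrow> \<gamma> p z \<in> X"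
    and chart_inj: "p \<in> X \<Longrightarrow> inj_on (\<gamma> p) (ball 0 (r p))"
    and cover: "(\<And>p. p \<in> X \<Longrightarrow> \<rho> p > 0) \<Longrightarrow>
      \<exists>F\<subseteq>X. finite F \<and> X \<subseteq> (\<Union>p\<in>F. \<gamma> p ` ball 0 (min (\<rho> p) (r p)))"
    and separated: "p \<in> X \<Longrightarrow> q \<in> X \<Longrightarrow> p \<noteq> q \<Longrightarrow>
      \<exists>\<rho>>0. \<gamma> p ` ball 0 (min \<rho> (r p)) \<inter> \<gamma> q ` ball 0 (min \<rho> (r q)) = {}"
begin

definition ord_at :: "('p \<Rightarrow> complex) \<Rightarrow> 'p \<Rightarrow> int" where
  "ord_at f p = (THE k. has_ord (\<lambda>z. f (\<gamma> p z)) k)"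

lemma ord_at_eq: "has_ord (\<lambda>z. f (\<gamma> p z)) k \<Longrightarrow> ord_at f p = k"
  unfolding ord_at_def by (rule the_equality) (auto intro: has_ord_unique)

text \<open>Around each point there is a disc in which at most the centre is bad, and finitely many
  such discs cover X.\<close>

lemma finite_if_isolated:
  assumes "\<And>p. p \<in> X \<Longrightarrow> \<forall>\<^sub>F z in at 0. \<not> B (\<gamma> p z)"
  shows "finite {p \<in> X. B p}"
proof -
  have "\<forall>p\<in>X. \<exists>\<rho>>0. \<forall>z. z \<noteq> 0 \<and> dist z 0 < \<rho> \<longrightarrow> \<not> B (\<gamma> p z)"
    using assms unfolding eventually_at by blast
  then obtain \<rho> where \<rho>: "\<And>p. p \<in> X \<Longrightarrow> \<rho> p > 0"
    "\<And>p z. p \<in> X \<Longrightarrow> z \<noteq> 0 \<Longrightarrow> dist z 0 < \<rho> p \<Longrightarrow> \<not> B (\<gamma> p z)"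
    by metis
  from cover[of \<rho>, OF \<rho>(1)] obtain F where F: "F \<subseteq> X" "finite F"
    "X \<subseteq> (\<Union>p\<in>F. \<gamma> p ` ball 0 (min (\<rho> p) (r p)))" by blast
  have "{p \<in> X. B p} \<subseteq> F"
  proof
    fix q assume q: "q \<in> {p \<in> X. B p}"
    then obtain p z where p: "p \<in> F" "z \<in> ball 0 (min (\<rho> p) (r p))" "q = \<gamma> p z"
      using F(3) by blast
    have "z = 0"
      using \<rho>(2)[of p z] p q F(1) by (auto simp: dist_commute)
    then show "q \<in> F" using p F(1) chart_0 by auto
  qed
  then show ?thesis using F(2) finite_subset by blast
qed

lemma separated_finite:
  assumes "finite Q" "Q \<subseteq> X"
  shows "\<exists>\<rho>>0. \<forall>p\<in>Q. \<forall>q\<in>Q. p \<noteq> q \<longrightarrow>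
    \<gamma> p ` ball 0 (min \<rho> (r p)) \<inter> \<gamma> q ` ball 0 (min \<rho> (r q)) = {}"
proof -
  have "\<exists>\<rho>>0. fst x \<noteq> snd x \<longrightarrow>
    \<gamma> (fst x) ` ball 0 (min \<rho> (r (fst x))) \<inter> \<gamma> (snd x) ` ball 0 (min \<rho> (r (snd x))) = {}"
    if "x \<in> Q \<times> Q" for x
  proof (cases "fst x = snd x")
    case False
    then show ?thesis using separated[of "fst x" "snd x"] that assms(2) by (auto simp: mem_Times_iff)
  qed (auto intro: exI[of _ 1])
  then obtain \<rho> where \<rho>: "\<And>x. x \<in> Q \<times> Q \<Longrightarrow> \<rho> x > 0 \<and> (fst x \<noteq> snd x \<longrightarrow>
    \<gamma> (fst x) ` ball 0 (min (\<rho> x) (r (fst x))) \<inter> \<gamma> (snd x) ` ball 0 (min (\<rho> x) (r (snd x))) = {})"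
    by metis
  define \<delta> where "\<delta> = Min (insert 1 (\<rho> ` (Q \<times> Q)))"
  have fin: "finite (insert 1 (\<rho> ` (Q \<times> Q)))" using assms(1) by blast
  have le: "\<delta> \<le> \<rho> x" if "x \<in> Q \<times> Q" for x
    unfolding \<delta>_def using fin that by (intro Min_le) auto
  have "\<delta> > 0" unfolding \<delta>_def using fin \<rho> by (subst Min_gr_iff) auto
  moreover have "\<gamma> p ` ball 0 (min \<delta> (r p)) \<inter> \<gamma> q ` ball 0 (min \<delta> (r q)) = {}"
    if "p \<in> Q" "q \<in> Q" "p \<noteq> q" for p q
  proof -
    have "\<gamma> p ` ball 0 (min \<delta> (r p)) \<subseteq> \<gamma> p ` ball 0 (min (\<rho> (p, q)) (r p))"
      "\<gamma> q ` ball 0 (min \<delta> (r q)) \<subseteq> \<gamma> q ` ball 0 (min (\<rho> (p, q)) (r q))"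
      using le[of "(p, q)"] that by (auto intro!: image_mono)
    then show ?thesis using \<rho>[of "(p, q)"] that by fastforce
  qed
  ultimately show ?thesis by blast
qed

section \<open>Sums over the fibres of a function\<close>

lemma bounded_away_if_ord_nonpos:
  assumes "has_ord f k" "k \<le> 0"
  shows "\<exists>\<delta>>0. \<forall>\<^sub>F z in at 0. \<delta> \<le> norm (f z)"
proof (cases "k = 0")
  case True
  with assms obtain c where c: "c \<noteq> 0" "(f \<longlongrightarrow> c) (at 0)" using has_ord_limit_nz by metis
  have "\<forall>\<^sub>F z in at 0. norm c / 2 < norm (f z)"
    by (rule order_tendstoD(1)[OF tendsto_norm[OF c(2)]]) (use c(1) in auto)
  then show ?thesis using c(1) by (intro exI[of _ "norm c / 2"]) (auto elim!: eventually_mono)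
next
  case False
  have "((\<lambda>z. 1 / f z) \<longlongrightarrow> 0) (at 0)"
    using has_ord_limit_0[OF has_ord_inverse[OF assms(1)]] assms(2) False by simp
  then have "\<forall>\<^sub>F z in at 0. norm (1 / f z) < 1"
    using tendstoD[of "\<lambda>z. 1 / f z" 0 "at 0" 1] by (simp add: dist_norm)
  with has_ord_eventually_nz[OF assms(1)] have "\<forall>\<^sub>F z in at 0. 1 \<le> norm (f z)"
    by eventually_elim (auto simp: norm_divide field_simps)
  then show ?thesis by (intro exI[of _ 1]) auto
qed

text \<open>Away from the zeros of x - c0 compactness bounds |x - c0| from below, so for c near c0
  the whole fibre lies in small punctured discs about these zeros. Q is defined by orders because
  the value of x at a single point may differ from its limit there. One family of radii serves both
  the splitting of the sum and the limits on the discs.\<close>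

lemma fibre_decomposition:
  fixes x :: "'p \<Rightarrow> complex" and c0 :: complex
  defines "Q \<equiv> {p \<in> X. ord_at (\<lambda>q. x q - c0) p > 0}"
  assumes ord: "\<And>p. p \<in> X \<Longrightarrow> \<exists>k. has_ord (\<lambda>z. x (\<gamma> p z) - c0) k"
    and fin: "finite Q"
  shows "\<exists>\<rho>. (\<forall>p\<in>Q. 0 < \<rho> p \<and> \<rho> p \<le> r p) \<and>
    (\<forall>\<^sub>F c in at c0. \<forall>w :: 'p \<Rightarrow> complex. (\<Sum>q | q \<in> X \<and> x q = c. w q) =
       (\<Sum>p\<in>Q. \<Sum>z | z \<in> ball 0 (\<rho> p) - {0} \<and> x (\<gamma> p z) = c. w (\<gamma> p z))) \<and>
    (\<forall>p\<in>Q. \<forall>(h :: complex \<Rightarrow> complex) Y. (h \<longlongrightarrow> Y) (at 0) \<longrightarrow>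
       ((\<lambda>c. \<Sum>z | z \<in> ball 0 (\<rho> p) - {0} \<and> x (\<gamma> p z) = c. h z) \<longlongrightarrow>
          of_int (ord_at (\<lambda>q. x q - c0) p) * Y) (at c0))"
proof -
  define o' where "o' = ord_at (\<lambda>q. x q - c0)"
  have o: "has_ord (\<lambda>z. x (\<gamma> p z) - c0) (o' p)" if "p \<in> X" for p
    using ord[OF that] ord_at_eq[of "\<lambda>q. x q - c0" p] by (auto simp: o'_def)
  have Q: "p \<in> Q \<longleftrightarrow> p \<in> X \<and> o' p > 0" for p by (simp add: Q_def o'_def)
  have "Q \<subseteq> X" by (auto simp: Q)
  obtain \<rho>s where \<rho>s: "\<rho>s > 0" "\<And>p q. p \<in> Q \<Longrightarrow> q \<in> Q \<Longrightarrow> p \<noteq> q \<Longrightarrow>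
    \<gamma> p ` ball 0 (min \<rho>s (r p)) \<inter> \<gamma> q ` ball 0 (min \<rho>s (r q)) = {}"
    using separated_finite[OF fin \<open>Q \<subseteq> X\<close>] by auto
  define Fin where "Fin = (\<lambda>p \<rho>. \<forall>\<^sub>F c in at c0. finite {z \<in> ball 0 \<rho> - {0}. x (\<gamma> p z) = c})"
  define Lim where "Lim = (\<lambda>p \<rho>. \<forall>(h :: complex \<Rightarrow> complex) Y. (h \<longlongrightarrow> Y) (at 0) \<longrightarrow>
    ((\<lambda>c. \<Sum>z | z \<in> ball 0 \<rho> - {0} \<and> x (\<gamma> p z) = c. h z) \<longlongrightarrow> of_int (o' p) * Y) (at c0))"
  have "\<exists>\<rho>0>0. \<forall>\<rho>. 0 < \<rho> \<and> \<rho> \<le> \<rho>0 \<longrightarrow> Fin p \<rho>" if "p \<in> Q" for p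
  proof -
    from that have p: "p \<in> X" "0 < o' p" by (auto simp: Q)
    show ?thesis
      using card_local_fibre[OF o p(2), OF p(1)] unfolding Fin_def eventually_conj_iff by fast
  qed
  then obtain \<rho>1 where \<rho>1: "\<And>p. p \<in> Q \<Longrightarrow> \<rho>1 p > 0"
    "\<And>p \<rho>. p \<in> Q \<Longrightarrow> 0 < \<rho> \<Longrightarrow> \<rho> \<le> \<rho>1 p \<Longrightarrow> Fin p \<rho>"
    by metis
  have "\<exists>\<rho>0>0. \<forall>\<rho>. 0 < \<rho> \<and> \<rho> \<le> \<rho>0 \<longrightarrow> Lim p \<rho>" if "p \<in> Q" for p
  proof -
    from that have p: "p \<in> X" "0 < o' p" by (auto simp: Q)
    show ?thesis
      using tendsto_local_fibre_sum[OF o p(2), OF p(1)] unfolding Lim_def by fast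
  qed
  then obtain \<rho>2 where \<rho>2: "\<And>p. p \<in> Q \<Longrightarrow> \<rho>2 p > 0"
    "\<And>p \<rho>. p \<in> Q \<Longrightarrow> 0 < \<rho> \<Longrightarrow> \<rho> \<le> \<rho>2 p \<Longrightarrow> Lim p \<rho>"
    by metis
  have "\<exists>\<rho>>0. \<exists>\<delta>>0. \<forall>z. z \<noteq> 0 \<and> dist z 0 < \<rho> \<longrightarrow> \<delta> \<le> norm (x (\<gamma> p z) - c0)"
    if p: "p \<in> X - Q" for p
  proof -
    have "o' p \<le> 0" using p Q[of p] by auto
    then obtain \<delta> where "\<delta> > 0" "\<forall>\<^sub>F z in at 0. \<delta> \<le> norm (x (\<gamma> p z) - c0)"
      using bounded_away_if_ord_nonpos[OF o] p by blast
    then show ?thesis unfolding eventually_at by auto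
  qed
  then obtain \<rho>3 \<delta> where \<rho>3: "\<And>p. p \<in> X - Q \<Longrightarrow> \<rho>3 p > 0 \<and> \<delta> p > 0 \<and>
    (\<forall>z. z \<noteq> 0 \<and> dist z 0 < \<rho>3 p \<longrightarrow> \<delta> p \<le> norm (x (\<gamma> p z) - c0))"
    by metis
  define \<rho> where "\<rho> = (\<lambda>p. if p \<in> Q then Min {\<rho>1 p, \<rho>2 p, \<rho>s, r p} else \<rho>3 p)"
  have \<rho>pos: "\<rho> p > 0" if "p \<in> X" for p
    using that \<rho>1(1) \<rho>2(1) \<rho>s(1) \<rho>3 r_pos by (auto simp: \<rho>_def)
  have \<rho>Q: "\<rho> p \<le> \<rho>1 p" "\<rho> p \<le> \<rho>2 p" "\<rho> p \<le> \<rho>s" "\<rho> p \<le> r p" if "p \<in> Q" for p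
    using that by (auto simp: \<rho>_def)
  obtain F where F: "F \<subseteq> X" "finite F" "X \<subseteq> (\<Union>p\<in>F. \<gamma> p ` ball 0 (min (\<rho> p) (r p)))"
    using cover[of \<rho>, OF \<rho>pos] by blast
  \<comment> \<open>The second set takes care of the centres, which punctured discs miss: a centre
    whose value differs from c0 is kept out of the fibre over c.\<close>
  define \<delta>0 where "\<delta>0 = Min (insert 1 (\<delta> ` (F - Q) \<union> (\<lambda>p. norm (x p - c0)) ` {p \<in> F. x p \<noteq> c0}))"
  have finD: "finite (insert 1 (\<delta> ` (F - Q) \<union> (\<lambda>p. norm (x p - c0)) ` {p \<in> F. x p \<noteq> c0}))"
    using F(2) by auto
  have \<delta>0: "\<delta>0 > 0"
    unfolding \<delta>0_def using finD \<rho>3 F(1) by (subst Min_gr_iff) auto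
  have \<delta>0_le: "\<delta>0 \<le> t" if "t \<in> insert 1 (\<delta> ` (F - Q) \<union> (\<lambda>p. norm (x p - c0)) ` {p \<in> F. x p \<noteq> c0})" for t
    unfolding \<delta>0_def using finD that by (rule Min_le)
  define Z where "Z = (\<lambda>p c. {z \<in> ball 0 (\<rho> p) - {0}. x (\<gamma> p z) = c})"
  have fibre: "{q. q \<in> X \<and> x q = c} = (\<Union>p\<in>Q. \<gamma> p ` Z p c)" if c: "c \<noteq> c0" "dist c c0 < \<delta>0" for c
  proof (intro equalityI subsetI)
    fix q assume "q \<in> {q. q \<in> X \<and> x q = c}"
    then have q: "q \<in> X" "x q = c" by auto
    with F(3) obtain p z where p: "p \<in> F" "z \<in> ball 0 (min (\<rho> p) (r p))" "q = \<gamma> p z" by blast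
    have "z \<noteq> 0"
    proof
      assume "z = 0"
      then have "q = p" using p chart_0 F(1) by auto
      then have "\<delta>0 \<le> norm (x p - c0)" using p(1) q(2) c(1) by (intro \<delta>0_le) auto
      then show False using c(2) q(2) \<open>q = p\<close> by (simp add: dist_norm)
    qed
    have "p \<in> Q"
    proof (rule ccontr)
      assume "p \<notin> Q"
      then have "\<delta> p \<le> norm (x q - c0)"
        using \<rho>3[of p] p F(1) \<open>z \<noteq> 0\<close> by (auto simp: \<rho>_def)
      moreover have "\<delta>0 \<le> \<delta> p" using p(1) \<open>p \<notin> Q\<close> by (intro \<delta>0_le) auto
      ultimately show False using c(2) q(2) by (simp add: dist_norm)
    qed
    then show "q \<in> (\<Union>p\<in>Q. \<gamma> p ` Z p c)"
      using p \<open>z \<noteq> 0\<close> q(2) by (auto simp: Z_def)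
  next
    fix q assume "q \<in> (\<Union>p\<in>Q. \<gamma> p ` Z p c)"
    then obtain p z where "p \<in> Q" "z \<in> Z p c" "q = \<gamma> p z" by blast
    then show "q \<in> {q. q \<in> X \<and> x q = c}"
      using \<rho>Q(4)[of p] by (auto simp: Z_def Q intro!: chart_in)
  qed
  have "\<forall>\<^sub>F c in at c0. \<forall>p\<in>Q. finite (Z p c)"
    using \<rho>1(2) \<rho>pos \<rho>Q(1) \<open>Q \<subseteq> X\<close> unfolding Z_def Fin_def
    by (intro eventually_ball_finite[OF fin] ballI) blast
  moreover have "\<forall>\<^sub>F c in at c0. c \<noteq> c0 \<and> dist c c0 < \<delta>0"
    unfolding eventually_at using \<delta>0 by blast
  ultimately have "\<forall>\<^sub>F c in at c0. \<forall>w :: 'p \<Rightarrow> complex.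
    (\<Sum>q | q \<in> X \<and> x q = c. w q) = (\<Sum>p\<in>Q. \<Sum>z\<in>Z p c. w (\<gamma> p z))"
  proof eventually_elim
    case (elim c)
    have inj: "inj_on (\<gamma> p) (Z p c)" if "p \<in> Q" for p
    proof (rule inj_on_subset[OF chart_inj])
      show "Z p c \<subseteq> ball 0 (r p)" using that \<rho>Q(4)[of p] by (auto simp: Z_def)
    qed (use that Q in blast)
    have disj: "\<gamma> p ` Z p c \<inter> \<gamma> q ` Z q c = {}" if "p \<in> Q" "q \<in> Q" "p \<noteq> q" for p q
    proof -
      have "Z p c \<subseteq> ball 0 (min \<rho>s (r p))" "Z q c \<subseteq> ball 0 (min \<rho>s (r q))"
        using \<rho>Q(3,4)[of p] \<rho>Q(3,4)[of q] that by (auto simp: Z_def)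
      then show ?thesis using \<rho>s(2)[OF that] by blast
    qed
    show ?case
    proof
      fix w :: "'p \<Rightarrow> complex"
      have "(\<Sum>q | q \<in> X \<and> x q = c. w q) = sum w (\<Union>p\<in>Q. \<gamma> p ` Z p c)"
        using fibre[of c] elim by simp
      also have "\<dots> = (\<Sum>p\<in>Q. sum w (\<gamma> p ` Z p c))"
        using elim disj fin by (intro sum.UNION_disjoint) auto
      also have "\<dots> = (\<Sum>p\<in>Q. \<Sum>z\<in>Z p c. w (\<gamma> p z))"
        using inj by (intro sum.cong refl) (simp add: sum.reindex)
      finally show "(\<Sum>q | q \<in> X \<and> x q = c. w q) = (\<Sum>p\<in>Q. \<Sum>z\<in>Z p c. w (\<gamma> p z))" .
    qed
  qed
  moreover have "\<forall>p\<in>Q. 0 < \<rho> p \<and> \<rho> p \<le> r p" using \<rho>pos \<rho>Q(4) \<open>Q \<subseteq> X\<close> by blast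
  moreover have "((\<lambda>c. \<Sum>z\<in>Z p c. h z) \<longlongrightarrow> of_int (o' p) * Y) (at c0)"
    if "p \<in> Q" "(h \<longlongrightarrow> Y) (at 0)" for p and h :: "complex \<Rightarrow> complex" and Y
    using \<rho>2(2)[OF that(1), of "\<rho> p"] \<rho>pos \<rho>Q(2) that \<open>Q \<subseteq> X\<close> unfolding Lim_def Z_def by blast
  ultimately show ?thesis
    unfolding Z_def o'_def
    by (intro exI[of _ \<rho>] conjI ballI allI impI) (assumption | blast)+
qed

lemma fibre_sum_tendsto:
  fixes x w Y :: "'p \<Rightarrow> complex" and c0 :: complex
  defines "Q \<equiv> {p \<in> X. ord_at (\<lambda>q. x q - c0) p > 0}"
  assumes ord: "\<And>p. p \<in> X \<Longrightarrow> \<exists>k. has_ord (\<lambda>z. x (\<gamma> p z) - c0) k"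
    and fin: "finite Q" and lim: "\<And>p. p \<in> Q \<Longrightarrow> ((\<lambda>z. w (\<gamma> p z)) \<longlongrightarrow> Y p) (at 0)"
  shows "((\<lambda>c. \<Sum>q | q \<in> X \<and> x q = c. w q) \<longlongrightarrow>
    (\<Sum>p\<in>Q. of_int (ord_at (\<lambda>q. x q - c0) p) * Y p)) (at c0)"
proof -
  obtain \<rho> where \<rho>:
    "\<forall>\<^sub>F c in at c0. \<forall>w :: 'p \<Rightarrow> complex. (\<Sum>q | q \<in> X \<and> x q = c. w q) =
       (\<Sum>p\<in>Q. \<Sum>z | z \<in> ball 0 (\<rho> p) - {0} \<and> x (\<gamma> p z) = c. w (\<gamma> p z))"
    "\<forall>p\<in>Q. \<forall>(h :: complex \<Rightarrow> complex) Y. (h \<longlongrightarrow> Y) (at 0) \<longrightarrow>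
       ((\<lambda>c. \<Sum>z | z \<in> ball 0 (\<rho> p) - {0} \<and> x (\<gamma> p z) = c. h z) \<longlongrightarrow>
          of_int (ord_at (\<lambda>q. x q - c0) p) * Y) (at c0)"
    using fibre_decomposition[of x c0, OF ord] fin unfolding Q_def by blast
  have "((\<lambda>c. \<Sum>p\<in>Q. \<Sum>z | z \<in> ball 0 (\<rho> p) - {0} \<and> x (\<gamma> p z) = c. w (\<gamma> p z)) \<longlongrightarrow>
    (\<Sum>p\<in>Q. of_int (ord_at (\<lambda>q. x q - c0) p) * Y p)) (at c0)"
    using \<rho>(2) lim by (intro tendsto_sum) blast
  then show ?thesis
    by (rule Lim_transform_eventually) (use \<rho>(1) in \<open>auto elim!: eventually_mono\<close>)
qed

text \<open>Over an unramified value each point of the fibre continues to a single nearby point. The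
  difference quotient of the sum is then itself a fibre sum, namely of (w - w p)/(x - c0), and the
  limit lemma for fibre sums evaluates it as the sum of w'/x'. No local inverse of x is
  constructed.\<close>

lemma fibre_sum_differentiable:
  fixes x w :: "'p \<Rightarrow> complex" and c0 :: complex
  assumes ord: "\<And>p. p \<in> X \<Longrightarrow> \<exists>k. has_ord (\<lambda>z. x (\<gamma> p z) - c0) k"
    and fin: "finite {q \<in> X. x q = c0}"
    and Q: "{p \<in> X. ord_at (\<lambda>q. x q - c0) p > 0} = {q \<in> X. x q = c0}"
    and ord_1: "\<And>p. p \<in> X \<Longrightarrow> x p = c0 \<Longrightarrow> ord_at (\<lambda>q. x q - c0) p = 1"
    and x: "\<And>p. p \<in> X \<Longrightarrow> x p = c0 \<Longrightarrow>
      (\<lambda>z. x (\<gamma> p z)) analytic_on {0} \<and> deriv (\<lambda>z. x (\<gamma> p z)) 0 \<noteq> 0"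
    and w: "\<And>p. p \<in> X \<Longrightarrow> x p = c0 \<Longrightarrow> (\<lambda>z. w (\<gamma> p z)) analytic_on {0}"
  shows "(\<lambda>c. \<Sum>q | q \<in> X \<and> x q = c. w q) field_differentiable (at c0)"
proof -
  define Q where "Q = {q \<in> X. x q = c0}"
  define T where "T = (\<lambda>c. \<Sum>q | q \<in> X \<and> x q = c. w q)"
  have finQ: "finite Q" using fin by (simp add: Q_def)
  have fd: "\<exists>\<rho>. (\<forall>p\<in>Q. 0 < \<rho> p \<and> \<rho> p \<le> r p) \<and>
    (\<forall>\<^sub>F c in at c0. \<forall>w :: 'p \<Rightarrow> complex. (\<Sum>q | q \<in> X \<and> x q = c. w q) =
       (\<Sum>p\<in>Q. \<Sum>z | z \<in> ball 0 (\<rho> p) - {0} \<and> x (\<gamma> p z) = c. w (\<gamma> p z))) \<and>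
    (\<forall>p\<in>Q. \<forall>(h :: complex \<Rightarrow> complex) Y. (h \<longlongrightarrow> Y) (at 0) \<longrightarrow>
       ((\<lambda>c. \<Sum>z | z \<in> ball 0 (\<rho> p) - {0} \<and> x (\<gamma> p z) = c. h z) \<longlongrightarrow>
          of_int (ord_at (\<lambda>q. x q - c0) p) * Y) (at c0))"
    using fibre_decomposition[of x c0, OF ord] finQ unfolding Q Q_def by blast
  obtain \<rho> where \<rho>:
    "\<forall>\<^sub>F c in at c0. \<forall>w :: 'p \<Rightarrow> complex. (\<Sum>q | q \<in> X \<and> x q = c. w q) =
       (\<Sum>p\<in>Q. \<Sum>z | z \<in> ball 0 (\<rho> p) - {0} \<and> x (\<gamma> p z) = c. w (\<gamma> p z))"
    and lim: "\<And>p (h :: complex \<Rightarrow> complex) Y. p \<in> Q \<Longrightarrow> (h \<longlongrightarrow> Y) (at 0) \<Longrightarrow>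
       ((\<lambda>c. \<Sum>z | z \<in> ball 0 (\<rho> p) - {0} \<and> x (\<gamma> p z) = c. h z) \<longlongrightarrow> Y) (at c0)"
    using fd ord_1 by (auto simp: Q_def)
  define Z where "Z = (\<lambda>p c. {z \<in> ball 0 (\<rho> p) - {0}. x (\<gamma> p z) = c})"
  \<comment> \<open>The limit lemma for h = 1 gives the limit 1, and a natural number at distance
    less than 1 from 1 equals 1.\<close>
  have "\<forall>\<^sub>F c in at c0. card (Z p c) = 1" if "p \<in> Q" for p
  proof -
    have "\<forall>\<^sub>F c in at c0. dist (\<Sum>z\<in>Z p c. 1::complex) 1 < 1"
      using tendstoD[OF lim[OF that tendsto_const], of 1 1] by (simp add: Z_def)
    then show ?thesis
    proof eventually_elim
      case (elim c)
      then have "norm (of_real (real (card (Z p c)) - 1) :: complex) < 1"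
        by (simp add: dist_norm)
      then have "\<bar>real (card (Z p c)) - 1\<bar> < 1"
        unfolding norm_of_real .
      then show ?case by linarith
    qed
  qed
  then have "\<forall>\<^sub>F c in at c0. \<forall>p\<in>Q. card (Z p c) = 1"
    using finQ by (simp add: eventually_ball_finite)
  moreover have "\<forall>\<^sub>F c in at c0. c \<noteq> c0" by (simp add: eventually_at_filter)
  ultimately have eq: "\<forall>\<^sub>F c in at c0.
    (\<Sum>p\<in>Q. \<Sum>z\<in>Z p c. (w (\<gamma> p z) - w p) / (x (\<gamma> p z) - c0)) = (T c - T c0) / (c - c0)"
    using \<rho>
  proof eventually_elim
    case (elim c)
    have "(\<Sum>p\<in>Q. \<Sum>z\<in>Z p c. (w (\<gamma> p z) - w p) / (x (\<gamma> p z) - c0))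
      = (\<Sum>p\<in>Q. ((\<Sum>z\<in>Z p c. w (\<gamma> p z)) - w p) / (c - c0))"
    proof (rule sum.cong[OF refl])
      fix p assume p: "p \<in> Q"
      have "(\<Sum>z\<in>Z p c. (w (\<gamma> p z) - w p) / (x (\<gamma> p z) - c0))
        = (\<Sum>z\<in>Z p c. (w (\<gamma> p z) - w p) / (c - c0))"
        by (intro sum.cong) (auto simp: Z_def)
      also have "\<dots> = ((\<Sum>z\<in>Z p c. w (\<gamma> p z)) - w p) / (c - c0)"
        using elim p by (simp add: sum_subtractf flip: sum_divide_distrib)
      finally show "(\<Sum>z\<in>Z p c. (w (\<gamma> p z) - w p) / (x (\<gamma> p z) - c0))
        = ((\<Sum>z\<in>Z p c. w (\<gamma> p z)) - w p) / (c - c0)" .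
    qed
    also have "\<dots> = ((\<Sum>p\<in>Q. \<Sum>z\<in>Z p c. w (\<gamma> p z)) - (\<Sum>p\<in>Q. w p)) / (c - c0)"
      by (simp add: sum_subtractf flip: sum_divide_distrib)
    also have "\<dots> = (T c - T c0) / (c - c0)"
      using elim by (simp add: T_def Z_def Q_def)
    finally show ?case .
  qed
  have quot: "((\<lambda>z. (w (\<gamma> p z) - w p) / (x (\<gamma> p z) - c0)) \<longlongrightarrow>
    deriv (\<lambda>z. w (\<gamma> p z)) 0 / deriv (\<lambda>z. x (\<gamma> p z)) 0) (at 0)" if "p \<in> Q" for p
  proof -
    have p: "p \<in> X" "x p = c0" using that by (auto simp: Q_def)
    have D: "((\<lambda>z. (f (\<gamma> p z) - f p) / (z - 0)) \<longlongrightarrow> deriv (\<lambda>z. f (\<gamma> p z)) 0) (at 0)"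
      if "(\<lambda>z. f (\<gamma> p z)) analytic_on {0}" for f :: "'p \<Rightarrow> complex"
    proof -
      have "((\<lambda>z. f (\<gamma> p z)) has_field_derivative deriv (\<lambda>z. f (\<gamma> p z)) 0) (at 0)"
        using analytic_on_imp_differentiable_at[OF that, of 0] by (simp add: DERIV_deriv_iff_field_differentiable)
      then show ?thesis unfolding has_field_derivative_iff using chart_0[OF p(1)] by simp
    qed
    have "((\<lambda>z. (w (\<gamma> p z) - w p) / (z - 0) / ((x (\<gamma> p z) - x p) / (z - 0))) \<longlongrightarrow>
      deriv (\<lambda>z. w (\<gamma> p z)) 0 / deriv (\<lambda>z. x (\<gamma> p z)) 0) (at 0)"
      using D x w p by (intro tendsto_divide) auto
    moreover have "\<forall>\<^sub>F z in at 0. (w (\<gamma> p z) - w p) / (z - 0) / ((x (\<gamma> p z) - x p) / (z - 0))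
      = (w (\<gamma> p z) - w p) / (x (\<gamma> p z) - c0)"
      unfolding eventually_at_filter by (rule always_eventually) (simp add: p(2))
    ultimately show ?thesis by (rule Lim_transform_eventually)
  qed
  have "((\<lambda>c. \<Sum>p\<in>Q. \<Sum>z\<in>Z p c. (w (\<gamma> p z) - w p) / (x (\<gamma> p z) - c0)) \<longlongrightarrow>
    (\<Sum>p\<in>Q. deriv (\<lambda>z. w (\<gamma> p z)) 0 / deriv (\<lambda>z. x (\<gamma> p z)) 0)) (at c0)"
    unfolding Z_def by (intro tendsto_sum lim quot)
  then have "((\<lambda>c. (T c - T c0) / (c - c0)) \<longlongrightarrow>
    (\<Sum>p\<in>Q. deriv (\<lambda>z. w (\<gamma> p z)) 0 / deriv (\<lambda>z. x (\<gamma> p z)) 0)) (at c0)"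
    using eq by (rule Lim_transform_eventually)
  then show ?thesis
    unfolding T_def[symmetric] field_differentiable_def has_field_derivative_iff by blast
qed

end

text \<open>The condition that (z - c) f tends to 0 admits functions that are a priori unbounded
  near c, as a fibre sum may be near a branch value.\<close>

lemma removable_singularities_lim:
  fixes f :: "complex \<Rightarrow> complex"
  assumes "finite C" "f holomorphic_on - C" "\<And>c. c \<in> C \<Longrightarrow> ((\<lambda>z. (z - c) * f z) \<longlongrightarrow> 0) (at c)"
  shows "\<exists>g. g holomorphic_on UNIV \<and> (\<forall>z. z \<notin> C \<longrightarrow> g z = f z)"
  using assms
proof (induction C arbitrary: f rule: finite_induct)
  case (insert a C)
  have "open (- C)" using insert.hyps(1) by (simp add: finite_imp_closed open_Compl)
  then have "a \<in> interior (- C)" using insert.hyps(2) by (simp add: interior_open)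
  moreover have "f holomorphic_on (- C) - {a}"
    using insert.prems(1) by (simp add: Compl_insert)
  ultimately obtain g where g: "g holomorphic_on - C" "\<And>z. z \<in> - C - {a} \<Longrightarrow> g z = f z"
    using holomorphic_on_extend_lim[of f "- C" a] insert.prems(2)[of a] by auto
  have "((\<lambda>z. (z - c) * g z) \<longlongrightarrow> 0) (at c)" if "c \<in> C" for c
  proof -
    have "open (- (insert a C - {c}))"
      by (intro open_Compl finite_imp_closed finite_Diff) (simp add: insert.hyps(1))
    then have "\<forall>\<^sub>F z in at c. z \<in> - (insert a C - {c}) - {c}"
      by (rule eventually_at_in_open) auto
    then have "\<forall>\<^sub>F z in at c. (z - c) * f z = (z - c) * g z"
      by eventually_elim (use g(2) in auto)
    with insert.prems(2)[of c] that show ?thesis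
      by (blast intro: Lim_transform_eventually)
  qed
  from insert.IH[OF g(1) this] obtain h where "h holomorphic_on UNIV" "\<forall>z. z \<notin> C \<longrightarrow> h z = g z"
    by blast
  then show ?case using g(2) by auto
qed auto

context charted_surface begin

text \<open>\<open>lim0\<close> makes the singularities of the fibre sum T removable, and
  \<open>limY\<close> gives T a limit at 0 and at infinity. The zeros of x contribute their order
  times Y to the first, the poles minus their order times Y to the second; a constant T equates the
  two.\<close>

theorem sum_ord_mult_limit_eq_0:
  fixes x w Y :: "'p \<Rightarrow> complex"
  assumes ord: "\<And>p c. p \<in> X \<Longrightarrow> \<exists>k. has_ord (\<lambda>z. x (\<gamma> p z) - c) k"
    and S: "finite S"
    and x: "\<And>p. p \<in> X - S \<Longrightarrow> (\<lambda>z. x (\<gamma> p z)) analytic_on {0} \<and> deriv (\<lambda>z. x (\<gamma> p z)) 0 \<noteq> 0"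
    and w: "\<And>p. p \<in> X - S \<Longrightarrow> (\<lambda>z. w (\<gamma> p z)) analytic_on {0}"
    and lim0: "\<And>p c. p \<in> X \<Longrightarrow> ord_at (\<lambda>q. x q - c) p > 0 \<Longrightarrow>
      ((\<lambda>z. (x (\<gamma> p z) - c) * w (\<gamma> p z)) \<longlongrightarrow> 0) (at 0)"
    and limY: "\<And>p. p \<in> X \<Longrightarrow> ord_at x p \<noteq> 0 \<Longrightarrow> ((\<lambda>z. w (\<gamma> p z)) \<longlongrightarrow> Y p) (at 0)"
  shows "(\<Sum>p | p \<in> X \<and> ord_at x p \<noteq> 0. of_int (ord_at x p) * Y p) = 0"
proof -
  define T where "T = (\<lambda>c. \<Sum>q | q \<in> X \<and> x q = c. w q)"
  have o: "has_ord (\<lambda>z. x (\<gamma> p z) - c) (ord_at (\<lambda>q. x q - c) p)" if "p \<in> X" for p c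
    using ord[OF that, of c] ord_at_eq[of "\<lambda>q. x q - c" p] by auto
  have o0: "has_ord (\<lambda>z. x (\<gamma> p z)) (ord_at x p)" if "p \<in> X" for p
    using o[OF that, of 0] by simp
  have limx: "((\<lambda>z. x (\<gamma> p z)) \<longlongrightarrow> c) (at 0)" if "p \<in> X" "ord_at (\<lambda>q. x q - c) p > 0" for p c
    using has_ord_limit_0[OF o[OF that(1)] that(2)] Lim_null by blast
  have limx': "((\<lambda>z. x (\<gamma> p z)) \<longlongrightarrow> x p) (at 0)" if "p \<in> X - S" for p
  proof -
    have "isCont (\<lambda>z. x (\<gamma> p z)) 0" using x[OF that] by (intro analytic_at_imp_isCont) blast
    then show ?thesis using chart_0[of p] that by (simp add: isCont_def)
  qed
  have fin: "finite {q \<in> X. x q = c}" for c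
  proof (rule finite_if_isolated)
    fix p assume "p \<in> X"
    show "\<forall>\<^sub>F z in at 0. x (\<gamma> p z) \<noteq> c"
      using has_ord_eventually_nz[OF o[OF \<open>p \<in> X\<close>, of c]] by (auto elim: eventually_mono)
  qed
  have Q_eq: "x p = c" if "p \<in> X - S" "ord_at (\<lambda>q. x q - c) p > 0" for p c
    using tendsto_unique[OF _ limx limx'] that by auto
  have finQ: "finite {p \<in> X. ord_at (\<lambda>q. x q - c) p > 0}" for c
    by (rule finite_subset[of _ "S \<union> {q \<in> X. x q = c}"]) (use S fin Q_eq in auto)
  have ord_1: "ord_at (\<lambda>q. x q - c) p = 1" if "p \<in> X - S" "x p = c" for p c
  proof -
    have an: "(\<lambda>z. x (\<gamma> p z)) analytic_on {0}" and d: "deriv (\<lambda>z. x (\<gamma> p z)) 0 \<noteq> 0"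
      using x[OF that(1)] by auto
    have "((\<lambda>z. x (\<gamma> p z)) has_field_derivative deriv (\<lambda>z. x (\<gamma> p z)) 0) (at 0)"
      using analytic_on_imp_differentiable_at[OF an, of 0]
      by (simp add: DERIV_deriv_iff_field_differentiable)
    then have lim: "((\<lambda>z. (x (\<gamma> p z) - c) / z) \<longlongrightarrow> deriv (\<lambda>z. x (\<gamma> p z)) 0) (at 0)"
      unfolding has_field_derivative_iff using chart_0[of p] that by simp
    have o1: "has_ord (\<lambda>z. (x (\<gamma> p z) - c) / z) (ord_at (\<lambda>q. x q - c) p - 1)"
      using has_ord_divide[OF o has_ord_id] that(1) by blast
    have "\<not> ord_at (\<lambda>q. x q - c) p - 1 > 0"
      using tendsto_unique[OF _ lim has_ord_limit_0[OF o1]] d by auto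
    moreover have "\<not> ord_at (\<lambda>q. x q - c) p - 1 < 0"
    proof
      assume "ord_at (\<lambda>q. x q - c) p - 1 < 0"
      then have lim0: "((\<lambda>z. 1 / ((x (\<gamma> p z) - c) / z)) \<longlongrightarrow> 0) (at 0)"
        using has_ord_limit_0[OF has_ord_inverse[OF o1]] by linarith
      have "((\<lambda>z. 1 / ((x (\<gamma> p z) - c) / z)) \<longlongrightarrow> 1 / deriv (\<lambda>z. x (\<gamma> p z)) 0) (at 0)"
        by (intro tendsto_divide tendsto_const lim d)
      from tendsto_unique[OF _ this lim0] d show False by simp
    qed
    ultimately show ?thesis by linarith
  qed
  \<comment> \<open>A point of S can spoil T both at the limit of x there and at the value assigned
    to x there, and these may be different.\<close>
  define C where "C = (\<Union>p\<in>S \<inter> X. {c. ord_at (\<lambda>q. x q - c) p > 0}) \<union> x ` S"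
  have "finite {c. ord_at (\<lambda>q. x q - c) p > 0}" if "p \<in> X" for p
  proof (cases "\<exists>c. ord_at (\<lambda>q. x q - c) p > 0")
    case True
    then obtain c where c: "ord_at (\<lambda>q. x q - c) p > 0" by blast
    have "{c. ord_at (\<lambda>q. x q - c) p > 0} \<subseteq> {c}"
      using tendsto_unique[OF _ limx[OF that] limx[OF that c]] by auto
    then show ?thesis using finite_subset by blast
  qed auto
  then have finC: "finite C" using S by (auto simp: C_def)
  have "T field_differentiable (at c)" if c: "c \<notin> C" for c
    unfolding T_def
  proof (rule fibre_sum_differentiable)
    have *: "p \<in> X - S" if "p \<in> X" "x p = c" for p using that c by (auto simp: C_def)
    show "{p \<in> X. 0 < ord_at (\<lambda>q. x q - c) p} = {q \<in> X. x q = c}"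
    proof (intro Collect_cong conj_cong refl iffI)
      fix p assume p: "p \<in> X" "0 < ord_at (\<lambda>q. x q - c) p"
      then have "p \<notin> S" using c by (auto simp: C_def)
      then show "x p = c" using Q_eq p by blast
    next
      fix p assume "p \<in> X" "x p = c"
      then show "0 < ord_at (\<lambda>q. x q - c) p" using ord_1 * by simp
    qed
    show "ord_at (\<lambda>q. x q - c) p = 1" if "p \<in> X" "x p = c" for p
      using ord_1 * that by blast
    show "(\<lambda>z. x (\<gamma> p z)) analytic_on {0} \<and> deriv (\<lambda>z. x (\<gamma> p z)) 0 \<noteq> 0"
      if "p \<in> X" "x p = c" for p using x * that by blast
    show "(\<lambda>z. w (\<gamma> p z)) analytic_on {0}" if "p \<in> X" "x p = c" for p using w * that by blast
  qed (use ord fin in auto)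
  then have "T holomorphic_on - C"
    by (auto simp: holomorphic_on_def intro: field_differentiable_at_within)
  \<comment> \<open>On the fibre over c the factor c - c0 equals x q - c0, so (c - c0) T c is the
    fibre sum of (x - c0) w, whose local limits vanish by \<open>lim0\<close>.\<close>
  moreover have "((\<lambda>c. (c - c0) * T c) \<longlongrightarrow> 0) (at c0)" for c0
  proof -
    have "((\<lambda>c. \<Sum>q | q \<in> X \<and> x q = c. (x q - c0) * w q) \<longlongrightarrow>
      (\<Sum>p | p \<in> X \<and> ord_at (\<lambda>q. x q - c0) p > 0. of_int (ord_at (\<lambda>q. x q - c0) p) * 0)) (at c0)"
      by (rule fibre_sum_tendsto) (use ord finQ lim0 in auto)
    moreover have "(\<Sum>q | q \<in> X \<and> x q = c. (x q - c0) * w q) = (c - c0) * T c" for c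
      by (simp add: T_def sum_distrib_left)
    ultimately show ?thesis by simp
  qed
  ultimately obtain g where g: "g holomorphic_on UNIV" "\<And>c. c \<notin> C \<Longrightarrow> g c = T c"
    using removable_singularities_lim[OF finC, of T] by blast
  \<comment> \<open>The poles of x are the zeros of 1/x with the opposite orders, whence the
    sign.\<close>
  define l where "l = (\<Sum>p | p \<in> X \<and> ord_at x p < 0. - of_int (ord_at x p) * Y p)"
  have ord_inv: "ord_at (\<lambda>q. 1 / x q - 0) p = - ord_at x p" if "p \<in> X" for p
    using has_ord_inverse[OF o0[OF that]] by (intro ord_at_eq) simp
  have "{p \<in> X. ord_at x p < 0} \<subseteq> S"
  proof (rule ccontr)
    assume "\<not> {p \<in> X. ord_at x p < 0} \<subseteq> S"
    then obtain p where p: "p \<in> X - S" "ord_at x p < 0" by blast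
    have "((\<lambda>z. 1 / x (\<gamma> p z)) \<longlongrightarrow> 0) (at 0)"
      using has_ord_limit_0[OF has_ord_inverse[OF o0[of p]]] p by simp
    then have "((\<lambda>z. x (\<gamma> p z) * (1 / x (\<gamma> p z))) \<longlongrightarrow> x p * 0) (at 0)"
      by (intro tendsto_mult limx' p)
    moreover have "\<forall>\<^sub>F z in at 0. x (\<gamma> p z) * (1 / x (\<gamma> p z)) = 1"
      using has_ord_eventually_nz[OF o0[of p]] p by (auto elim: eventually_mono)
    then have "((\<lambda>z. x (\<gamma> p z) * (1 / x (\<gamma> p z))) \<longlongrightarrow> 1) (at 0)"
      by (rule tendsto_eventually)
    ultimately show False using tendsto_unique[of "at (0::complex)"] by fastforce
  qed
  then have finP: "finite {p \<in> X. ord_at x p < 0}" using S finite_subset by blast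
  have "((\<lambda>c. \<Sum>q | q \<in> X \<and> 1 / x q = c. w q) \<longlongrightarrow>
    (\<Sum>p | p \<in> X \<and> ord_at (\<lambda>q. 1 / x q - 0) p > 0. of_int (ord_at (\<lambda>q. 1 / x q - 0) p) * Y p)) (at 0)"
  proof (rule fibre_sum_tendsto)
    show "\<exists>k. has_ord (\<lambda>z. 1 / x (\<gamma> p z) - 0) k" if "p \<in> X" for p
      using has_ord_inverse[OF o0[OF that]] by auto
    have "{p \<in> X. ord_at (\<lambda>q. 1 / x q - 0) p > 0} = {p \<in> X. ord_at x p < 0}"
      using ord_inv by auto
    then show "finite {p \<in> X. ord_at (\<lambda>q. 1 / x q - 0) p > 0}" using finP by simp
  qed (use limY ord_inv in auto)
  also have "(\<Sum>p | p \<in> X \<and> ord_at (\<lambda>q. 1 / x q - 0) p > 0. of_int (ord_at (\<lambda>q. 1 / x q - 0) p) * Y p) = l"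
    unfolding l_def by (rule sum.cong) (use ord_inv in auto)
  finally have "((\<lambda>c. T (inverse c)) \<longlongrightarrow> l) (at 0)"
  proof (rule Lim_transform_eventually)
    have "\<forall>\<^sub>F c in at 0. c \<noteq> (0::complex)" by (simp add: eventually_at_filter)
    then show "\<forall>\<^sub>F c in at 0. (\<Sum>q | q \<in> X \<and> 1 / x q = c. w q) = T (inverse c)"
    proof eventually_elim
      case (elim c)
      have "(1 / x q = c) = (x q = inverse c)" for q
        by (metis inverse_eq_divide inverse_inverse_eq)
      then show ?case by (simp add: T_def)
    qed
  qed
  then have "(T \<longlongrightarrow> l) at_infinity"
    by (simp add: lim_at_infinity_0 o_def)
  moreover have "\<forall>\<^sub>F c in at_infinity. T c = g c"
  proof -
    obtain B where B: "\<And>c. c \<in> C \<Longrightarrow> norm c \<le> B"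
      using finite_imp_bounded[OF finC] unfolding bounded_iff by blast
    have "T c = g c" if "norm c \<ge> B + 1" for c
      using B[of c] that g(2)[of c] by fastforce
    then show ?thesis unfolding eventually_at_infinity by blast
  qed
  ultimately have "(g \<longlongrightarrow> l) at_infinity" by (rule Lim_transform_eventually)
  then have gl: "g c = l" for c using Liouville_weak[OF g(1)] by blast
  have "(T \<longlongrightarrow> (\<Sum>p | p \<in> X \<and> ord_at (\<lambda>q. x q - 0) p > 0. of_int (ord_at (\<lambda>q. x q - 0) p) * Y p)) (at 0)"
    unfolding T_def by (rule fibre_sum_tendsto) (use ord[of _ 0] finQ[of 0] limY in auto)
  moreover have "\<forall>\<^sub>F c in at 0. T c = l"
  proof -
    have "open (- (C - {0}))" by (intro open_Compl finite_imp_closed finite_Diff finC)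
    then have "\<forall>\<^sub>F c in at 0. c \<in> - (C - {0}) - {0}" by (rule eventually_at_in_open) auto
    then show ?thesis by eventually_elim (use g(2) gl in auto)
  qed
  then have "(T \<longlongrightarrow> l) (at 0)" by (rule tendsto_eventually)
  ultimately have pos: "(\<Sum>p | p \<in> X \<and> ord_at x p > 0. of_int (ord_at x p) * Y p) = l"
    using tendsto_unique[of "at (0::complex)"] by fastforce
  have "{p. p \<in> X \<and> ord_at x p \<noteq> 0} = {p. p \<in> X \<and> ord_at x p > 0} \<union> {p. p \<in> X \<and> ord_at x p < 0}"
    by auto
  then have "(\<Sum>p | p \<in> X \<and> ord_at x p \<noteq> 0. of_int (ord_at x p) * Y p) =
    (\<Sum>p | p \<in> X \<and> ord_at x p > 0. of_int (ord_at x p) * Y p) +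
    (\<Sum>p | p \<in> X \<and> ord_at x p < 0. of_int (ord_at x p) * Y p)"
    using finQ[of 0] finP by (simp, subst sum.union_disjoint[symmetric]) auto
  also have "\<dots> = 0" unfolding pos l_def by (simp add: sum_negf)
  finally show ?thesis .
qed

end

section \<open>Forms and polynomial functions\<close>

definition form :: "nat \<Rightarrow> ((nat \<Rightarrow> complex) \<Rightarrow> complex) set" where
  "form e = {eval_mpoly F | F. homogeneous e F}"

definition monom_val :: "(nat \<Rightarrow>\<^sub>0 nat) \<Rightarrow> (nat \<Rightarrow> complex) \<Rightarrow> complex" where
  "monom_val m v = (\<Prod>i\<in>Poly_Mapping.keys m. v i ^ Poly_Mapping.lookup m i)"

definition monom_deg :: "(nat \<Rightarrow>\<^sub>0 nat) \<Rightarrow> nat" where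
  "monom_deg m = (\<Sum>i\<in>Poly_Mapping.keys m. Poly_Mapping.lookup m i)"

lemma monom_val_superset:
  "finite A \<Longrightarrow> Poly_Mapping.keys m \<subseteq> A \<Longrightarrow> monom_val m v = (\<Prod>i\<in>A. v i ^ Poly_Mapping.lookup m i)"
  unfolding monom_val_def by (rule prod.mono_neutral_left) (auto simp: in_keys_iff)

lemma monom_deg_superset:
  "finite A \<Longrightarrow> Poly_Mapping.keys m \<subseteq> A \<Longrightarrow> monom_deg m = (\<Sum>i\<in>A. Poly_Mapping.lookup m i)"
  unfolding monom_deg_def by (rule sum.mono_neutral_left) (auto simp: in_keys_iff)

lemma monom_val_add: "monom_val (m + m') v = monom_val m v * monom_val m' v"
proof -
  define A where "A = Poly_Mapping.keys m \<union> Poly_Mapping.keys m'"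
  have A: "finite A" "Poly_Mapping.keys m \<subseteq> A" "Poly_Mapping.keys m' \<subseteq> A" "Poly_Mapping.keys (m + m') \<subseteq> A"
    using Poly_Mapping.keys_add[of m m'] by (auto simp: A_def)
  show ?thesis
    using monom_val_superset[OF A(1)] A(2-4)
    by (simp add: lookup_add power_add prod.distrib)
qed

lemma monom_deg_add: "monom_deg (m + m') = monom_deg m + monom_deg m'"
proof -
  define A where "A = Poly_Mapping.keys m \<union> Poly_Mapping.keys m'"
  have A: "finite A" "Poly_Mapping.keys m \<subseteq> A" "Poly_Mapping.keys m' \<subseteq> A" "Poly_Mapping.keys (m + m') \<subseteq> A"
    using Poly_Mapping.keys_add[of m m'] by (auto simp: A_def)
  show ?thesis
    using monom_deg_superset[OF A(1)] A(2-4) by (simp add: lookup_add sum.distrib)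
qed

lemma eval_mpoly_superset:
  "finite A \<Longrightarrow> Poly_Mapping.keys F \<subseteq> A \<Longrightarrow>
     eval_mpoly F v = (\<Sum>m\<in>A. Poly_Mapping.lookup F m * monom_val m v)"
  unfolding eval_mpoly_def monom_val_def by (rule sum.mono_neutral_left) (auto simp: in_keys_iff)

lemma eval_mpoly_add: "eval_mpoly (F + G) v = eval_mpoly F v + eval_mpoly G v"
proof -
  define A where "A = Poly_Mapping.keys F \<union> Poly_Mapping.keys G"
  have A: "finite A" "Poly_Mapping.keys F \<subseteq> A" "Poly_Mapping.keys G \<subseteq> A" "Poly_Mapping.keys (F + G) \<subseteq> A"
    using Poly_Mapping.keys_add[of F G] by (auto simp: A_def)
  show ?thesis
    using eval_mpoly_superset[OF A(1)] A(2-4) by (simp add: lookup_add distrib_right sum.distrib)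
qed

lemma eval_mpoly_0: "eval_mpoly 0 v = 0"
  by (simp add: eval_mpoly_def)

lemma eval_mpoly_sum: "eval_mpoly (\<Sum>x\<in>A. f x) v = (\<Sum>x\<in>A. eval_mpoly (f x) v)"
  by (induction A rule: infinite_finite_induct) (auto simp: eval_mpoly_0 eval_mpoly_add)

lemma eval_mpoly_single: "eval_mpoly (Poly_Mapping.single m c) v = c * monom_val m v"
  by (subst eval_mpoly_superset[of "{m}"]) auto

lemma sum_monomials: "(\<Sum>m\<in>Poly_Mapping.keys F. Poly_Mapping.single m (Poly_Mapping.lookup F m)) = F"
proof (rule poly_mapping_eqI)
  fix k
  have "Poly_Mapping.lookup (\<Sum>m\<in>Poly_Mapping.keys F. Poly_Mapping.single m (Poly_Mapping.lookup F m)) k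
    = (\<Sum>m\<in>Poly_Mapping.keys F. if m = k then Poly_Mapping.lookup F m else 0)"
    by (simp add: lookup_sum lookup_single when_def)
  also have "\<dots> = Poly_Mapping.lookup F k"
    by (simp add: in_keys_iff)
  finally show "Poly_Mapping.lookup (\<Sum>m\<in>Poly_Mapping.keys F. Poly_Mapping.single m (Poly_Mapping.lookup F m)) k
    = Poly_Mapping.lookup F k" .
qed

lemma eval_mpoly_mult: "eval_mpoly (F * G) v = eval_mpoly F v * eval_mpoly G v"
proof -
  have "F * G = (\<Sum>m\<in>Poly_Mapping.keys F. Poly_Mapping.single m (Poly_Mapping.lookup F m)) *
    (\<Sum>m\<in>Poly_Mapping.keys G. Poly_Mapping.single m (Poly_Mapping.lookup G m))"
    by (simp add: sum_monomials)
  also have "\<dots> = (\<Sum>m\<in>Poly_Mapping.keys F. \<Sum>m'\<in>Poly_Mapping.keys G.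
      Poly_Mapping.single (m + m') (Poly_Mapping.lookup F m * Poly_Mapping.lookup G m'))"
    by (simp add: sum_product mult_single)
  finally have "eval_mpoly (F * G) v = (\<Sum>m\<in>Poly_Mapping.keys F. \<Sum>m'\<in>Poly_Mapping.keys G.
      (Poly_Mapping.lookup F m * monom_val m v) * (Poly_Mapping.lookup G m' * monom_val m' v))"
    by (simp add: eval_mpoly_sum eval_mpoly_single monom_val_add algebra_simps)
  then show ?thesis
    by (simp add: eval_mpoly_superset[of "Poly_Mapping.keys F"] eval_mpoly_superset[of "Poly_Mapping.keys G"] sum_product)
qed

lemma homogeneous_iff: "homogeneous e F \<longleftrightarrow> (\<forall>m\<in>Poly_Mapping.keys F. monom_deg m = e)"
  by (simp add: homogeneous_def monom_deg_def)

lemma form_mult: "f \<in> form e \<Longrightarrow> g \<in> form e' \<Longrightarrow> (\<lambda>v. f v * g v) \<in> form (e + e')"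
proof -
  assume "f \<in> form e" "g \<in> form e'"
  then obtain F G where FG: "f = eval_mpoly F" "g = eval_mpoly G" "homogeneous e F" "homogeneous e' G"
    by (auto simp: form_def)
  have "homogeneous (e + e') (F * G)"
    using FG(3,4) keys_mult[of F G] by (fastforce simp: homogeneous_iff monom_deg_add)
  then show ?thesis
    unfolding form_def FG by (auto simp: eval_mpoly_mult[symmetric] intro!: exI[of _ "F * G"])
qed

lemma form_add: "f \<in> form e \<Longrightarrow> g \<in> form e \<Longrightarrow> (\<lambda>v. f v + g v) \<in> form e"
proof -
  assume "f \<in> form e" "g \<in> form e"
  then obtain F G where FG: "f = eval_mpoly F" "g = eval_mpoly G" "homogeneous e F" "homogeneous e G"
    by (auto simp: form_def)
  have "homogeneous e (F + G)"
    using FG(3,4) Poly_Mapping.keys_add[of F G] by (fastforce simp: homogeneous_iff)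
  then show ?thesis
    unfolding form_def FG by (auto simp: eval_mpoly_add[symmetric] intro!: exI[of _ "F + G"])
qed

lemma form_const: "(\<lambda>_. c) \<in> form 0"
proof -
  have "homogeneous 0 (Poly_Mapping.single 0 c)" "eval_mpoly (Poly_Mapping.single 0 c) = (\<lambda>_. c)"
    by (auto simp: homogeneous_iff monom_deg_def monom_val_def eval_mpoly_single fun_eq_iff split: if_splits)
  then show ?thesis unfolding form_def by force
qed

lemma form_coord: "(\<lambda>v. v i) \<in> form 1"
proof -
  have "homogeneous 1 (Poly_Mapping.single (Poly_Mapping.single i 1) 1)"
    "eval_mpoly (Poly_Mapping.single (Poly_Mapping.single i 1) 1) = (\<lambda>v. v i)"
    by (auto simp: homogeneous_iff monom_deg_def monom_val_def eval_mpoly_single fun_eq_iff split: if_splits)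
  then show ?thesis unfolding form_def by force
qed

lemma form_scale: "f \<in> form e \<Longrightarrow> (\<lambda>v. c * f v) \<in> form e"
  using form_mult[OF form_const] by force

lemma form_diff: "f \<in> form e \<Longrightarrow> g \<in> form e \<Longrightarrow> (\<lambda>v. f v - g v) \<in> form e"
  using form_add[of f e "\<lambda>v. (-1) * g v"] form_scale[of g e "-1"] by simp

lemma form_power: "f \<in> form e \<Longrightarrow> (\<lambda>v. f v ^ n) \<in> form (n * e)"
  by (induction n) (auto intro: form_const form_mult)

lemma form_coord_power: "(\<lambda>v. v i ^ n) \<in> form n"
  using form_power[OF form_coord, of i n] by simp

lemma form_homogeneous: "f \<in> form e \<Longrightarrow> f (\<lambda>i. c * v i) = c ^ e * f v"
proof -
  assume "f \<in> form e"
  then obtain F where F: "f = eval_mpoly F" "homogeneous e F" by (auto simp: form_def)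
  have "monom_val m (\<lambda>i. c * v i) = c ^ monom_deg m * monom_val m v" for m
    by (simp add: monom_val_def monom_deg_def power_mult_distrib prod.distrib power_sum)
  then show ?thesis
    using F by (simp add: eval_mpoly_superset[of "Poly_Mapping.keys F"] homogeneous_iff sum_distrib_left algebra_simps)
qed

inductive_set poly_fun :: "((nat \<Rightarrow> complex) \<Rightarrow> complex) set" where
  const: "(\<lambda>_. c) \<in> poly_fun"
| coord: "(\<lambda>v. v i) \<in> poly_fun"
| add: "P \<in> poly_fun \<Longrightarrow> Q \<in> poly_fun \<Longrightarrow> (\<lambda>v. P v + Q v) \<in> poly_fun"
| mult: "P \<in> poly_fun \<Longrightarrow> Q \<in> poly_fun \<Longrightarrow> (\<lambda>v. P v * Q v) \<in> poly_fun"

lemma poly_fun_diff: "P \<in> poly_fun \<Longrightarrow> Q \<in> poly_fun \<Longrightarrow> (\<lambda>v. P v - Q v) \<in> poly_fun"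
  using poly_fun.add[OF _ poly_fun.mult[OF poly_fun.const[of "-1"]], of P Q] by simp

lemma poly_fun_sum: "(\<And>x. x \<in> A \<Longrightarrow> f x \<in> poly_fun) \<Longrightarrow> (\<lambda>v. \<Sum>x\<in>A. f x v) \<in> poly_fun"
  by (induction A rule: infinite_finite_induct) (auto intro: poly_fun.intros)

lemma poly_fun_prod: "(\<And>x. x \<in> A \<Longrightarrow> f x \<in> poly_fun) \<Longrightarrow> (\<lambda>v. \<Prod>x\<in>A. f x v) \<in> poly_fun"
  by (induction A rule: infinite_finite_induct) (auto intro: poly_fun.intros)

lemma poly_fun_power: "f \<in> poly_fun \<Longrightarrow> (\<lambda>v. f v ^ n) \<in> poly_fun"
  by (induction n) (auto intro: poly_fun.intros)

lemma form_poly_fun: "f \<in> form e \<Longrightarrow> f \<in> poly_fun"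
proof -
  assume "f \<in> form e"
  then obtain F where "f = eval_mpoly F" by (auto simp: form_def)
  moreover have "eval_mpoly F \<in> poly_fun"
    unfolding eval_mpoly_def
    by (intro poly_fun_sum poly_fun_prod poly_fun_power poly_fun.mult poly_fun.const poly_fun.coord)
  ultimately show ?thesis by simp
qed

text \<open>The exponent e need not be a degree: a sum is brought to the common exponent e + e', so
  that no notion of degree for polynomial functions enters.\<close>

lemma homogenize:
  assumes "P \<in> poly_fun"
  shows "\<exists>e. \<exists>f\<in>form e. \<forall>v. v a \<noteq> 0 \<longrightarrow> f v = v a ^ e * P (\<lambda>i. v i / v a)"
  using assms
proof induction
  case (const c)
  then show ?case using form_const[of c] by (intro exI[of _ 0] bexI[of _ "\<lambda>_. c"]) auto
next
  case (coord i)
  then show ?case using form_coord[of i] by (intro exI[of _ 1] bexI[of _ "\<lambda>v. v i"]) auto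
next
  case (add P Q)
  then obtain e f e' g where fg: "f \<in> form e" "\<And>v. v a \<noteq> 0 \<Longrightarrow> f v = v a ^ e * P (\<lambda>i. v i / v a)"
    "g \<in> form e'" "\<And>v. v a \<noteq> 0 \<Longrightarrow> g v = v a ^ e' * Q (\<lambda>i. v i / v a)" by blast
  have "(\<lambda>v. v a ^ e' * f v) \<in> form (e + e')"
    using form_mult[OF form_coord_power[of a e'] fg(1)] by (simp add: add.commute)
  moreover have "(\<lambda>v. v a ^ e * g v) \<in> form (e + e')"
    using form_mult[OF form_coord_power[of a e] fg(3)] .
  ultimately have "(\<lambda>v. v a ^ e' * f v + v a ^ e * g v) \<in> form (e + e')" by (rule form_add)
  then show ?case
    by (rule_tac exI[of _ "e + e'"], rule_tac bexI) (auto simp: fg power_add algebra_simps)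
next
  case (mult P Q)
  then obtain e f e' g where fg: "f \<in> form e" "\<And>v. v a \<noteq> 0 \<Longrightarrow> f v = v a ^ e * P (\<lambda>i. v i / v a)"
    "g \<in> form e'" "\<And>v. v a \<noteq> 0 \<Longrightarrow> g v = v a ^ e' * Q (\<lambda>i. v i / v a)" by blast
  from form_mult[OF fg(1,3)] show ?case
    by (rule_tac exI[of _ "e + e'"], rule_tac bexI) (auto simp: fg power_add algebra_simps)
qed

text \<open>P - P y0 lies in the ideal generated by the coordinate differences. Only coordinates up
  to N may move, as is the case for points of a projective space of dimension N, which keeps the sum
  finite.\<close>

lemma poly_fun_division:
  assumes "P \<in> poly_fun"
  shows "\<exists>R. (\<forall>i. R i \<in> poly_fun) \<and>
    (\<forall>y. (\<forall>i>N. y i = y0 i) \<longrightarrow> P y - P y0 = (\<Sum>i\<le>N. (y i - y0 i) * R i y))"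
  using assms
proof induction
  case (const c)
  then show ?case by (intro exI[of _ "\<lambda>_ _. 0"]) (auto intro: poly_fun.const)
next
  case (coord j)
  have "y j - y0 j = (\<Sum>i\<le>N. (y i - y0 i) * (if i = j then 1 else 0))" if "\<forall>i>N. y i = y0 i" for y
    using that by (simp add: if_distrib[of "\<lambda>x. _ * x"] cong: if_cong)
  then show ?case by (intro exI[of _ "\<lambda>i _. if i = j then 1 else 0"]) (auto intro: poly_fun.const)
next
  case (add P Q)
  then obtain R S where RS: "\<forall>i. R i \<in> poly_fun" "\<forall>i. S i \<in> poly_fun"
    "\<And>y. (\<forall>i>N. y i = y0 i) \<Longrightarrow> P y - P y0 = (\<Sum>i\<le>N. (y i - y0 i) * R i y)"
    "\<And>y. (\<forall>i>N. y i = y0 i) \<Longrightarrow> Q y - Q y0 = (\<Sum>i\<le>N. (y i - y0 i) * S i y)" by blast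
  have "P y + Q y - (P y0 + Q y0) = (\<Sum>i\<le>N. (y i - y0 i) * (R i y + S i y))" if "\<forall>i>N. y i = y0 i" for y
  proof -
    have "P y + Q y - (P y0 + Q y0) = (P y - P y0) + (Q y - Q y0)" by simp
    then show ?thesis unfolding distrib_left sum.distrib RS(3,4)[OF that] .
  qed
  then show ?case
    using RS(1,2) by (intro exI[of _ "\<lambda>i y. R i y + S i y"]) (auto intro: poly_fun.add)
next
  case (mult P Q)
  then obtain R S where RS: "\<forall>i. R i \<in> poly_fun" "\<forall>i. S i \<in> poly_fun"
    "\<And>y. (\<forall>i>N. y i = y0 i) \<Longrightarrow> P y - P y0 = (\<Sum>i\<le>N. (y i - y0 i) * R i y)"
    "\<And>y. (\<forall>i>N. y i = y0 i) \<Longrightarrow> Q y - Q y0 = (\<Sum>i\<le>N. (y i - y0 i) * S i y)" by blast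
  have "P y * Q y - P y0 * Q y0 = (\<Sum>i\<le>N. (y i - y0 i) * (R i y * Q y + P y0 * S i y))"
    if "\<forall>i>N. y i = y0 i" for y
  proof -
    have "P y * Q y - P y0 * Q y0 = (P y - P y0) * Q y + P y0 * (Q y - Q y0)"
      by (simp add: algebra_simps)
    also have "\<dots> = (\<Sum>i\<le>N. (y i - y0 i) * (R i y * Q y + P y0 * S i y))"
      unfolding RS(3,4)[OF that] by (simp add: sum_distrib_left sum_distrib_right sum.distrib distrib_left mult_ac)
    finally show ?thesis .
  qed
  then show ?case
    using RS(1,2) mult.hyps by (intro exI[of _ "\<lambda>i y. R i y * Q y + P y0 * S i y"]) (auto intro!: poly_fun.intros)
qed

lemma rational_division:
  assumes "P \<in> poly_fun" "Q \<in> poly_fun" "Q y0 \<noteq> 0"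
  shows "\<exists>R. (\<forall>i. R i \<in> poly_fun) \<and> (\<forall>y. (\<forall>i>N. y i = y0 i) \<and> Q y \<noteq> 0 \<longrightarrow>
    P y / Q y = P y0 / Q y0 + (\<Sum>i\<le>N. (y i - y0 i) * (R i y / Q y)))"
proof -
  have "(\<lambda>y. P y - P y0 / Q y0 * Q y) \<in> poly_fun"
    using assms by (intro poly_fun_diff poly_fun.mult poly_fun.const)
  from poly_fun_division[OF this, of N y0] obtain R where R: "\<forall>i. R i \<in> poly_fun"
    "\<And>y. (\<forall>i>N. y i = y0 i) \<Longrightarrow> P y - P y0 / Q y0 * Q y - (P y0 - P y0 / Q y0 * Q y0)
      = (\<Sum>i\<le>N. (y i - y0 i) * R i y)" by blast
  have "P y / Q y = P y0 / Q y0 + (\<Sum>i\<le>N. (y i - y0 i) * (R i y / Q y))"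
    if "\<forall>i>N. y i = y0 i" "Q y \<noteq> 0" for y
  proof -
    have "(\<Sum>i\<le>N. (y i - y0 i) * (R i y / Q y)) = (\<Sum>i\<le>N. (y i - y0 i) * R i y) / Q y"
      by (simp add: sum_divide_distrib)
    also have "\<dots> = (P y - P y0 / Q y0 * Q y) / Q y"
      using R(2)[OF that(1)] assms(3) by simp
    finally show ?thesis using that(2) by (simp add: diff_divide_distrib)
  qed
  then show ?thesis using R(1) by blast
qed

section \<open>The Zariski topology and germs of regular functions\<close>

text \<open>A product of forms is nonzero exactly where both factors are, so the generating sets are
  closed under intersection and form a basis rather than a mere subbasis.\<close>

lemma openin_zariski:
  "openin (zariski A) U \<longleftrightarrow> U \<subseteq> A \<and>
     (\<forall>p\<in>U. \<exists>e. \<exists>f\<in>form e. (\<forall>v\<in>p. f v \<noteq> 0) \<and> (\<forall>q\<in>A. (\<forall>v\<in>q. f v \<noteq> 0) \<longrightarrow> q \<in> U))"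
proof
  assume "openin (zariski A) U"
  then have "generate_topology_on {{p \<in> A. \<forall>v\<in>p. eval_mpoly F v \<noteq> 0} | F. \<exists>e. homogeneous e F} U"
    by (simp add: zariski_def openin_topology_generated_by_iff)
  then show "U \<subseteq> A \<and>
     (\<forall>p\<in>U. \<exists>e. \<exists>f\<in>form e. (\<forall>v\<in>p. f v \<noteq> 0) \<and> (\<forall>q\<in>A. (\<forall>v\<in>q. f v \<noteq> 0) \<longrightarrow> q \<in> U))"
  proof induction
    case (Int U V)
    show ?case
    proof (intro conjI ballI)
      fix p assume "p \<in> U \<inter> V"
      then have pU: "p \<in> U" and pV: "p \<in> V" by auto
      from Int.IH(1) pU obtain e f where f: "f \<in> form e" "\<forall>v\<in>p. f v \<noteq> 0"
        "\<forall>q\<in>A. (\<forall>v\<in>q. f v \<noteq> 0) \<longrightarrow> q \<in> U" by blast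
      from Int.IH(2) pV obtain e' g where g: "g \<in> form e'" "\<forall>v\<in>p. g v \<noteq> 0"
        "\<forall>q\<in>A. (\<forall>v\<in>q. g v \<noteq> 0) \<longrightarrow> q \<in> V" by blast
      from form_mult[OF f(1) g(1)] f(2,3) g(2,3)
      show "\<exists>e. \<exists>f\<in>form e. (\<forall>v\<in>p. f v \<noteq> 0) \<and> (\<forall>q\<in>A. (\<forall>v\<in>q. f v \<noteq> 0) \<longrightarrow> q \<in> U \<inter> V)"
        by (rule_tac exI, rule_tac bexI) auto
    qed (use Int in blast)
  next
    case (UN K)
    show ?case
    proof (intro conjI ballI)
      fix p assume "p \<in> \<Union> K"
      then obtain k where k: "k \<in> K" "p \<in> k" by blast
      with UN.IH[OF k(1)] obtain e f where "f \<in> form e" "\<forall>v\<in>p. f v \<noteq> 0"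
        "\<forall>q\<in>A. (\<forall>v\<in>q. f v \<noteq> 0) \<longrightarrow> q \<in> k" by blast
      with k(1) show "\<exists>e. \<exists>f\<in>form e. (\<forall>v\<in>p. f v \<noteq> 0) \<and> (\<forall>q\<in>A. (\<forall>v\<in>q. f v \<noteq> 0) \<longrightarrow> q \<in> \<Union> K)"
        by blast
    qed (use UN.IH in blast)
  next
    case (Basis s)
    then show ?case unfolding form_def by blast
  qed auto
next
  assume *: "U \<subseteq> A \<and>
     (\<forall>p\<in>U. \<exists>e. \<exists>f\<in>form e. (\<forall>v\<in>p. f v \<noteq> 0) \<and> (\<forall>q\<in>A. (\<forall>v\<in>q. f v \<noteq> 0) \<longrightarrow> q \<in> U))"
  show "openin (zariski A) U"
  proof (subst openin_subopen, intro ballI)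
    fix p assume p: "p \<in> U"
    with * obtain e f where f: "f \<in> form e" "\<forall>v\<in>p. f v \<noteq> 0" "\<forall>q\<in>A. (\<forall>v\<in>q. f v \<noteq> 0) \<longrightarrow> q \<in> U" by blast
    from f(1) obtain F where F: "f = eval_mpoly F" "homogeneous e F" by (auto simp: form_def)
    have "openin (zariski A) {q \<in> A. \<forall>v\<in>q. f v \<noteq> 0}"
      unfolding zariski_def F(1) using F(2) by (intro topology_generated_by_Basis) auto
    then show "\<exists>T. openin (zariski A) T \<and> p \<in> T \<and> T \<subseteq> U"
      using f p * by (intro exI[of _ "{q \<in> A. \<forall>v\<in>q. f v \<noteq> 0}"]) auto
  qed
qed

lemma openin_zariski_basic: "f \<in> form e \<Longrightarrow> openin (zariski A) {q \<in> A. \<forall>v\<in>q. f v \<noteq> 0}"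
  unfolding openin_zariski by blast

lemma topspace_zariski [simp]: "topspace (zariski A) = A"
proof -
  have "openin (zariski A) A" unfolding openin_zariski using form_const[of 1] by fastforce
  then show ?thesis using openin_subset openin_topspace[of "zariski A"] unfolding openin_zariski[of A "topspace _"] by blast
qed

definition rep :: "point \<Rightarrow> nat \<Rightarrow> complex" where
  "rep p = (SOME v. v \<in> p)"

definition affine_coord :: "nat \<Rightarrow> point \<Rightarrow> nat \<Rightarrow> complex" where
  "affine_coord a p = (\<lambda>i. rep p i / rep p a)"

lemma rep_in: "p \<in> proj_space N \<Longrightarrow> rep p \<in> p"
proof -
  assume "p \<in> proj_space N"
  then obtain v where v: "p = {\<lambda>i. c * v i | c. c \<noteq> 0}" by (auto simp: proj_space_def)
  have "(\<lambda>i. 1 * v i) \<in> p" unfolding v by (intro CollectI exI[of _ 1]) simp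
  then show ?thesis unfolding rep_def by (rule someI[where P = "\<lambda>v. v \<in> p"])
qed

lemma in_point_iff:
  assumes "p \<in> proj_space N" "v \<in> p"
  shows "w \<in> p \<longleftrightarrow> (\<exists>c. c \<noteq> 0 \<and> w = (\<lambda>i. c * v i))"
proof -
  from assms(1) obtain u where u: "p = {\<lambda>i. c * u i | c. c \<noteq> 0}" by (auto simp: proj_space_def)
  with assms(2) obtain b where b: "b \<noteq> 0" "v = (\<lambda>i. b * u i)" by auto
  show ?thesis
  proof
    assume "w \<in> p"
    then obtain c where "c \<noteq> 0" "w = (\<lambda>i. c * u i)" using u by auto
    then show "\<exists>c. c \<noteq> 0 \<and> w = (\<lambda>i. c * v i)" using b by (intro exI[of _ "c / b"]) auto
  next
    assume "\<exists>c. c \<noteq> 0 \<and> w = (\<lambda>i. c * v i)"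
    then obtain c where "c \<noteq> 0" "w = (\<lambda>i. c * v i)" by blast
    then show "w \<in> p" using b u by (auto intro!: exI[of _ "c * b"] simp: mult.assoc)
  qed
qed

lemma rep_support:
  assumes "p \<in> proj_space N"
  shows "i > N \<Longrightarrow> rep p i = 0" "\<exists>a\<le>N. rep p a \<noteq> 0"
proof -
  from assms obtain u where u: "p = {\<lambda>i. c * u i | c. c \<noteq> 0}" "u \<noteq> (\<lambda>_. 0)" "\<forall>i>N. u i = 0"
    by (auto simp: proj_space_def)
  with rep_in[OF assms] obtain b where b: "b \<noteq> 0" "rep p = (\<lambda>i. b * u i)" by auto
  then show "i > N \<Longrightarrow> rep p i = 0" using u by simp
  from u(2) obtain a where "u a \<noteq> 0" by auto
  then show "\<exists>a\<le>N. rep p a \<noteq> 0" using b u(3) by (intro exI[of _ a]) (auto simp: not_less[symmetric])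
qed

lemma point_eqI:
  assumes "p \<in> proj_space N" "q \<in> proj_space N" "v \<in> p" "v \<in> q" shows "p = q"
  using in_point_iff[OF assms(1,3)] in_point_iff[OF assms(2,4)] by blast

lemma form_nonzero_iff:
  assumes "p \<in> proj_space N" "f \<in> form e"
  shows "(\<forall>v\<in>p. f v \<noteq> 0) \<longleftrightarrow> f (rep p) \<noteq> 0"
  using in_point_iff[OF assms(1) rep_in[OF assms(1)]] rep_in[OF assms(1)] form_homogeneous[OF assms(2)]
  by (metis mult_eq_0_iff power_eq_0_iff)

lemma affine_coord_eq:
  assumes "p \<in> proj_space N" "v \<in> p"
  shows "affine_coord a p = (\<lambda>i. v i / v a)"
proof -
  obtain c where "c \<noteq> 0" "v = (\<lambda>i. c * rep p i)"
    using in_point_iff[OF assms(1) rep_in[OF assms(1)]] assms(2) by blast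
  then show ?thesis by (auto simp: affine_coord_def)
qed

lemma form_affine_coord:
  assumes "f \<in> form e" shows "f (affine_coord a q) = f (rep q) / rep q a ^ e"
  using form_homogeneous[OF assms, of "1 / rep q a" "rep q"]
  by (simp add: affine_coord_def power_divide)

lemma irreducible_closed_subset: "irreducible_closed T Z \<Longrightarrow> Z \<subseteq> topspace T"
  unfolding irreducible_closed_def using closedin_subset by blast

section \<open>Neighbourhoods and local rings on the curve\<close>

locale projective_curve =
  fixes X :: "point set" and N :: nat
  assumes irr: "irreducible_closed (zariski (proj_space N)) X"
    and dim1: "krull_dim (zariski X) = 1"
    and smooth: "smooth X"
begin

lemma in_proj: "p \<in> X \<Longrightarrow> p \<in> proj_space N"
  using irreducible_closed_subset[OF irr] by auto

lemma openin_X: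
  "openin (zariski X) U \<longleftrightarrow> U \<subseteq> X \<and>
    (\<forall>p\<in>U. \<exists>e. \<exists>f\<in>form e. f (rep p) \<noteq> 0 \<and> (\<forall>q\<in>X. f (rep q) \<noteq> 0 \<longrightarrow> q \<in> U))"
  unfolding openin_zariski using form_nonzero_iff[OF in_proj] by (smt (verit) subsetD)

lemma openin_nonvanishing: "f \<in> form e \<Longrightarrow> openin (zariski X) {q \<in> X. f (rep q) \<noteq> 0}"
  unfolding openin_X by blast

lemma X_closed:
  assumes "p \<in> proj_space N" "\<And>e f. f \<in> form e \<Longrightarrow> (\<And>q. q \<in> X \<Longrightarrow> f (rep q) = 0) \<Longrightarrow> f (rep p) = 0"
  shows "p \<in> X"
proof (rule ccontr)
  assume "p \<notin> X"
  have "openin (zariski (proj_space N)) (proj_space N - X)"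
    using irr unfolding irreducible_closed_def closedin_def topspace_zariski by blast
  with \<open>p \<notin> X\<close> assms(1) obtain e f where f: "f \<in> form e" "\<forall>v\<in>p. f v \<noteq> 0"
    "\<forall>q\<in>proj_space N. (\<forall>v\<in>q. f v \<noteq> 0) \<longrightarrow> q \<in> proj_space N - X"
    unfolding openin_zariski by blast
  have "f (rep q) = 0" if "q \<in> X" for q
    using f(3) form_nonzero_iff[OF in_proj[OF that] f(1)] in_proj[OF that] that by blast
  from assms(2)[OF f(1) this] f(2) rep_in[OF assms(1)] show False by blast
qed

lemma form_irreducible:
  assumes "f \<in> form e" "g \<in> form e'" "p \<in> X" "f (rep p) \<noteq> 0" "q \<in> X" "g (rep q) \<noteq> 0"
  shows "\<exists>w\<in>X. f (rep w) \<noteq> 0 \<and> g (rep w) \<noteq> 0"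
proof (rule ccontr)
  assume *: "\<not> ?thesis"
  have cl: "closedin (zariski (proj_space N)) {x \<in> proj_space N. f (rep x) = 0}" if "f \<in> form e" for f e
  proof -
    have "proj_space N - {x \<in> proj_space N. f (rep x) = 0} = {x \<in> proj_space N. \<forall>v\<in>x. f v \<noteq> 0}"
      using form_nonzero_iff[OF _ that] by blast
    then show ?thesis
      unfolding closedin_def topspace_zariski using openin_zariski_basic[OF that, of "proj_space N"] by auto
  qed
  have "X \<subseteq> {x \<in> proj_space N. f (rep x) = 0} \<union> {x \<in> proj_space N. g (rep x) = 0}"
    using * in_proj by blast
  then have "X \<subseteq> {x \<in> proj_space N. f (rep x) = 0} \<or> X \<subseteq> {x \<in> proj_space N. g (rep x) = 0}"
    using irr cl[OF assms(1)] cl[OF assms(2)] unfolding irreducible_closed_def by blast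
  then show False using assms by blast
qed

lemma openin_meet:
  assumes "openin (zariski X) U" "openin (zariski X) V" "U \<noteq> {}" "V \<noteq> {}"
  shows "U \<inter> V \<noteq> {}"
proof -
  obtain p q where "p \<in> U" "q \<in> V" using assms by blast
  from assms(1) \<open>p \<in> U\<close> obtain e f where f: "f \<in> form e" "f (rep p) \<noteq> 0"
    "\<forall>q\<in>X. f (rep q) \<noteq> 0 \<longrightarrow> q \<in> U" unfolding openin_X by blast
  from assms(2) \<open>q \<in> V\<close> obtain e' g where g: "g \<in> form e'" "g (rep q) \<noteq> 0"
    "\<forall>q\<in>X. g (rep q) \<noteq> 0 \<longrightarrow> q \<in> V" unfolding openin_X by blast
  have "p \<in> X" "q \<in> X"
    using openin_subset[OF assms(1)] openin_subset[OF assms(2)] \<open>p \<in> U\<close> \<open>q \<in> V\<close> by auto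
  from form_irreducible[OF f(1) g(1) this(1) f(2) this(2) g(2)] f(3) g(3) show ?thesis by blast
qed

lemma irreducible_closed_X: "irreducible_closed (zariski X) X"
  unfolding irreducible_closed_def
proof (intro conjI allI impI)
  show "closedin (zariski X) X" using closedin_topspace[of "zariski X"] by (simp add: topspace_zariski)
  show "X \<noteq> {}" using irr by (simp add: irreducible_closed_def)
  fix A B assume "closedin (zariski X) A \<and> closedin (zariski X) B \<and> X \<subseteq> A \<union> B"
  then show "X \<subseteq> A \<or> X \<subseteq> B"
    using openin_meet[of "X - A" "X - B"] unfolding closedin_def topspace_zariski by blast
qed

lemma separating_form:
  assumes "p \<in> proj_space N" "q \<in> proj_space N" "p \<noteq> q"
  shows "\<exists>i j. rep p i * rep q j - rep p j * rep q i \<noteq> 0"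
proof (rule ccontr)
  assume *: "\<not> ?thesis"
  obtain a where a: "rep p a \<noteq> 0" using rep_support(2)[OF assms(1)] by blast
  define c where "c = rep q a / rep p a"
  have eq: "rep q = (\<lambda>i. c * rep p i)" using * a by (auto simp: c_def fun_eq_iff field_simps)
  have "c \<noteq> 0" using rep_support(2)[OF assms(2)] eq by auto
  then have "rep q \<in> p" using in_point_iff[OF assms(1) rep_in[OF assms(1)]] eq by blast
  then show False using point_eqI[OF assms(1,2) _ rep_in[OF assms(2)]] assms(3) by blast
qed

lemma openin_remove_point: "p \<in> X \<Longrightarrow> openin (zariski X) (X - {p})"
  unfolding openin_X
proof (intro conjI ballI)
  fix q assume p: "p \<in> X" and q: "q \<in> X - {p}"
  obtain i j where ij: "rep p i * rep q j - rep p j * rep q i \<noteq> 0"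
    using separating_form[of p q] in_proj p q by auto
  have "(\<lambda>v. rep p i * v j - rep p j * v i) \<in> form 1"
    by (intro form_diff form_scale form_coord)
  then show "\<exists>e. \<exists>f\<in>form e. f (rep q) \<noteq> 0 \<and> (\<forall>q\<in>X. f (rep q) \<noteq> 0 \<longrightarrow> q \<in> X - {p})"
    using ij by (rule_tac exI, rule_tac bexI) auto
qed auto

lemma closedin_singleton: "p \<in> X \<Longrightarrow> closedin (zariski X) {p}"
  unfolding closedin_def topspace_zariski using openin_remove_point by auto

lemma irreducible_closed_singleton: "p \<in> X \<Longrightarrow> irreducible_closed (zariski X) {p}"
  unfolding irreducible_closed_def using closedin_singleton by auto

text \<open>On a single point every chain of irreducible closed sets has length 0, which contradicts
  dimension 1.\<close>

lemma X_not_singleton: "X \<noteq> {p}"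
proof
  assume X: "X = {p}"
  have "n = 0" if "\<forall>i\<le>n. irreducible_closed (zariski X) (Z i)" "\<forall>i<n. Z i \<subset> Z (Suc i)" for n and Z :: "nat \<Rightarrow> point set"
  proof (rule ccontr)
    assume "n \<noteq> 0"
    then have Z: "irreducible_closed (zariski X) (Z 0)" "irreducible_closed (zariski X) (Z 1)" "Z 0 \<subset> Z 1"
      using that by auto
    have "Z 0 \<noteq> {}" using Z(1) by (simp add: irreducible_closed_def)
    moreover have "Z 1 \<subseteq> {p}" using irreducible_closed_subset[OF Z(2)] X by simp
    ultimately show False using Z(3) by auto
  qed
  then have "krull_dim (zariski X) \<le> 0"
    unfolding krull_dim_def by (intro Sup_least) (auto simp: zero_enat_def)
  then show False using dim1 by simp
qed

text \<open>If Z were smaller than X, the chain {p}, Z, X would force the dimension to be at least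
  2.\<close>

lemma irreducible_closed_cases:
  assumes "irreducible_closed (zariski X) Z" "p \<in> Z" "q \<in> Z" "p \<noteq> q"
  shows "Z = X"
proof (rule ccontr)
  assume "Z \<noteq> X"
  moreover have "Z \<subseteq> X" using irreducible_closed_subset[OF assms(1)] by simp
  ultimately have Z: "Z \<subset> X" by blast
  define C where "C = (\<lambda>i::nat. if i = 0 then {p} else if i = 1 then Z else X)"
  have "p \<in> X" using Z assms(2) by blast
  have "enat 2 \<le> krull_dim (zariski X)"
    unfolding krull_dim_def
  proof (intro Sup_upper CollectI exI conjI)
    show "\<forall>i\<le>2. irreducible_closed (zariski X) (C i)"
      using assms(1) irreducible_closed_X irreducible_closed_singleton[OF \<open>p \<in> X\<close>] by (auto simp: C_def)
    show "\<forall>i<2. C i \<subset> C (Suc i)" using Z assms by (auto simp: C_def less_2_cases_iff)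
  qed simp
  then show False using dim1 by (simp add: one_enat_def)
qed

text \<open>Germs at p are functions up to equality along this filter, and ring operations on germs
  become reasoning with \<open>eventually\<close>. The point p belongs to all the neighbourhoods, so
  a germ has a well-defined value at p.\<close>

definition nz :: "point \<Rightarrow> point filter" where
  "nz p = nhdsin (zariski X) p"

lemma eventually_nz_open:
  "p \<in> X \<Longrightarrow> eventually A (nz p) \<longleftrightarrow> (\<exists>U. openin (zariski X) U \<and> p \<in> U \<and> (\<forall>q\<in>U. A q))"
  unfolding nz_def eventually_nhdsin topspace_zariski by blast

lemma eventually_nz:
  assumes "p \<in> X"
  shows "eventually A (nz p) \<longleftrightarrow> (\<exists>e. \<exists>f\<in>form e. f (rep p) \<noteq> 0 \<and> (\<forall>q\<in>X. f (rep q) \<noteq> 0 \<longrightarrow> A q))"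
  unfolding eventually_nz_open[OF assms]
proof
  assume "\<exists>U. openin (zariski X) U \<and> p \<in> U \<and> (\<forall>q\<in>U. A q)"
  then show "\<exists>e. \<exists>f\<in>form e. f (rep p) \<noteq> 0 \<and> (\<forall>q\<in>X. f (rep q) \<noteq> 0 \<longrightarrow> A q)"
    unfolding openin_X by meson
next
  assume "\<exists>e. \<exists>f\<in>form e. f (rep p) \<noteq> 0 \<and> (\<forall>q\<in>X. f (rep q) \<noteq> 0 \<longrightarrow> A q)"
  then show "\<exists>U. openin (zariski X) U \<and> p \<in> U \<and> (\<forall>q\<in>U. A q)"
    using openin_nonvanishing assms by blast
qed

lemma eventually_nz_self: "p \<in> X \<Longrightarrow> eventually A (nz p) \<Longrightarrow> A p"
  unfolding eventually_nz_open by blast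

lemma eventually_nz_in: "p \<in> X \<Longrightarrow> \<forall>\<^sub>F q in nz p. q \<in> X"
  unfolding eventually_nz using form_const[of 1] by fastforce

lemma eventually_eventually_nz: "p \<in> X \<Longrightarrow> eventually A (nz p) \<Longrightarrow> \<forall>\<^sub>F q in nz p. eventually A (nz q)"
proof -
  assume p: "p \<in> X" and "eventually A (nz p)"
  then obtain U where U: "openin (zariski X) U" "p \<in> U" "\<forall>q\<in>U. A q" by (auto simp: eventually_nz_open)
  have "eventually A (nz q)" if "q \<in> U" for q
  proof -
    have "q \<in> X" using openin_subset[OF U(1)] that by auto
    then show ?thesis using U that by (subst eventually_nz_open) auto
  qed
  with U p show ?thesis by (auto simp: eventually_nz_open)
qed

text \<open>Irreducibility: two nonempty open sets meet, so local facts at different points can be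
  confronted at a common point.\<close>

lemma eventually_nz_meet:
  assumes "p \<in> X" "q \<in> X" "eventually A (nz p)" "eventually B (nz q)"
  shows "\<exists>w\<in>X. A w \<and> B w"
proof -
  obtain U V where "openin (zariski X) U" "p \<in> U" "\<forall>q\<in>U. A q" "openin (zariski X) V" "q \<in> V" "\<forall>q\<in>V. B q"
    using assms(3,4) unfolding eventually_nz_open[OF assms(1)] eventually_nz_open[OF assms(2)] by blast
  then show ?thesis using openin_meet[of U V] openin_subset[of "zariski X" U] by (auto simp: topspace_zariski)
qed

lemma eventually_nz_openin: "openin (zariski X) U \<Longrightarrow> p \<in> U \<Longrightarrow> \<forall>\<^sub>F q in nz p. q \<in> U"
  using openin_subset[of "zariski X" U] by (subst eventually_nz_open) (auto simp: topspace_zariski)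

lemma eventually_form_nonzero: "p \<in> X \<Longrightarrow> f \<in> form e \<Longrightarrow> f (rep p) \<noteq> 0 \<Longrightarrow> \<forall>\<^sub>F q in nz p. f (rep q) \<noteq> 0"
  unfolding eventually_nz by blast

lemma affine_coord_support: "q \<in> X \<Longrightarrow> i > N \<Longrightarrow> affine_coord a q i = 0"
  using rep_support(1)[OF in_proj] by (simp add: affine_coord_def)

lemma poly_affine_nonzero:
  assumes "p \<in> X" "rep p a \<noteq> 0" "P \<in> poly_fun" "P (affine_coord a p) \<noteq> 0"
  shows "\<forall>\<^sub>F q in nz p. rep q a \<noteq> 0 \<and> P (affine_coord a q) \<noteq> 0"
proof -
  obtain e f where f: "f \<in> form e" "\<And>v. v a \<noteq> 0 \<Longrightarrow> f v = v a ^ e * P (\<lambda>i. v i / v a)"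
    using homogenize[OF assms(3), of a] by blast
  have "f (rep p) \<noteq> 0" using f(2)[of "rep p"] assms by (simp add: affine_coord_def)
  from eventually_form_nonzero[OF assms(1) f(1) this] eventually_form_nonzero[OF assms(1) form_coord[of a] assms(2)]
  show ?thesis by eventually_elim (use f(2) in \<open>auto simp: affine_coord_def\<close>)
qed

text \<open>The local ring at p, seen in the affine chart where the coordinate a is nonzero.
  Polynomials in affine coordinates are free of the condition that numerator and denominator have
  the same degree, so the ring operations become easy.\<close>

lemma reg_at_iff:
  assumes p: "p \<in> X" and a: "rep p a \<noteq> 0"
  shows "f \<in> reg_at X p \<longleftrightarrow> (\<exists>P\<in>poly_fun. \<exists>Q\<in>poly_fun. Q (affine_coord a p) \<noteq> 0 \<and>
    (\<forall>\<^sub>F q in nz p. rep q a \<noteq> 0 \<and> Q (affine_coord a q) \<noteq> 0 \<and> f q = P (affine_coord a q) / Q (affine_coord a q)))"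
    (is "_ \<longleftrightarrow> ?rhs")
proof
  assume "f \<in> reg_at X p"
  then obtain U where U: "openin (zariski X) U" "p \<in> U" "restr U f \<in> reg X U" by (auto simp: reg_at_def)
  then obtain W e F G where W: "openin (zariski X) W" "p \<in> W" "W \<subseteq> U" "homogeneous e F" "homogeneous e G"
    "\<forall>q\<in>W. \<forall>v\<in>q. eval_mpoly G v \<noteq> 0 \<and> restr U f q = eval_mpoly F v / eval_mpoly G v"
    unfolding reg_def by blast
  have FG: "eval_mpoly F \<in> form e" "eval_mpoly G \<in> form e" using W by (auto simp: form_def)
  have "rep q a \<noteq> 0 \<and> eval_mpoly G (affine_coord a q) \<noteq> 0 \<and>
      f q = eval_mpoly F (affine_coord a q) / eval_mpoly G (affine_coord a q)"
    if "q \<in> W" "rep q a \<noteq> 0" for q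
  proof -
    have "q \<in> X" using that(1) openin_subset[OF W(1)] by (auto simp: topspace_zariski)
    then have "rep q \<in> q" using rep_in in_proj by blast
    moreover have "q \<in> U" using W(3) that(1) by blast
    ultimately have "eval_mpoly G (rep q) \<noteq> 0" "f q = eval_mpoly F (rep q) / eval_mpoly G (rep q)"
      using W(6) that(1) by (auto simp: restr_def)
    then show ?thesis
      using that(2) unfolding form_affine_coord[OF FG(1)] form_affine_coord[OF FG(2)] by simp
  qed
  note * = this
  have "\<forall>\<^sub>F q in nz p. rep q a \<noteq> 0 \<and> eval_mpoly G (affine_coord a q) \<noteq> 0 \<and>
      f q = eval_mpoly F (affine_coord a q) / eval_mpoly G (affine_coord a q)"
    using eventually_nz_openin[OF W(1,2)] eventually_form_nonzero[OF p form_coord[of a] a]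
    by eventually_elim (use * in auto)
  moreover have "eval_mpoly G (affine_coord a p) \<noteq> 0" using *[OF W(2) a] by blast
  ultimately show ?rhs using form_poly_fun[OF FG(1)] form_poly_fun[OF FG(2)] by blast
next
  assume ?rhs
  then obtain P Q where PQ: "P \<in> poly_fun" "Q \<in> poly_fun" "Q (affine_coord a p) \<noteq> 0"
    "\<forall>\<^sub>F q in nz p. rep q a \<noteq> 0 \<and> Q (affine_coord a q) \<noteq> 0 \<and> f q = P (affine_coord a q) / Q (affine_coord a q)"
    by blast
  obtain e1 F1 where F1: "F1 \<in> form e1" "\<And>v. v a \<noteq> 0 \<Longrightarrow> F1 v = v a ^ e1 * P (\<lambda>i. v i / v a)"
    using homogenize[OF PQ(1), of a] by blast
  obtain e2 F2 where F2: "F2 \<in> form e2" "\<And>v. v a \<noteq> 0 \<Longrightarrow> F2 v = v a ^ e2 * Q (\<lambda>i. v i / v a)"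
    using homogenize[OF PQ(2), of a] by blast
  obtain U where U: "openin (zariski X) U" "p \<in> U"
    "\<forall>q\<in>U. rep q a \<noteq> 0 \<and> Q (affine_coord a q) \<noteq> 0 \<and> f q = P (affine_coord a q) / Q (affine_coord a q)"
    using PQ(4) unfolding eventually_nz_open[OF p] by blast
  \<comment> \<open>The powers of v a bring numerator and denominator to the common degree e1 +
    e2.\<close>
  have "(\<lambda>v. F1 v * v a ^ e2) \<in> form (e1 + e2)" "(\<lambda>v. v a ^ e1 * F2 v) \<in> form (e1 + e2)"
    by (intro form_mult F1 F2 form_coord_power)+
  then obtain F G where FG: "homogeneous (e1 + e2) F" "eval_mpoly F = (\<lambda>v. F1 v * v a ^ e2)"
    "homogeneous (e1 + e2) G" "eval_mpoly G = (\<lambda>v. v a ^ e1 * F2 v)" by (force simp: form_def)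
  have "eval_mpoly G v \<noteq> 0 \<and> restr U f q = eval_mpoly F v / eval_mpoly G v" if "q \<in> U" "v \<in> q" for q v
  proof -
    have q: "q \<in> proj_space N" using that(1) openin_subset[OF U(1)] in_proj by (auto simp: topspace_zariski)
    obtain c where c: "c \<noteq> 0" "v = (\<lambda>i. c * rep q i)"
      using in_point_iff[OF q rep_in[OF q]] \<open>v \<in> q\<close> by blast
    have va: "v a \<noteq> 0" using U(3) \<open>q \<in> U\<close> c by simp
    have aff: "(\<lambda>i. v i / v a) = affine_coord a q" using affine_coord_eq[OF q \<open>v \<in> q\<close>] by simp
    have "F1 v = v a ^ e1 * P (affine_coord a q)" "F2 v = v a ^ e2 * Q (affine_coord a q)"
      using F1(2)[of v] F2(2)[of v] va aff by auto
    then show ?thesis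
      using U(3) \<open>q \<in> U\<close> va by (auto simp: FG restr_def)
  qed
  then have "restr U f \<in> reg X U"
    unfolding reg_def using U(1) FG(1,3) by (fastforce simp: restr_def)
  then show "f \<in> reg_at X p" using U unfolding reg_at_def by blast
qed

lemma reg_iff:
  assumes "openin (zariski X) U"
  shows "f \<in> reg X U \<longleftrightarrow> (\<forall>q. q \<notin> U \<longrightarrow> f q = 0) \<and> (\<forall>p\<in>U. f \<in> reg_at X p)"
proof (intro iffI conjI ballI)
  assume f: "f \<in> reg X U"
  then show "\<forall>q. q \<notin> U \<longrightarrow> f q = 0" by (auto simp: reg_def)
  then have "restr U f = f" by (auto simp: restr_def)
  then show "f \<in> reg_at X p" if "p \<in> U" for p using f assms that unfolding reg_at_def by auto
next
  assume *: "(\<forall>q. q \<notin> U \<longrightarrow> f q = 0) \<and> (\<forall>p\<in>U. f \<in> reg_at X p)"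
  have "\<exists>W e F G. openin (zariski X) W \<and> p \<in> W \<and> W \<subseteq> U \<and> homogeneous e F \<and> homogeneous e G \<and>
        (\<forall>q\<in>W. \<forall>v\<in>q. eval_mpoly G v \<noteq> 0 \<and> f q = eval_mpoly F v / eval_mpoly G v)" if "p \<in> U" for p
  proof -
    obtain V where V: "openin (zariski X) V" "p \<in> V" "restr V f \<in> reg X V" using * \<open>p \<in> U\<close> unfolding reg_at_def by blast
    then obtain W e F G where W: "openin (zariski X) W" "p \<in> W" "W \<subseteq> V" "homogeneous e F" "homogeneous e G"
      "\<forall>q\<in>W. \<forall>v\<in>q. eval_mpoly G v \<noteq> 0 \<and> restr V f q = eval_mpoly F v / eval_mpoly G v"
      unfolding reg_def by blast
    have "\<forall>q\<in>W. \<forall>v\<in>q. eval_mpoly G v \<noteq> 0 \<and> f q = eval_mpoly F v / eval_mpoly G v"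
      using W(3,6) unfolding restr_def by (metis subsetD)
    then show ?thesis
      using openin_Int[OF W(1) assms] \<open>p \<in> U\<close> W(2,4,5)
      by (intro exI[of _ "W \<inter> U"] exI[of _ e] exI[of _ F] exI[of _ G]) auto
  qed
  then show "f \<in> reg X U" using * by (simp add: reg_def)
qed

lemma exists_chart_index: "p \<in> X \<Longrightarrow> \<exists>a\<le>N. rep p a \<noteq> 0"
  using rep_support(2) in_proj by blast

lemma reg_at_cong:
  assumes "p \<in> X" "f \<in> reg_at X p" "\<forall>\<^sub>F q in nz p. f q = g q" shows "g \<in> reg_at X p"
proof -
  obtain a where a: "rep p a \<noteq> 0" using exists_chart_index[OF assms(1)] by blast
  obtain P Q where PQ: "P\<in>poly_fun" "Q\<in>poly_fun" "Q (affine_coord a p) \<noteq> 0"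
    "\<forall>\<^sub>F q in nz p. rep q a \<noteq> 0 \<and> Q (affine_coord a q) \<noteq> 0 \<and> f q = P (affine_coord a q) / Q (affine_coord a q)"
    using assms(2) unfolding reg_at_iff[OF assms(1) a] by blast
  from PQ(4) assms(3) have "\<forall>\<^sub>F q in nz p. rep q a \<noteq> 0 \<and> Q (affine_coord a q) \<noteq> 0 \<and> g q = P (affine_coord a q) / Q (affine_coord a q)"
    by eventually_elim auto
  with PQ show ?thesis unfolding reg_at_iff[OF assms(1) a] by blast
qed

lemma reg_at_affine:
  assumes "p \<in> X" "rep p a \<noteq> 0" "P \<in> poly_fun"
  shows "(\<lambda>q. P (affine_coord a q)) \<in> reg_at X p"
  unfolding reg_at_iff[OF assms(1,2)]
  using eventually_form_nonzero[OF assms(1) form_coord[of a] assms(2)]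
  by (intro bexI[of _ P] bexI[of _ "\<lambda>_. 1"] conjI) (auto intro: poly_fun.const assms elim!: eventually_mono)

lemma reg_at_const: "p \<in> X \<Longrightarrow> (\<lambda>_. c) \<in> reg_at X p"
  using exists_chart_index[of p] reg_at_affine[OF _ _ poly_fun.const[of c]] by blast

lemma reg_at_add_mult:
  assumes "p \<in> X" "f \<in> reg_at X p" "g \<in> reg_at X p"
  shows "(\<lambda>q. f q + g q) \<in> reg_at X p" "(\<lambda>q. f q * g q) \<in> reg_at X p"
proof -
  obtain a where a: "rep p a \<noteq> 0" using exists_chart_index[OF assms(1)] by blast
  obtain P Q where PQ: "P\<in>poly_fun" "Q\<in>poly_fun" "Q (affine_coord a p) \<noteq> 0"
    "\<forall>\<^sub>F q in nz p. rep q a \<noteq> 0 \<and> Q (affine_coord a q) \<noteq> 0 \<and> f q = P (affine_coord a q) / Q (affine_coord a q)"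
    using assms(2) unfolding reg_at_iff[OF assms(1) a] by blast
  obtain R S where RS: "R\<in>poly_fun" "S\<in>poly_fun" "S (affine_coord a p) \<noteq> 0"
    "\<forall>\<^sub>F q in nz p. rep q a \<noteq> 0 \<and> S (affine_coord a q) \<noteq> 0 \<and> g q = R (affine_coord a q) / S (affine_coord a q)"
    using assms(3) unfolding reg_at_iff[OF assms(1) a] by blast
  show "(\<lambda>q. f q + g q) \<in> reg_at X p"
    unfolding reg_at_iff[OF assms(1) a]
  proof (intro bexI conjI)
    show "\<forall>\<^sub>F q in nz p. rep q a \<noteq> 0 \<and> Q (affine_coord a q) * S (affine_coord a q) \<noteq> 0 \<and>
      f q + g q = (P (affine_coord a q) * S (affine_coord a q) + R (affine_coord a q) * Q (affine_coord a q)) / (Q (affine_coord a q) * S (affine_coord a q))"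
      using PQ(4) RS(4) by eventually_elim (auto simp: field_simps)
  qed (use PQ RS in \<open>auto intro!: poly_fun.intros\<close>)
  show "(\<lambda>q. f q * g q) \<in> reg_at X p"
    unfolding reg_at_iff[OF assms(1) a]
  proof (intro bexI conjI)
    show "\<forall>\<^sub>F q in nz p. rep q a \<noteq> 0 \<and> Q (affine_coord a q) * S (affine_coord a q) \<noteq> 0 \<and>
      f q * g q = (P (affine_coord a q) * R (affine_coord a q)) / (Q (affine_coord a q) * S (affine_coord a q))"
      using PQ(4) RS(4) by eventually_elim (auto simp: field_simps)
  qed (use PQ RS in \<open>auto intro!: poly_fun.intros\<close>)
qed

lemmas reg_at_add = reg_at_add_mult(1) and reg_at_mult = reg_at_add_mult(2)

lemma reg_at_diff: "p \<in> X \<Longrightarrow> f \<in> reg_at X p \<Longrightarrow> g \<in> reg_at X p \<Longrightarrow> (\<lambda>q. f q - g q) \<in> reg_at X p"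
  using reg_at_add[of p f "\<lambda>q. (-1) * g q"] reg_at_mult[of p "\<lambda>_. -1" g] reg_at_const[of p "-1"] by simp

lemma reg_at_sum: "p \<in> X \<Longrightarrow> (\<And>i. i \<in> A \<Longrightarrow> f i \<in> reg_at X p) \<Longrightarrow> (\<lambda>q. \<Sum>i\<in>A. f i q) \<in> reg_at X p"
  by (induction A rule: infinite_finite_induct) (auto intro: reg_at_const reg_at_add)

lemma reg_at_power: "p \<in> X \<Longrightarrow> f \<in> reg_at X p \<Longrightarrow> (\<lambda>q. f q ^ n) \<in> reg_at X p"
  by (induction n) (auto intro: reg_at_const reg_at_mult)

lemma reg_at_inverse:
  assumes "p \<in> X" "f \<in> reg_at X p" "f p \<noteq> 0"
  shows "(\<lambda>q. 1 / f q) \<in> reg_at X p" "\<forall>\<^sub>F q in nz p. f q \<noteq> 0"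
proof -
  obtain a where a: "rep p a \<noteq> 0" using exists_chart_index[OF assms(1)] by blast
  obtain P Q where PQ: "P\<in>poly_fun" "Q\<in>poly_fun" "Q (affine_coord a p) \<noteq> 0"
    "\<forall>\<^sub>F q in nz p. rep q a \<noteq> 0 \<and> Q (affine_coord a q) \<noteq> 0 \<and> f q = P (affine_coord a q) / Q (affine_coord a q)"
    using assms(2) unfolding reg_at_iff[OF assms(1) a] by blast
  have Pp: "P (affine_coord a p) \<noteq> 0" using eventually_nz_self[OF assms(1) PQ(4)] assms(3) by auto
  note ev = poly_affine_nonzero[OF assms(1) a PQ(1) Pp]
  from PQ(4) ev show "\<forall>\<^sub>F q in nz p. f q \<noteq> 0" by eventually_elim auto
  from PQ(4) ev have "\<forall>\<^sub>F q in nz p. rep q a \<noteq> 0 \<and> P (affine_coord a q) \<noteq> 0 \<and> 1 / f q = Q (affine_coord a q) / P (affine_coord a q)"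
    by eventually_elim auto
  then show "(\<lambda>q. 1 / f q) \<in> reg_at X p" unfolding reg_at_iff[OF assms(1) a] using PQ Pp by blast
qed

lemma reg_at_divide:
  "p \<in> X \<Longrightarrow> f \<in> reg_at X p \<Longrightarrow> g \<in> reg_at X p \<Longrightarrow> g p \<noteq> 0 \<Longrightarrow> (\<lambda>q. f q / g q) \<in> reg_at X p"
  using reg_at_mult[OF _ _ reg_at_inverse(1), of p f g] by simp

lemma eventually_reg_at:
  assumes "p \<in> X" "f \<in> reg_at X p" shows "\<forall>\<^sub>F q in nz p. f \<in> reg_at X q"
proof -
  obtain U where U: "openin (zariski X) U" "p \<in> U" "restr U f \<in> reg X U" using assms(2) by (auto simp: reg_at_def)
  then have "f \<in> reg_at X q" if "q \<in> U" for q using that unfolding reg_at_def by blast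
  then show ?thesis using eventually_nz_openin[OF U(1,2)] by (auto elim: eventually_mono)
qed

text \<open>The maximal ideal at p is generated by the differences of affine coordinates, by
  division in the polynomial ring.\<close>

lemma reg_at_expansion:
  assumes p: "p \<in> X" and a: "rep p a \<noteq> 0" and f: "f \<in> reg_at X p" "f p = 0"
  shows "\<exists>g. (\<forall>i. g i \<in> reg_at X p) \<and>
    (\<forall>\<^sub>F q in nz p. f q = (\<Sum>i\<le>N. (affine_coord a q i - affine_coord a p i) * g i q))"
proof -
  obtain P Q where PQ: "P\<in>poly_fun" "Q\<in>poly_fun" "Q (affine_coord a p) \<noteq> 0"
    "\<forall>\<^sub>F q in nz p. rep q a \<noteq> 0 \<and> Q (affine_coord a q) \<noteq> 0 \<and> f q = P (affine_coord a q) / Q (affine_coord a q)"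
    using f(1) unfolding reg_at_iff[OF p a] by blast
  obtain R where R: "\<forall>i. R i \<in> poly_fun" "\<And>y. (\<forall>i>N. y i = affine_coord a p i) \<Longrightarrow> Q y \<noteq> 0 \<Longrightarrow>
    P y / Q y = P (affine_coord a p) / Q (affine_coord a p) + (\<Sum>i\<le>N. (y i - affine_coord a p i) * (R i y / Q y))"
    using rational_division[OF PQ(1-3), of N] by blast
  have P0: "P (affine_coord a p) = 0" using eventually_nz_self[OF p PQ(4)] f(2) by auto
  have "\<forall>\<^sub>F q in nz p. f q = (\<Sum>i\<le>N. (affine_coord a q i - affine_coord a p i) * (R i (affine_coord a q) / Q (affine_coord a q)))"
    using PQ(4) eventually_nz_in[OF p]
    by eventually_elim (use R(2) P0 affine_coord_support p in auto)
  moreover have "(\<lambda>q. R i (affine_coord a q) / Q (affine_coord a q)) \<in> reg_at X p" for i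
    using R(1) PQ(2,3) by (intro reg_at_divide reg_at_affine p a) auto
  ultimately show ?thesis by (intro exI[of _ "\<lambda>i q. R i (affine_coord a q) / Q (affine_coord a q)"]) blast
qed

end

text \<open>Stated for an arbitrary scalar multiplication, since it serves functions on the curve,
  where it builds a tangent vector, as well as sections, where it separates tensors.\<close>

lemma linear_functional_extend:
  fixes scale :: "complex \<Rightarrow> 'b::ab_group_add \<Rightarrow> 'b" and g :: "'b \<Rightarrow> complex"
  assumes "vector_space scale" "\<not> module.dependent scale B"
  shows "\<exists>\<phi>. (\<forall>x y. \<phi> (x + y) = \<phi> x + \<phi> y) \<and> (\<forall>c x. \<phi> (scale c x) = c * \<phi> x) \<and> (\<forall>b\<in>B. \<phi> b = g b)"
proof -
  interpret V: vector_space scale by fact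
  interpret C: vector_space "(*) :: complex \<Rightarrow> complex \<Rightarrow> complex"
    by standard (auto simp: algebra_simps)
  interpret P: vector_space_pair scale "(*) :: complex \<Rightarrow> complex \<Rightarrow> complex" ..
  obtain \<phi> where \<phi>: "Vector_Spaces.linear scale (*) \<phi>" "\<forall>b\<in>B. \<phi> b = g b"
    using P.linear_independent_extend[OF assms(2)] by blast
  interpret L: Vector_Spaces.linear scale "(*)" \<phi> by fact
  show ?thesis using \<phi>(2) L.add L.scale by blast
qed

context projective_curve begin

section \<open>The tangent space\<close>

lemma tangent_cases:
  assumes "D \<in> tangent_space X p" "f \<in> reg_at X p"
  shows "D (\<lambda>q. c * f q) = c * D f"
    and "g \<in> reg_at X p \<Longrightarrow> D (\<lambda>q. f q + g q) = D f + D g"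
    and "g \<in> reg_at X p \<Longrightarrow> D (\<lambda>q. f q * g q) = f p * D g + g p * D f"
  using assms by (auto simp: tangent_space_def scale_fun_def)

lemma tangent_const:
  assumes "p \<in> X" "D \<in> tangent_space X p" shows "D (\<lambda>_. c) = 0"
proof -
  have "D (\<lambda>_. 1) = D (\<lambda>_. 1) + D (\<lambda>_. 1)"
    using tangent_cases(3)[OF assms(2) reg_at_const[OF assms(1), of 1] reg_at_const[OF assms(1), of 1]] by simp
  then have "D (\<lambda>_. 1) = 0" by simp
  then show ?thesis using tangent_cases(1)[OF assms(2) reg_at_const[OF assms(1), of 1], of c] by simp
qed

lemma tangent_diff:
  assumes "p \<in> X" "D \<in> tangent_space X p" "f \<in> reg_at X p" "g \<in> reg_at X p"
  shows "D (\<lambda>q. f q - g q) = D f - D g"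
  using tangent_cases(2)[OF assms(2,3) reg_at_mult[OF assms(1) reg_at_const[OF assms(1), of "-1"] assms(4)]]
    tangent_cases(1)[OF assms(2,4), of "-1"] by simp

lemma tangent_cong:
  assumes p: "p \<in> X" and D: "D \<in> tangent_space X p" and f: "f \<in> reg_at X p"
    and ev: "\<forall>\<^sub>F q in nz p. f q = g q"
  shows "D f = D g"
proof -
  have g: "g \<in> reg_at X p" by (rule reg_at_cong[OF p f ev])
  define h where "h = (\<lambda>q. f q - g q)"
  define \<theta> where "\<theta> = (\<lambda>q. if f q = g q then 0 else 1 :: complex)"
  have h: "h \<in> reg_at X p" unfolding h_def by (rule reg_at_diff[OF p f g])
  have "\<forall>\<^sub>F q in nz p. 0 = \<theta> q" using ev by eventually_elim (simp add: \<theta>_def)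
  from reg_at_cong[OF p reg_at_const[OF p] this] have \<theta>: "\<theta> \<in> reg_at X p" .
  have p0: "h p = 0" "\<theta> p = 0" using eventually_nz_self[OF p ev] by (auto simp: h_def \<theta>_def)
  have "h = (\<lambda>q. h q * \<theta> q)" by (auto simp: h_def \<theta>_def)
  then have "D h = h p * D \<theta> + \<theta> p * D h" using tangent_cases(3)[OF D h \<theta>] by simp
  then have "D h = 0" by (simp add: p0)
  then show ?thesis using tangent_diff[OF p D f g] by (simp add: h_def)
qed

lemma tangent_sum:
  assumes "p \<in> X" "D \<in> tangent_space X p" "\<And>i. i \<in> A \<Longrightarrow> f i \<in> reg_at X p"
  shows "D (\<lambda>q. \<Sum>i\<in>A. f i q) = (\<Sum>i\<in>A. D (f i))"
  using assms(3)
proof (induction A rule: infinite_finite_induct)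
  case (insert i A)
  then show ?case
    using tangent_cases(2)[OF assms(2), of "f i" "\<lambda>q. \<Sum>i\<in>A. f i q"] reg_at_sum[OF assms(1), of A f] by simp
qed (use tangent_const[OF assms(1,2), of 0] in auto)

lemma tangent_space_dim1:
  assumes "p \<in> X"
  shows "\<exists>D0\<in>tangent_space X p. D0 \<noteq> 0 \<and> (\<forall>D\<in>tangent_space X p. \<exists>c. \<forall>f. D f = c * D0 f)"
proof -
  have "cfun.dim (tangent_space X p) = 1"
    using smooth assms unfolding smooth_def dim1 by (simp add: one_enat_def)
  then obtain B where B: "B \<subseteq> tangent_space X p" "cfun.independent B" "tangent_space X p \<subseteq> cfun.span B" "card B = 1"
    using cfun.basis_exists[of "tangent_space X p"] by metis
  then obtain b where b: "B = {b}" using card_1_singletonE by blast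
  then have "b \<noteq> 0" using B(2) cfun.dependent_zero by blast
  moreover have "\<exists>c. \<forall>f. D f = c * b f" if "D \<in> tangent_space X p" for D
    using that B(3) unfolding b cfun.span_singleton by (auto simp: scale_fun_def)
  ultimately show ?thesis using B(1) b by blast
qed

text \<open>The duality between derivations and m/m^2, where m is the maximal ideal at p. If w were
  outside the span of products, a functional \<phi> that kills all products and takes the value 1 at
  w would give a derivation with value 1 at w. No multiple of D0 has that value, since D0 kills
  w.\<close>

lemma tangent_vanishes_imp_span:
  assumes p: "p \<in> X" and D0: "D0 \<in> tangent_space X p" "\<And>D. D \<in> tangent_space X p \<Longrightarrow> \<exists>c. \<forall>f. D f = c * D0 f"
    and w: "w \<in> reg_at X p" "w p = 0" "D0 w = 0"
  shows "w \<in> cfun.span {\<lambda>q. f q * g q | f g. f \<in> reg_at X p \<and> g \<in> reg_at X p \<and> f p = 0 \<and> g p = 0}"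
    (is "w \<in> cfun.span ?Q")
proof (rule ccontr)
  assume nin: "w \<notin> cfun.span ?Q"
  obtain B where B: "B \<subseteq> ?Q" "cfun.independent B" "?Q \<subseteq> cfun.span B"
    using cfun.maximal_independent_subset[of ?Q] by blast
  have "w \<notin> cfun.span B" using nin cfun.span_mono[OF B(1)] by blast
  then have ind: "cfun.independent (insert w B)" and wB: "w \<notin> B"
    using cfun.independent_insertI[OF _ B(2)] cfun.span_base by blast+
  obtain \<phi> where \<phi>: "\<And>x y. \<phi> (x + y) = \<phi> x + \<phi> y" "\<And>c x. \<phi> (scale_fun c x) = c * \<phi> x"
    "\<And>b. b \<in> insert w B \<Longrightarrow> \<phi> b = (if b = w then 1 else 0)"
    using linear_functional_extend[OF cfun.vector_space_axioms ind, of "\<lambda>b. if b = w then 1 else 0"] by blast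
  have \<phi>0: "\<phi> 0 = 0" using \<phi>(1)[of 0 0] by simp
  have "cfun.subspace {x. \<phi> x = 0}"
    by (rule cfun.subspaceI) (auto simp: \<phi> \<phi>0)
  moreover have "B \<subseteq> {x. \<phi> x = 0}" using \<phi>(3) wB by auto
  ultimately have "cfun.span B \<subseteq> {x. \<phi> x = 0}" by (rule cfun.span_minimal[rotated])
  then have Q0: "\<phi> (\<lambda>q. f q * g q) = 0" if "f \<in> reg_at X p" "g \<in> reg_at X p" "f p = 0" "g p = 0" for f g
    using B(3) that by blast
  have add: "\<phi> (\<lambda>q. f q + g q) = \<phi> f + \<phi> g" for f g using \<phi>(1)[of f g] by (simp add: plus_fun_def)
  have sc: "\<phi> (\<lambda>q. c * f q) = c * \<phi> f" for c f using \<phi>(2)[of c f] by (simp add: scale_fun_def)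
  \<comment> \<open>Subtracting f p puts the argument into the maximal ideal; the Leibniz rule holds
    because \<phi> kills the product of two such differences.\<close>
  define D where "D = (\<lambda>f. if f \<in> reg_at X p then \<phi> (\<lambda>q. f q - f p) else 0)"
  have "D \<in> tangent_space X p"
    unfolding tangent_space_def
  proof (intro CollectI conjI allI ballI impI)
    fix f assume "f \<notin> reg_at X p" then show "D f = 0" by (simp add: D_def)
  next
    fix f c assume f: "f \<in> reg_at X p"
    have "(\<lambda>q. c * f q - c * f p) = (\<lambda>q. c * (f q - f p))" by (simp add: algebra_simps)
    then show "D (scale_fun c f) = c * D f"
      using f reg_at_mult[OF p reg_at_const[OF p, of c] f] sc[of c "\<lambda>q. f q - f p"] by (simp add: D_def scale_fun_def)
  next
    fix f g assume f: "f \<in> reg_at X p" and g: "g \<in> reg_at X p"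
    have "(\<lambda>q. f q + g q - (f p + g p)) = (\<lambda>q. (f q - f p) + (g q - g p))" by (simp add: algebra_simps)
    then show "D (\<lambda>q. f q + g q) = D f + D g"
      using f g reg_at_add[OF p f g] add[of "\<lambda>q. f q - f p" "\<lambda>q. g q - g p"] by (simp add: D_def)
    define f' g' where "f' = (\<lambda>q. f q - f p)" and "g' = (\<lambda>q. g q - g p)"
    have f': "f' \<in> reg_at X p" "f' p = 0" and g': "g' \<in> reg_at X p" "g' p = 0"
      unfolding f'_def g'_def by (auto intro: reg_at_diff[OF p] reg_at_const[OF p] f g)
    have "(\<lambda>q. f q * g q - f p * g p) = (\<lambda>q. f' q * g' q + (f p * g' q + g p * f' q))"
      by (simp add: f'_def g'_def algebra_simps)
    then have "D (\<lambda>q. f q * g q) = \<phi> (\<lambda>q. f' q * g' q + (f p * g' q + g p * f' q))"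
      using reg_at_mult[OF p f g] by (simp add: D_def)
    also have "\<dots> = f p * \<phi> g' + g p * \<phi> f'" using Q0[OF f'(1) g'(1) f'(2) g'(2)] by (simp add: add sc)
    finally show "D (\<lambda>q. f q * g q) = f p * D g + g p * D f"
      using f g by (simp add: D_def f'_def g'_def)
  qed
  from D0(2)[OF this] obtain c where "D w = c * D0 w" by blast
  moreover have "D w = \<phi> w" using w by (simp add: D_def)
  ultimately show False using \<phi>(3)[of w] w(3) by simp
qed

text \<open>The form of Nakayama's lemma that makes the maximal ideal of a point principal.\<close>

lemma nakayama:
  assumes p: "p \<in> X" and "finite I" and t: "t \<in> reg_at X p"
    and "\<And>i. i \<in> I \<Longrightarrow> x i \<in> reg_at X p"
    and "\<And>i. i \<in> I \<Longrightarrow> a i \<in> reg_at X p"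
    and "\<And>i k. i \<in> I \<Longrightarrow> k \<in> I \<Longrightarrow> m i k \<in> reg_at X p \<and> m i k p = 0"
    and "\<And>i. i \<in> I \<Longrightarrow> \<forall>\<^sub>F q in nz p. x i q = a i q * t q + (\<Sum>k\<in>I. m i k q * x k q)"
  shows "\<forall>i\<in>I. \<exists>b\<in>reg_at X p. \<forall>\<^sub>F q in nz p. x i q = b q * t q"
  using assms(2,4-)
proof (induction I arbitrary: a m rule: finite_induct)
  case (insert k I)
  have mkk: "m k k \<in> reg_at X p" "m k k p = 0" using insert.prems(3) by auto
  \<comment> \<open>1 - m k k is a unit at p, so the equation for x k can be solved and substituted
    into the others; the new coefficients still vanish at p.\<close>
  define c where "c = (\<lambda>q. 1 / (1 - m k k q))"
  have u: "(\<lambda>q. 1 - m k k q) \<in> reg_at X p" by (intro reg_at_diff reg_at_const p mkk)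
  have c: "c \<in> reg_at X p" unfolding c_def using reg_at_inverse(1)[OF p u] mkk by simp
  have nz: "\<forall>\<^sub>F q in nz p. 1 - m k k q \<noteq> 0" using reg_at_inverse(2)[OF p u] mkk by simp
  have xk: "\<forall>\<^sub>F q in nz p. x k q = c q * (a k q * t q + (\<Sum>l\<in>I. m k l q * x l q))"
    using nz insert.prems(4)[of k, OF insertI1]
    by eventually_elim (use insert.hyps in \<open>auto simp: c_def field_simps\<close>)
  define a' where "a' = (\<lambda>i q. a i q + m i k q * c q * a k q)"
  define m' where "m' = (\<lambda>i l q. m i l q + m i k q * c q * m k l q)"
  have "\<forall>i\<in>I. \<exists>b\<in>reg_at X p. \<forall>\<^sub>F q in nz p. x i q = b q * t q"
  proof (rule insert.IH[of a' m'])
    show "a' i \<in> reg_at X p" if "i \<in> I" for i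
      unfolding a'_def using insert.prems that c by (intro reg_at_add reg_at_mult p) auto
    show "m' i l \<in> reg_at X p \<and> m' i l p = 0" if "i \<in> I" "l \<in> I" for i l
    proof
      show "m' i l \<in> reg_at X p"
        unfolding m'_def using insert.prems that c by (intro reg_at_add reg_at_mult p) auto
      show "m' i l p = 0" using insert.prems(3) that by (simp add: m'_def)
    qed
    show "\<forall>\<^sub>F q in nz p. x i q = a' i q * t q + (\<Sum>l\<in>I. m' i l q * x l q)" if "i \<in> I" for i
      using xk insert.prems(4)[of i, OF insertI2[OF that]]
    proof eventually_elim
      case (elim q)
      have "x i q = a i q * t q + (m i k q * x k q + (\<Sum>l\<in>I. m i l q * x l q))"
        using elim(2) insert.hyps by simp
      also have "\<dots> = a' i q * t q + (\<Sum>l\<in>I. m' i l q * x l q)"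
        unfolding elim(1) a'_def m'_def
        by (simp add: distrib_left distrib_right sum.distrib sum_distrib_left mult.assoc)
      finally show ?case .
    qed
  qed (use insert.prems in auto)
  then obtain b where b: "\<And>i. i \<in> I \<Longrightarrow> b i \<in> reg_at X p"
    "\<And>i. i \<in> I \<Longrightarrow> \<forall>\<^sub>F q in nz p. x i q = b i q * t q" by metis
  have ev: "\<forall>\<^sub>F q in nz p. \<forall>i\<in>I. x i q = b i q * t q"
    using b(2) insert.hyps(1) by (simp add: eventually_ball_finite)
  have "\<forall>\<^sub>F q in nz p. x k q = (c q * (a k q + (\<Sum>l\<in>I. m k l q * b l q))) * t q"
    using xk ev
  proof eventually_elim
    case (elim q)
    have "(\<Sum>l\<in>I. m k l q * x l q) = (\<Sum>l\<in>I. m k l q * b l q) * t q"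
      unfolding sum_distrib_right by (rule sum.cong) (use elim(2) in auto)
    then show ?case unfolding elim(1) by (simp add: algebra_simps)
  qed
  moreover have "(\<lambda>q. c q * (a k q + (\<Sum>l\<in>I. m k l q * b l q))) \<in> reg_at X p"
    using insert.prems b(1) c by (intro reg_at_mult reg_at_add reg_at_sum p) auto
  ultimately have "\<exists>b\<in>reg_at X p. \<forall>\<^sub>F q in nz p. x k q = b q * t q"
    by (intro bexI[of _ "\<lambda>q. c q * (a k q + (\<Sum>l\<in>I. m k l q * b l q))"])
  with b show ?case by blast
qed auto

definition ucoord :: "nat \<Rightarrow> point \<Rightarrow> nat \<Rightarrow> point \<Rightarrow> complex" where
  "ucoord a p i q = affine_coord a q i - affine_coord a p i"

lemma ucoord_0 [simp]: "ucoord a p i p = 0"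
  by (simp add: ucoord_def)

lemma ucoord_reg: "w \<in> X \<Longrightarrow> rep w a \<noteq> 0 \<Longrightarrow> ucoord a p i \<in> reg_at X w"
  using reg_at_affine[OF _ _ poly_fun_diff[OF poly_fun.coord[of i] poly_fun.const[of "affine_coord a p i"]], of w a]
  unfolding ucoord_def[abs_def] by simp

text \<open>An element of m^2, expanded in coordinate differences, has coefficients in m. These are
  the error terms that \<open>nakayama\<close> absorbs.\<close>

lemma span_products_expansion:
  assumes p: "p \<in> X" and a: "rep p a \<noteq> 0"
    and w: "w \<in> cfun.span {\<lambda>q. f q * g q | f g. f \<in> reg_at X p \<and> g \<in> reg_at X p \<and> f p = 0 \<and> g p = 0}"
  shows "\<exists>M. (\<forall>i. M i \<in> reg_at X p \<and> M i p = 0) \<and> (\<forall>\<^sub>F q in nz p. w q = (\<Sum>i\<le>N. M i q * ucoord a p i q))"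
proof -
  define S where "S = {w. \<exists>M. (\<forall>i. M i \<in> reg_at X p \<and> M i p = 0) \<and>
    (\<forall>\<^sub>F q in nz p. w q = (\<Sum>i\<le>N. M i q * ucoord a p i q))}"
  have "cfun.subspace S"
  proof (rule cfun.subspaceI)
    show "0 \<in> S" unfolding S_def
      by (intro CollectI exI[of _ "\<lambda>_ _. 0"]) (auto intro: reg_at_const p)
  next
    fix x y assume "x \<in> S" "y \<in> S"
    then obtain M M' where M: "\<forall>i. M i \<in> reg_at X p \<and> M i p = 0" "\<forall>i. M' i \<in> reg_at X p \<and> M' i p = 0"
      "\<forall>\<^sub>F q in nz p. x q = (\<Sum>i\<le>N. M i q * ucoord a p i q)"
      "\<forall>\<^sub>F q in nz p. y q = (\<Sum>i\<le>N. M' i q * ucoord a p i q)" unfolding S_def by blast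
    have "\<forall>\<^sub>F q in nz p. (x + y) q = (\<Sum>i\<le>N. (M i q + M' i q) * ucoord a p i q)"
      using M(3,4) by eventually_elim (simp add: distrib_right sum.distrib)
    then show "x + y \<in> S" unfolding S_def using M(1,2)
      by (intro CollectI exI[of _ "\<lambda>i q. M i q + M' i q"]) (auto intro: reg_at_add p)
  next
    fix c x assume "x \<in> S"
    then obtain M where M: "\<forall>i. M i \<in> reg_at X p \<and> M i p = 0"
      "\<forall>\<^sub>F q in nz p. x q = (\<Sum>i\<le>N. M i q * ucoord a p i q)" unfolding S_def by blast
    have "\<forall>\<^sub>F q in nz p. scale_fun c x q = (\<Sum>i\<le>N. (c * M i q) * ucoord a p i q)"
      using M(2) by eventually_elim (simp add: scale_fun_def sum_distrib_left mult.assoc)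
    then show "scale_fun c x \<in> S" unfolding S_def using M(1)
      by (intro CollectI exI[of _ "\<lambda>i q. c * M i q"]) (use reg_at_mult[OF p reg_at_const[OF p, of c]] in auto)
  qed
  moreover have "{\<lambda>q. f q * g q | f g. f \<in> reg_at X p \<and> g \<in> reg_at X p \<and> f p = 0 \<and> g p = 0} \<subseteq> S"
  proof clarify
    fix f g assume f: "f \<in> reg_at X p" "f p = 0" and g: "g \<in> reg_at X p" "g p = 0"
    obtain h where h: "\<forall>i. h i \<in> reg_at X p" "\<forall>\<^sub>F q in nz p. g q = (\<Sum>i\<le>N. ucoord a p i q * h i q)"
      using reg_at_expansion[OF p a g] by (auto simp: ucoord_def)
    from h(2) have "\<forall>\<^sub>F q in nz p. f q * g q = (\<Sum>i\<le>N. (f q * h i q) * ucoord a p i q)"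
      by eventually_elim (simp add: sum_distrib_left mult_ac)
    then show "(\<lambda>q. f q * g q) \<in> S" unfolding S_def using f h(1)
      by (intro CollectI exI[of _ "\<lambda>i q. f q * h i q"]) (auto intro: reg_at_mult p)
  qed
  ultimately have "w \<in> S" using w cfun.span_minimal by blast
  then show ?thesis by (simp add: S_def)
qed

text \<open>D0 is determined by its values on the coordinate differences u_i, so some u_j is not
  killed. With c_i = D0 u_i / D0 u_j the germ u_i - c_i u_j is killed by D0, hence lies in m^2, and
  Nakayama's lemma makes every u_i a multiple of u_j.\<close>

lemma exists_uniformizing_coord:
  assumes p: "p \<in> X" and a: "rep p a \<noteq> 0"
  shows "\<exists>j\<le>N. (\<forall>i\<le>N. \<exists>h\<in>reg_at X p. \<forall>\<^sub>F q in nz p. ucoord a p i q = h q * ucoord a p j q) \<and>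
    (\<exists>D\<in>tangent_space X p. D (ucoord a p j) \<noteq> 0)"
proof -
  obtain D0 where D0: "D0 \<in> tangent_space X p" "D0 \<noteq> 0"
    "\<And>D. D \<in> tangent_space X p \<Longrightarrow> \<exists>c. \<forall>f. D f = c * D0 f"
    using tangent_space_dim1[OF p] by blast
  let ?u = "ucoord a p"
  have u: "?u i \<in> reg_at X p" for i by (rule ucoord_reg[OF p a])
  have "\<exists>j\<le>N. D0 (?u j) \<noteq> 0"
  proof (rule ccontr)
    assume *: "\<not> ?thesis"
    have "D0 f = 0" for f
    proof (cases "f \<in> reg_at X p")
      case False
      then show ?thesis using D0(1) by (simp add: tangent_space_def)
    next
      case True
      have f': "(\<lambda>q. f q - f p) \<in> reg_at X p" by (intro reg_at_diff reg_at_const p True)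
      obtain h where h: "\<forall>i. h i \<in> reg_at X p" "\<forall>\<^sub>F q in nz p. f q - f p = (\<Sum>i\<le>N. ?u i q * h i q)"
        using reg_at_expansion[OF p a f'] by (auto simp: ucoord_def)
      have "D0 f = D0 (\<lambda>q. f q - f p)"
        using tangent_diff[OF p D0(1) True reg_at_const[OF p]] tangent_const[OF p D0(1)] by simp
      also have "\<dots> = D0 (\<lambda>q. \<Sum>i\<le>N. ?u i q * h i q)" by (rule tangent_cong[OF p D0(1) f' h(2)])
      also have "\<dots> = (\<Sum>i\<le>N. D0 (\<lambda>q. ?u i q * h i q))"
        using h u by (intro tangent_sum[OF p D0(1)] reg_at_mult p) auto
      also have "\<dots> = 0"
        using * h(1) u by (intro sum.neutral) (simp add: tangent_cases(3)[OF D0(1)])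
      finally show ?thesis .
    qed
    then show False using D0(2) by (simp add: fun_eq_iff)
  qed
  then obtain j where j: "j \<le> N" "D0 (?u j) \<noteq> 0" by blast
  define c where "c = (\<lambda>i. D0 (?u i) / D0 (?u j))"
  have "\<exists>M. (\<forall>k. M k \<in> reg_at X p \<and> M k p = 0) \<and>
    (\<forall>\<^sub>F q in nz p. ?u i q - c i * ?u j q = (\<Sum>k\<le>N. M k q * ?u k q))" for i
  proof -
    have cu: "(\<lambda>q. c i * ?u j q) \<in> reg_at X p" by (intro reg_at_mult reg_at_const p u)
    have w: "(\<lambda>q. ?u i q - c i * ?u j q) \<in> reg_at X p" by (intro reg_at_diff p u cu)
    have "D0 (\<lambda>q. ?u i q - c i * ?u j q) = 0"
      unfolding tangent_diff[OF p D0(1) u cu] tangent_cases(1)[OF D0(1) u] using j(2) by (simp add: c_def)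
    from span_products_expansion[OF p a tangent_vanishes_imp_span[OF p D0(1,3) w _ this]]
    show ?thesis by simp
  qed
  then have "\<exists>M. \<forall>i. (\<forall>k. M i k \<in> reg_at X p \<and> M i k p = 0) \<and>
    (\<forall>\<^sub>F q in nz p. ?u i q - c i * ?u j q = (\<Sum>k\<le>N. M i k q * ?u k q))"
    by (intro choice allI)
  then obtain M where M: "\<And>i k. M i k \<in> reg_at X p \<and> M i k p = 0"
    "\<And>i. \<forall>\<^sub>F q in nz p. ?u i q - c i * ?u j q = (\<Sum>k\<le>N. M i k q * ?u k q)" by blast
  have "\<forall>i\<in>{..N}. \<exists>b\<in>reg_at X p. \<forall>\<^sub>F q in nz p. ?u i q = b q * ?u j q"
  proof (rule nakayama[OF p _ u, where a = "\<lambda>i _. c i" and m = M])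
    show "\<forall>\<^sub>F q in nz p. ?u i q = c i * ?u j q + (\<Sum>k\<le>N. M i k q * ?u k q)" for i
      using M(2)[of i] by eventually_elim (simp add: algebra_simps)
  qed (use u M(1) reg_at_const[OF p] in auto)
  then show ?thesis using j D0(1) by auto
qed

text \<open>If neither germ is zero, each function is nonzero on some nonempty open subset of a
  common neighbourhood, and these two sets meet.\<close>

lemma reg_at_domain:
  assumes p: "p \<in> X" and f: "f \<in> reg_at X p" and g: "g \<in> reg_at X p"
    and ev: "\<forall>\<^sub>F q in nz p. f q * g q = 0"
  shows "(\<forall>\<^sub>F q in nz p. f q = 0) \<or> (\<forall>\<^sub>F q in nz p. g q = 0)"
proof (rule ccontr)
  assume *: "\<not> ?thesis"
  have "\<forall>\<^sub>F q in nz p. q \<in> X \<and> f \<in> reg_at X q \<and> g \<in> reg_at X q \<and> f q * g q = 0"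
    using ev eventually_nz_in[OF p] eventually_reg_at[OF p f] eventually_reg_at[OF p g]
    by eventually_elim auto
  then obtain U where U: "openin (zariski X) U" "p \<in> U"
    "\<And>q. q \<in> U \<Longrightarrow> q \<in> X \<and> f \<in> reg_at X q \<and> g \<in> reg_at X q \<and> f q * g q = 0"
    unfolding eventually_nz_open[OF p] by blast
  have "\<exists>q\<in>U. f q \<noteq> 0" "\<exists>q\<in>U. g q \<noteq> 0"
    using * U(1,2) unfolding eventually_nz_open[OF p] by blast+
  then obtain q1 q2 where q: "q1 \<in> U" "f q1 \<noteq> 0" "q2 \<in> U" "g q2 \<noteq> 0" by blast
  have "\<forall>\<^sub>F q in nz q1. q \<in> U \<and> f q \<noteq> 0"
    using reg_at_inverse(2)[of q1 f] U(3)[OF q(1)] q(2) eventually_nz_openin[OF U(1) q(1)] by (auto elim: eventually_elim2)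
  moreover have "\<forall>\<^sub>F q in nz q2. g q \<noteq> 0"
    using reg_at_inverse(2)[of q2 g] U(3)[OF q(3)] q(4) by auto
  ultimately obtain w where "w \<in> U" "f w \<noteq> 0" "g w \<noteq> 0"
    using eventually_nz_meet[of q1 q2] U(3) q(1,3) by blast
  then show False using U(3) by auto
qed

text \<open>Near p all coordinate differences are multiples of the j-th one, so where that one
  vanishes all affine coordinates agree with those of p. Since X has further points and is
  irreducible, p is not isolated, and the j-th difference is not the zero germ.\<close>

lemma ucoord_not_0:
  assumes p: "p \<in> X" and a: "rep p a \<noteq> 0"
    and h: "\<And>i. i \<le> N \<Longrightarrow> \<exists>h\<in>reg_at X p. \<forall>\<^sub>F q in nz p. ucoord a p i q = h q * ucoord a p j q"
  shows "\<forall>\<^sub>F q in nz p. ucoord a p j q = 0 \<longrightarrow> q = p"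
    and "\<not> (\<forall>\<^sub>F q in nz p. ucoord a p j q = 0)"
proof -
  have "\<forall>\<^sub>F q in nz p. ucoord a p j q = 0 \<longrightarrow> ucoord a p i q = 0" if "i \<le> N" for i
    using h[OF that] by (auto elim!: eventually_mono)
  then have "\<forall>\<^sub>F q in nz p. \<forall>i\<in>{..N}. ucoord a p j q = 0 \<longrightarrow> ucoord a p i q = 0"
    by (intro eventually_ball_finite) auto
  with eventually_nz_in[OF p] eventually_form_nonzero[OF p form_coord[of a] a]
  show ev: "\<forall>\<^sub>F q in nz p. ucoord a p j q = 0 \<longrightarrow> q = p"
  proof eventually_elim
    case (elim q)
    show ?case
    proof
      assume "ucoord a p j q = 0"
      then have "affine_coord a q i = affine_coord a p i" for i
        using elim affine_coord_support[OF elim(1)] affine_coord_support[OF p]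
        by (cases "i \<le> N") (auto simp: ucoord_def)
      then have eq: "rep q i / rep q a = rep p i / rep p a" for i by (simp add: affine_coord_def)
      have "rep q = (\<lambda>i. (rep q a / rep p a) * rep p i)"
      proof
        show "rep q i = (rep q a / rep p a) * rep p i" for i
          using eq[of i] a elim(2) by (simp add: field_simps)
      qed
      moreover have "rep q a / rep p a \<noteq> 0" using a elim(2) by simp
      ultimately have "rep q \<in> p"
        using in_point_iff[OF in_proj[OF p] rep_in[OF in_proj[OF p]]] by blast
      then show "q = p"
        using point_eqI[OF in_proj[OF elim(1)] in_proj[OF p] rep_in[OF in_proj[OF elim(1)]]] by blast
    qed
  qed
  show "\<not> (\<forall>\<^sub>F q in nz p. ucoord a p j q = 0)"
  proof
    assume "\<forall>\<^sub>F q in nz p. ucoord a p j q = 0"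
    with ev have "\<forall>\<^sub>F q in nz p. q = p" by eventually_elim auto
    obtain q where "q \<in> X" "q \<noteq> p" using X_not_singleton[of p] p by blast
    have "\<forall>\<^sub>F x in nz q. x \<in> X - {p}"
      using eventually_nz_openin[OF openin_remove_point[OF p]] \<open>q \<in> X\<close> \<open>q \<noteq> p\<close> by blast
    from eventually_nz_meet[OF p \<open>q \<in> X\<close> \<open>\<forall>\<^sub>F q in nz p. q = p\<close> this] show False by blast
  qed
qed

end

section \<open>Holomorphic arcs\<close>

definition coord_box :: "nat \<Rightarrow> (nat \<Rightarrow> complex) \<Rightarrow> real \<Rightarrow> (nat \<Rightarrow> complex) set" where
  "coord_box N y0 d = {y. (\<forall>i>N. y i = y0 i) \<and> (\<forall>i\<le>N. norm (y i - y0 i) \<le> d)}"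

text \<open>Points have infinitely many coordinates, so the maximum of the first N + 1 differences
  is replaced by an arbitrary upper bound t. The bound M on f itself is carried along because the
  Lipschitz constant of a product depends on it.\<close>

definition lipschitz_bound :: "nat \<Rightarrow> (nat \<Rightarrow> complex) set \<Rightarrow> ((nat \<Rightarrow> complex) \<Rightarrow> complex) \<Rightarrow> real \<Rightarrow> real \<Rightarrow> bool" where
  "lipschitz_bound N B f L M \<longleftrightarrow> 0 \<le> L \<and> 0 \<le> M \<and> (\<forall>y\<in>B. norm (f y) \<le> M) \<and>
     (\<forall>y\<in>B. \<forall>y'\<in>B. \<forall>t. (\<forall>i\<le>N. norm (y i - y' i) \<le> t) \<longrightarrow> norm (f y - f y') \<le> L * t)"

lemma coord_box_mono: "d \<le> d' \<Longrightarrow> coord_box N y0 d \<subseteq> coord_box N y0 d'"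
  by (auto simp: coord_box_def)

lemma coord_box_center: "d \<ge> 0 \<Longrightarrow> y0 \<in> coord_box N y0 d"
  by (auto simp: coord_box_def)

lemma lipschitz_bound_mono: "lipschitz_bound N B f L M \<Longrightarrow> B' \<subseteq> B \<Longrightarrow> L \<le> L' \<Longrightarrow> M \<le> M' \<Longrightarrow> lipschitz_bound N B' f L' M'"
  unfolding lipschitz_bound_def
proof (intro conjI ballI allI impI; elim conjE)
  fix y y' t
  assume *: "0 \<le> L" "\<forall>y\<in>B. \<forall>y'\<in>B. \<forall>t. (\<forall>i\<le>N. norm (y i - y' i) \<le> t) \<longrightarrow> norm (f y - f y') \<le> L * t"
    "B' \<subseteq> B" "L \<le> L'" "y \<in> B'" "y' \<in> B'" "\<forall>i\<le>N. norm (y i - y' i) \<le> t"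
  then have "norm (f y - f y') \<le> L * t" by blast
  moreover have "0 \<le> t" using *(7) norm_ge_zero order_trans by blast
  ultimately show "norm (f y - f y') \<le> L' * t" using *(4) by (meson mult_right_mono order_trans)
qed (meson order_trans subsetD)+

lemma poly_fun_lips:
  assumes "P \<in> poly_fun" shows "\<exists>L M. lipschitz_bound N (coord_box N y0 1) P L M"
  using assms
proof induction
  case (const c)
  have "lipschitz_bound N (coord_box N y0 1) (\<lambda>_. c) 0 (norm c)" by (simp add: lipschitz_bound_def)
  then show ?case by blast
next
  case (coord i)
  have "lipschitz_bound N (coord_box N y0 1) (\<lambda>v. v i) 1 (norm (y0 i) + 1)"
    unfolding lipschitz_bound_def
  proof (intro conjI ballI allI impI)
    fix y assume "y \<in> coord_box N y0 1"
    then have "norm (y i - y0 i) \<le> 1" by (cases "i \<le> N") (auto simp: coord_box_def)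
    then show "norm (y i) \<le> norm (y0 i) + 1" using norm_triangle_ineq2[of "y i" "y0 i"] by linarith
  next
    fix y y' t
    assume *: "y \<in> coord_box N y0 1" "y' \<in> coord_box N y0 1" "\<forall>i\<le>N. norm (y i - y' i) \<le> t"
    then have "0 \<le> t" using norm_ge_zero order_trans by blast
    then show "norm (y i - y' i) \<le> 1 * t" using * by (cases "i \<le> N") (auto simp: coord_box_def)
  qed auto
  then show ?case by blast
next
  case (add P Q)
  then obtain L M L' M' where PQ: "lipschitz_bound N (coord_box N y0 1) P L M" "lipschitz_bound N (coord_box N y0 1) Q L' M'" by blast
  have "lipschitz_bound N (coord_box N y0 1) (\<lambda>v. P v + Q v) (L + L') (M + M')"
    unfolding lipschitz_bound_def
  proof (intro conjI ballI allI impI)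
    fix y assume "y \<in> coord_box N y0 1"
    then show "norm (P y + Q y) \<le> M + M'" using PQ norm_triangle_mono unfolding lipschitz_bound_def by blast
  next
    fix y y' t
    assume "y \<in> coord_box N y0 1" "y' \<in> coord_box N y0 1" "\<forall>i\<le>N. norm (y i - y' i) \<le> t"
    then have "norm (P y - P y') \<le> L * t" "norm (Q y - Q y') \<le> L' * t" using PQ unfolding lipschitz_bound_def by blast+
    then show "norm (P y + Q y - (P y' + Q y')) \<le> (L + L') * t"
      unfolding add_diff_add distrib_right by (rule norm_triangle_mono)
  qed (use PQ in \<open>auto simp: lipschitz_bound_def\<close>)
  then show ?case by blast
next
  case (mult P Q)
  then obtain L M L' M' where PQ: "lipschitz_bound N (coord_box N y0 1) P L M" "lipschitz_bound N (coord_box N y0 1) Q L' M'" by blast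
  then have nn: "0 \<le> L" "0 \<le> M" "0 \<le> L'" "0 \<le> M'" by (auto simp: lipschitz_bound_def)
  have "lipschitz_bound N (coord_box N y0 1) (\<lambda>v. P v * Q v) (M * L' + L * M') (M * M')"
    unfolding lipschitz_bound_def
  proof (intro conjI ballI allI impI)
    fix y assume "y \<in> coord_box N y0 1"
    then show "norm (P y * Q y) \<le> M * M'"
      using PQ nn unfolding lipschitz_bound_def norm_mult by (intro mult_mono) auto
  next
    fix y y' t
    assume *: "y \<in> coord_box N y0 1" "y' \<in> coord_box N y0 1" "\<forall>i\<le>N. norm (y i - y' i) \<le> t"
    then have "0 \<le> t" using norm_ge_zero order_trans by blast
    have "norm (P y - P y') \<le> L * t" "norm (Q y - Q y') \<le> L' * t" "norm (P y) \<le> M" "norm (Q y') \<le> M'"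
      using PQ * unfolding lipschitz_bound_def by blast+
    then have "norm (P y * (Q y - Q y')) \<le> M * (L' * t)" "norm ((P y - P y') * Q y') \<le> (L * t) * M'"
      unfolding norm_mult using nn \<open>0 \<le> t\<close> by (auto intro!: mult_mono)
    then have "norm (P y * (Q y - Q y') + (P y - P y') * Q y') \<le> M * (L' * t) + (L * t) * M'"
      by (rule norm_triangle_mono)
    then show "norm (P y * Q y - P y' * Q y') \<le> (M * L' + L * M') * t"
      by (simp add: algebra_simps)
  qed (use nn in auto)
  then show ?case by blast
qed

lemma rational_lips:
  assumes "P \<in> poly_fun" "Q \<in> poly_fun" "Q y0 \<noteq> 0"
  shows "\<exists>d L M. 0 < d \<and> (\<forall>y\<in>coord_box N y0 d. Q y \<noteq> 0) \<and> lipschitz_bound N (coord_box N y0 d) (\<lambda>y. P y / Q y) L M"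
proof -
  obtain L M where P: "lipschitz_bound N (coord_box N y0 1) P L M" using poly_fun_lips[OF assms(1)] by blast
  obtain L' M' where Q: "lipschitz_bound N (coord_box N y0 1) Q L' M'" using poly_fun_lips[OF assms(2)] by blast
  have nn: "0 \<le> L" "0 \<le> M" "0 \<le> L'" "0 \<le> M'" using P Q by (auto simp: lipschitz_bound_def)
  \<comment> \<open>On a box with L' d at most q the denominator keeps at least half of its modulus
    at y0.\<close>
  define q where "q = norm (Q y0) / 2"
  have q: "q > 0" using assms(3) by (simp add: q_def)
  define d where "d = min 1 (q / (L' + 1))"
  have d: "0 < d" "d \<le> 1" "L' * d \<le> q"
  proof -
    show "0 < d" "d \<le> 1" using q nn by (auto simp: d_def)
    have "L' * d \<le> L' * (q / (L' + 1))" using nn by (intro mult_left_mono) (auto simp: d_def)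
    also have "\<dots> \<le> q" using nn q by (simp add: field_simps)
    finally show "L' * d \<le> q" .
  qed
  have sub: "coord_box N y0 d \<subseteq> coord_box N y0 1" using d(2) by (rule coord_box_mono)
  have Qlow: "norm (Q y) \<ge> q" if "y \<in> coord_box N y0 d" for y
  proof -
    have "norm (Q y - Q y0) \<le> L' * d"
      using Q sub that coord_box_center[of 1 y0 N] unfolding lipschitz_bound_def by (auto simp: coord_box_def)
    then show ?thesis using d(3) norm_triangle_ineq2[of "Q y0" "Q y"] by (simp add: q_def norm_minus_commute)
  qed
  have "lipschitz_bound N (coord_box N y0 d) (\<lambda>y. P y / Q y) ((M * L' + L * M') / (q * q)) (M / q)"
    unfolding lipschitz_bound_def
  proof (intro conjI ballI allI impI)
    fix y assume y: "y \<in> coord_box N y0 d"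
    then have "norm (P y) \<le> M" using P sub unfolding lipschitz_bound_def by blast
    then show "norm (P y / Q y) \<le> M / q"
      unfolding norm_divide using Qlow[OF y] q nn by (intro frac_le) auto
  next
    fix y y' t
    assume *: "y \<in> coord_box N y0 d" "y' \<in> coord_box N y0 d" "\<forall>i\<le>N. norm (y i - y' i) \<le> t"
    then have t: "0 \<le> t" using norm_ge_zero order_trans by blast
    have mem: "y \<in> coord_box N y0 1" "y' \<in> coord_box N y0 1" using * sub by auto
    have b: "norm (P y - P y') \<le> L * t" "norm (Q y - Q y') \<le> L' * t" "norm (P y) \<le> M" "norm (Q y) \<le> M'"
      using P Q mem *(3) unfolding lipschitz_bound_def by blast+
    then have "norm (P y * (Q y' - Q y)) \<le> M * (L' * t)" "norm ((P y - P y') * Q y) \<le> (L * t) * M'"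
      unfolding norm_mult using nn t by (auto intro!: mult_mono simp: norm_minus_commute)
    then have num: "norm (P y * (Q y' - Q y) + (P y - P y') * Q y) \<le> M * (L' * t) + (L * t) * M'"
      by (rule norm_triangle_mono)
    have nz: "Q y \<noteq> 0" "Q y' \<noteq> 0" using Qlow[OF *(1)] Qlow[OF *(2)] q by auto
    have "norm (P y / Q y - P y' / Q y') = norm (P y * (Q y' - Q y) + (P y - P y') * Q y) / (norm (Q y) * norm (Q y'))"
      using nz by (simp add: field_simps flip: norm_mult norm_divide)
    also have "\<dots> \<le> (M * (L' * t) + (L * t) * M') / (q * q)"
      using num Qlow[OF *(1)] Qlow[OF *(2)] q nn t by (intro frac_le mult_mono) auto
    finally show "norm (P y / Q y - P y' / Q y') \<le> (M * L' + L * M') / (q * q) * t"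
      by (simp add: algebra_simps)
  qed (use nn q in auto)
  moreover have "\<forall>y\<in>coord_box N y0 d. Q y \<noteq> 0" using Qlow q by fastforce
  ultimately show ?thesis using d(1) by blast
qed

lemma rational_family_lips:
  assumes "\<And>i. i \<le> N \<Longrightarrow> P i \<in> poly_fun \<and> Q i \<in> poly_fun \<and> Q i y0 \<noteq> 0"
  shows "\<exists>d L M. 0 < d \<and> (\<forall>i\<le>N. (\<forall>y\<in>coord_box N y0 d. Q i y \<noteq> 0) \<and>
    lipschitz_bound N (coord_box N y0 d) (\<lambda>y. P i y / Q i y) L M)"
proof -
  have "\<forall>i\<in>{..N}. \<exists>d L M. 0 < d \<and> (\<forall>y\<in>coord_box N y0 d. Q i y \<noteq> 0) \<and> lipschitz_bound N (coord_box N y0 d) (\<lambda>y. P i y / Q i y) L M"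
    using rational_lips assms by auto
  then obtain d L M where *: "\<And>i. i \<le> N \<Longrightarrow> 0 < d i \<and> (\<forall>y\<in>coord_box N y0 (d i). Q i y \<noteq> 0) \<and>
    lipschitz_bound N (coord_box N y0 (d i)) (\<lambda>y. P i y / Q i y) (L i) (M i)"
    by (metis atMost_iff)
  then have nn: "0 \<le> L i" "0 \<le> M i" if "i \<le> N" for i using that by (auto simp: lipschitz_bound_def)
  define d0 where "d0 = Min (d ` {..N})"
  have d0: "0 < d0" unfolding d0_def using * by (subst Min_gr_iff) auto
  have d0_le: "d0 \<le> d i" if "i \<le> N" for i unfolding d0_def using that by (intro Min_le) auto
  have "(\<forall>y\<in>coord_box N y0 d0. Q i y \<noteq> 0) \<and> lipschitz_bound N (coord_box N y0 d0) (\<lambda>y. P i y / Q i y) (\<Sum>i\<le>N. L i) (\<Sum>i\<le>N. M i)"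
    if "i \<le> N" for i
  proof
    show "\<forall>y\<in>coord_box N y0 d0. Q i y \<noteq> 0" using *[OF that] coord_box_mono[OF d0_le[OF that]] by blast
    show "lipschitz_bound N (coord_box N y0 d0) (\<lambda>y. P i y / Q i y) (\<Sum>i\<le>N. L i) (\<Sum>i\<le>N. M i)"
    proof (rule lipschitz_bound_mono)
      show "lipschitz_bound N (coord_box N y0 (d i)) (\<lambda>y. P i y / Q i y) (L i) (M i)" using *[OF that] by blast
    qed (use that nn coord_box_mono[OF d0_le[OF that]] in \<open>auto intro!: member_le_sum\<close>)
  qed
  then show ?thesis using d0 by blast
qed

lemma poly_fun_holomorphic:
  assumes "P \<in> poly_fun" "\<And>i. (\<lambda>z. Y z i) holomorphic_on S"
  shows "(\<lambda>z. P (Y z)) holomorphic_on S"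
  using assms(1) by induction (auto intro!: holomorphic_intros assms(2))

text \<open>The equations y_i = y0_i + z H_i(y) form a fixed point problem with the small factor z.
  The iterates from y0 are holomorphic in z and converge uniformly, so the solution is holomorphic.
  Uniqueness in the box is what later identifies points of the curve with points of the arc.\<close>

lemma exists_arc:
  assumes PQ: "\<And>i. i \<le> N \<Longrightarrow> P i \<in> poly_fun \<and> Q i \<in> poly_fun \<and> Q i y0 \<noteq> 0"
  shows "\<exists>d r Y. 0 < d \<and> 0 < r \<and> (\<forall>i. (\<lambda>z. Y z i) holomorphic_on ball 0 r) \<and>
    (\<forall>z\<in>ball 0 r. Y z \<in> coord_box N y0 d \<and> (\<forall>i\<le>N. Y z i = y0 i + z * (P i (Y z) / Q i (Y z)))) \<and>
    (\<forall>z\<in>ball 0 r. \<forall>y\<in>coord_box N y0 d. (\<forall>i\<le>N. y i = y0 i + z * (P i y / Q i y)) \<longrightarrow> y = Y z)"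
proof -
  define H where "H = (\<lambda>i y. P i y / Q i y)"
  obtain d L M where d: "0 < d" "\<And>i y. i \<le> N \<Longrightarrow> y \<in> coord_box N y0 d \<Longrightarrow> Q i y \<noteq> 0"
    "\<And>i. i \<le> N \<Longrightarrow> lipschitz_bound N (coord_box N y0 d) (H i) L M"
    using rational_family_lips[of N P Q y0, OF PQ] unfolding H_def by blast
  have nn: "0 \<le> L" "0 \<le> M" using d(3)[of 0] by (auto simp: lipschitz_bound_def)
  \<comment> \<open>The first bound keeps the iterates in the box, the second makes the map a
    contraction by the factor 1/2.\<close>
  define r where "r = min (d / (M + 1)) (1 / (2 * (L + 1)))"
  have r: "0 < r" using d(1) nn by (simp add: r_def)
  have rM: "norm z * M \<le> d" and rL: "norm z * L \<le> 1 / 2" if "z \<in> ball 0 r" for z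
  proof -
    have z: "norm z \<le> d / (M + 1)" "norm z \<le> 1 / (2 * (L + 1))" using that by (auto simp: r_def)
    have "norm z * M \<le> d / (M + 1) * M" using z nn by (intro mult_right_mono) auto
    also have "\<dots> \<le> d" using nn d(1) by (simp add: field_simps)
    finally show "norm z * M \<le> d" .
    have "norm z * L \<le> 1 / (2 * (L + 1)) * L" using z nn by (intro mult_right_mono) auto
    also have "\<dots> \<le> 1 / 2" using nn by (simp add: field_simps)
    finally show "norm z * L \<le> 1 / 2" .
  qed
  define it where "it = (\<lambda>n. ((\<lambda>y z i. if i \<le> N then y0 i + z * H i (y z) else y0 i) ^^ n) (\<lambda>z. y0))"
  have it0: "it 0 = (\<lambda>z. y0)" by (simp add: it_def)
  have itS: "it (Suc n) z i = (if i \<le> N then y0 i + z * H i (it n z) else y0 i)" for n z i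
    by (simp add: it_def)
  have box: "it n z \<in> coord_box N y0 d" if "z \<in> ball 0 r" for n z
  proof (induction n)
    case 0
    then show ?case using d(1) by (simp add: it0 coord_box_center)
  next
    case (Suc n)
    have "norm (z * H i (it n z)) \<le> d" if "i \<le> N" for i
    proof -
      have "norm (H i (it n z)) \<le> M" using d(3)[OF that] Suc unfolding lipschitz_bound_def by blast
      then have "norm (z * H i (it n z)) \<le> norm z * M" by (simp add: norm_mult mult_left_mono)
      then show ?thesis using rM[OF \<open>z \<in> ball 0 r\<close>] by linarith
    qed
    then show ?case by (auto simp: coord_box_def itS)
  qed
  have step: "norm (it (Suc n) z i - it n z i) \<le> d * (1 / 2) ^ n" if z: "z \<in> ball 0 r" for n z i
  proof (induction n arbitrary: i)
    case 0
    then show ?case using box[OF z, of "Suc 0"] d(1) by (cases "i \<le> N") (auto simp: it0 coord_box_def)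
  next
    case (Suc n)
    show ?case
    proof (cases "i \<le> N")
      case True
      have "norm (H i (it (Suc n) z) - H i (it n z)) \<le> L * (d * (1 / 2) ^ n)"
        using d(3)[OF True] box[OF z] Suc unfolding lipschitz_bound_def by blast
      then have "norm z * norm (H i (it (Suc n) z) - H i (it n z)) \<le> norm z * (L * (d * (1 / 2) ^ n))"
        by (intro mult_left_mono) auto
      also have "\<dots> \<le> 1 / 2 * (d * (1 / 2) ^ n)"
        using mult_right_mono[OF rL[OF z], of "d * (1 / 2) ^ n"] d(1) by (simp add: mult.assoc)
      finally have "norm (z * (H i (it (Suc n) z) - H i (it n z))) \<le> d * (1 / 2) ^ Suc n"
        by (simp add: norm_mult)
      then show ?thesis unfolding itS[of "Suc n"] using True itS[of n z i] by (simp add: algebra_simps)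
    qed (use itS d(1) in auto)
  qed
  define Y where "Y = (\<lambda>z i. y0 i + suminf (\<lambda>n. it (Suc n) z i - it n z i))"
  have tele: "(\<Sum>k<n. it (Suc k) z i - it k z i) = it n z i - y0 i" for n z i
    by (subst sum_lessThan_telescope) (simp add: it0)
  have unif: "uniform_limit (ball 0 r) (\<lambda>n z. it n z i) (\<lambda>z. Y z i) sequentially" for i
  proof -
    have "uniform_limit (ball 0 r) (\<lambda>n z. \<Sum>k<n. it (Suc k) z i - it k z i) (\<lambda>z. suminf (\<lambda>n. it (Suc n) z i - it n z i)) sequentially"
      by (rule Weierstrass_m_test[OF step]) (auto intro!: summable_mult)
    then have "uniform_limit (ball 0 r) (\<lambda>n z. y0 i + (it n z i - y0 i)) (\<lambda>z. Y z i) sequentially"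
      unfolding Y_def tele by (intro uniform_limit_intros)
    then show ?thesis by simp
  qed
  have lim: "(\<lambda>n. it n z i) \<longlonglongrightarrow> Y z i" if "z \<in> ball 0 r" for z i
    using tendsto_uniform_limitI[OF unif that] .
  have hol_it: "(\<lambda>z. it n z i) holomorphic_on ball 0 r" for n i
  proof (induction n arbitrary: i)
    case (Suc n)
    have "(\<lambda>z. y0 i + z * (P i (it n z) / Q i (it n z))) holomorphic_on ball 0 r" if "i \<le> N"
      using PQ[OF that] d(2)[OF that box] by (intro holomorphic_intros poly_fun_holomorphic[OF _ Suc]) auto
    then show ?case by (cases "i \<le> N") (auto simp: itS H_def)
  qed (simp add: it0)
  have hol: "(\<lambda>z. Y z i) holomorphic_on ball 0 r" for i
  proof (rule holomorphic_uniform_sequence[OF open_ball])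
    show "(\<lambda>z. it n z i) holomorphic_on ball 0 r" for n by (rule hol_it)
    fix x :: complex assume "x \<in> ball 0 r"
    then obtain e where "e > 0" "cball x e \<subseteq> ball 0 r" using open_contains_cball open_ball by metis
    then show "\<exists>d>0. cball x d \<subseteq> ball 0 r \<and> uniform_limit (cball x d) (\<lambda>n z. it n z i) (\<lambda>z. Y z i) sequentially"
      using uniform_limit_on_subset[OF unif] by blast
  qed
  have Ybox: "Y z \<in> coord_box N y0 d" if z: "z \<in> ball 0 r" for z
  proof -
    have "Y z i = y0 i" if "i > N" for i
    proof (rule LIMSEQ_unique[OF lim[OF z]])
      have "it n z i = y0 i" for n using box[OF z, of n] that by (auto simp: coord_box_def)
      then show "(\<lambda>n. it n z i) \<longlonglongrightarrow> y0 i" by simp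
    qed
    moreover have "norm (Y z i - y0 i) \<le> d" if "i \<le> N" for i
    proof (rule LIMSEQ_le_const2[OF tendsto_norm[OF tendsto_diff[OF lim[OF z] tendsto_const]]])
      show "\<exists>n0. \<forall>n\<ge>n0. norm (it n z i - y0 i) \<le> d" using box[OF z] that by (auto simp: coord_box_def)
    qed
    ultimately show ?thesis by (auto simp: coord_box_def)
  qed
  have fixp: "Y z i = y0 i + z * H i (Y z)" if z: "z \<in> ball 0 r" and i: "i \<le> N" for z i
  proof (rule LIMSEQ_unique[OF LIMSEQ_Suc[OF lim[OF z]]])
    have t: "(\<lambda>n. L * (\<Sum>k\<le>N. norm (it n z k - Y z k))) \<longlonglongrightarrow> L * (\<Sum>k\<le>N. norm (Y z k - Y z k))"
      by (intro tendsto_intros lim z)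
    have "(\<lambda>n. H i (it n z) - H i (Y z)) \<longlonglongrightarrow> 0"
    proof (rule Lim_null_comparison)
      show "\<forall>\<^sub>F n in sequentially. norm (H i (it n z) - H i (Y z)) \<le> L * (\<Sum>k\<le>N. norm (it n z k - Y z k))"
      proof (rule always_eventually, intro allI)
        fix n
        have "\<forall>k\<le>N. norm (it n z k - Y z k) \<le> (\<Sum>k\<le>N. norm (it n z k - Y z k))"
          by (auto intro!: member_le_sum[of _ "{..N}" "\<lambda>k. norm (it n z k - Y z k)"])
        then show "norm (H i (it n z) - H i (Y z)) \<le> L * (\<Sum>k\<le>N. norm (it n z k - Y z k))"
          using d(3)[OF i] box[OF z] Ybox[OF z] unfolding lipschitz_bound_def by blast
      qed
    qed (use t in simp)
    then have "(\<lambda>n. H i (it n z)) \<longlonglongrightarrow> H i (Y z)" by (simp add: LIM_zero_iff)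
    then have "(\<lambda>n. y0 i + z * H i (it n z)) \<longlonglongrightarrow> y0 i + z * H i (Y z)" by (intro tendsto_intros)
    then show "(\<lambda>n. it (Suc n) z i) \<longlonglongrightarrow> y0 i + z * H i (Y z)" using i by (simp add: itS)
  qed
  have uniq: "y = Y z" if z: "z \<in> ball 0 r" and y: "y \<in> coord_box N y0 d" "\<forall>i\<le>N. y i = y0 i + z * H i y" for z y
  proof -
    define t where "t = Max ((\<lambda>i. norm (y i - Y z i)) ` {..N})"
    have le: "\<forall>i\<le>N. norm (y i - Y z i) \<le> t" unfolding t_def by auto
    have "norm (y i - Y z i) \<le> 1 / 2 * t" if "i \<le> N" for i
    proof -
      have "norm (H i y - H i (Y z)) \<le> L * t" using d(3)[OF that] y(1) Ybox[OF z] le unfolding lipschitz_bound_def by blast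
      then have "norm z * norm (H i y - H i (Y z)) \<le> norm z * (L * t)" by (intro mult_left_mono) auto
      moreover have "0 \<le> t" using order_trans[OF norm_ge_zero le[rule_format, of 0]] by simp
      from mult_right_mono[OF rL[OF z] this] have "norm z * (L * t) \<le> 1 / 2 * t"
        by (simp add: mult.assoc)
      moreover have "y i - Y z i = z * (H i y - H i (Y z))"
        using y(2) fixp[OF z that] that by (simp add: algebra_simps)
      ultimately show ?thesis by (simp add: norm_mult)
    qed
    then have "t \<le> 1 / 2 * t" unfolding t_def[of] by (subst Max_le_iff) (auto simp: t_def)
    then have "t \<le> 0" by simp
    then have "y i = Y z i" if "i \<le> N" for i using le that by (metis norm_le_zero_iff order_trans right_minus_eq)
    moreover have "y i = Y z i" if "i > N" for i using that y(1) Ybox[OF z] by (auto simp: coord_box_def)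
    ultimately show ?thesis by (metis ext linorder_not_le)
  qed
  show ?thesis
    using d(1) r hol Ybox fixp uniq unfolding H_def by (intro exI[of _ d] exI[of _ r] exI[of _ Y]) blast
qed

lemma holomorphic_zero_near_imp_zero:
  assumes "f holomorphic_on ball 0 r" "z0 \<in> ball 0 r" "\<forall>\<^sub>F z in at z0. f z = 0" "z \<in> ball 0 r"
  shows "f z = 0"
proof -
  obtain e where e: "e > 0" "\<And>z. z \<noteq> z0 \<Longrightarrow> dist z z0 < e \<Longrightarrow> f z = 0"
    using assms(3) unfolding eventually_at by blast
  obtain e' where e': "e' > 0" "ball z0 e' \<subseteq> ball 0 r"
    using assms(2) open_contains_ball open_ball by metis
  define U where "U = ball z0 (min e e') - {z0}"
  have "z0 + of_real (min e e' / 2) \<in> U" using e(1) e'(1) by (auto simp: U_def dist_norm)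
  then have "U \<noteq> {}" by blast
  moreover have "U \<subseteq> ball 0 r" using e'(2) by (auto simp: U_def)
  moreover have "f x = 0" if "x \<in> U" for x using that e(2)[of x] by (auto simp: U_def dist_commute)
  moreover have "open U" by (auto simp: U_def open_delete)
  ultimately show ?thesis
    using analytic_continuation_open[of U "ball 0 r" f "\<lambda>_. 0" z] assms(1,4) by auto
qed

section \<open>Rational functions in affine coordinates\<close>

text \<open>Rational functions on affine space rather than germs on the curve: the same h is
  evaluated on the curve and on the arc, before it is known that the arc lies on the curve.\<close>

definition rat_at :: "(nat \<Rightarrow> complex) \<Rightarrow> ((nat \<Rightarrow> complex) \<Rightarrow> complex) set" where
  "rat_at y0 = {h. \<exists>A\<in>poly_fun. \<exists>B\<in>poly_fun. B y0 \<noteq> 0 \<and> (\<forall>y. B y \<noteq> 0 \<longrightarrow> h y = A y / B y)}"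

lemma rat_at_divide: "A \<in> poly_fun \<Longrightarrow> B \<in> poly_fun \<Longrightarrow> B y0 \<noteq> 0 \<Longrightarrow> (\<lambda>y. A y / B y) \<in> rat_at y0"
  unfolding rat_at_def by blast

lemma rat_at_add_mult:
  assumes "f \<in> rat_at y0" "g \<in> rat_at y0"
  shows "(\<lambda>y. f y + g y) \<in> rat_at y0" "(\<lambda>y. f y * g y) \<in> rat_at y0"
proof -
  obtain A B C D where AB: "A \<in> poly_fun" "B \<in> poly_fun" "B y0 \<noteq> 0" "\<And>y. B y \<noteq> 0 \<Longrightarrow> f y = A y / B y"
    "C \<in> poly_fun" "D \<in> poly_fun" "D y0 \<noteq> 0" "\<And>y. D y \<noteq> 0 \<Longrightarrow> g y = C y / D y"
    using assms unfolding rat_at_def by blast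
  show "(\<lambda>y. f y + g y) \<in> rat_at y0"
    unfolding rat_at_def
    by (intro CollectI bexI[of _ "\<lambda>y. A y * D y + C y * B y"] bexI[of _ "\<lambda>y. B y * D y"])
      (auto simp: AB field_simps intro!: poly_fun.intros AB)
  show "(\<lambda>y. f y * g y) \<in> rat_at y0"
    unfolding rat_at_def
    by (intro CollectI bexI[of _ "\<lambda>y. A y * C y"] bexI[of _ "\<lambda>y. B y * D y"])
      (auto simp: AB field_simps intro!: poly_fun.intros AB)
qed

lemma rat_at_poly_fun: "A \<in> poly_fun \<Longrightarrow> A \<in> rat_at y0"
  using rat_at_divide[OF _ poly_fun.const[of 1], of A y0] by simp

lemma rat_at_sum: "(\<And>i. i \<in> I \<Longrightarrow> f i \<in> rat_at y0) \<Longrightarrow> (\<lambda>y. \<Sum>i\<in>I. f i y) \<in> rat_at y0"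
  by (induction I rule: infinite_finite_induct) (auto intro: rat_at_add_mult(1) rat_at_poly_fun poly_fun.const)

text \<open>\<tau> stands for the local coordinate when y runs through the curve and for the
  parameter z when y runs through the arc. Since h' is chosen before y and \<tau>, one division
  serves both.\<close>

lemma rat_at_step:
  assumes h: "h \<in> rat_at y0" and H: "\<And>i. i \<le> N \<Longrightarrow> H i \<in> rat_at y0"
  shows "\<exists>h'\<in>rat_at y0. \<exists>C\<in>poly_fun. C y0 \<noteq> 0 \<and> (\<forall>y \<tau>. (\<forall>i>N. y i = y0 i) \<and> C y \<noteq> 0 \<and>
    (\<forall>i\<le>N. y i - y0 i = \<tau> * H i y) \<longrightarrow> h y = h y0 + \<tau> * h' y)"
proof -
  obtain A B where AB: "A \<in> poly_fun" "B \<in> poly_fun" "B y0 \<noteq> 0" "\<And>y. B y \<noteq> 0 \<Longrightarrow> h y = A y / B y"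
    using h unfolding rat_at_def by blast
  obtain R where R: "\<forall>i. R i \<in> poly_fun" "\<And>y. (\<forall>i>N. y i = y0 i) \<Longrightarrow> B y \<noteq> 0 \<Longrightarrow>
    A y / B y = A y0 / B y0 + (\<Sum>i\<le>N. (y i - y0 i) * (R i y / B y))"
    using rational_division[OF AB(1-3), of N] by blast
  define h' where "h' = (\<lambda>y. \<Sum>i\<le>N. H i y * (R i y / B y))"
  have "h' \<in> rat_at y0"
    unfolding h'_def using H R(1) AB(2,3) by (intro rat_at_sum rat_at_add_mult(2) rat_at_divide) auto
  moreover have "h y = h y0 + \<tau> * h' y"
    if y: "\<forall>i>N. y i = y0 i" "B y \<noteq> 0" "\<forall>i\<le>N. y i - y0 i = \<tau> * H i y" for y \<tau>
  proof -
    have "(\<Sum>i\<le>N. (y i - y0 i) * (R i y / B y)) = \<tau> * h' y"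
      unfolding h'_def sum_distrib_left by (rule sum.cong) (use y(3) in \<open>auto simp: mult.assoc\<close>)
    then show ?thesis using R(2)[OF y(1,2)] AB(3,4) y(2) by simp
  qed
  ultimately show ?thesis using AB(2,3) by blast
qed

lemma poly_fun_along_tendsto:
  assumes "A \<in> poly_fun" "\<And>i. (\<lambda>z. Y z i) holomorphic_on ball 0 r" "r > 0"
  shows "((\<lambda>z. A (Y z)) \<longlongrightarrow> A (Y 0)) (at 0)"
  using analytic_at_imp_isCont[OF analytic_near_0[OF poly_fun_holomorphic[OF assms(1,2)] assms(3)]]
  by (simp add: isCont_def)

lemma rat_at_along_tendsto:
  assumes "h \<in> rat_at (Y 0)" "\<And>i. (\<lambda>z. Y z i) holomorphic_on ball 0 r" "r > 0"
  shows "((\<lambda>z. h (Y z)) \<longlongrightarrow> h (Y 0)) (at 0)"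
proof -
  obtain A B where AB: "A \<in> poly_fun" "B \<in> poly_fun" "B (Y 0) \<noteq> 0" "\<And>y. B y \<noteq> 0 \<Longrightarrow> h y = A y / B y"
    using assms(1) unfolding rat_at_def by blast
  note A = poly_fun_along_tendsto[OF AB(1) assms(2,3)] and B = poly_fun_along_tendsto[OF AB(2) assms(2,3)]
  have "((\<lambda>z. A (Y z) / B (Y z)) \<longlongrightarrow> A (Y 0) / B (Y 0)) (at 0)" by (intro tendsto_divide A B AB)
  moreover have "\<forall>\<^sub>F z in at 0. A (Y z) / B (Y z) = h (Y z)"
    using tendsto_imp_eventually_ne[OF B AB(3)] by eventually_elim (simp add: AB(4))
  ultimately show ?thesis using Lim_transform_eventually AB(3,4) by fastforce
qed

context projective_curve begin

lemma rat_at_reg: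
  assumes "p \<in> X" "rep p a \<noteq> 0" "h \<in> rat_at (affine_coord a p)"
  shows "(\<lambda>q. h (affine_coord a q)) \<in> reg_at X p"
proof -
  obtain A B where AB: "A \<in> poly_fun" "B \<in> poly_fun" "B (affine_coord a p) \<noteq> 0" "\<And>y. B y \<noteq> 0 \<Longrightarrow> h y = A y / B y"
    using assms(3) unfolding rat_at_def by blast
  from poly_affine_nonzero[OF assms(1,2) AB(2,3)]
  have "\<forall>\<^sub>F q in nz p. rep q a \<noteq> 0 \<and> B (affine_coord a q) \<noteq> 0 \<and> h (affine_coord a q) = A (affine_coord a q) / B (affine_coord a q)"
    by eventually_elim (simp add: AB(4))
  then show ?thesis unfolding reg_at_iff[OF assms(1,2)] using AB(1-3) by blast
qed

text \<open>
  The arc solves \<open>u\<^sub>i = z h\<^sub>i\<close>, the equations that hold on \<^term>\<open>X\<close> with \<open>z = u\<^sub>j\<close>. On \<^term>\<open>X\<close>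
  and on the arc alike, they turn a function vanishing at \<open>p\<close> into \<open>z\<close> times another one of the same
  kind, so that a function vanishing on \<^term>\<open>X\<close> vanishes to infinite order on the arc.
\<close>

lemma vanishes_on_arc:
  assumes p: "p \<in> X" and a: "rep p a \<noteq> 0" and H: "\<And>i. i \<le> N \<Longrightarrow> H i \<in> rat_at (affine_coord a p)"
    and u: "\<forall>\<^sub>F q in nz p. \<forall>i\<le>N. ucoord a p i q = ucoord a p j q * H i (affine_coord a q)"
    and u0: "\<not> (\<forall>\<^sub>F q in nz p. ucoord a p j q = 0)"
    and Y: "\<And>i. (\<lambda>z. Y z i) holomorphic_on ball 0 r" "r > 0" "Y 0 = affine_coord a p"
    and Y_supp: "\<And>z i. z \<in> ball 0 r \<Longrightarrow> i > N \<Longrightarrow> Y z i = 0"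
    and Y_eq: "\<And>z i. z \<in> ball 0 r \<Longrightarrow> i \<le> N \<Longrightarrow> Y z i = affine_coord a p i + z * H i (Y z)"
    and F: "F \<in> poly_fun" "\<And>q. q \<in> X \<Longrightarrow> rep q a \<noteq> 0 \<Longrightarrow> F (affine_coord a q) = 0"
    and z: "z \<in> ball 0 r"
  shows "F (Y z) = 0"
proof -
  let ?y0 = "affine_coord a p"
  have uj: "j \<le> N \<Longrightarrow> ucoord a p j \<in> reg_at X p" by (rule ucoord_reg[OF p a])
  have ev_a: "\<forall>\<^sub>F q in nz p. rep q a \<noteq> 0" by (rule eventually_form_nonzero[OF p form_coord a])
  have "\<exists>h\<in>rat_at ?y0. (\<forall>\<^sub>F q in nz p. h (affine_coord a q) = 0) \<and> (\<forall>\<^sub>F z in at 0. F (Y z) = z ^ n * h (Y z))" for n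
  proof (induction n)
    case 0
    have "\<forall>\<^sub>F q in nz p. F (affine_coord a q) = 0"
      using ev_a eventually_nz_in[OF p] by eventually_elim (use F(2) in auto)
    then show ?case using rat_at_poly_fun[OF F(1)] by (intro bexI[of _ F]) auto
  next
    case (Suc n)
    then obtain h where h: "h \<in> rat_at ?y0" "\<forall>\<^sub>F q in nz p. h (affine_coord a q) = 0"
      "\<forall>\<^sub>F z in at 0. F (Y z) = z ^ n * h (Y z)" by blast
    have hp: "h ?y0 = 0" using eventually_nz_self[OF p h(2)] .
    obtain h' C where h': "h' \<in> rat_at ?y0" "C \<in> poly_fun" "C ?y0 \<noteq> 0"
      "\<And>y \<tau>. (\<forall>i>N. y i = ?y0 i) \<Longrightarrow> C y \<noteq> 0 \<Longrightarrow> (\<forall>i\<le>N. y i - ?y0 i = \<tau> * H i y) \<Longrightarrow> h y = h ?y0 + \<tau> * h' y"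
      using rat_at_step[of h ?y0 N H, OF h(1) H] by blast
    have "\<forall>\<^sub>F q in nz p. ucoord a p j q * h' (affine_coord a q) = 0"
      using poly_affine_nonzero[OF p a h'(2,3)] u h(2) eventually_nz_in[OF p]
    proof eventually_elim
      case (elim q)
      have "h (affine_coord a q) = h ?y0 + ucoord a p j q * h' (affine_coord a q)"
        using elim affine_coord_support p by (intro h'(4)) (auto simp: ucoord_def)
      then show ?case using hp elim by simp
    qed
    \<comment> \<open>The local coordinate is not the zero germ, and the local ring has no zero
      divisors, so it can be cancelled.\<close>
    then have "\<forall>\<^sub>F q in nz p. h' (affine_coord a q) = 0"
      using reg_at_domain[OF p ucoord_reg[OF p a] rat_at_reg[OF p a h'(1)]] u0 by blast
    moreover have "\<forall>\<^sub>F z in at 0. F (Y z) = z ^ Suc n * h' (Y z)"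
    proof -
      have "\<forall>\<^sub>F z in at 0. C (Y z) \<noteq> 0"
        using tendsto_imp_eventually_ne[OF poly_fun_along_tendsto[OF h'(2) Y(1,2)]] h'(3) Y(3) by simp
      with h(3) eventually_at_0_ball[OF Y(2)] show ?thesis
      proof eventually_elim
        case (elim z)
        have "h (Y z) = h ?y0 + z * h' (Y z)"
          using elim Y_supp Y_eq affine_coord_support[OF p] by (intro h'(4)) auto
        then show ?case using elim hp by simp
      qed
    qed
    ultimately show ?case using h'(1) by blast
  qed
  note * = this
  have hol: "(\<lambda>z. F (Y z)) holomorphic_on ball 0 r" by (rule poly_fun_holomorphic[OF F(1) Y(1)])
  have "\<forall>\<^sub>F z in at 0. F (Y z) = 0"
  proof (rule ccontr)
    assume "\<not> (\<forall>\<^sub>F z in at 0. F (Y z) = 0)"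
    then obtain m where m: "has_ord (\<lambda>z. F (Y z)) (int m)"
      using analytic_has_ord[OF analytic_near_0[OF hol Y(2)]] by blast
    \<comment> \<open>A nonzero analytic germ has a finite order m, yet F along the arc is divisible
      by z^(m+1).\<close>
    obtain h where h: "h \<in> rat_at ?y0" "\<forall>\<^sub>F z in at 0. F (Y z) = z ^ Suc m * h (Y z)" using * by blast
    have "has_ord (\<lambda>z. F (Y z) / z ^ m) 0" using has_ord_divide[OF m has_ord_power[of m]] by simp
    then obtain c where c: "c \<noteq> 0" "((\<lambda>z. F (Y z) / z ^ m) \<longlongrightarrow> c) (at 0)" by (rule has_ord_limit_nz)
    have "\<forall>\<^sub>F z in at 0. z \<noteq> (0::complex)" by (simp add: eventually_at_filter)
    with h(2) have ev: "\<forall>\<^sub>F z in at 0. z * h (Y z) = F (Y z) / z ^ m"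
      by eventually_elim auto
    have "h \<in> rat_at (Y 0)" using h(1) Y(3) by simp
    from tendsto_mult[OF tendsto_ident_at rat_at_along_tendsto[where h = h and Y = Y, OF this Y(1,2)]]
    have "((\<lambda>z. z * h (Y z)) \<longlongrightarrow> 0 * h (Y 0)) (at 0)" .
    then have "((\<lambda>z. z * h (Y z)) \<longlongrightarrow> 0) (at 0)" by simp
    from Lim_transform_eventually[OF this ev] c show False using tendsto_unique[of "at (0::complex)"] by fastforce
  qed
  then show ?thesis using holomorphic_zero_near_imp_zero[OF hol _ _ z, of 0] Y(2) by simp
qed

text \<open>
  \<open>Y\<close> parametrises all points of \<^term>\<open>X\<close> near \<open>p\<close> by their \<open>j\<close>-th affine coordinate.
\<close>

definition is_chart :: "point \<Rightarrow> nat \<Rightarrow> nat \<Rightarrow> (complex \<Rightarrow> nat \<Rightarrow> complex) \<Rightarrow> real \<Rightarrow> real \<Rightarrow> bool" where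
  "is_chart p a j Y r d \<longleftrightarrow> rep p a \<noteq> 0 \<and> a \<le> N \<and> j \<le> N \<and> 0 < r \<and> 0 < d \<and>
     (\<forall>i. (\<lambda>z. Y z i) holomorphic_on ball 0 r) \<and> Y 0 = affine_coord a p \<and>
     (\<forall>z\<in>ball 0 r. Y z a = 1 \<and> (\<forall>i>N. Y z i = 0) \<and> Y z j = affine_coord a p j + z \<and>
        (\<forall>i\<le>N. norm (Y z i - affine_coord a p i) < d) \<and>
        (\<forall>e. \<forall>f\<in>form e. (\<forall>q\<in>X. f (rep q) = 0) \<longrightarrow> f (Y z) = 0)) \<and>
     (\<forall>q\<in>X. rep q a \<noteq> 0 \<and> (\<forall>i\<le>N. norm (ucoord a p i q) < d) \<and> norm (ucoord a p j q) < r \<longrightarrow>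
        affine_coord a q = Y (ucoord a p j q)) \<and>
     (\<forall>f\<in>reg_at X p. f p = 0 \<longrightarrow> (\<exists>h\<in>reg_at X p. \<forall>\<^sub>F q in nz p. f q = ucoord a p j q * h q)) \<and>
     (\<forall>\<^sub>F q in nz p. ucoord a p j q = 0 \<longrightarrow> q = p)"

text \<open>The arc solves the equations u_i = u_j h_i of the principal maximal ideal with z in
  place of u_j. \<open>vanishes_on_arc\<close> puts it on the curve, and the uniqueness in
  \<open>exists_arc\<close> shows that it meets every nearby point of the curve.\<close>

lemma exists_chart:
  assumes p: "p \<in> X" shows "\<exists>a j Y r d. is_chart p a j Y r d"
proof -
  obtain a where a: "a \<le> N" "rep p a \<noteq> 0" using exists_chart_index[OF p] by blast
  obtain j D where j: "j \<le> N" "\<And>i. i \<le> N \<Longrightarrow> \<exists>h\<in>reg_at X p. \<forall>\<^sub>F q in nz p. ucoord a p i q = h q * ucoord a p j q"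
    "D \<in> tangent_space X p" "D (ucoord a p j) \<noteq> 0"
    using exists_uniformizing_coord[OF p a(2)] by blast
  let ?y0 = "affine_coord a p"
  have ev_a: "\<forall>\<^sub>F q in nz p. rep q a \<noteq> 0" by (rule eventually_form_nonzero[OF p form_coord a(2)])
  have "\<forall>\<^sub>F q in nz p. ucoord a p a q = 0"
    using ev_a by eventually_elim (use a(2) in \<open>simp add: ucoord_def affine_coord_def\<close>)
  \<comment> \<open>The difference of the a-th coordinates is zero near p, so every tangent vector
    kills it, whereas D does not kill the j-th difference.\<close>
  from tangent_cong[OF p j(3) ucoord_reg[OF p a(2)] this] tangent_const[OF p j(3), of 0]
  have ja: "j \<noteq> a" using j(4) by auto
  \<comment> \<open>The a-th affine coordinate is constantly 1 and the j-th is the parameter up to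
    translation. The exact choices P a = 0 and P j = Q j = 1 make both hold on the arc as
    well.\<close>
  define good where "good = (\<lambda>i P Q. P \<in> poly_fun \<and> Q \<in> poly_fun \<and> Q ?y0 \<noteq> 0 \<and>
    (\<forall>\<^sub>F q in nz p. ucoord a p i q = ucoord a p j q * (P (affine_coord a q) / Q (affine_coord a q))) \<and>
    (i = a \<longrightarrow> P = (\<lambda>_. 0)) \<and> (i = j \<longrightarrow> P = (\<lambda>_. 1) \<and> Q = (\<lambda>_. 1)))"
  have "\<exists>P Q. good i P Q" if iN: "i \<le> N" for i
  proof (cases "i = a \<or> i = j")
    case True
    have "\<forall>\<^sub>F q in nz p. ucoord a p i q = ucoord a p j q * ((if i = a then 0 else 1) / 1)"
      using ev_a by eventually_elim (use a(2) True in \<open>auto simp: ucoord_def affine_coord_def\<close>)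
    then show ?thesis using ja unfolding good_def
      by (intro exI[of _ "\<lambda>_. if i = a then 0 else 1"] exI[of _ "\<lambda>_. 1"]) (auto intro: poly_fun.const)
  next
    case False
    obtain h where h: "h \<in> reg_at X p" "\<forall>\<^sub>F q in nz p. ucoord a p i q = h q * ucoord a p j q" using j(2)[OF iN] by blast
    then obtain P Q where PQ: "P \<in> poly_fun" "Q \<in> poly_fun" "Q ?y0 \<noteq> 0"
      "\<forall>\<^sub>F q in nz p. rep q a \<noteq> 0 \<and> Q (affine_coord a q) \<noteq> 0 \<and> h q = P (affine_coord a q) / Q (affine_coord a q)"
      unfolding reg_at_iff[OF p a(2)] by blast
    from h(2) PQ(4) have "\<forall>\<^sub>F q in nz p. ucoord a p i q = ucoord a p j q * (P (affine_coord a q) / Q (affine_coord a q))"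
      by eventually_elim simp
    then show ?thesis using PQ False unfolding good_def by blast
  qed
  then obtain P Q where good: "\<And>i. i \<le> N \<Longrightarrow> good i (P i) (Q i)" by metis
  then have PQ: "\<And>i. i \<le> N \<Longrightarrow> P i \<in> poly_fun \<and> Q i \<in> poly_fun \<and> Q i ?y0 \<noteq> 0"
    "\<And>i. i \<le> N \<Longrightarrow> \<forall>\<^sub>F q in nz p. ucoord a p i q = ucoord a p j q * (P i (affine_coord a q) / Q i (affine_coord a q))"
    "P a = (\<lambda>_. 0)" "P j = (\<lambda>_. 1)" "Q j = (\<lambda>_. 1)"
    using a(1) j(1) unfolding good_def by blast+
  have "\<forall>\<^sub>F q in nz p. \<forall>i\<in>{..N}. ucoord a p i q = ucoord a p j q * (P i (affine_coord a q) / Q i (affine_coord a q))"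
    using PQ(2) by (intro eventually_ball_finite) auto
  then have evu: "\<forall>\<^sub>F q in nz p. \<forall>i\<le>N. ucoord a p i q = ucoord a p j q * (P i (affine_coord a q) / Q i (affine_coord a q))"
    by (simp add: Ball_def)
  then obtain e g where g: "g \<in> form e" "g (rep p) \<noteq> 0" "\<And>q i. q \<in> X \<Longrightarrow> g (rep q) \<noteq> 0 \<Longrightarrow> i \<le> N \<Longrightarrow>
      ucoord a p i q = ucoord a p j q * (P i (affine_coord a q) / Q i (affine_coord a q))"
    unfolding eventually_nz[OF p] by blast
  have "g ?y0 \<noteq> 0" using form_affine_coord[OF g(1), of a p] g(2) a(2) by simp
  \<comment> \<open>The equations are known on the curve only where g is nonzero, a Zariski
    condition. It holds automatically on a small box about y0, so points of the curve that are close
    in the classical sense satisfy the equations.\<close>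
  then obtain dg where dg: "0 < dg" "\<And>y. y \<in> coord_box N ?y0 dg \<Longrightarrow> g y \<noteq> 0"
    using rational_lips[OF poly_fun.const form_poly_fun[OF g(1)], of ?y0 N] by blast
  obtain d0 R Y where Y: "0 < d0" "0 < R" "\<And>i. (\<lambda>z. Y z i) holomorphic_on ball 0 R"
    "\<And>z. z \<in> ball 0 R \<Longrightarrow> Y z \<in> coord_box N ?y0 d0"
    "\<And>z i. z \<in> ball 0 R \<Longrightarrow> i \<le> N \<Longrightarrow> Y z i = ?y0 i + z * (P i (Y z) / Q i (Y z))"
    "\<And>z y. z \<in> ball 0 R \<Longrightarrow> y \<in> coord_box N ?y0 d0 \<Longrightarrow> (\<forall>i\<le>N. y i = ?y0 i + z * (P i y / Q i y)) \<Longrightarrow> y = Y z"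
    using exists_arc[of N P Q ?y0, OF PQ(1)] by blast
  define d where "d = min d0 dg"
  have d: "0 < d" using Y(1) dg(1) by (simp add: d_def)
  have supp: "Y z i = 0" if "z \<in> ball 0 R" "i > N" for z i
    using Y(4)[OF that(1)] that(2) affine_coord_support[OF p that(2)] by (simp add: coord_box_def)
  have Y0: "Y 0 = ?y0"
    using Y(6)[of 0 ?y0] Y(1,2) coord_box_center[of d0 ?y0 N] by simp
  have "\<forall>\<^sub>F z in at 0. \<forall>i\<in>{..N}. norm (Y z i - ?y0 i) < d"
  proof (rule eventually_ball_finite)
    show "\<forall>i\<in>{..N}. \<forall>\<^sub>F z in at 0. norm (Y z i - ?y0 i) < d"
    proof
      show "\<forall>\<^sub>F z in at 0. norm (Y z i - ?y0 i) < d" for i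
        using tendstoD[OF poly_fun_along_tendsto[OF poly_fun.coord[of i] Y(3,2)] d] Y0 by (simp add: dist_norm)
    qed
  qed simp
  then obtain r0 where r0: "r0 > 0" "\<And>z i. z \<noteq> 0 \<Longrightarrow> dist z 0 < r0 \<Longrightarrow> i \<le> N \<Longrightarrow> norm (Y z i - ?y0 i) < d"
    unfolding eventually_at by auto
  define r where "r = min R r0"
  have r: "0 < r" using Y(2) r0(1) by (simp add: r_def)
  have sub: "z \<in> ball 0 R" if "z \<in> ball 0 r" for z :: complex using that by (simp add: r_def)
  have H: "(\<lambda>y. P i y / Q i y) \<in> rat_at ?y0" if "i \<le> N" for i
    using PQ(1)[OF that] rat_at_divide by blast
  have nz0: "\<forall>\<^sub>F q in nz p. ucoord a p j q = 0 \<longrightarrow> q = p" "\<not> (\<forall>\<^sub>F q in nz p. ucoord a p j q = 0)"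
    using ucoord_not_0[OF p a(2) j(2)] by auto
  have "is_chart p a j Y r d"
    unfolding is_chart_def
  proof (intro conjI allI ballI impI)
    show "(\<lambda>z. Y z i) holomorphic_on ball 0 r" for i
      using Y(3) by (rule holomorphic_on_subset) (auto simp: r_def)
  next
    fix z :: complex assume z: "z \<in> ball 0 r"
    have "rep p a / rep p a = 1" using a(2) by simp
    then show "Y z a = 1" using Y(5)[OF sub[OF z] a(1)] PQ(3) by (simp add: affine_coord_def)
    show "Y z i = 0" if "i > N" for i using supp[OF sub[OF z] that] .
    show "Y z j = ?y0 j + z" using Y(5)[OF sub[OF z] j(1)] PQ(4,5) by simp
    show "norm (Y z i - ?y0 i) < d" if "i \<le> N" for i
      using r0(2)[of z i] z that Y0 d by (cases "z = 0") (auto simp: r_def)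
    fix e f assume f: "f \<in> form e" "\<forall>q\<in>X. f (rep q) = 0"
    show "f (Y z) = 0"
    proof (rule vanishes_on_arc[OF p a(2) H evu nz0(2) Y(3,2) Y0 supp Y(5) form_poly_fun[OF f(1)] _ sub[OF z]])
      show "f (affine_coord a q) = 0" if "q \<in> X" for q
        using form_affine_coord[OF f(1), of a q] f(2) that by simp
    qed
  next
    fix q assume q: "q \<in> X" "rep q a \<noteq> 0 \<and> (\<forall>i\<le>N. norm (ucoord a p i q) < d) \<and> norm (ucoord a p j q) < r"
    have supp': "\<forall>i>N. affine_coord a q i = ?y0 i"
      using affine_coord_support[OF q(1)] affine_coord_support[OF p] by simp
    have box: "affine_coord a q \<in> coord_box N ?y0 d"
      using q(2) supp' by (auto simp: coord_box_def ucoord_def)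
    then have "g (affine_coord a q) \<noteq> 0" using dg(2) coord_box_mono[of d dg] by (auto simp: d_def)
    then have "g (rep q) \<noteq> 0" using form_affine_coord[OF g(1), of a q] by auto
    from g(3)[OF q(1) this] have "\<forall>i\<le>N. affine_coord a q i = ?y0 i + ucoord a p j q * (P i (affine_coord a q) / Q i (affine_coord a q))"
      by (simp add: ucoord_def algebra_simps)
    then show "affine_coord a q = Y (ucoord a p j q)"
      using Y(6)[of "ucoord a p j q" "affine_coord a q"] q(2) box coord_box_mono[of d d0] by (auto simp: d_def r_def)
  next
    fix f assume f: "f \<in> reg_at X p" "f p = 0"
    obtain k where k: "\<forall>i. k i \<in> reg_at X p" "\<forall>\<^sub>F q in nz p. f q = (\<Sum>i\<le>N. ucoord a p i q * k i q)"
      using reg_at_expansion[OF p a(2) f] by (auto simp: ucoord_def)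
    have "\<forall>\<^sub>F q in nz p. f q = ucoord a p j q * (\<Sum>i\<le>N. P i (affine_coord a q) / Q i (affine_coord a q) * k i q)"
      using k(2) evu
    proof eventually_elim
      case (elim q)
      show ?case unfolding elim(1) sum_distrib_left
        by (rule sum.cong) (use elim(2) in auto)
    qed
    moreover have "(\<lambda>q. \<Sum>i\<le>N. P i (affine_coord a q) / Q i (affine_coord a q) * k i q) \<in> reg_at X p"
      using k(1) rat_at_reg[OF p a(2) H] by (intro reg_at_sum reg_at_mult p) auto
    ultimately show "\<exists>h\<in>reg_at X p. \<forall>\<^sub>F q in nz p. f q = ucoord a p j q * h q"
      by (intro bexI[of _ "\<lambda>q. \<Sum>i\<le>N. P i (affine_coord a q) / Q i (affine_coord a q) * k i q"])
  qed (use a j(1) r d Y0 nz0 in auto)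
  then show ?thesis by blast
qed

end

section \<open>Compactness and separation in the classical topology\<close>

lemma poly_fun_continuous: "P \<in> poly_fun \<Longrightarrow> continuous_on UNIV P"
  by (induction rule: poly_fun.induct) (auto intro!: continuous_intros)

text \<open>Tychonoff's theorem for vectors with all coordinates; that the coordinates beyond N
  vanish is a closed condition imposed afterwards.\<close>

lemma compact_unit_polydisc: "compact {v :: nat \<Rightarrow> complex. \<forall>i. norm (v i) \<le> 1}"
proof -
  have "compactin (product_topology (\<lambda>i. euclidean :: complex topology) (UNIV :: nat set)) (Pi\<^sub>E UNIV (\<lambda>i. cball 0 1))"
    by (simp add: compactin_PiE)
  moreover have "Pi\<^sub>E UNIV (\<lambda>i. cball (0::complex) 1) = {v :: nat \<Rightarrow> complex. \<forall>i. norm (v i) \<le> 1}"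
    by (auto simp: PiE_def)
  ultimately show ?thesis by (simp add: euclidean_product_topology)
qed

context projective_curve begin

section \<open>The curve as a charted surface\<close>

definition chart_data :: "point \<Rightarrow> nat \<times> nat \<times> (complex \<Rightarrow> nat \<Rightarrow> complex) \<times> real \<times> real" where
  "chart_data p = (SOME t. case t of (a, j, Y, r, d) \<Rightarrow> is_chart p a j Y r d)"

definition ca :: "point \<Rightarrow> nat" where "ca p = fst (chart_data p)"
definition cj :: "point \<Rightarrow> nat" where "cj p = fst (snd (chart_data p))"
definition cY :: "point \<Rightarrow> complex \<Rightarrow> nat \<Rightarrow> complex" where "cY p = fst (snd (snd (chart_data p)))"
definition cr :: "point \<Rightarrow> real" where "cr p = fst (snd (snd (snd (chart_data p))))"
definition cd :: "point \<Rightarrow> real" where "cd p = snd (snd (snd (snd (chart_data p))))"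

definition arc :: "point \<Rightarrow> complex \<Rightarrow> point" where
  "arc p z = {\<lambda>i. c * cY p z i | c. c \<noteq> 0}"

definition up :: "point \<Rightarrow> point \<Rightarrow> complex" where
  "up p = ucoord (ca p) p (cj p)"

lemma chart: "p \<in> X \<Longrightarrow> is_chart p (ca p) (cj p) (cY p) (cr p) (cd p)"
proof -
  assume "p \<in> X"
  then have "\<exists>t. case t of (a, j, Y, r, d) \<Rightarrow> is_chart p a j Y r d"
    using exists_chart by (auto simp: split_paired_Ex)
  then have "case chart_data p of (a, j, Y, r, d) \<Rightarrow> is_chart p a j Y r d"
    unfolding chart_data_def by (rule someI_ex)
  then show ?thesis by (simp add: ca_def cj_def cY_def cr_def cd_def case_prod_beta)
qed

lemma cr_pos: "p \<in> X \<Longrightarrow> 0 < cr p" and cd_pos: "p \<in> X \<Longrightarrow> 0 < cd p"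
  and rep_ca: "p \<in> X \<Longrightarrow> rep p (ca p) \<noteq> 0"
  and cY_0: "p \<in> X \<Longrightarrow> cY p 0 = affine_coord (ca p) p"
  and cY_hol: "p \<in> X \<Longrightarrow> (\<lambda>z. cY p z i) holomorphic_on ball 0 (cr p)"
  and cY_ca: "p \<in> X \<Longrightarrow> z \<in> ball 0 (cr p) \<Longrightarrow> cY p z (ca p) = 1"
  and cY_supp: "p \<in> X \<Longrightarrow> z \<in> ball 0 (cr p) \<Longrightarrow> i > N \<Longrightarrow> cY p z i = 0"
  and cY_cj: "p \<in> X \<Longrightarrow> z \<in> ball 0 (cr p) \<Longrightarrow> cY p z (cj p) = affine_coord (ca p) p (cj p) + z"
  and cY_near: "p \<in> X \<Longrightarrow> z \<in> ball 0 (cr p) \<Longrightarrow> i \<le> N \<Longrightarrow> norm (cY p z i - affine_coord (ca p) p i) < cd p"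
  and cY_form: "p \<in> X \<Longrightarrow> z \<in> ball 0 (cr p) \<Longrightarrow> F \<in> form e \<Longrightarrow> (\<And>q. q \<in> X \<Longrightarrow> F (rep q) = 0) \<Longrightarrow> F (cY p z) = 0"
  and cY_onto: "p \<in> X \<Longrightarrow> q \<in> X \<Longrightarrow> rep q (ca p) \<noteq> 0 \<Longrightarrow> (\<And>i. i \<le> N \<Longrightarrow> norm (ucoord (ca p) p i q) < cd p) \<Longrightarrow>
     norm (up p q) < cr p \<Longrightarrow> affine_coord (ca p) q = cY p (up p q)"
  and up_generates: "p \<in> X \<Longrightarrow> f \<in> reg_at X p \<Longrightarrow> f p = 0 \<Longrightarrow> \<exists>h\<in>reg_at X p. \<forall>\<^sub>F q in nz p. f q = up p q * h q"
  and up_nonzero: "p \<in> X \<Longrightarrow> \<forall>\<^sub>F q in nz p. up p q = 0 \<longrightarrow> q = p"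
  using chart[of p] unfolding is_chart_def up_def by blast+

lemma up_self [simp]: "up p p = 0" by (simp add: up_def)

lemma up_reg: "p \<in> X \<Longrightarrow> up p \<in> reg_at X p"
  unfolding up_def by (rule ucoord_reg[OF _ rep_ca])

lemma point_eq_affine:
  assumes "p \<in> proj_space N" "q \<in> proj_space N" "rep p a \<noteq> 0" "rep q a \<noteq> 0" "affine_coord a p = affine_coord a q"
  shows "p = q"
proof -
  have "rep p i / rep p a = rep q i / rep q a" for i
    using fun_cong[OF assms(5), of i] by (simp add: affine_coord_def)
  then have "rep q = (\<lambda>i. (rep q a / rep p a) * rep p i)"
    using assms(3,4) by (auto simp: field_simps)
  moreover have "rep q a / rep p a \<noteq> 0" using assms by simp
  ultimately have "rep q \<in> p" using in_point_iff[OF assms(1) rep_in[OF assms(1)]] by blast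
  then show ?thesis using point_eqI[OF assms(1,2) _ rep_in[OF assms(2)]] by blast
qed

lemma arc_basic:
  assumes p: "p \<in> X" and z: "z \<in> ball 0 (cr p)"
  shows arc_proj: "arc p z \<in> proj_space N" and cY_in_arc: "cY p z \<in> arc p z"
    and arc_in: "arc p z \<in> X"
    and arc_affine: "affine_coord b (arc p z) = (\<lambda>i. cY p z i / cY p z b)"
    and arc_form: "f \<in> form e \<Longrightarrow> f (rep (arc p z)) = 0 \<longleftrightarrow> f (cY p z) = 0"
proof -
  have "cY p z \<noteq> (\<lambda>_. 0)" using cY_ca[OF p z] by (metis zero_neq_one)
  then show proj: "arc p z \<in> proj_space N"
    unfolding proj_space_def arc_def using cY_supp[OF p z] by blast
  have "(\<lambda>i. 1 * cY p z i) \<in> arc p z" unfolding arc_def by (intro CollectI exI[of _ 1]) simp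
  then show mem: "cY p z \<in> arc p z" by simp
  show form: "f (rep (arc p z)) = 0 \<longleftrightarrow> f (cY p z) = 0" if f: "f \<in> form e" for f e
  proof -
    obtain c where "c \<noteq> 0" "cY p z = (\<lambda>i. c * rep (arc p z) i)"
      using in_point_iff[OF proj rep_in[OF proj]] mem by blast
    then show ?thesis using form_homogeneous[OF f, of c "rep (arc p z)"] by simp
  qed
  show "arc p z \<in> X"
    using X_closed[OF proj] form cY_form[OF p z] by blast
  show "affine_coord b (arc p z) = (\<lambda>i. cY p z i / cY p z b)"
    by (rule affine_coord_eq[OF proj mem])
qed

lemma arc_rep_nonzero: "p \<in> X \<Longrightarrow> z \<in> ball 0 (cr p) \<Longrightarrow> rep (arc p z) i = 0 \<longleftrightarrow> cY p z i = 0"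
  using arc_form[OF _ _ form_coord[of i]] by simp

lemma arc_rep_ca: "p \<in> X \<Longrightarrow> z \<in> ball 0 (cr p) \<Longrightarrow> rep (arc p z) (ca p) \<noteq> 0"
  using arc_rep_nonzero cY_ca by simp

lemma arc_affine_ca: "p \<in> X \<Longrightarrow> z \<in> ball 0 (cr p) \<Longrightarrow> affine_coord (ca p) (arc p z) = cY p z"
  using arc_affine[of p z "ca p"] cY_ca[of p z] by simp

lemma up_arc: "p \<in> X \<Longrightarrow> z \<in> ball 0 (cr p) \<Longrightarrow> up p (arc p z) = z"
  by (simp add: up_def ucoord_def arc_affine_ca cY_cj)

lemma arc_0: "p \<in> X \<Longrightarrow> arc p 0 = p"
proof -
  assume p: "p \<in> X"
  have z: "0 \<in> ball 0 (cr p)" using cr_pos[OF p] by simp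
  show ?thesis
    using point_eq_affine[OF arc_proj[OF p z] in_proj[OF p] arc_rep_ca[OF p z] rep_ca[OF p]]
      arc_affine_ca[OF p z] cY_0[OF p] by simp
qed

lemma arc_onto:
  assumes "p \<in> X" "q \<in> X" "rep q (ca p) \<noteq> 0" "\<And>i. i \<le> N \<Longrightarrow> norm (ucoord (ca p) p i q) < cd p" "norm (up p q) < cr p"
  shows "q = arc p (up p q)"
proof -
  have z: "up p q \<in> ball 0 (cr p)" using assms(5) by simp
  show ?thesis
    using point_eq_affine[OF in_proj[OF assms(2)] arc_proj[OF assms(1) z] assms(3) arc_rep_ca[OF assms(1) z]]
      arc_affine_ca[OF assms(1) z] cY_onto[OF assms] by simp
qed

lemma cY_tendsto: "p \<in> X \<Longrightarrow> ((\<lambda>z. cY p z i) \<longlongrightarrow> cY p 0 i) (nhds 0)"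
proof -
  assume p: "p \<in> X"
  have "isCont (\<lambda>z. cY p z i) 0"
    by (rule analytic_at_imp_isCont[OF analytic_near_0[OF cY_hol[OF p] cr_pos[OF p]]])
  then show ?thesis by (simp add: continuous_at tendsto_nhds_iff)
qed

text \<open>Compactness of projective space by means of normalised vectors. S consists of coordinate
  vectors of points of X with all moduli at most 1 and some coordinate equal to 1, a closed subset
  of the compact polydisc; a finite cover of S by open cones gives one of X by arcs.\<close>

lemma arcs_cover:
  assumes \<rho>: "\<And>p. p \<in> X \<Longrightarrow> \<rho> p > 0"
  shows "\<exists>F\<subseteq>X. finite F \<and> X \<subseteq> (\<Union>p\<in>F. arc p ` ball 0 (min (\<rho> p) (cr p)))"
proof -
  define S where "S = {v :: nat \<Rightarrow> complex. (\<forall>i. norm (v i) \<le> 1)} \<inter> (\<Inter>i\<in>{N<..}. {v. v i = 0}) \<inter>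
    (\<Union>i\<in>{..N}. {v. v i = 1}) \<inter> (\<Inter>f\<in>{f. \<exists>e. f \<in> form e \<and> (\<forall>q\<in>X. f (rep q) = 0)}. {v. f v = 0})"
  have coord: "continuous_on UNIV (\<lambda>v :: nat \<Rightarrow> complex. v i)" for i by simp
  have "compact S"
    unfolding S_def
    by (intro compact_Int_closed compact_unit_polydisc closed_INT closed_UN closed_Collect_eq ballI)
      (auto intro: form_poly_fun poly_fun_continuous)
  have S_point: "\<exists>q\<in>X. v \<in> q" if "v \<in> S" for v
  proof -
    have v: "\<And>i. i > N \<Longrightarrow> v i = 0" "\<exists>i. v i = 1"
      "\<And>f e. f \<in> form e \<Longrightarrow> (\<And>q. q \<in> X \<Longrightarrow> f (rep q) = 0) \<Longrightarrow> f v = 0"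
      using that unfolding S_def by auto
    define q where "q = {\<lambda>i. c * v i | c. c \<noteq> 0}"
    have "v \<noteq> (\<lambda>_. 0)" using v(2) by auto
    then have q: "q \<in> proj_space N" unfolding proj_space_def q_def using v(1) by blast
    have "(\<lambda>i. 1 * v i) \<in> q" unfolding q_def by (intro CollectI exI[of _ 1]) simp
    then have vq: "v \<in> q" by simp
    have "q \<in> X"
    proof (rule X_closed[OF q])
      fix e f assume f: "f \<in> form e" "\<And>q. q \<in> X \<Longrightarrow> f (rep q) = 0"
      obtain c where "rep q = (\<lambda>i. c * v i)" using in_point_iff[OF q vq] rep_in[OF q] by blast
      then show "f (rep q) = 0" using form_homogeneous[OF f(1), of c v] v(3)[OF f] by simp
    qed
    then show ?thesis using vq by blast
  qed
  have S_onto: "\<exists>v\<in>S. v \<in> q" if q: "q \<in> X" for q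
  proof -
    obtain b where b: "b \<le> N" "rep q b \<noteq> 0" using exists_chart_index[OF q] by blast
    have "Max ((\<lambda>i. norm (rep q i)) ` {..N}) \<in> (\<lambda>i. norm (rep q i)) ` {..N}" by (rule Max_in) auto
    then obtain m where m': "m \<in> {..N}" "Max ((\<lambda>i. norm (rep q i)) ` {..N}) = norm (rep q m)"
      by (rule imageE) blast
    have mle: "norm (rep q i) \<le> norm (rep q m)" if "i \<le> N" for i
      unfolding m'(2)[symmetric] using that by auto
    have mN: "m \<le> N" using m'(1) by simp
    note m = mN mle
    have nz: "rep q m \<noteq> 0" using m(2)[OF b(1)] b(2) by auto
    \<comment> \<open>Division by a coordinate of largest modulus gives the normalised
      representative.\<close>
    define v where "v = (\<lambda>i. (1 / rep q m) * rep q i)"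
    have "1 / rep q m \<noteq> 0" using nz by simp
    then have vq: "v \<in> q" unfolding v_def in_point_iff[OF in_proj[OF q] rep_in[OF in_proj[OF q]]] by blast
    have "norm (v i) \<le> 1" for i
      using m(2)[of i] nz rep_support(1)[OF in_proj[OF q], of i]
      by (cases "i \<le> N") (auto simp: v_def norm_divide)
    moreover have "f v = 0" if "f \<in> form e" "\<forall>q\<in>X. f (rep q) = 0" for f e
      unfolding v_def using form_homogeneous[OF that(1), of "1 / rep q m" "rep q"] that(2) q by simp
    ultimately have "v \<in> S"
      unfolding S_def using rep_support(1)[OF in_proj[OF q]] nz m(1) by (auto simp: v_def intro: bexI[of _ m])
    then show ?thesis using vq by blast
  qed
  define \<delta> where "\<delta> = (\<lambda>p. min (cd p) (min (\<rho> p) (cr p)))"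
  have \<delta>: "\<delta> p > 0" if "p \<in> X" for p using \<rho>[OF that] cd_pos[OF that] cr_pos[OF that] by (simp add: \<delta>_def)
  \<comment> \<open>This is |u_i| < \<delta> with the denominator v (ca p) cleared, so openness is
    visible; the strict inequality forces v (ca p) to be nonzero.\<close>
  define O' where "O' = (\<lambda>p. \<Inter>i\<in>{..N}. {v :: nat \<Rightarrow> complex. norm (v i - affine_coord (ca p) p i * v (ca p)) < \<delta> p * norm (v (ca p))})"
  have "open (O' p)" for p
    unfolding O'_def by (intro open_INT ballI open_Collect_less continuous_intros coord) auto
  moreover have "S \<subseteq> (\<Union>p\<in>X. O' p)"
  proof
    fix v assume "v \<in> S"
    then obtain q where q: "q \<in> X" "v \<in> q" using S_point by blast
    have a: "v (ca q) \<noteq> 0" using form_nonzero_iff[OF in_proj[OF q(1)] form_coord[of "ca q"]] rep_ca[OF q(1)] q(2) by blast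
    have eq0: "v i - affine_coord (ca q) q i * v (ca q) = 0" for i
      using affine_coord_eq[OF in_proj[OF q(1)] q(2), of "ca q"] a by simp
    have "0 < \<delta> q * norm (v (ca q))" using a \<delta>[OF q(1)] by simp
    then have "v \<in> O' q" unfolding O'_def by (intro INT_I CollectI) (simp only: eq0 norm_zero)
    then show "v \<in> (\<Union>p\<in>X. O' p)" using q(1) by blast
  qed
  ultimately obtain F where F: "F \<subseteq> X" "finite F" "S \<subseteq> (\<Union>p\<in>F. O' p)"
    using compactE_image[OF \<open>compact S\<close>, of X O'] by metis
  have "X \<subseteq> (\<Union>p\<in>F. arc p ` ball 0 (min (\<rho> p) (cr p)))"
  proof
    fix q assume q: "q \<in> X"
    then obtain v where v: "v \<in> S" "v \<in> q" using S_onto by blast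
    then obtain p where p: "p \<in> F" "v \<in> O' p" using F(3) by blast
    then have pX: "p \<in> X" using F(1) by blast
    have lt: "norm (v i - affine_coord (ca p) p i * v (ca p)) < \<delta> p * norm (v (ca p))" if "i \<le> N" for i
      using p(2) that by (auto simp: O'_def)
    have va: "v (ca p) \<noteq> 0" using lt[of 0] by auto
    have rq: "rep q (ca p) \<noteq> 0"
      using form_nonzero_iff[OF in_proj[OF q] form_coord[of "ca p"]] in_point_iff[OF in_proj[OF q] v(2)] va by auto
    have u: "norm (ucoord (ca p) p i q) < \<delta> p" if "i \<le> N" for i
    proof -
      have "ucoord (ca p) p i q = (v i - affine_coord (ca p) p i * v (ca p)) / v (ca p)"
        using affine_coord_eq[OF in_proj[OF q] v(2), of "ca p"] va by (simp add: ucoord_def field_simps)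
      then have "norm (ucoord (ca p) p i q) = norm (v i - affine_coord (ca p) p i * v (ca p)) / norm (v (ca p))"
        by (simp only: norm_divide)
      also have "\<dots> < \<delta> p" using lt[OF that] va by (subst pos_divide_less_eq) auto
      finally show ?thesis .
    qed
    have "cj p \<le> N" using chart[OF pX] by (simp add: is_chart_def)
    then have up: "norm (up p q) < \<delta> p" unfolding up_def by (rule u)
    have "q = arc p (up p q)"
      using up u by (intro arc_onto[OF pX q rq]) (auto simp: \<delta>_def less_le_trans)
    then show "q \<in> (\<Union>p\<in>F. arc p ` ball 0 (min (\<rho> p) (cr p)))"
      using p(1) up by (intro UN_I[of p] image_eqI[of _ _ "up p q"]) (auto simp: \<delta>_def)
  qed
  then show ?thesis using F(1,2) by blast
qed

text \<open>A 2 by 2 minor of the coordinate vectors that is nonzero at the centres stays nonzero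
  for nearby parameters, whereas equal points have proportional vectors.\<close>

lemma arcs_separated:
  assumes p: "p \<in> X" and q: "q \<in> X" and "p \<noteq> q"
  shows "\<exists>\<rho>>0. arc p ` ball 0 (min \<rho> (cr p)) \<inter> arc q ` ball 0 (min \<rho> (cr q)) = {}"
proof -
  obtain i k where ik: "rep p i * rep q k - rep p k * rep q i \<noteq> 0"
    using separating_form[OF in_proj[OF p] in_proj[OF q] assms(3)] by blast
  define G where "G = (\<lambda>x. cY p (fst x) i * cY q (snd x) k - cY p (fst x) k * cY q (snd x) i)"
  have "G (0, 0) = (rep p i * rep q k - rep p k * rep q i) / (rep p (ca p) * rep q (ca q))"
    by (simp add: G_def cY_0[OF p] cY_0[OF q] affine_coord_def diff_divide_distrib)
  then have G0: "G (0, 0) \<noteq> 0" using ik rep_ca[OF p] rep_ca[OF q] by simp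
  have "(G \<longlongrightarrow> G (0, 0)) (nhds 0 \<times>\<^sub>F nhds 0)"
    unfolding G_def fst_conv snd_conv
    by (intro tendsto_diff tendsto_mult filterlim_compose[OF cY_tendsto[OF p] filterlim_fst]
        filterlim_compose[OF cY_tendsto[OF q] filterlim_snd])
  then have "\<forall>\<^sub>F x in nhds 0 \<times>\<^sub>F nhds 0. G x \<noteq> 0" using G0 by (rule tendsto_imp_eventually_ne)
  then obtain A B where AB: "eventually A (nhds 0)" "eventually B (nhds 0)" "\<And>z w. A z \<Longrightarrow> B w \<Longrightarrow> G (z, w) \<noteq> 0"
    unfolding eventually_prod_filter by blast
  obtain r1 r2 where r: "r1 > 0" "\<And>z. dist z 0 < r1 \<Longrightarrow> A z" "r2 > 0" "\<And>z. dist z 0 < r2 \<Longrightarrow> B z"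
    using AB(1,2) unfolding eventually_nhds_metric by blast
  have "arc p z \<noteq> arc q w"
    if z: "z \<in> ball 0 (min (min r1 r2) (cr p))" and w: "w \<in> ball 0 (min (min r1 r2) (cr q))" for z w
  proof
    assume eq: "arc p z = arc q w"
    have z': "z \<in> ball 0 (cr p)" and w': "w \<in> ball 0 (cr q)" using z w by auto
    obtain c where "cY q w = (\<lambda>i. c * cY p z i)"
      using in_point_iff[OF arc_proj[OF p z'] cY_in_arc[OF p z']] cY_in_arc[OF q w'] eq by blast
    then have "G (z, w) = 0" by (simp add: G_def)
    then show False using AB(3)[OF r(2,4)] z w by auto
  qed
  then show ?thesis using r(1,3) by (intro exI[of _ "min r1 r2"]) auto
qed

sublocale charted_surface X arc cr
proof
  show "inj_on (arc p) (ball 0 (cr p))" if "p \<in> X" for p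
    using up_arc[OF that] by (metis inj_onI)
qed (use cr_pos arc_0 arc_in arcs_cover arcs_separated in auto)

text \<open>Polynomials are continuous along the arc, so Zariski neighbourhoods pull back to
  neighbourhoods of the parameter. This is the passage from germs on the curve to germs in
  z.\<close>

lemma eventually_nz_along:
  assumes p: "p \<in> X" and z: "z0 \<in> ball 0 (cr p)" and A: "eventually A (nz (arc p z0))"
  shows "\<forall>\<^sub>F z in nhds z0. z \<in> ball 0 (cr p) \<and> A (arc p z)"
proof -
  obtain e f where f: "f \<in> form e" "f (rep (arc p z0)) \<noteq> 0" "\<And>q. q \<in> X \<Longrightarrow> f (rep q) \<noteq> 0 \<Longrightarrow> A q"
    using A unfolding eventually_nz[OF arc_in[OF p z]] by blast
  have hol: "(\<lambda>z. f (cY p z)) holomorphic_on ball 0 (cr p)"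
    by (rule poly_fun_holomorphic[OF form_poly_fun[OF f(1)] cY_hol[OF p]])
  have "continuous_on (ball 0 (cr p)) (\<lambda>z. f (cY p z))" using hol by (rule holomorphic_on_imp_continuous_on)
  then have "isCont (\<lambda>z. f (cY p z)) z0" using z by (simp add: continuous_on_eq_continuous_at)
  then have "((\<lambda>z. f (cY p z)) \<longlongrightarrow> f (cY p z0)) (nhds z0)" by (simp add: continuous_at tendsto_nhds_iff)
  moreover have "f (cY p z0) \<noteq> 0" using f(2) arc_form[OF p z f(1)] by simp
  ultimately have "\<forall>\<^sub>F z in nhds z0. f (cY p z) \<noteq> 0" by (rule tendsto_imp_eventually_ne)
  moreover have "\<forall>\<^sub>F z in nhds z0. z \<in> ball 0 (cr p)" using z by (intro eventually_nhds_in_open) auto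
  ultimately show ?thesis
    by eventually_elim (use f(3) arc_in[OF p] arc_form[OF p _ f(1)] in auto)
qed

lemma eventually_nz_along_0:
  assumes p: "p \<in> X" and A: "eventually A (nz p)"
  shows "\<forall>\<^sub>F z in at 0. z \<in> ball 0 (cr p) \<and> A (arc p z)"
  using eventually_nz_along[OF p, of 0 A] A arc_0[OF p] cr_pos[OF p] by (simp add: eventually_at_filter eventually_mono)

lemma reg_along:
  assumes p: "p \<in> X" and z: "z0 \<in> ball 0 (cr p)" and f: "f \<in> reg_at X (arc p z0)"
  shows "(\<lambda>z. f (arc p z)) analytic_on {z0}"
proof -
  note a = arc_rep_ca[OF p z]
  obtain P Q where PQ: "P \<in> poly_fun" "Q \<in> poly_fun" "Q (affine_coord (ca p) (arc p z0)) \<noteq> 0"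
    "\<forall>\<^sub>F q in nz (arc p z0). rep q (ca p) \<noteq> 0 \<and> Q (affine_coord (ca p) q) \<noteq> 0 \<and>
       f q = P (affine_coord (ca p) q) / Q (affine_coord (ca p) q)"
    using f unfolding reg_at_iff[OF arc_in[OF p z] a] by blast
  have "(\<lambda>z. g (cY p z)) analytic_on {z0}" if "g \<in> poly_fun" for g
  proof (rule analytic_on_subset)
    show "(\<lambda>z. g (cY p z)) analytic_on ball 0 (cr p)"
      using poly_fun_holomorphic[OF that cY_hol[OF p]] by (simp add: analytic_on_open)
  qed (use z in simp)
  then have an: "(\<lambda>z. P (cY p z) / Q (cY p z)) analytic_on {z0}"
    using PQ(1-3) arc_affine_ca[OF p z] by (intro analytic_on_divide) auto
  have "\<forall>\<^sub>F z in nhds z0. P (cY p z) / Q (cY p z) = f (arc p z)"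
    using eventually_nz_along[OF p z PQ(4)] by eventually_elim (simp add: arc_affine_ca[OF p])
  from analytic_at_cong[OF this refl] an show ?thesis by blast
qed

lemma reg_along_0: "p \<in> X \<Longrightarrow> f \<in> reg_at X p \<Longrightarrow> (\<lambda>z. f (arc p z)) analytic_on {0}"
  using reg_along[of p 0 f] arc_0 cr_pos by simp

lemma analytic_mult_zero:
  assumes "f analytic_on {0}" "g analytic_on {0}" "\<forall>\<^sub>F z in at 0. f z * g z = 0"
  shows "(\<forall>\<^sub>F z in at 0. f z = 0) \<or> (\<forall>\<^sub>F z in at (0::complex). g z = 0)"
proof (rule ccontr)
  assume "\<not> ?thesis"
  then obtain m n where "has_ord f (int m)" "has_ord g (int n)"
    using analytic_has_ord[OF assms(1)] analytic_has_ord[OF assms(2)] by metis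
  from has_ord_eventually_nz[OF has_ord_mult[OF this]] assms(3)
  have "\<forall>\<^sub>F z in at (0::complex). False" by eventually_elim simp
  then show False by simp
qed

text \<open>The Zariski closure of an arc is irreducible, hence all of \<^term>\<open>X\<close>.\<close>

lemma form_zero_along_arc:
  assumes p: "p \<in> X" and f: "f \<in> form e" "\<forall>\<^sub>F z in at 0. f (cY p z) = 0" and q: "q \<in> X"
  shows "f (rep q) = 0"
proof -
  let ?van = "\<lambda>f. \<forall>\<^sub>F z in at 0. f (cY p z) = 0"
  define Z where "Z = {q \<in> X. \<forall>e. \<forall>f\<in>form e. ?van f \<longrightarrow> f (rep q) = 0}"
  have hol: "(\<lambda>z. f (cY p z)) holomorphic_on ball 0 (cr p)" if "f \<in> form e" for f e
    by (rule poly_fun_holomorphic[OF form_poly_fun[OF that] cY_hol[OF p]])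
  have arcZ: "arc p z \<in> Z" if z: "z \<in> ball 0 (cr p)" for z
    using arc_in[OF p z] arc_form[OF p z] holomorphic_zero_near_imp_zero[OF hol _ _ z, of _ _ 0] cr_pos[OF p]
    by (auto simp: Z_def)
  have clZ: "closedin (zariski X) Z"
    unfolding closedin_def topspace_zariski openin_X
  proof (intro conjI ballI)
    fix q assume "q \<in> X - Z"
    then obtain e f where "f \<in> form e" "?van f" "f (rep q) \<noteq> 0" by (auto simp: Z_def)
    then show "\<exists>e. \<exists>f\<in>form e. f (rep q) \<noteq> 0 \<and> (\<forall>q\<in>X. f (rep q) \<noteq> 0 \<longrightarrow> q \<in> X - Z)"
      by (auto simp: Z_def)
  qed (auto simp: Z_def)
  have out: "\<exists>e. \<exists>f\<in>form e. \<not> ?van f \<and> (\<forall>q\<in>A. f (rep q) = 0)" if clA: "closedin (zariski X) A" and nA: "\<not> Z \<subseteq> A" for A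
  proof -
    obtain q where q: "q \<in> Z" "q \<in> X - A" using nA by (auto simp: Z_def)
    have "openin (zariski X) (X - A)" "A \<subseteq> X" using clA by (auto simp: closedin_def)
    then obtain e f where "f \<in> form e" "f (rep q) \<noteq> 0" "\<forall>q\<in>X. f (rep q) \<noteq> 0 \<longrightarrow> q \<in> X - A"
      using q(2) unfolding openin_X by blast
    then show ?thesis using q(1) \<open>A \<subseteq> X\<close> by (intro exI bexI[of _ f]) (auto simp: Z_def)
  qed
  have "irreducible_closed (zariski X) Z"
    unfolding irreducible_closed_def
  proof (intro conjI allI impI)
    show "Z \<noteq> {}" using arcZ[of 0] cr_pos[OF p] by auto
    fix A B assume AB: "closedin (zariski X) A \<and> closedin (zariski X) B \<and> Z \<subseteq> A \<union> B"
    show "Z \<subseteq> A \<or> Z \<subseteq> B"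
    proof (rule ccontr)
      assume "\<not> ?thesis"
      then obtain e f e' g where fg: "f \<in> form e" "\<not> ?van f" "\<forall>q\<in>A. f (rep q) = 0"
        "g \<in> form e'" "\<not> ?van g" "\<forall>q\<in>B. g (rep q) = 0"
        using out[of A] out[of B] AB by blast
      \<comment> \<open>Each point of the arc lies in A or in B, so the product of the two forms
        vanishes along the arc although neither factor does. Analytic germs have no zero
        divisors.\<close>
      have prod0: "f (cY p z) * g (cY p z) = 0" if z: "z \<in> ball 0 (cr p)" for z
        using arcZ[OF z] AB fg(3,6) arc_form[OF p z fg(1)] arc_form[OF p z fg(4)] by auto
      have "\<forall>\<^sub>F z in at 0. f (cY p z) * g (cY p z) = 0"
        using eventually_at_0_ball[OF cr_pos[OF p]] by eventually_elim (use prod0 in blast)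
      then show False
        using analytic_mult_zero[OF analytic_near_0[OF hol[OF fg(1)] cr_pos[OF p]] analytic_near_0[OF hol[OF fg(4)] cr_pos[OF p]]]
          fg(2,5) by blast
    qed
  qed (rule clZ)
  moreover have half: "of_real (cr p / 2) \<in> ball (0::complex) (cr p)" using cr_pos[OF p] by simp
  moreover have "arc p (of_real (cr p / 2)) \<noteq> arc p 0"
    using up_arc[OF p half] up_arc[OF p, of 0] cr_pos[OF p] by (metis centre_in_ball half_gt_zero less_irrefl of_real_eq_0_iff)
  ultimately have "Z = X"
    using irreducible_closed_cases[OF _ arcZ[of 0] arcZ[OF half]] cr_pos[OF p] by auto
  then show ?thesis using f q by (auto simp: Z_def)
qed

text \<open>A form that is nonzero somewhere on X does not vanish identically along any arc, so its
  zeros are isolated and by compactness finite.\<close>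

lemma finite_form_zeros:
  assumes "f \<in> form e" "p \<in> X" "f (rep p) \<noteq> 0"
  shows "finite {q \<in> X. f (rep q) = 0}"
proof (rule finite_if_isolated)
  fix q assume q: "q \<in> X"
  have "\<not> (\<forall>\<^sub>F z in at 0. f (cY q z) = 0)" using form_zero_along_arc[OF q assms(1) _ assms(2)] assms(3) by blast
  moreover have "(\<lambda>z. f (cY q z)) analytic_on {0}"
    by (rule analytic_near_0[OF poly_fun_holomorphic[OF form_poly_fun[OF assms(1)] cY_hol[OF q]] cr_pos[OF q]])
  ultimately obtain n where "has_ord (\<lambda>z. f (cY q z)) (int n)" using analytic_has_ord by metis
  from has_ord_eventually_nz[OF this] eventually_at_0_ball[OF cr_pos[OF q]]
  show "\<forall>\<^sub>F z in at 0. f (rep (arc q z)) \<noteq> 0"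
    by eventually_elim (use arc_form[OF q _ assms(1)] in auto)
qed

text \<open>Zariski neighbourhoods are cofinite, so a statement about germs at one point is a
  statement about the whole curve up to finitely many exceptions.\<close>

lemma finite_not_eventually: "p \<in> X \<Longrightarrow> eventually A (nz p) \<Longrightarrow> finite {q \<in> X. \<not> A q}"
proof -
  assume p: "p \<in> X" and "eventually A (nz p)"
  then obtain e f where f: "f \<in> form e" "f (rep p) \<noteq> 0" "\<forall>q\<in>X. f (rep q) \<noteq> 0 \<longrightarrow> A q"
    unfolding eventually_nz[OF p] by blast
  have "{q \<in> X. \<not> A q} \<subseteq> {q \<in> X. f (rep q) = 0}" using f(3) by blast
  then show ?thesis using finite_form_zeros[OF f(1) p f(2)] by (rule finite_subset)
qed

lemma eventually_nz_finite: "p \<in> X \<Longrightarrow> finite F \<Longrightarrow> \<forall>\<^sub>F q in nz p. q \<in> F \<longrightarrow> q = p"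
proof -
  assume p: "p \<in> X" and F: "finite F"
  have ev: "\<forall>\<^sub>F q in nz p. q = x \<longrightarrow> q = p" for x
  proof (cases "x = p \<or> x \<notin> X")
    case True
    from eventually_nz_in[OF p] show ?thesis by eventually_elim (use True in blast)
  next
    case False
    then have "x \<in> X" "p \<in> X - {x}" using p by auto
    from eventually_nz_openin[OF openin_remove_point[OF this(1)] this(2)]
    show ?thesis by eventually_elim blast
  qed
  have "\<forall>\<^sub>F q in nz p. \<forall>x\<in>F. q = x \<longrightarrow> q = p" using F ev by (intro eventually_ball_finite) auto
  then show ?thesis by eventually_elim auto
qed

lemma infinite_X: "infinite X"
proof
  assume fin: "finite X"
  obtain p where p: "p \<in> X" using irr by (auto simp: irreducible_closed_def)
  have "inj_on (arc p) (ball 0 (cr p))" "arc p ` ball 0 (cr p) \<subseteq> X" using chart_inj p arc_in by auto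
  then have "finite (ball (0::complex) (cr p))" using fin finite_image_iff finite_subset by blast
  then show False using uncountable_ball[OF cr_pos[OF p]] countable_finite by blast
qed

lemma openin_cofinite: "openin (zariski X) U \<Longrightarrow> U \<noteq> {} \<Longrightarrow> finite (X - U)"
proof -
  assume U: "openin (zariski X) U" "U \<noteq> {}"
  then obtain p where p: "p \<in> U" "p \<in> X" using openin_subset[OF U(1)] by auto
  have "X - U = {q \<in> X. \<not> q \<in> U}" by auto
  then show ?thesis using finite_not_eventually[OF p(2) eventually_nz_openin[OF U(1) p(1)]] by simp
qed

section \<open>Orders of regular and rational functions\<close>

text \<open>A regular germ is determined by its restriction to the arc. Clearing the denominator
  leaves a form, and a form that vanishes along one arc vanishes on X.\<close>

lemma reg_zero_along:
  assumes p: "p \<in> X" and f: "f \<in> reg_at X p" and ev: "\<forall>\<^sub>F z in at 0. f (arc p z) = 0"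
  shows "\<forall>\<^sub>F q in nz p. f q = 0"
proof -
  obtain P Q where PQ: "P \<in> poly_fun" "Q \<in> poly_fun" "Q (affine_coord (ca p) p) \<noteq> 0"
    "\<forall>\<^sub>F q in nz p. rep q (ca p) \<noteq> 0 \<and> Q (affine_coord (ca p) q) \<noteq> 0 \<and>
       f q = P (affine_coord (ca p) q) / Q (affine_coord (ca p) q)"
    using f unfolding reg_at_iff[OF p rep_ca[OF p]] by blast
  obtain e F where F: "F \<in> form e" "\<And>v. v (ca p) \<noteq> 0 \<Longrightarrow> F v = v (ca p) ^ e * P (\<lambda>i. v i / v (ca p))"
    using homogenize[OF PQ(1), of "ca p"] by blast
  have "\<forall>\<^sub>F z in at 0. F (cY p z) = 0"
    using ev eventually_nz_along_0[OF p PQ(4)]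
  proof eventually_elim
    case (elim z)
    then have "P (cY p z) = 0" by (auto simp: arc_affine_ca[OF p])
    then show ?case using F(2)[of "cY p z"] cY_ca[OF p] elim by simp
  qed
  then have Fz: "F (rep q) = 0" if "q \<in> X" for q using form_zero_along_arc[OF p F(1) _ that] by blast
  from PQ(4) eventually_nz_in[OF p] show ?thesis
  proof eventually_elim
    case (elim q)
    then have "P (affine_coord (ca p) q) = 0" using F(2)[of "rep q"] Fz[of q] by (auto simp: affine_coord_def)
    then show ?case using elim by simp
  qed
qed

lemma reg_has_ord:
  assumes "p \<in> X" "f \<in> reg_at X p" "\<not> (\<forall>\<^sub>F q in nz p. f q = 0)"
  shows "\<exists>n. has_ord (\<lambda>z. f (arc p z)) (int n)"
proof (rule analytic_has_ord[OF reg_along_0[OF assms(1,2)]])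
  show "\<not> (\<forall>\<^sub>F z in at 0. f (arc p z) = 0)" using reg_zero_along[OF assms(1,2)] assms(3) by blast
qed blast

lemma reg_along_tendsto: "p \<in> X \<Longrightarrow> f \<in> reg_at X p \<Longrightarrow> ((\<lambda>z. f (arc p z)) \<longlongrightarrow> f p) (at 0)"
  using analytic_at_imp_isCont[OF reg_along_0] by (metis arc_0 isCont_def)

lemma up_has_ord: "p \<in> X \<Longrightarrow> has_ord (\<lambda>z. up p (arc p z)) 1"
proof (rule has_ord_cong[OF has_ord_id])
  assume p: "p \<in> X"
  show "\<forall>\<^sub>F z in at 0. z = up p (arc p z)"
    using eventually_at_0_ball[OF cr_pos[OF p]] by eventually_elim (simp add: up_arc[OF p])
qed

text \<open>The analytic order along the arc is the algebraic order, the exponent of the local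
  coordinate: a germ vanishing at p is divisible by \<open>up p\<close>, and each division lowers
  the order by one.\<close>

lemma reg_factor:
  assumes p: "p \<in> X"
  shows "f \<in> reg_at X p \<Longrightarrow> has_ord (\<lambda>z. f (arc p z)) (int n) \<Longrightarrow>
    \<exists>u\<in>reg_at X p. u p \<noteq> 0 \<and> (\<forall>\<^sub>F q in nz p. f q = up p q ^ n * u q)"
proof (induction n arbitrary: f)
  case 0
  from 0(2) obtain c where "c \<noteq> 0" "((\<lambda>z. f (arc p z)) \<longlongrightarrow> c) (at 0)" using has_ord_limit_nz by auto
  then have "f p \<noteq> 0" using tendsto_unique[OF _ reg_along_tendsto[OF p 0(1)]] by auto
  then show ?case using 0(1) by (intro bexI[of _ f]) auto
next
  case (Suc n)
  have "((\<lambda>z. f (arc p z)) \<longlongrightarrow> 0) (at 0)" by (rule has_ord_limit_0[OF Suc.prems(2)]) simp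
  then have "f p = 0" using tendsto_unique[OF _ reg_along_tendsto[OF p Suc.prems(1)]] by auto
  then obtain h where h: "h \<in> reg_at X p" "\<forall>\<^sub>F q in nz p. f q = up p q * h q"
    using up_generates[OF p Suc.prems(1)] by blast
  have "has_ord (\<lambda>z. f (arc p z) / z) (int (Suc n) - 1)"
    by (rule has_ord_divide[OF Suc.prems(2) has_ord_id])
  moreover have "\<forall>\<^sub>F z in at 0. f (arc p z) / z = h (arc p z)"
    using eventually_nz_along_0[OF p h(2)] eventually_at_0_ball[OF cr_pos[OF p]]
    by eventually_elim (simp add: up_arc[OF p])
  ultimately have "has_ord (\<lambda>z. h (arc p z)) (int n)" using has_ord_cong by fastforce
  from Suc.IH[OF h(1) this] obtain u where u: "u \<in> reg_at X p" "u p \<noteq> 0" "\<forall>\<^sub>F q in nz p. h q = up p q ^ n * u q"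
    by blast
  from h(2) u(3) have "\<forall>\<^sub>F q in nz p. f q = up p q ^ Suc n * u q" by eventually_elim simp
  then show ?case using u by blast
qed

text \<open>A rational function is represented by a total function. Near each p it has to be a
  quotient of regular germs only away from p, so that a pole may carry any value.\<close>

definition rational :: "(point \<Rightarrow> complex) \<Rightarrow> bool" where
  "rational f \<longleftrightarrow> (\<forall>p\<in>X. \<exists>g\<in>reg_at X p. \<exists>h\<in>reg_at X p. \<not> (\<forall>\<^sub>F q in nz p. h q = 0) \<and>
     (\<forall>\<^sub>F q in nz p. q \<noteq> p \<longrightarrow> h q \<noteq> 0 \<and> f q = g q / h q))"

lemma arc_neq: "p \<in> X \<Longrightarrow> z \<in> ball 0 (cr p) \<Longrightarrow> z \<noteq> 0 \<Longrightarrow> arc p z \<noteq> p"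
  using up_arc up_self by metis

lemma rational_isolated:
  assumes "rational f" "p \<in> X"
  shows "\<forall>\<^sub>F q in nz p. q \<noteq> p \<longrightarrow> f \<in> reg_at X q"
proof -
  obtain g h where gh: "g \<in> reg_at X p" "h \<in> reg_at X p"
    "\<forall>\<^sub>F q in nz p. q \<noteq> p \<longrightarrow> h q \<noteq> 0 \<and> f q = g q / h q" using assms unfolding rational_def by blast
  from eventually_eventually_nz[OF assms(2) gh(3)] eventually_reg_at[OF assms(2) gh(1)]
    eventually_reg_at[OF assms(2) gh(2)] eventually_nz_in[OF assms(2)] gh(3)
  show ?thesis
  proof eventually_elim
    case (elim q)
    show ?case
    proof
      assume q: "q \<noteq> p"
      have "\<forall>\<^sub>F x in nz q. x \<in> {p} \<longrightarrow> x = q" by (rule eventually_nz_finite[OF elim(4)]) simp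
      with elim(1) have "\<forall>\<^sub>F x in nz q. g x / h x = f x" by eventually_elim (use q in auto)
      from reg_at_cong[OF elim(4) reg_at_divide[OF elim(4,2,3)] this] elim(5) q
      show "f \<in> reg_at X q" by blast
    qed
  qed
qed

lemma rational_finite_irregular: "rational f \<Longrightarrow> finite {q \<in> X. f \<notin> reg_at X q}"
proof (rule finite_if_isolated)
  fix p assume f: "rational f" and p: "p \<in> X"
  from eventually_nz_along_0[OF p rational_isolated[OF f p]] eventually_at_0_ball[OF cr_pos[OF p]]
  show "\<forall>\<^sub>F z in at 0. \<not> f \<notin> reg_at X (arc p z)"
    by eventually_elim (use arc_neq[OF p] in auto)
qed

lemma rational_has_ord:
  assumes f: "rational f" and inf: "infinite {q \<in> X. f q \<noteq> 0}" and p: "p \<in> X"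
  shows "\<exists>k. has_ord (\<lambda>z. f (arc p z)) k"
proof -
  obtain g h where gh: "g \<in> reg_at X p" "h \<in> reg_at X p" "\<not> (\<forall>\<^sub>F q in nz p. h q = 0)"
    "\<forall>\<^sub>F q in nz p. q \<noteq> p \<longrightarrow> h q \<noteq> 0 \<and> f q = g q / h q" using f p unfolding rational_def by blast
  have "\<not> (\<forall>\<^sub>F q in nz p. g q = 0)"
  proof
    assume "\<forall>\<^sub>F q in nz p. g q = 0"
    with gh(4) have "\<forall>\<^sub>F q in nz p. q \<noteq> p \<longrightarrow> f q = 0" by eventually_elim auto
    from finite_not_eventually[OF p this] have "finite (insert p {q \<in> X. \<not> (q \<noteq> p \<longrightarrow> f q = 0)})" by simp
    then have "finite {q \<in> X. f q \<noteq> 0}" by (rule finite_subset[rotated]) auto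
    with inf show False by blast
  qed
  then obtain m n where "has_ord (\<lambda>z. g (arc p z)) (int m)" "has_ord (\<lambda>z. h (arc p z)) (int n)"
    using reg_has_ord[OF p] gh by blast
  note o = has_ord_divide[OF this]
  have "\<forall>\<^sub>F z in at 0. g (arc p z) / h (arc p z) = f (arc p z)"
    using eventually_nz_along_0[OF p gh(4)] eventually_at_0_ball[OF cr_pos[OF p]]
    by eventually_elim (use arc_neq[OF p] in auto)
  from has_ord_cong[OF o this] show ?thesis by blast
qed

lemma rational_diff_const: "rational f \<Longrightarrow> rational (\<lambda>q. f q - c)"
  unfolding rational_def
proof
  fix p assume f: "\<forall>p\<in>X. \<exists>g\<in>reg_at X p. \<exists>h\<in>reg_at X p. \<not> (\<forall>\<^sub>F q in nz p. h q = 0) \<and>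
     (\<forall>\<^sub>F q in nz p. q \<noteq> p \<longrightarrow> h q \<noteq> 0 \<and> f q = g q / h q)" and p: "p \<in> X"
  then obtain g h where gh: "g \<in> reg_at X p" "h \<in> reg_at X p" "\<not> (\<forall>\<^sub>F q in nz p. h q = 0)"
    "\<forall>\<^sub>F q in nz p. q \<noteq> p \<longrightarrow> h q \<noteq> 0 \<and> f q = g q / h q" by blast
  have "\<forall>\<^sub>F q in nz p. q \<noteq> p \<longrightarrow> h q \<noteq> 0 \<and> f q - c = (g q - c * h q) / h q"
    using gh(4) by eventually_elim (auto simp: field_simps)
  moreover have "(\<lambda>q. g q - c * h q) \<in> reg_at X p"
    by (intro reg_at_diff reg_at_mult reg_at_const p gh)
  ultimately show "\<exists>g\<in>reg_at X p. \<exists>h\<in>reg_at X p. \<not> (\<forall>\<^sub>F q in nz p. h q = 0) \<and>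
     (\<forall>\<^sub>F q in nz p. q \<noteq> p \<longrightarrow> h q \<noteq> 0 \<and> f q - c = g q / h q)"
    using gh(2,3) by (intro bexI[of _ "\<lambda>q. g q - c * h q"] bexI[of _ h]) auto
qed

section \<open>Tangent vectors along arcs\<close>

text \<open>The velocity of the chart of p at the parameter z, as a derivation of the local ring at
  \<open>arc p z\<close>. It restricts forms to charts.\<close>

definition tvec :: "point \<Rightarrow> complex \<Rightarrow> tangent" where
  "tvec p z f = (if f \<in> reg_at X (arc p z) then deriv (\<lambda>\<zeta>. f (arc p \<zeta>)) z else 0)"

lemma tvec_tangent:
  assumes p: "p \<in> X" and z: "z \<in> ball 0 (cr p)"
  shows "tvec p z \<in> tangent_space X (arc p z)"
proof -
  let ?w = "arc p z"
  have w: "?w \<in> X" by (rule arc_in[OF p z])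
  have D: "(\<lambda>\<zeta>. f (arc p \<zeta>)) field_differentiable (at z)" if "f \<in> reg_at X ?w" for f
    using reg_along[OF p z that] analytic_on_imp_differentiable_at by blast
  show ?thesis
    unfolding tangent_space_def
  proof (intro CollectI conjI allI ballI impI)
    show "tvec p z f = 0" if "f \<notin> reg_at X ?w" for f using that by (simp add: tvec_def)
    show "tvec p z (scale_fun c f) = c * tvec p z f" if "f \<in> reg_at X ?w" for f c
      using that reg_at_mult[OF w reg_at_const[OF w, of c] that] D[OF that]
      by (simp add: tvec_def scale_fun_def)
    fix f g assume f: "f \<in> reg_at X ?w" and g: "g \<in> reg_at X ?w"
    show "tvec p z (\<lambda>q. f q + g q) = tvec p z f + tvec p z g"
      using f g reg_at_add[OF w f g] D by (simp add: tvec_def)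
    show "tvec p z (\<lambda>q. f q * g q) = f ?w * tvec p z g + g ?w * tvec p z f"
      using f g reg_at_mult[OF w f g] D by (simp add: tvec_def)
  qed
qed

lemma tvec_up: "p \<in> X \<Longrightarrow> z \<in> ball 0 (cr p) \<Longrightarrow> tvec p z (up p) = 1"
proof -
  assume p: "p \<in> X" and z: "z \<in> ball 0 (cr p)"
  have "up p \<in> reg_at X (arc p z)" unfolding up_def by (rule ucoord_reg[OF arc_in[OF p z] arc_rep_ca[OF p z]])
  moreover have "\<forall>\<^sub>F \<zeta> in nhds z. \<zeta> \<in> ball 0 (cr p)" using z by (intro eventually_nhds_in_open) auto
  then have "\<forall>\<^sub>F \<zeta> in nhds z. up p (arc p \<zeta>) = \<zeta>" by eventually_elim (simp add: up_arc[OF p])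
  then have "deriv (\<lambda>\<zeta>. up p (arc p \<zeta>)) z = deriv (\<lambda>\<zeta>. \<zeta>) z" by (intro deriv_cong_ev) auto
  ultimately show ?thesis by (simp add: tvec_def)
qed

lemma tvec_spans:
  assumes p: "p \<in> X" and z: "z \<in> ball 0 (cr p)" and D: "D \<in> tangent_space X (arc p z)"
  shows "\<exists>c. \<forall>f. D f = c * tvec p z f"
proof -
  obtain D0 where D0: "\<And>D. D \<in> tangent_space X (arc p z) \<Longrightarrow> \<exists>c. \<forall>f. D f = c * D0 f"
    using tangent_space_dim1[OF arc_in[OF p z]] by blast
  obtain c where c: "\<And>f. D f = c * D0 f" using D0[OF D] by blast
  obtain b where b: "\<And>f. tvec p z f = b * D0 f" using D0[OF tvec_tangent[OF p z]] by blast
  have "b \<noteq> 0" using tvec_up[OF p z] b[of "up p"] by auto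
  then have "D f = (c / b) * tvec p z f" for f using b c by simp
  then show ?thesis by blast
qed

text \<open>Two nonzero vectors of a one-dimensional tangent space are proportional. This takes the
  place of the chain rule for a change of charts; the later arguments use that c is nonzero or let
  it cancel.\<close>

lemma tvec_change_center:
  assumes p: "p \<in> X" and z: "z \<in> ball 0 (cr p)"
  shows "\<exists>c. c \<noteq> 0 \<and> (\<forall>f. tvec p z f = c * tvec (arc p z) 0 f)"
proof -
  let ?w = "arc p z"
  have w: "?w \<in> X" "0 \<in> ball 0 (cr ?w)" "arc ?w 0 = ?w" using arc_in[OF p z] cr_pos arc_0 by auto
  obtain c where c: "\<And>f. tvec p z f = c * tvec ?w 0 f"
    using tvec_spans[OF w(1,2), of "tvec p z"] tvec_tangent[OF p z] w(3) by auto
  then have "c \<noteq> 0" using tvec_up[OF p z] c[of "up p"] by auto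
  then show ?thesis using c by blast
qed

text \<open>At each p some x - c has nonzero order, and then the derivative of x is nonzero on a
  punctured disc. Hence poles and ramification points are isolated.\<close>

lemma finite_ramification:
  assumes x: "rational x" and nc: "\<And>c. infinite {q \<in> X. x q \<noteq> c}"
  shows "finite {q \<in> X. x \<notin> reg_at X q \<or> tvec q 0 x = 0}"
proof (rule finite_if_isolated)
  fix p assume p: "p \<in> X"
  have ho: "\<exists>k. has_ord (\<lambda>z. x (arc p z) - c) k" for c
    using rational_has_ord[OF rational_diff_const[OF x, of c] _ p] nc[of c] by simp
  \<comment> \<open>If all these orders were 0, x would have a limit l at p, and x - l would tend to
    0 in spite of having order 0.\<close>
  have "\<exists>c k. k \<noteq> 0 \<and> has_ord (\<lambda>z. x (arc p z) - c) k"
  proof (rule ccontr)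
    assume "\<not> ?thesis"
    then have all0: "has_ord (\<lambda>z. x (arc p z) - c) 0" for c using ho by metis
    from has_ord_limit_nz[OF all0[of 0]] obtain l where l: "((\<lambda>z. x (arc p z) - 0) \<longlongrightarrow> l) (at 0)" by metis
    from has_ord_limit_nz[OF all0[of l]] obtain m where m: "m \<noteq> 0" "((\<lambda>z. x (arc p z) - l) \<longlongrightarrow> m) (at 0)" by metis
    have "((\<lambda>z. x (arc p z) - l) \<longlongrightarrow> l - l) (at 0)" using l by (intro tendsto_diff) auto
    from tendsto_unique[OF _ this m(2)] m(1) show False by simp
  qed
  then obtain c k where k: "k \<noteq> 0" "has_ord (\<lambda>z. x (arc p z) - c) k" by blast
  have "deriv (\<lambda>z. x (arc p z) - c) z = deriv (\<lambda>z. x (arc p z)) z"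
    if "(\<lambda>\<zeta>. x (arc p \<zeta>)) analytic_on {z}" for z
    using analytic_on_imp_differentiable_at[OF that, of z] by simp
  note d = this
  from has_ord_deriv(1)[OF k(2,1)] eventually_nz_along_0[OF p rational_isolated[OF x p]] eventually_at_0_ball[OF cr_pos[OF p]]
  show "\<forall>\<^sub>F z in at 0. \<not> (x \<notin> reg_at X (arc p z) \<or> tvec (arc p z) 0 x = 0)"
  proof eventually_elim
    case (elim z)
    then have reg: "x \<in> reg_at X (arc p z)" using arc_neq[OF p] by blast
    have "tvec p z x \<noteq> 0" using elim(1) d[OF reg_along[OF p _ reg]] elim(2) reg by (simp add: tvec_def)
    then show ?case using tvec_change_center[OF p, of z] elim(2) reg by auto
  qed
qed

text \<open>For the weight w = 1 the fibre sum counts the points of a fibre. A function that equals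
  a nonzero constant off a finite set is treated apart: it has order 0 everywhere.\<close>

theorem degree_principal:
  assumes x: "rational x" and inf: "infinite {q \<in> X. x q \<noteq> 0}"
  shows "(\<Sum>p | p \<in> X \<and> ord_at x p \<noteq> 0. ord_at x p) = 0"
proof (cases "\<exists>c. finite {q \<in> X. x q \<noteq> c}")
  case True
  then obtain c where c: "finite {q \<in> X. x q \<noteq> c}" by blast
  have "ord_at x p = 0" if p: "p \<in> X" for p
  proof (rule ord_at_eq)
    have "c \<noteq> 0" using c inf by auto
    then have "has_ord (\<lambda>_. c) 0" by (intro has_ord_analytic_0) auto
    moreover have "\<forall>\<^sub>F z in at 0. c = x (arc p z)"
      using eventually_nz_along_0[OF p eventually_nz_finite[OF p c]] eventually_at_0_ball[OF cr_pos[OF p]]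
      by eventually_elim (use arc_neq[OF p] arc_in[OF p] in auto)
    ultimately show "has_ord (\<lambda>z. x (arc p z)) 0" by (rule has_ord_cong)
  qed
  then show ?thesis by (intro sum.neutral) auto
next
  case False
  then have nc: "infinite {q \<in> X. x q \<noteq> c}" for c by blast
  have "(\<Sum>p | p \<in> X \<and> ord_at x p \<noteq> 0. of_int (ord_at x p) * (1::complex)) = 0"
  proof (rule sum_ord_mult_limit_eq_0[where w = "\<lambda>_. 1"])
    show "\<exists>k. has_ord (\<lambda>z. x (arc p z) - c) k" if "p \<in> X" for p c
      using rational_has_ord[OF rational_diff_const[OF x, of c] _ that] nc[of c] by simp
    show "finite {q \<in> X. x \<notin> reg_at X q \<or> tvec q 0 x = 0}" by (rule finite_ramification[OF x nc])
    show "(\<lambda>z. x (arc p z)) analytic_on {0} \<and> deriv (\<lambda>z. x (arc p z)) 0 \<noteq> 0"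
      if "p \<in> X - {q \<in> X. x \<notin> reg_at X q \<or> tvec q 0 x = 0}" for p
      using that reg_along_0[of p x] arc_0[of p] by (auto simp: tvec_def)
    show "((\<lambda>z. (x (arc p z) - c) * 1) \<longlongrightarrow> 0) (at 0)" if p: "p \<in> X" "0 < ord_at (\<lambda>q. x q - c) p" for p c
    proof -
      obtain k where k: "has_ord (\<lambda>z. x (arc p z) - c) k"
        using rational_has_ord[OF rational_diff_const[OF x, of c] _ p(1)] nc[of c] by auto
      then have "k > 0" using ord_at_eq[of "\<lambda>q. x q - c", OF k] p(2) by simp
      from has_ord_limit_0[OF k this] show ?thesis by simp
    qed
  qed auto
  then have "of_int (\<Sum>p | p \<in> X \<and> ord_at x p \<noteq> 0. ord_at x p) = (0::complex)" by simp
  then show ?thesis by (simp only: of_int_eq_0_iff)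
qed

end

section \<open>Vanishing orders of analytic germs\<close>

text \<open>Order at least n, the zero germ included, so that vanishing conditions cut out linear
  subspaces.\<close>

definition vanish :: "(complex \<Rightarrow> complex) \<Rightarrow> nat \<Rightarrow> bool" where
  "vanish f n \<longleftrightarrow> (\<exists>h. h analytic_on {0} \<and> (\<forall>\<^sub>F z in at 0. f z = z ^ n * h z))"

lemma vanish_0: "f analytic_on {0} \<Longrightarrow> vanish f 0"
  unfolding vanish_def by (intro exI[of _ f]) simp

lemma vanish_cong: "vanish f n \<Longrightarrow> \<forall>\<^sub>F z in at 0. f z = g z \<Longrightarrow> vanish g n"
  unfolding vanish_def by (elim exE conjE, rule exI, rule conjI, assumption) (auto elim: eventually_elim2)

lemma vanish_add: "vanish f n \<Longrightarrow> vanish g n \<Longrightarrow> vanish (\<lambda>z. f z + g z) n"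
proof -
  assume "vanish f n" "vanish g n"
  then obtain h k where hk: "h analytic_on {0}" "\<forall>\<^sub>F z in at 0. f z = z ^ n * h z"
    "k analytic_on {0}" "\<forall>\<^sub>F z in at 0. g z = z ^ n * k z" unfolding vanish_def by blast
  from hk(2,4) have "\<forall>\<^sub>F z in at 0. f z + g z = z ^ n * (h z + k z)"
    by eventually_elim (simp add: algebra_simps)
  then show ?thesis unfolding vanish_def using hk by (intro exI[of _ "\<lambda>z. h z + k z"]) (auto intro: analytic_intros)
qed

lemma vanish_scale: "vanish f n \<Longrightarrow> vanish (\<lambda>z. c * f z) n"
proof -
  assume "vanish f n"
  then obtain h where hk: "h analytic_on {0}" "\<forall>\<^sub>F z in at 0. f z = z ^ n * h z" unfolding vanish_def by blast
  from hk(2) have "\<forall>\<^sub>F z in at 0. c * f z = z ^ n * (c * h z)" by eventually_elim simp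
  then show ?thesis unfolding vanish_def using hk by (intro exI[of _ "\<lambda>z. c * h z"]) (auto intro: analytic_intros)
qed

lemma vanish_zero: "vanish (\<lambda>_. 0) n"
  unfolding vanish_def by (intro exI[of _ "\<lambda>_. 0"]) auto

lemma analytic_zero_factor:
  assumes "h analytic_on {0}" "h 0 = 0"
  shows "vanish h 1"
proof (cases "\<forall>\<^sub>F z in at 0. h z = 0")
  case True
  then show ?thesis using vanish_cong[OF vanish_zero] by (metis (mono_tags, lifting) eventually_mono)
next
  case False
  then obtain n where n: "has_ord h (int n)" using analytic_has_ord[OF assms(1)] by metis
  have lim: "(h \<longlongrightarrow> 0) (at 0)" using analytic_at_imp_isCont[OF assms(1)] assms(2) by (simp add: isCont_def)
  have "n \<noteq> 0"
  proof
    assume "n = 0"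
    then obtain c where "c \<noteq> 0" "(h \<longlongrightarrow> c) (at 0)" using has_ord_limit_nz n by auto
    then show False using tendsto_unique[OF _ lim] by auto
  qed
  then obtain m where m: "n = Suc m" using not0_implies_Suc by blast
  obtain u where u: "u analytic_on {0}" "\<forall>\<^sub>F z in at 0. h z = z powi int n * u z"
    using n unfolding has_ord_def by blast
  from u(2) have "\<forall>\<^sub>F z in at 0. h z = z ^ 1 * (z ^ m * u z)"
    unfolding m power_int_of_nat by eventually_elim simp
  then show ?thesis unfolding vanish_def using u(1)
    by (intro exI[of _ "\<lambda>z. z ^ m * u z"]) (auto intro!: analytic_intros)
qed

lemma vanish_Suc:
  assumes "h analytic_on {0}" "\<forall>\<^sub>F z in at 0. f z = z ^ n * h z" "h 0 = 0"
  shows "vanish f (Suc n)"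
proof -
  obtain k where k: "k analytic_on {0}" "\<forall>\<^sub>F z in at 0. h z = z ^ 1 * k z"
    using analytic_zero_factor[OF assms(1,3)] unfolding vanish_def by blast
  from assms(2) k(2) have "\<forall>\<^sub>F z in at 0. f z = z ^ Suc n * k z" by eventually_elim simp
  with k(1) show ?thesis unfolding vanish_def by blast
qed

lemma vanish_SucD: "vanish f (Suc n) \<Longrightarrow> vanish f n"
proof -
  assume "vanish f (Suc n)"
  then obtain h where h: "h analytic_on {0}" "\<forall>\<^sub>F z in at 0. f z = z ^ Suc n * h z" unfolding vanish_def by blast
  from h(2) have "\<forall>\<^sub>F z in at 0. f z = z ^ n * (z * h z)" by eventually_elim simp
  then show ?thesis unfolding vanish_def using h(1)
    by (intro exI[of _ "\<lambda>z. z * h z"]) (auto intro!: analytic_intros)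
qed

lemma vanish_antimono: "vanish f n \<Longrightarrow> m \<le> n \<Longrightarrow> vanish f m"
  by (induction n) (auto simp: le_Suc_eq dest: vanish_SucD)

text \<open>Vanishing to one more order is a single linear condition, on the leading coefficient.
  Codimension at most 1 is expressed through two elements because this is the form that
  \<open>dim_step\<close> takes.\<close>

lemma vanish_combination:
  assumes "vanish f n" "vanish g n"
  shows "\<exists>a b. (a \<noteq> 0 \<or> b \<noteq> 0) \<and> vanish (\<lambda>z. a * f z + b * g z) (Suc n)"
proof -
  obtain h k where hk: "h analytic_on {0}" "\<forall>\<^sub>F z in at 0. f z = z ^ n * h z"
    "k analytic_on {0}" "\<forall>\<^sub>F z in at 0. g z = z ^ n * k z" using assms unfolding vanish_def by blast
  have *: "vanish (\<lambda>z. a * f z + b * g z) (Suc n)" if "a * h 0 + b * k 0 = 0" for a b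
  proof (rule vanish_Suc)
    show "(\<lambda>z. a * h z + b * k z) analytic_on {0}" using hk by (auto intro!: analytic_intros)
    show "\<forall>\<^sub>F z in at 0. a * f z + b * g z = z ^ n * (a * h z + b * k z)"
      using hk(2,4) by eventually_elim (simp add: algebra_simps)
  qed (rule that)
  show ?thesis
  proof (cases "h 0 = 0 \<and> k 0 = 0")
    case True
    then show ?thesis using *[of 1 0] by (intro exI[of _ 1] exI[of _ 0]) auto
  next
    case False
    then show ?thesis using *[of "k 0" "- h 0"] by (intro exI[of _ "k 0"] exI[of _ "- h 0"]) auto
  qed
qed

lemma vanish_exact: "vanish f n \<Longrightarrow> \<not> vanish f (Suc n) \<Longrightarrow> has_ord f (int n)"
proof -
  assume v: "vanish f n" and nv: "\<not> vanish f (Suc n)"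
  obtain h where h: "h analytic_on {0}" "\<forall>\<^sub>F z in at 0. f z = z ^ n * h z" using v unfolding vanish_def by blast
  have "h 0 \<noteq> 0" using vanish_Suc[OF h] nv by blast
  moreover have "\<forall>\<^sub>F z in at 0. f z = z powi int n * h z" unfolding power_int_of_nat by (rule h(2))
  ultimately show ?thesis using h(1) by (intro has_ordI[of h])
qed

lemma has_ord_vanish: "has_ord f (int n) \<Longrightarrow> m \<le> n \<Longrightarrow> vanish f m"
proof -
  assume "has_ord f (int n)" "m \<le> n"
  then obtain u where u: "u analytic_on {0}" "\<forall>\<^sub>F z in at 0. f z = z powi int n * u z"
    unfolding has_ord_def by blast
  then have "vanish f n" unfolding vanish_def by auto
  then show ?thesis using vanish_antimono \<open>m \<le> n\<close> by blast
qed

context projective_curve begin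

section \<open>Regular differentials\<close>

text \<open>The germ version of \<open>canonical\<close>: coefficients are regular near p only, so
  that operations on forms need no bookkeeping of open sets.\<close>

definition regular_form_at :: "point \<Rightarrow> tangent sec \<Rightarrow> bool" where
  "regular_form_at p \<omega> \<longleftrightarrow> (\<exists>(m::nat) f g. (\<forall>i<m. f i \<in> reg_at X p \<and> g i \<in> reg_at X p) \<and>
     (\<forall>\<^sub>F q in nz p. \<forall>D\<in>tangent_space X q. \<omega> q D = (\<Sum>i<m. f i q * D (g i))))"

lemma restr_reg:
  assumes "openin (zariski X) W" "\<And>q. q \<in> W \<Longrightarrow> f \<in> reg_at X q"
  shows "restr W f \<in> reg X W"
proof -
  have "restr W f \<in> reg_at X q" if q: "q \<in> W" for q
  proof (rule reg_at_cong[OF _ assms(2)[OF q]])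
    show "q \<in> X" using openin_subset[OF assms(1)] q by auto
    show "\<forall>\<^sub>F x in nz q. f x = restr W f x"
      using eventually_nz_openin[OF assms(1) q] by eventually_elim (simp add: restr_def)
  qed
  then show ?thesis unfolding reg_iff[OF assms(1)] by (auto simp: restr_def)
qed

lemma canonical_iff:
  assumes U: "openin (zariski X) U"
  shows "\<omega> \<in> canonical X U \<longleftrightarrow> (\<forall>p D. p \<notin> U \<or> D \<notin> tangent_space X p \<longrightarrow> \<omega> p D = 0) \<and> (\<forall>p\<in>U. regular_form_at p \<omega>)"
proof (intro iffI conjI ballI)
  assume \<omega>: "\<omega> \<in> canonical X U"
  then show "\<forall>p D. p \<notin> U \<or> D \<notin> tangent_space X p \<longrightarrow> \<omega> p D = 0" by (simp add: canonical_def)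
  fix p assume "p \<in> U"
  with \<omega> have "\<exists>W (m::nat) f g. openin (zariski X) W \<and> p \<in> W \<and> W \<subseteq> U \<and>
      (\<forall>i<m. f i \<in> reg X W \<and> g i \<in> reg X W) \<and>
      (\<forall>q\<in>W. \<forall>D\<in>tangent_space X q. \<omega> q D = (\<Sum>i<m. f i q * D (g i)))" by (simp add: canonical_def)
  then obtain W m f g where W: "openin (zariski X) W" "p \<in> W" "\<forall>i<m. f i \<in> reg X W \<and> g i \<in> reg X W"
    "\<forall>q\<in>W. \<forall>D\<in>tangent_space X q. \<omega> q D = (\<Sum>i<m::nat. f i q * D (g i))" by (elim exE conjE) (rule that)
  have "\<forall>i<m. f i \<in> reg_at X p \<and> g i \<in> reg_at X p" using W(2,3) reg_iff[OF W(1)] by auto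
  moreover have "\<forall>\<^sub>F q in nz p. \<forall>D\<in>tangent_space X q. \<omega> q D = (\<Sum>i<m. f i q * D (g i))"
    using eventually_nz_openin[OF W(1,2)] by eventually_elim (use W(4) in blast)
  ultimately show "regular_form_at p \<omega>" unfolding regular_form_at_def by blast
next
  assume *: "(\<forall>p D. p \<notin> U \<or> D \<notin> tangent_space X p \<longrightarrow> \<omega> p D = 0) \<and> (\<forall>p\<in>U. regular_form_at p \<omega>)"
  have "\<exists>W (m::nat) f g. openin (zariski X) W \<and> p \<in> W \<and> W \<subseteq> U \<and>
      (\<forall>i<m. f i \<in> reg X W \<and> g i \<in> reg X W) \<and>
      (\<forall>q\<in>W. \<forall>D\<in>tangent_space X q. \<omega> q D = (\<Sum>i<m. f i q * D (g i)))" if "p \<in> U" for p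
  proof -
    have p: "p \<in> X" using openin_subset[OF U] that by auto
    have c: "regular_form_at p \<omega>" using * that by blast
    obtain m f g where fg: "\<forall>i<m::nat. f i \<in> reg_at X p \<and> g i \<in> reg_at X p"
      "\<forall>\<^sub>F q in nz p. \<forall>D\<in>tangent_space X q. \<omega> q D = (\<Sum>i<m. f i q * D (g i))"
      using c unfolding regular_form_at_def by blast
    have "\<forall>\<^sub>F q in nz p. \<forall>i\<in>{..<m}. f i \<in> reg_at X q \<and> g i \<in> reg_at X q"
      using fg(1) eventually_reg_at[OF p] by (intro eventually_ball_finite) (auto simp: eventually_conj_iff)
    with fg(2) eventually_nz_openin[OF U that]
    have "\<forall>\<^sub>F q in nz p. q \<in> U \<and> (\<forall>D\<in>tangent_space X q. \<omega> q D = (\<Sum>i<m. f i q * D (g i))) \<and>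
      (\<forall>i<m. f i \<in> reg_at X q \<and> g i \<in> reg_at X q)"
      by eventually_elim auto
    then obtain W where W0: "openin (zariski X) W" "p \<in> W"
      "\<forall>q\<in>W. q \<in> U \<and> (\<forall>D\<in>tangent_space X q. \<omega> q D = (\<Sum>i<m. f i q * D (g i))) \<and>
      (\<forall>i<m. f i \<in> reg_at X q \<and> g i \<in> reg_at X q)" unfolding eventually_nz_open[OF p] by (elim exE conjE) (rule that)
    then have W: "openin (zariski X) W" "p \<in> W" "\<And>q. q \<in> W \<Longrightarrow> q \<in> U"
      "\<And>q D. q \<in> W \<Longrightarrow> D \<in> tangent_space X q \<Longrightarrow> \<omega> q D = (\<Sum>i<m. f i q * D (g i))"
      "\<And>q i. q \<in> W \<Longrightarrow> i < m \<Longrightarrow> f i \<in> reg_at X q \<and> g i \<in> reg_at X q"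
      by auto
    \<comment> \<open>Elements of \<open>reg X W\<close> vanish outside W, so the coefficients are
      cut off there; tangent vectors at points of W do not notice the change.\<close>
    have "\<omega> q D = (\<Sum>i<m. restr W (f i) q * D (restr W (g i)))" if q: "q \<in> W" "D \<in> tangent_space X q" for q D
    proof -
      have "q \<in> X" using openin_subset[OF W(1)] q by auto
      have "D (restr W (g i)) = D (g i)" if "i < m" for i
      proof (rule tangent_cong[OF \<open>q \<in> X\<close> q(2), symmetric])
        show "\<forall>\<^sub>F x in nz q. g i x = restr W (g i) x"
          using eventually_nz_openin[OF W(1) q(1)] by eventually_elim (simp add: restr_def)
      qed (use W(5) q(1) that in blast)
      then show ?thesis using W(4)[OF q] q(1) by (simp add: restr_def)
    qed
    moreover have "restr W (f i) \<in> reg X W \<and> restr W (g i) \<in> reg X W" if "i < m" for i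
      using restr_reg[OF W(1)] W(5) that by blast
    ultimately show ?thesis using W(1,2,3)
      by (intro exI[of _ W] exI[of _ m] exI[of _ "\<lambda>i. restr W (f i)"] exI[of _ "\<lambda>i. restr W (g i)"]) auto
  qed
  then show "\<omega> \<in> canonical X U" using * U by (simp add: canonical_def)
qed

lemma openin_X_self: "openin (zariski X) X"
  using openin_topspace[of "zariski X"] by simp

lemma regular_form_at_cong:
  "regular_form_at p \<omega> \<Longrightarrow> \<forall>\<^sub>F q in nz p. \<forall>D\<in>tangent_space X q. \<omega> q D = \<psi> q D \<Longrightarrow> regular_form_at p \<psi>"
proof -
  assume "regular_form_at p \<omega>" and ev: "\<forall>\<^sub>F q in nz p. \<forall>D\<in>tangent_space X q. \<omega> q D = \<psi> q D"
  then obtain m f g where fg: "\<forall>i<m::nat. f i \<in> reg_at X p \<and> g i \<in> reg_at X p"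
    "\<forall>\<^sub>F q in nz p. \<forall>D\<in>tangent_space X q. \<omega> q D = (\<Sum>i<m. f i q * D (g i))" unfolding regular_form_at_def by blast
  from fg(2) ev have "\<forall>\<^sub>F q in nz p. \<forall>D\<in>tangent_space X q. \<psi> q D = (\<Sum>i<m. f i q * D (g i))"
    by eventually_elim auto
  with fg(1) show ?thesis unfolding regular_form_at_def by blast
qed

lemma regular_form_at_add:
  assumes "regular_form_at p \<omega>" "regular_form_at p \<psi>" shows "regular_form_at p (\<lambda>q D. \<omega> q D + \<psi> q D)"
proof -
  obtain m f g where fg: "\<forall>i<m::nat. f i \<in> reg_at X p \<and> g i \<in> reg_at X p"
    "\<forall>\<^sub>F q in nz p. \<forall>D\<in>tangent_space X q. \<omega> q D = (\<Sum>i<m. f i q * D (g i))"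
    using assms(1) unfolding regular_form_at_def by blast
  obtain n f' g' where fg': "\<forall>i<n::nat. f' i \<in> reg_at X p \<and> g' i \<in> reg_at X p"
    "\<forall>\<^sub>F q in nz p. \<forall>D\<in>tangent_space X q. \<psi> q D = (\<Sum>i<n. f' i q * D (g' i))"
    using assms(2) unfolding regular_form_at_def by blast
  define F G where "F = (\<lambda>i. if i < m then f i else f' (i - m))" and "G = (\<lambda>i. if i < m then g i else g' (i - m))"
  have split: "(\<Sum>i<m + n. F i q * D (G i)) = (\<Sum>i<m. f i q * D (g i)) + (\<Sum>i<n. f' i q * D (g' i))" for q D n
    by (induction n) (auto simp: F_def G_def)
  from fg(2) fg'(2) have "\<forall>\<^sub>F q in nz p. \<forall>D\<in>tangent_space X q. \<omega> q D + \<psi> q D = (\<Sum>i<m + n. F i q * D (G i))"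
    by eventually_elim (simp add: split)
  moreover have "\<forall>i<m + n. F i \<in> reg_at X p \<and> G i \<in> reg_at X p"
    using fg(1) fg'(1) by (auto simp: F_def G_def)
  ultimately show ?thesis unfolding regular_form_at_def by blast
qed

lemma regular_form_at_smul:
  assumes "p \<in> X" "b \<in> reg_at X p" "regular_form_at p \<omega>" shows "regular_form_at p (\<lambda>q D. b q * \<omega> q D)"
proof -
  obtain m f g where fg: "\<forall>i<m::nat. f i \<in> reg_at X p \<and> g i \<in> reg_at X p"
    "\<forall>\<^sub>F q in nz p. \<forall>D\<in>tangent_space X q. \<omega> q D = (\<Sum>i<m. f i q * D (g i))"
    using assms(3) unfolding regular_form_at_def by blast
  from fg(2) have "\<forall>\<^sub>F q in nz p. \<forall>D\<in>tangent_space X q. b q * \<omega> q D = (\<Sum>i<m. (b q * f i q) * D (g i))"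
    by eventually_elim (simp add: sum_distrib_left mult.assoc)
  with fg(1) reg_at_mult[OF assms(1,2)] show ?thesis
    unfolding regular_form_at_def by (intro exI[of _ m] exI[of _ "\<lambda>i q. b q * f i q"] exI[of _ g]) auto
qed

lemma regular_form_at_one: "f \<in> reg_at X p \<Longrightarrow> g \<in> reg_at X p \<Longrightarrow> regular_form_at p (\<lambda>q D. f q * D g)"
  unfolding regular_form_at_def by (intro exI[of _ 1] exI[of _ "\<lambda>_. f"] exI[of _ "\<lambda>_. g"]) auto

lemma regular_form_at_sum:
  "p \<in> X \<Longrightarrow> (\<And>i. i < (m::nat) \<Longrightarrow> f i \<in> reg_at X p \<and> g i \<in> reg_at X p) \<Longrightarrow> regular_form_at p (\<lambda>q D. \<Sum>i<m. f i q * D (g i))"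
  unfolding regular_form_at_def by (intro exI[of _ m] exI[of _ f] exI[of _ g]) auto

lemma regular_form_at_scale_tangent:
  assumes "p \<in> X" "regular_form_at p \<omega>" "D \<in> tangent_space X p" "D' \<in> tangent_space X p" "\<And>f. D f = c * D' f"
  shows "\<omega> p D = c * \<omega> p D'"
proof -
  obtain m f g where fg: "\<forall>\<^sub>F q in nz p. \<forall>D\<in>tangent_space X q. \<omega> q D = (\<Sum>i<m::nat. f i q * D (g i))"
    using assms(2) unfolding regular_form_at_def by blast
  then have "\<omega> p D = (\<Sum>i<m. f i p * D (g i))" "\<omega> p D' = (\<Sum>i<m. f i p * D' (g i))"
    using eventually_nz_self[OF assms(1) fg] assms(3,4) by auto
  then show ?thesis by (simp add: assms(5) sum_distrib_left mult_ac)
qed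

text \<open>The coefficient of \<omega> with respect to dz in the chart of p.\<close>

definition along :: "tangent sec \<Rightarrow> point \<Rightarrow> complex \<Rightarrow> complex" where
  "along \<omega> p z = \<omega> (arc p z) (tvec p z)"

lemma tvec_0_tangent: "p \<in> X \<Longrightarrow> tvec p 0 \<in> tangent_space X p"
  using tvec_tangent[of p 0] arc_0 cr_pos by simp

lemma along_0: "p \<in> X \<Longrightarrow> along \<omega> p 0 = \<omega> p (tvec p 0)"
  by (simp add: along_def arc_0)

lemma along_eventually:
  assumes p: "p \<in> X" and ev: "\<forall>\<^sub>F q in nz p. \<forall>D\<in>tangent_space X q. \<omega> q D = b q * \<psi> q D"
  shows "\<forall>\<^sub>F z in at 0. along \<omega> p z = b (arc p z) * along \<psi> p z"
  using eventually_nz_along_0[OF p ev] by eventually_elim (simp add: along_def tvec_tangent[OF p])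

lemma along_analytic:
  assumes p: "p \<in> X" and c: "regular_form_at p \<omega>" shows "along \<omega> p analytic_on {0}"
proof -
  obtain m f g where fg: "\<forall>i<m::nat. f i \<in> reg_at X p \<and> g i \<in> reg_at X p"
    "\<forall>\<^sub>F q in nz p. \<forall>D\<in>tangent_space X q. \<omega> q D = (\<Sum>i<m. f i q * D (g i))" using c unfolding regular_form_at_def by blast
  have z0: "0 \<in> ball 0 (cr p)" using cr_pos[OF p] by simp
  have "\<forall>\<^sub>F q in nz p. \<forall>i\<in>{..<m}. g i \<in> reg_at X q"
    using fg(1) eventually_reg_at[OF p] by (intro eventually_ball_finite) auto
  with fg(2) have "\<forall>\<^sub>F q in nz p. (\<forall>D\<in>tangent_space X q. \<omega> q D = (\<Sum>i<m. f i q * D (g i))) \<and> (\<forall>i\<in>{..<m}. g i \<in> reg_at X q)"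
    by eventually_elim auto
  then have "\<forall>\<^sub>F q in nz (arc p 0). (\<forall>D\<in>tangent_space X q. \<omega> q D = (\<Sum>i<m. f i q * D (g i))) \<and> (\<forall>i\<in>{..<m}. g i \<in> reg_at X q)"
    by (simp add: arc_0[OF p])
  from eventually_nz_along[OF p z0 this]
  have "\<forall>\<^sub>F z in nhds 0. (\<Sum>i<m. f i (arc p z) * deriv (\<lambda>\<zeta>. g i (arc p \<zeta>)) z) = along \<omega> p z"
    by eventually_elim (auto simp: along_def tvec_tangent[OF p] tvec_def[of p _ "g _"] intro!: sum.cong)
  from analytic_at_cong[OF this refl] show ?thesis
  proof (rule iffD1)
    show "(\<lambda>z. \<Sum>i<m. f i (arc p z) * deriv (\<lambda>\<zeta>. g i (arc p \<zeta>)) z) analytic_on {0}"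
      using fg(1) reg_along_0[OF p] by (intro analytic_intros) (auto intro: analytic_deriv)
  qed
qed

text \<open>
  Writing \<open>g\<^sub>i = g\<^sub>i(p) + u k\<^sub>i\<close> for the local coordinate \<open>u\<close> gives
  \<open>\<Sum> f\<^sub>i dg\<^sub>i = (\<Sum> f\<^sub>i k\<^sub>i) du + u \<Sum> f\<^sub>i dk\<^sub>i\<close>, and the first coefficient vanishes at \<open>p\<close>.
\<close>

lemma regular_form_at_peel:
  assumes p: "p \<in> X" and c: "regular_form_at p \<omega>" and 0: "\<omega> p (tvec p 0) = 0"
  shows "\<exists>\<psi>. regular_form_at p \<psi> \<and> (\<forall>\<^sub>F q in nz p. \<forall>D\<in>tangent_space X q. \<omega> q D = up p q * \<psi> q D)"
proof -
  obtain m f g where fg: "\<forall>i<m::nat. f i \<in> reg_at X p \<and> g i \<in> reg_at X p"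
    "\<forall>\<^sub>F q in nz p. \<forall>D\<in>tangent_space X q. \<omega> q D = (\<Sum>i<m. f i q * D (g i))" using c unfolding regular_form_at_def by blast
  have "\<forall>i\<in>{..<m}. \<exists>k\<in>reg_at X p. \<forall>\<^sub>F q in nz p. g i q - g i p = up p q * k q"
    using fg(1) by (intro ballI up_generates[OF p] reg_at_diff[OF p] reg_at_const[OF p]) auto
  then have "\<exists>k. \<forall>i\<in>{..<m}. k i \<in> reg_at X p \<and> (\<forall>\<^sub>F q in nz p. g i q - g i p = up p q * k i q)"
    unfolding Bex_def by (rule bchoice)
  then obtain k where "\<forall>i\<in>{..<m}. k i \<in> reg_at X p \<and> (\<forall>\<^sub>F q in nz p. g i q - g i p = up p q * k i q)" ..
  then have k: "\<And>i. i < m \<Longrightarrow> k i \<in> reg_at X p"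
    "\<And>i. i < m \<Longrightarrow> \<forall>\<^sub>F q in nz p. g i q - g i p = up p q * k i q" by auto
  have "\<forall>\<^sub>F q in nz p. \<forall>i\<in>{..<m}. g i \<in> reg_at X q \<and> k i \<in> reg_at X q \<and> (\<forall>\<^sub>F x in nz q. g i p + up p x * k i x = g i x)"
  proof (intro eventually_ball_finite ballI)
    fix i assume i: "i \<in> {..<m}"
    then have "\<forall>\<^sub>F q in nz p. g i p + up p q * k i q = g i q" using k(2)[of i] by (auto elim!: eventually_mono simp: algebra_simps)
    from eventually_eventually_nz[OF p this] eventually_reg_at[OF p] fg(1) k(1) i
    show "\<forall>\<^sub>F q in nz p. g i \<in> reg_at X q \<and> k i \<in> reg_at X q \<and> (\<forall>\<^sub>F x in nz q. g i p + up p x * k i x = g i x)"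
      by (auto simp: eventually_conj_iff)
  qed simp
  with eventually_nz_in[OF p] eventually_reg_at[OF p up_reg[OF p]]
  have dg: "\<forall>\<^sub>F q in nz p. \<forall>D\<in>tangent_space X q. \<forall>i<m. D (g i) = up p q * D (k i) + k i q * D (up p)"
  proof eventually_elim
    case (elim q)
    show ?case
    proof (intro ballI allI impI)
      fix D i assume D: "D \<in> tangent_space X q" and i: "i < m"
      have r: "k i \<in> reg_at X q" "g i \<in> reg_at X q" using elim(3) i by auto
      have uk: "(\<lambda>x. up p x * k i x) \<in> reg_at X q" by (rule reg_at_mult[OF elim(1,2) r(1)])
      have guk: "(\<lambda>x. g i p + up p x * k i x) \<in> reg_at X q" by (rule reg_at_add[OF elim(1) reg_at_const[OF elim(1)] uk])
      have "D (g i) = D (\<lambda>x. g i p + up p x * k i x)"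
        using tangent_cong[OF elim(1) D guk, of "g i"] elim(3) i by auto
      also have "\<dots> = up p q * D (k i) + k i q * D (up p)"
        using tangent_cases(2)[OF D reg_at_const[OF elim(1)] uk] tangent_cases(3)[OF D elim(2) r(1)]
          tangent_const[OF elim(1) D] by simp
      finally show "D (g i) = up p q * D (k i) + k i q * D (up p)" .
    qed
  qed
  define \<kappa> where "\<kappa> = (\<lambda>q. \<Sum>i<m. f i q * k i q)"
  have \<kappa>: "\<kappa> \<in> reg_at X p" unfolding \<kappa>_def using fg(1) k(1) by (intro reg_at_sum reg_at_mult p) auto
  have \<omega>_eq: "\<forall>\<^sub>F q in nz p. \<forall>D\<in>tangent_space X q. \<omega> q D = \<kappa> q * D (up p) + up p q * (\<Sum>i<m. f i q * D (k i))"
    using fg(2) dg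
  proof eventually_elim
    case (elim q)
    show ?case
    proof
      fix D assume D: "D \<in> tangent_space X q"
      have "\<omega> q D = (\<Sum>i<m. f i q * (up p q * D (k i) + k i q * D (up p)))"
        using elim D by simp
      also have "\<dots> = \<kappa> q * D (up p) + up p q * (\<Sum>i<m. f i q * D (k i))"
        by (simp add: \<kappa>_def distrib_left sum.distrib sum_distrib_left sum_distrib_right mult_ac)
      finally show "\<omega> q D = \<kappa> q * D (up p) + up p q * (\<Sum>i<m. f i q * D (k i))" .
    qed
  qed
  \<comment> \<open>At p the second term carries the factor \<open>up p p = 0\<close>, and
    \<open>tvec p 0\<close> maps \<open>up p\<close> to 1; so the value of \<omega> at p on this
    vector is exactly \<open>\<kappa> p\<close>.\<close>
  have "\<kappa> p = 0"
    using eventually_nz_self[OF p \<omega>_eq] tvec_0_tangent[OF p] 0 tvec_up[OF p, of 0] cr_pos[OF p] by auto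
  then obtain \<kappa>' where \<kappa>': "\<kappa>' \<in> reg_at X p" "\<forall>\<^sub>F q in nz p. \<kappa> q = up p q * \<kappa>' q"
    using up_generates[OF p \<kappa>] by blast
  have "regular_form_at p (\<lambda>q D. \<kappa>' q * D (up p) + (\<Sum>i<m. f i q * D (k i)))"
    using fg(1) k(1) by (intro regular_form_at_add regular_form_at_one regular_form_at_sum \<kappa>'(1) up_reg p) auto
  moreover have "\<forall>\<^sub>F q in nz p. \<forall>D\<in>tangent_space X q. \<omega> q D = up p q * (\<kappa>' q * D (up p) + (\<Sum>i<m. f i q * D (k i)))"
    using \<omega>_eq \<kappa>'(2) by eventually_elim (simp add: algebra_simps)
  ultimately show ?thesis by blast
qed

text \<open>Vanishing of an analytic coefficient becomes algebraic divisibility by a power of the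
  local coordinate. This is what makes the quotient of a differential by a section with the same
  zeros regular again.\<close>

lemma regular_form_at_factor:
  assumes p: "p \<in> X"
  shows "regular_form_at p \<omega> \<Longrightarrow> vanish (along \<omega> p) n \<Longrightarrow>
    \<exists>\<psi>. regular_form_at p \<psi> \<and> (\<forall>\<^sub>F q in nz p. \<forall>D\<in>tangent_space X q. \<omega> q D = up p q ^ n * \<psi> q D)"
proof (induction n arbitrary: \<omega>)
  case 0
  then show ?case by (intro exI[of _ \<omega>]) auto
next
  case (Suc n)
  obtain h where h: "h analytic_on {0}" "\<forall>\<^sub>F z in at 0. along \<omega> p z = z ^ Suc n * h z"
    using Suc.prems(2) unfolding vanish_def by blast
  have "(h \<longlongrightarrow> h 0) (at 0)" using analytic_at_imp_isCont[OF h(1)] by (simp add: isCont_def)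
  then have "((\<lambda>z. z ^ Suc n * h z) \<longlongrightarrow> 0 ^ Suc n * h 0) (at 0)" by (intro tendsto_intros)
  then have "((\<lambda>z. z ^ Suc n * h z) \<longlongrightarrow> 0) (at 0)" by simp
  then have lim0: "(along \<omega> p \<longlongrightarrow> 0) (at 0)"
    by (rule Lim_transform_eventually) (use h(2) in \<open>auto elim: eventually_mono\<close>)
  have "(along \<omega> p \<longlongrightarrow> along \<omega> p 0) (at 0)"
    using analytic_at_imp_isCont[OF along_analytic[OF p Suc.prems(1)]] by (simp add: isCont_def)
  then have "along \<omega> p 0 = 0" using tendsto_unique[OF _ lim0] by auto
  then have "\<omega> p (tvec p 0) = 0" by (simp only: along_0[OF p])
  from regular_form_at_peel[OF p Suc.prems(1) this] obtain \<psi> where \<psi>: "regular_form_at p \<psi>"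
    "\<forall>\<^sub>F q in nz p. \<forall>D\<in>tangent_space X q. \<omega> q D = up p q * \<psi> q D" by blast
  have "\<forall>\<^sub>F z in at 0. along \<psi> p z = z ^ n * h z"
    using along_eventually[OF p \<psi>(2)] h(2) eventually_at_0_ball[OF cr_pos[OF p]]
    by eventually_elim (simp add: up_arc[OF p])
  then have "vanish (along \<psi> p) n" using h(1) unfolding vanish_def by blast
  from Suc.IH[OF \<psi>(1) this] obtain \<chi>' where \<chi>': "regular_form_at p \<chi>'"
    "\<forall>\<^sub>F q in nz p. \<forall>D\<in>tangent_space X q. \<psi> q D = up p q ^ n * \<chi>' q D" by blast
  from \<psi>(2) \<chi>'(2) have "\<forall>\<^sub>F q in nz p. \<forall>D\<in>tangent_space X q. \<omega> q D = up p q ^ Suc n * \<chi>' q D"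
    by eventually_elim simp
  with \<chi>'(1) show ?case by blast
qed

section \<open>No differential has exactly one simple pole\<close>

text \<open>In the chart of another coordinate b, an affine coordinate with denominator a becomes a
  quotient of regular germs. In this way the local coordinate \<open>up p\<close> is a global
  rational function with a simple zero at p, to which the fibre sum theorem applies.\<close>

lemma rational_ucoord:
  assumes p0: "p0 \<in> X" and a: "rep p0 a \<noteq> 0" shows "rational (ucoord a p0 j)"
  unfolding rational_def
proof
  fix p assume p: "p \<in> X"
  obtain b where b: "rep p b \<noteq> 0" using exists_chart_index[OF p] by blast
  define y0 where "y0 = affine_coord a p0 j"
  define g where "g = (\<lambda>q. affine_coord b q j - y0 * affine_coord b q a)"
  define h where "h = (\<lambda>q. affine_coord b q a)"
  have "(\<lambda>v. v j - y0 * v a) \<in> poly_fun" by (intro poly_fun_diff poly_fun.intros)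
  from reg_at_affine[OF p b this] have g: "g \<in> reg_at X p" by (simp add: g_def)
  have h: "h \<in> reg_at X p" unfolding h_def by (rule reg_at_affine[OF p b poly_fun.coord])
  have ev_b: "\<forall>\<^sub>F q in nz p. rep q b \<noteq> 0" by (rule eventually_form_nonzero[OF p form_coord b])
  have "\<not> (\<forall>\<^sub>F q in nz p. h q = 0)"
  proof
    assume "\<forall>\<^sub>F q in nz p. h q = 0"
    with ev_b have "\<forall>\<^sub>F q in nz p. rep q a = 0" by eventually_elim (simp add: h_def affine_coord_def)
    from eventually_nz_meet[OF p p0 this eventually_form_nonzero[OF p0 form_coord a]] show False by blast
  qed
  moreover have "\<forall>\<^sub>F q in nz p. q \<noteq> p \<longrightarrow> h q \<noteq> 0 \<and> ucoord a p0 j q = g q / h q"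
    using ev_b eventually_nz_finite[OF p finite_form_zeros[OF form_coord p0 a]] eventually_nz_in[OF p]
    by eventually_elim (auto simp: h_def g_def ucoord_def y0_def affine_coord_def field_simps)
  ultimately show "\<exists>g\<in>reg_at X p. \<exists>h\<in>reg_at X p. \<not> (\<forall>\<^sub>F q in nz p. h q = 0) \<and>
     (\<forall>\<^sub>F q in nz p. q \<noteq> p \<longrightarrow> h q \<noteq> 0 \<and> ucoord a p0 j q = g q / h q)" using g h by blast
qed

lemma up_rational: "p \<in> X \<Longrightarrow> rational (up p)"
  unfolding up_def by (rule rational_ucoord[OF _ rep_ca])

lemma infinite_up: "p \<in> X \<Longrightarrow> infinite {q \<in> X. up p q \<noteq> c}"
proof
  assume p: "p \<in> X" and fin: "finite {q \<in> X. up p q \<noteq> c}"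
  have "\<forall>\<^sub>F z in at 0. z - c = 0"
    using eventually_nz_along_0[OF p eventually_nz_finite[OF p fin]] eventually_at_0_ball[OF cr_pos[OF p]]
  proof eventually_elim
    case (elim z)
    then have "arc p z \<noteq> p" "arc p z \<in> X" using arc_neq[OF p] arc_in[OF p] by auto
    then show ?case using elim up_arc[OF p, of z] by auto
  qed
  then have ev: "\<forall>\<^sub>F z in at (0::complex). z = c" by eventually_elim simp
  have "((\<lambda>z. z) \<longlongrightarrow> c) (at (0::complex))" by (rule tendsto_eventually[OF ev])
  then have "c = 0" using tendsto_unique[OF _ _ tendsto_ident_at, of "0::complex" UNIV c] by auto
  with ev have "\<forall>\<^sub>F z in at (0::complex). False" by (auto simp: eventually_at_filter elim!: eventually_mono)
  then show False by simp
qed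

lemma finite_ord_at:
  assumes "rational x" "infinite {q \<in> X. x q \<noteq> 0}" shows "finite {p \<in> X. ord_at x p \<noteq> 0}"
proof -
  have "finite {q \<in> X. x q = 0}"
  proof (rule finite_if_isolated)
    fix p assume "p \<in> X"
    then obtain k where "has_ord (\<lambda>z. x (arc p z)) k" using rational_has_ord[OF assms] by blast
    then show "\<forall>\<^sub>F z in at 0. x (arc p z) \<noteq> 0" by (rule has_ord_eventually_nz)
  qed
  moreover have "{p \<in> X. ord_at x p \<noteq> 0} \<subseteq> {q \<in> X. x \<notin> reg_at X q} \<union> {q \<in> X. x q = 0}"
  proof
    fix p assume p: "p \<in> {p \<in> X. ord_at x p \<noteq> 0}"
    have "ord_at x p = 0" if "x \<in> reg_at X p" "x p \<noteq> 0"
      by (rule ord_at_eq, rule has_ord_analytic_0) (use that p reg_along_0 arc_0 in auto)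
    then show "p \<in> {q \<in> X. x \<notin> reg_at X q} \<union> {q \<in> X. x q = 0}" using p by auto
  qed
  ultimately show ?thesis using rational_finite_irregular[OF assms(1)] finite_subset by blast
qed

text \<open>The residue theorem for f \<omega> with at most one pole, which is simple: there the
  residue is the limit R, and at the other points the same limit is 0.\<close>

theorem no_single_simple_pole:
  assumes p0: "p0 \<in> X" and f: "rational f" and \<omega>: "\<omega> \<in> canonical X X"
    and reg: "\<And>p. p \<in> X \<Longrightarrow> p \<noteq> p0 \<Longrightarrow> ((\<lambda>z. z * (f (arc p z) * along \<omega> p z)) \<longlongrightarrow> 0) (at 0)"
    and pole: "((\<lambda>z. z * (f (arc p0 z) * along \<omega> p0 z)) \<longlongrightarrow> R) (at 0)"
  shows "R = 0"
proof -
  define x where "x = up p0"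
  have x: "rational x" and nc: "infinite {q \<in> X. x q \<noteq> c}" for c
    using up_rational[OF p0] infinite_up[OF p0] by (auto simp: x_def)
  have can: "regular_form_at p \<omega>" if "p \<in> X" for p using \<omega> that unfolding canonical_iff[OF openin_X_self] by blast
  \<comment> \<open>The quotient \<omega>/dx is a function. The factor x has a simple zero at p0 and
    cancels the pole there, so w has the limit R at p0.\<close>
  define w where "w = (\<lambda>q. x q * f q * \<omega> q (tvec q 0) / tvec q 0 x)"
  define Rp where "Rp = (\<lambda>p. if p = p0 then R else 0)"
  have lim: "((\<lambda>z. z * (f (arc p z) * along \<omega> p z)) \<longlongrightarrow> Rp p) (at 0)" if "p \<in> X" for p
    using reg pole that by (auto simp: Rp_def)
  define S where "S = {q \<in> X. x \<notin> reg_at X q \<or> tvec q 0 x = 0} \<union> {q \<in> X. f \<notin> reg_at X q}"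
  have finS: "finite S" unfolding S_def using finite_ramification[OF x nc] rational_finite_irregular[OF f] by blast
  have ord: "\<exists>k. has_ord (\<lambda>z. x (arc p z) - c) k" if "p \<in> X" for p c
    using rational_has_ord[OF rational_diff_const[OF x, of c] _ that] nc[of c] by simp
  \<comment> \<open>Both \<omega> and dx are linear in the tangent vector, so the quotient may be
    computed with the velocity of the chart of p instead of the vector at the centre of each
    chart.\<close>
  have w_along: "w (arc p z) = x (arc p z) * f (arc p z) * along \<omega> p z / tvec p z x"
    if p: "p \<in> X" and z: "z \<in> ball 0 (cr p)" for p z
  proof -
    let ?q = "arc p z"
    have q: "?q \<in> X" by (rule arc_in[OF p z])
    obtain c where c: "c \<noteq> 0" "\<And>f. tvec p z f = c * tvec ?q 0 f" using tvec_change_center[OF p z] by blast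
    have "along \<omega> p z = c * \<omega> ?q (tvec ?q 0)"
      unfolding along_def using regular_form_at_scale_tangent[OF q can[OF q] tvec_tangent[OF p z] tvec_0_tangent[OF q] c(2)] .
    then show ?thesis using c by (simp add: w_def)
  qed
  have tvec_x: "\<forall>\<^sub>F z in at 0. tvec p z x = deriv (\<lambda>\<zeta>. x (arc p \<zeta>) - c) z" if p: "p \<in> X" for p c
    using eventually_nz_along_0[OF p rational_isolated[OF x p]] eventually_at_0_ball[OF cr_pos[OF p]]
  proof eventually_elim
    case (elim z)
    then have xr: "x \<in> reg_at X (arc p z)" using arc_neq[OF p] by auto
    from elim have "(\<lambda>\<zeta>. x (arc p \<zeta>)) field_differentiable (at z)"
      using analytic_on_imp_differentiable_at[OF reg_along[OF p _ xr], of z] by auto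
    then show ?case using xr by (simp add: tvec_def)
  qed
  have key: "((\<lambda>z. (x (arc p z) - c) / (z * deriv (\<lambda>\<zeta>. x (arc p \<zeta>) - c) z) * (z * (f (arc p z) * along \<omega> p z))) \<longlongrightarrow>
      1 / of_int k * Rp p) (at 0)"
    if "p \<in> X" "has_ord (\<lambda>z. x (arc p z) - c) k" "k \<noteq> 0" for p c k
    by (intro tendsto_mult has_ord_deriv(2)[OF that(2,3)] lim[OF that(1)])
  have ord_p0: "has_ord (\<lambda>z. x (arc p0 z)) 1" unfolding x_def by (rule up_has_ord[OF p0])
  have "(\<Sum>p | p \<in> X \<and> ord_at x p \<noteq> 0. of_int (ord_at x p) * (1 / of_int (ord_at x p) * Rp p)) = 0"
  proof (rule sum_ord_mult_limit_eq_0[where w = w, OF ord finS])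
    fix p assume p: "p \<in> X - S"
    then have "p \<in> X" "x \<in> reg_at X p" "f \<in> reg_at X p" "tvec p 0 x \<noteq> 0" by (auto simp: S_def)
    note pX = this
    have an: "(\<lambda>z. x (arc p z)) analytic_on {0}" by (rule reg_along_0[OF pX(1,2)])
    have d: "deriv (\<lambda>z. x (arc p z)) 0 \<noteq> 0" using pX arc_0[OF pX(1)] by (simp add: tvec_def)
    show "(\<lambda>z. x (arc p z)) analytic_on {0} \<and> deriv (\<lambda>z. x (arc p z)) 0 \<noteq> 0" using an d by blast
    have "(\<lambda>z. x (arc p z) * f (arc p z) * along \<omega> p z / deriv (\<lambda>z. x (arc p z)) z) analytic_on {0}"
      using an d reg_along_0[OF pX(1,3)] along_analytic[OF pX(1) can[OF pX(1)]]
      by (intro analytic_on_divide analytic_on_mult) (auto intro: analytic_deriv)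
    note an2 = this
    have "\<forall>\<^sub>F z in nhds 0. x (arc p z) * f (arc p z) * along \<omega> p z / deriv (\<lambda>z. x (arc p z)) z = w (arc p z)"
    proof -
      have z0: "0 \<in> ball 0 (cr p)" using cr_pos[OF pX(1)] by simp
      have "\<forall>\<^sub>F q in nz (arc p 0). x \<in> reg_at X q" using eventually_reg_at[OF pX(1,2)] arc_0[OF pX(1)] by simp
      from eventually_nz_along[OF pX(1) z0 this] show ?thesis
        by eventually_elim (simp add: w_along[OF pX(1)] tvec_def)
    qed
    from analytic_at_cong[OF this refl] an2 show "(\<lambda>z. w (arc p z)) analytic_on {0}" by blast
  next
    fix p c assume p: "p \<in> X" "0 < ord_at (\<lambda>q. x q - c) p"
    obtain k where k: "has_ord (\<lambda>z. x (arc p z) - c) k" using ord[OF p(1)] by blast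
    have k0: "k > 0" using ord_at_eq[of "\<lambda>q. x q - c", OF k] p(2) by simp
    have xc: "((\<lambda>z. x (arc p z)) \<longlongrightarrow> c) (at 0)" using has_ord_limit_0[OF k k0] Lim_null by blast
    \<comment> \<open>\<open>Rp\<close> can be nonzero only at p0, where x has the limit 0, which
      forces c = 0.\<close>
    have "c * Rp p = 0"
    proof (cases "p = p0")
      case True
      have "((\<lambda>z. x (arc p z)) \<longlongrightarrow> 0) (at 0)" unfolding True by (rule has_ord_limit_0[OF ord_p0]) simp
      then show ?thesis using tendsto_unique[OF _ xc] by auto
    qed (simp add: Rp_def)
    moreover have "((\<lambda>z. x (arc p z) * ((x (arc p z) - c) / (z * deriv (\<lambda>\<zeta>. x (arc p \<zeta>) - c) z) * (z * (f (arc p z) * along \<omega> p z)))) \<longlongrightarrow>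
      c * (1 / of_int k * Rp p)) (at 0)"
      using k0 by (intro tendsto_mult xc key[OF p(1) k]) simp
    ultimately have "((\<lambda>z. x (arc p z) * ((x (arc p z) - c) / (z * deriv (\<lambda>\<zeta>. x (arc p \<zeta>) - c) z) * (z * (f (arc p z) * along \<omega> p z)))) \<longlongrightarrow> 0) (at 0)"
      by auto
    moreover have "\<forall>\<^sub>F z in at 0. x (arc p z) * ((x (arc p z) - c) / (z * deriv (\<lambda>\<zeta>. x (arc p \<zeta>) - c) z) * (z * (f (arc p z) * along \<omega> p z)))
      = (x (arc p z) - c) * w (arc p z)"
      using tvec_x[OF p(1), of c] eventually_at_0_ball[OF cr_pos[OF p(1)]]
      by eventually_elim (simp add: w_along[OF p(1)])
    ultimately show "((\<lambda>z. (x (arc p z) - c) * w (arc p z)) \<longlongrightarrow> 0) (at 0)" by (rule Lim_transform_eventually)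
  next
    fix p assume p: "p \<in> X" "ord_at x p \<noteq> 0"
    obtain k where k: "has_ord (\<lambda>z. x (arc p z) - 0) k" using ord[OF p(1)] by blast
    then have kx: "ord_at x p = k" using ord_at_eq[of x p k] by simp
    have "\<forall>\<^sub>F z in at 0. (x (arc p z) - 0) / (z * deriv (\<lambda>\<zeta>. x (arc p \<zeta>) - 0) z) * (z * (f (arc p z) * along \<omega> p z)) = w (arc p z)"
      using tvec_x[OF p(1), of 0] eventually_at_0_ball[OF cr_pos[OF p(1)]]
      by eventually_elim (simp add: w_along[OF p(1)])
    from Lim_transform_eventually[OF key[OF p(1) k] this] p(2) kx
    show "((\<lambda>z. w (arc p z)) \<longlongrightarrow> 1 / of_int (ord_at x p) * Rp p) (at 0)" by simp
  qed
  moreover have "(\<Sum>p | p \<in> X \<and> ord_at x p \<noteq> 0. of_int (ord_at x p) * (1 / of_int (ord_at x p) * Rp p))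
    = (\<Sum>p | p \<in> X \<and> ord_at x p \<noteq> 0. if p = p0 then R else 0)"
    by (rule sum.cong) (auto simp: Rp_def)
  moreover have "ord_at x p0 = 1" by (rule ord_at_eq[OF ord_p0])
  ultimately show ?thesis using p0 finite_ord_at[OF x nc] by simp
qed

end

section \<open>Line bundles\<close>

text \<open>Frames of rank one without index sets and extensional families;
  \<open>frame_on_1\<close> is the translation.\<close>

definition frame1 :: "point set \<Rightarrow> 'i sheaf \<Rightarrow> point set \<Rightarrow> 'i sec \<Rightarrow> bool" where
  "frame1 X L U e \<longleftrightarrow> openin (zariski X) U \<and> e \<in> L U \<and>
     (\<forall>V s. openin (zariski X) V \<and> V \<subseteq> U \<and> s \<in> L V \<longrightarrow> (\<exists>!f. f \<in> reg X V \<and> s = smul f e))"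

lemma frame_on_1:
  "openin (zariski X) U \<Longrightarrow> frame_on X L 1 U e \<longleftrightarrow> frame1 X L U (e 0)"
proof -
  have "(\<exists>!a. a \<in> {..<1::nat} \<rightarrow>\<^sub>E R \<and> s = (\<Sum>i<1. smul (a i) (e i))) \<longleftrightarrow> (\<exists>!f. f \<in> R \<and> s = smul f (e 0))" for R s
  proof
    assume "\<exists>!a. a \<in> {..<1::nat} \<rightarrow>\<^sub>E R \<and> s = (\<Sum>i<1. smul (a i) (e i))"
    then obtain a where "a \<in> {..<1} \<rightarrow>\<^sub>E R \<and> s = (\<Sum>i<1. smul (a i) (e i))"
      and "\<forall>b. b \<in> {..<1} \<rightarrow>\<^sub>E R \<and> s = (\<Sum>i<1. smul (b i) (e i)) \<longrightarrow> b = a" by (rule ex1E)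
    then have a: "a \<in> {..<1} \<rightarrow>\<^sub>E R" "s = (\<Sum>i<1. smul (a i) (e i))"
      and u: "\<And>b. b \<in> {..<1} \<rightarrow>\<^sub>E R \<Longrightarrow> s = (\<Sum>i<1. smul (b i) (e i)) \<Longrightarrow> b = a" by blast+
    show "\<exists>!f. f \<in> R \<and> s = smul f (e 0)"
    proof (rule ex1I[of _ "a 0"])
      show "a 0 \<in> R \<and> s = smul (a 0) (e 0)" using a by (auto dest: PiE_mem)
      fix f assume f: "f \<in> R \<and> s = smul f (e 0)"
      have "(\<lambda>i\<in>{..<1}. f) = a" by (rule u) (use f in auto)
      then show "f = a 0" by auto
    qed
  next
    assume "\<exists>!f. f \<in> R \<and> s = smul f (e 0)"
    then obtain f where f: "f \<in> R" "s = smul f (e 0)" and u: "\<And>g. g \<in> R \<Longrightarrow> s = smul g (e 0) \<Longrightarrow> g = f" by (elim ex1E) auto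
    show "\<exists>!a. a \<in> {..<1::nat} \<rightarrow>\<^sub>E R \<and> s = (\<Sum>i<1. smul (a i) (e i))"
    proof (rule ex1I[of _ "\<lambda>i\<in>{..<1}. f"])
      show "(\<lambda>i\<in>{..<1}. f) \<in> {..<1::nat} \<rightarrow>\<^sub>E R \<and> s = (\<Sum>i<1. smul ((\<lambda>i\<in>{..<1}. f) i) (e i))" using f by auto
      fix a assume a: "a \<in> {..<1::nat} \<rightarrow>\<^sub>E R \<and> s = (\<Sum>i<1. smul (a i) (e i))"
      then have "a 0 = f" by (intro u) (auto dest: PiE_mem)
      then show "a = (\<lambda>i\<in>{..<1}. f)" using a by (auto simp: PiE_def extensional_def fun_eq_iff)
    qed
  qed
  then show "openin (zariski X) U \<Longrightarrow> frame_on X L 1 U e \<longleftrightarrow> frame1 X L U (e 0)"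
    unfolding frame_on_def frame1_def by simp
qed

definition frame_coeff :: "point set \<Rightarrow> point set \<Rightarrow> 'i sec \<Rightarrow> point set \<Rightarrow> 'i sec \<Rightarrow> point \<Rightarrow> complex" where
  "frame_coeff X W e U s = (THE f. f \<in> reg X (U \<inter> W) \<and> restr (U \<inter> W) s = smul f e)"

lemma module_sheafD:
  assumes "module_sheaf X L" "openin (zariski X) U"
  shows "0 \<in> L U" "s \<in> L U \<Longrightarrow> t \<in> L U \<Longrightarrow> s + t \<in> L U" "f \<in> reg X U \<Longrightarrow> s \<in> L U \<Longrightarrow> smul f s \<in> L U"
    "s \<in> L U \<Longrightarrow> p \<notin> U \<Longrightarrow> s p = 0" "openin (zariski X) V \<Longrightarrow> V \<subseteq> U \<Longrightarrow> s \<in> L U \<Longrightarrow> restr V s \<in> L V"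
  using assms unfolding module_sheaf_def by auto

lemma module_sheaf_open: "module_sheaf X L \<Longrightarrow> s \<in> L U \<Longrightarrow> openin (zariski X) U"
  by (rule ccontr) (simp add: module_sheaf_def)

context projective_curve begin

lemma ex_nz: "p \<in> X \<Longrightarrow> eventually A (nz p) \<Longrightarrow> \<exists>q\<in>X. q \<noteq> p \<and> A q"
proof (rule ccontr)
  assume p: "p \<in> X" and A: "eventually A (nz p)" and n: "\<not> (\<exists>q\<in>X. q \<noteq> p \<and> A q)"
  have "X - {p} \<subseteq> {q \<in> X. \<not> A q}" using n by auto
  then have "finite (X - {p})" using finite_not_eventually[OF p A] finite_subset by blast
  then show False using infinite_X by simp
qed

lemma has_ord_pow: "has_ord f k \<Longrightarrow> has_ord (\<lambda>z. f z ^ n) (int n * k)"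
proof (induction n)
  case 0
  show ?case using has_ord_analytic_0[of "\<lambda>_. 1"] by simp
next
  case (Suc n)
  from has_ord_mult[OF Suc.prems Suc.IH[OF Suc.prems]] show ?case by (simp add: algebra_simps)
qed

lemma has_ord_powi: assumes f: "has_ord f l" shows "has_ord (\<lambda>z. f z powi k) (k * l)"
proof (cases "k \<ge> 0")
  case True
  then show ?thesis using has_ord_pow[OF f, of "nat k"] by (simp add: power_int_def)
next
  case False
  then show ?thesis using has_ord_inverse[OF has_ord_pow[OF f, of "nat (- k)"]]
    by (simp add: power_int_def field_simps)
qed

text \<open>\<open>has_order\<close> allows any uniformizer t. As \<open>up p\<close> is a multiple
  of t, the orders of t and of the cofactor add up to 1, and t vanishes at p; so t has order exactly
  1 along the arc.\<close>

lemma has_order_imp_has_ord: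
  assumes p: "p \<in> X" and f: "has_order X p f k"
  shows "has_ord (\<lambda>z. f (arc p z)) k"
proof -
  obtain W t u where W: "openin (zariski X) W" "p \<in> W" and t: "uniformizer X p t" and u: "u \<in> reg X W" "\<forall>q\<in>W. u q \<noteq> 0"
    and eq: "\<forall>q\<in>W - {p}. t q \<noteq> 0 \<and> f q = t q powi k * u q" using f unfolding has_order_def by blast
  have t_reg: "t \<in> reg_at X p" and t0: "t p = 0" using t by (auto simp: uniformizer_def)
  have "\<exists>h\<in>reg_at X p. \<exists>W. openin (zariski X) W \<and> p \<in> W \<and> (\<forall>q\<in>W. up p q = t q * h q)"
    using t up_reg[OF p] by (simp add: uniformizer_def)
  then obtain h where h: "h \<in> reg_at X p" "\<forall>\<^sub>F q in nz p. up p q = t q * h q"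
    unfolding eventually_nz_open[OF p] by blast
  have evW: "\<forall>\<^sub>F q in nz p. q \<in> W" by (rule eventually_nz_openin[OF W])
  have "\<not> (\<forall>\<^sub>F q in nz p. t q = 0)"
  proof
    assume "\<forall>\<^sub>F q in nz p. t q = 0"
    then have "\<forall>\<^sub>F q in nz p. t q = 0 \<and> q \<in> W" using evW by eventually_elim auto
    from ex_nz[OF p this] eq show False by blast
  qed
  then obtain m where m: "has_ord (\<lambda>z. t (arc p z)) (int m)" using reg_has_ord[OF p t_reg] by blast
  have "\<not> (\<forall>\<^sub>F q in nz p. h q = 0)"
  proof
    assume "\<forall>\<^sub>F q in nz p. h q = 0"
    then have "\<forall>\<^sub>F q in nz p. q = p" using h(2) up_nonzero[OF p] by eventually_elim auto
    from ex_nz[OF p this] show False by blast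
  qed
  then obtain n where n: "has_ord (\<lambda>z. h (arc p z)) (int n)" using reg_has_ord[OF p h(1)] by blast
  have "has_ord (\<lambda>z. up p (arc p z)) (int m + int n)"
  proof (rule has_ord_cong[OF has_ord_mult[OF m n]])
    show "\<forall>\<^sub>F z in at 0. t (arc p z) * h (arc p z) = up p (arc p z)"
      using eventually_nz_along_0[OF p h(2)] by eventually_elim simp
  qed
  then have mn: "int m + int n = 1" using has_ord_unique up_has_ord[OF p] by blast
  have "m \<noteq> 0"
  proof
    assume "m = 0"
    then obtain c where "c \<noteq> 0" "((\<lambda>z. t (arc p z)) \<longlongrightarrow> c) (at 0)" using has_ord_limit_nz m by auto
    then show False using tendsto_unique[OF _ reg_along_tendsto[OF p t_reg]] t0 by auto
  qed
  then have m1: "has_ord (\<lambda>z. t (arc p z)) 1" using mn m by (cases "m = 1") auto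
  have ur: "u \<in> reg_at X p" using u(1) W(2) reg_iff[OF W(1)] by blast
  have "u (arc p 0) \<noteq> 0" unfolding arc_0[OF p] using u(2) W(2) by blast
  then have "has_ord (\<lambda>z. u (arc p z)) 0" by (rule has_ord_analytic_0[OF reg_along_0[OF p ur]])
  from has_ord_mult[OF has_ord_powi[OF m1, of k] this]
  have "has_ord (\<lambda>z. t (arc p z) powi k * u (arc p z)) k" by simp
  then show ?thesis
  proof (rule has_ord_cong)
    show "\<forall>\<^sub>F z in at 0. t (arc p z) powi k * u (arc p z) = f (arc p z)"
      using eventually_nz_along_0[OF p evW] eventually_at_0_ball[OF cr_pos[OF p]]
    proof eventually_elim
      case (elim z)
      then have "arc p z \<in> W - {p}" using arc_neq[OF p] by auto
      then show ?case using eq by simp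
    qed
  qed
qed

lemma uniformizer_up: "p \<in> X \<Longrightarrow> uniformizer X p (up p)"
  unfolding uniformizer_def using up_reg[of p] up_generates[of p] eventually_nz_open[of p] by simp

text \<open>The factorisation by \<open>up p\<close>, which is a uniformizer, gives the converse for
  regular germs. The function a has to agree with f only off p, which admits functions that were cut
  off at p.\<close>

lemma has_order_regular:
  assumes p: "p \<in> X" and f: "f \<in> reg_at X p" "has_ord (\<lambda>z. f (arc p z)) (int n)"
    and a: "\<forall>\<^sub>F q in nz p. q \<noteq> p \<longrightarrow> a q = f q"
  shows "has_order X p a (int n)"
proof -
  obtain u where u: "u \<in> reg_at X p" "u p \<noteq> 0" "\<forall>\<^sub>F q in nz p. f q = up p q ^ n * u q"
    using reg_factor[OF p f] by blast
  have "\<forall>\<^sub>F q in nz p. u \<in> reg_at X q \<and> u q \<noteq> 0 \<and> (q \<noteq> p \<longrightarrow> up p q \<noteq> 0 \<and> a q = up p q powi int n * u q)"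
    using eventually_reg_at[OF p u(1)] reg_at_inverse(2)[OF p u(1,2)] up_nonzero[OF p] u(3) a
    by eventually_elim auto
  then obtain W where W: "openin (zariski X) W" "p \<in> W"
    "\<forall>q\<in>W. u \<in> reg_at X q \<and> u q \<noteq> 0 \<and> (q \<noteq> p \<longrightarrow> up p q \<noteq> 0 \<and> a q = up p q powi int n * u q)"
    unfolding eventually_nz_open[OF p] by blast
  have "restr W u \<in> reg X W" using restr_reg[OF W(1)] W(3) by blast
  show ?thesis unfolding has_order_def
  proof (intro exI conjI)
    show "openin (zariski X) W" "p \<in> W" "uniformizer X p (up p)" "restr W u \<in> reg X W"
      by fact+ (rule uniformizer_up[OF p], fact)
    show "\<forall>q\<in>W. restr W u q \<noteq> 0" using W(3) by (simp add: restr_def)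
    show "\<forall>q\<in>W - {p}. up p q \<noteq> 0 \<and> a q = up p q powi int n * restr W u q"
      using W(3) by (simp add: restr_def)
  qed
qed

lemma ratio_has_order:
  assumes p: "p \<in> X" and g: "g \<in> reg_at X p" and a: "has_order X p a k"
    and eq: "\<forall>\<^sub>F q in nz p. q \<noteq> p \<longrightarrow> g q = f q * a q"
  shows "\<exists>g\<in>reg_at X p. \<exists>h\<in>reg_at X p. \<not> (\<forall>\<^sub>F q in nz p. h q = 0) \<and>
     (\<forall>\<^sub>F q in nz p. q \<noteq> p \<longrightarrow> h q \<noteq> 0 \<and> f q = g q / h q)"
proof -
  obtain W t u where W: "openin (zariski X) W" "p \<in> W" and t: "uniformizer X p t" and u: "u \<in> reg X W" "\<forall>q\<in>W. u q \<noteq> 0"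
    and at: "\<forall>q\<in>W - {p}. t q \<noteq> 0 \<and> a q = t q powi k * u q" using a unfolding has_order_def by blast
  have t_reg: "t \<in> reg_at X p" using t by (auto simp: uniformizer_def)
  have ur: "u \<in> reg_at X p" using u(1) W(2) reg_iff[OF W(1)] by blast
  \<comment> \<open>The exponent k may have either sign: its positive part goes into the denominator
    h, its negative part into the numerator.\<close>
  define g' where "g' = (\<lambda>q. g q * t q ^ nat (- k))"
  define h where "h = (\<lambda>q. u q * t q ^ nat k)"
  have "\<forall>\<^sub>F q in nz p. q \<noteq> p \<longrightarrow> h q \<noteq> 0 \<and> f q = g' q / h q"
    using eq eventually_nz_openin[OF W]
  proof eventually_elim
    case (elim q)
    show ?case
    proof
      assume "q \<noteq> p"
      then have *: "t q \<noteq> 0" "a q = t q powi k * u q" "u q \<noteq> 0" "g q = f q * a q" using at u(2) elim by auto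
      then show "h q \<noteq> 0 \<and> f q = g' q / h q"
        by (cases "k \<ge> 0") (auto simp: h_def g'_def power_int_def field_simps)
    qed
  qed
  note ev = this
  have "\<not> (\<forall>\<^sub>F q in nz p. h q = 0)"
  proof
    assume "\<forall>\<^sub>F q in nz p. h q = 0"
    with ev have "\<forall>\<^sub>F q in nz p. q = p" by eventually_elim auto
    from ex_nz[OF p this] show False by blast
  qed
  moreover have "g' \<in> reg_at X p" "h \<in> reg_at X p" unfolding g'_def h_def
    using reg_at_mult[OF p] reg_at_power[OF p t_reg] g ur by auto
  ultimately show ?thesis using ev by blast
qed

end

section \<open>Sections of a line bundle in local frames\<close>

locale line_bundle = projective_curve X N for X N +
  fixes L :: "'i sheaf"
  assumes vb: "vector_bundle X 1 L"
begin

lemma module: "module_sheaf X L"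
  using vb by (simp add: vector_bundle_def)

lemma frame_coeff_props:
  assumes W: "frame1 X L W e" and s: "s \<in> L U"
  shows frame_coeff_reg: "frame_coeff X W e U s \<in> reg X (U \<inter> W)"
    and frame_coeff_eq: "restr (U \<inter> W) s = smul (frame_coeff X W e U s) e"
    and frame_coeff_unique: "\<And>f. f \<in> reg X (U \<inter> W) \<Longrightarrow> restr (U \<inter> W) s = smul f e \<Longrightarrow> frame_coeff X W e U s = f"
proof -
  have U: "openin (zariski X) U" using module_sheaf_open[OF module s] .
  have V: "openin (zariski X) (U \<inter> W)" using U W by (auto simp: frame1_def)
  have "restr (U \<inter> W) s \<in> L (U \<inter> W)" using module_sheafD(5)[OF module U V _ s] by simp
  note r = this
  have "\<forall>V s. openin (zariski X) V \<and> V \<subseteq> W \<and> s \<in> L V \<longrightarrow> (\<exists>!f. f \<in> reg X V \<and> s = smul f e)"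
    using W by (simp add: frame1_def)
  from this[rule_format, of "U \<inter> W" "restr (U \<inter> W) s"] r V
  have ex: "\<exists>!f. f \<in> reg X (U \<inter> W) \<and> restr (U \<inter> W) s = smul f e" by simp
  from theI'[OF this] show "frame_coeff X W e U s \<in> reg X (U \<inter> W)" "restr (U \<inter> W) s = smul (frame_coeff X W e U s) e"
    unfolding frame_coeff_def by auto
  show "frame_coeff X W e U s = f" if "f \<in> reg X (U \<inter> W)" "restr (U \<inter> W) s = smul f e" for f
    unfolding frame_coeff_def using the1_equality[OF ex] that by blast
qed

lemma frame_coeff_at:
  assumes "frame1 X L W e" "s \<in> L U" "q \<in> U" "q \<in> W"
  shows "s q i = frame_coeff X W e U s q * e q i"
proof -
  have "restr (U \<inter> W) s q i = smul (frame_coeff X W e U s) e q i" using frame_coeff_eq[OF assms(1,2)] by simp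
  then show ?thesis using assms by (simp add: restr_def smul_def)
qed

lemma openin_frame: "frame1 X L W e \<Longrightarrow> openin (zariski X) W"
  by (simp add: frame1_def)

lemma frame_coeff_reg_at:
  assumes "frame1 X L W e" "s \<in> L U" "q \<in> U" "q \<in> W"
  shows "frame_coeff X W e U s \<in> reg_at X q"
  using frame_coeff_reg[OF assms(1,2)] assms(3,4) reg_iff[of "U \<inter> W"] module_sheaf_open[OF module assms(2)] openin_frame[OF assms(1)]
  by blast

lemma frame_coeff_outside: "frame1 X L W e \<Longrightarrow> s \<in> L U \<Longrightarrow> q \<notin> U \<inter> W \<Longrightarrow> frame_coeff X W e U s q = 0"
  using frame_coeff_reg[of W e s U] by (auto simp: reg_def)

lemma restr_add_reg:
  assumes "openin (zariski X) U" "f \<in> reg X U" "g \<in> reg X U"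
  shows "(\<lambda>q. f q + g q) \<in> reg X U" "(\<lambda>q. f q * g q) \<in> reg X U"
proof -
  have "U \<subseteq> X" using openin_subset[OF assms(1)] by simp
  then show "(\<lambda>q. f q + g q) \<in> reg X U" "(\<lambda>q. f q * g q) \<in> reg X U"
    using assms(2,3) reg_at_add reg_at_mult unfolding reg_iff[OF assms(1)] by (auto simp: subset_iff)
qed

lemma reg_restrict:
  assumes "openin (zariski X) V" "V \<subseteq> U" "openin (zariski X) U" "f \<in> reg X U"
  shows "restr V f \<in> reg X V"
  using restr_reg[OF assms(1)] assms(2,4) reg_iff[OF assms(3)] by blast

lemma frame_coeff_add:
  assumes W: "frame1 X L W e" and s: "s \<in> L U" "t \<in> L U"
  shows "frame_coeff X W e U (s + t) = (\<lambda>q. frame_coeff X W e U s q + frame_coeff X W e U t q)"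
proof (rule frame_coeff_unique[OF W])
  have U: "openin (zariski X) U" using module_sheaf_open[OF module s(1)] .
  then have V: "openin (zariski X) (U \<inter> W)" using openin_frame[OF W] by blast
  show "s + t \<in> L U" by (rule module_sheafD(2)[OF module U s])
  show "(\<lambda>q. frame_coeff X W e U s q + frame_coeff X W e U t q) \<in> reg X (U \<inter> W)"
    by (rule restr_add_reg(1)[OF V frame_coeff_reg[OF W s(1)] frame_coeff_reg[OF W s(2)]])
  show "restr (U \<inter> W) (s + t) = smul (\<lambda>q. frame_coeff X W e U s q + frame_coeff X W e U t q) e"
    using frame_coeff_at[OF W s(1)] frame_coeff_at[OF W s(2)] frame_coeff_outside[OF W s(1)] frame_coeff_outside[OF W s(2)]
    by (auto simp: fun_eq_iff restr_def smul_def distrib_right)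
qed

lemma frame_coeff_smul:
  assumes W: "frame1 X L W e" and s: "s \<in> L U" and f: "f \<in> reg X U"
  shows "frame_coeff X W e U (smul f s) = (\<lambda>q. f q * frame_coeff X W e U s q)"
proof (rule frame_coeff_unique[OF W])
  have U: "openin (zariski X) U" using module_sheaf_open[OF module s(1)] .
  then have V: "openin (zariski X) (U \<inter> W)" using openin_frame[OF W] by blast
  show "smul f s \<in> L U" by (rule module_sheafD(3)[OF module U f s])
  have "(\<lambda>q. restr (U \<inter> W) f q * frame_coeff X W e U s q) \<in> reg X (U \<inter> W)"
    using reg_restrict[OF V _ U f] by (intro restr_add_reg(2)[OF V] frame_coeff_reg[OF W s(1)]) auto
  moreover have "(\<lambda>q. restr (U \<inter> W) f q * frame_coeff X W e U s q) = (\<lambda>q. f q * frame_coeff X W e U s q)"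
    using frame_coeff_outside[OF W s] by (auto simp: fun_eq_iff restr_def)
  ultimately show "(\<lambda>q. f q * frame_coeff X W e U s q) \<in> reg X (U \<inter> W)" by simp
  show "restr (U \<inter> W) (smul f s) = smul (\<lambda>q. f q * frame_coeff X W e U s q) e"
    using frame_coeff_at[OF W s(1)] frame_coeff_outside[OF W s(1)]
    by (auto simp: fun_eq_iff restr_def smul_def)
qed

lemma frame_coeff_restr:
  assumes W: "frame1 X L W e" and s: "s \<in> L U" and V: "openin (zariski X) V" "V \<subseteq> U"
  shows "frame_coeff X W e V (restr V s) = restr (V \<inter> W) (frame_coeff X W e U s)"
proof (rule frame_coeff_unique[OF W])
  have U: "openin (zariski X) U" using module_sheaf_open[OF module s(1)] .
  show "restr V s \<in> L V" by (rule module_sheafD(5)[OF module U V s])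
  show "restr (V \<inter> W) (frame_coeff X W e U s) \<in> reg X (V \<inter> W)"
    using V openin_frame[OF W] U by (intro reg_restrict[OF _ _ _ frame_coeff_reg[OF W s]]) auto
  show "restr (V \<inter> W) (restr V s) = smul (restr (V \<inter> W) (frame_coeff X W e U s)) e"
    using frame_coeff_at[OF W s(1)] V by (auto simp: fun_eq_iff restr_def smul_def)
qed

lemma frame_section: "frame1 X L W e \<Longrightarrow> e \<in> L W"
  by (simp add: frame1_def)

lemma frame_coeff_change:
  assumes W: "frame1 X L W e" and W': "frame1 X L W' e'" and s: "s \<in> L U"
    and q: "q \<in> U" "q \<in> W" "q \<in> W'"
  shows "frame_coeff X W' e' U s q = frame_coeff X W e U s q * frame_coeff X W' e' W e q"
proof -
  have U: "openin (zariski X) U" using module_sheaf_open[OF module s] .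
  note O = openin_frame[OF W] openin_frame[OF W']
  have UW: "openin (zariski X) (U \<inter> W)" using U O by blast
  have f: "frame_coeff X W e U s \<in> reg X (U \<inter> W)" by (rule frame_coeff_reg[OF W s])
  have e: "restr (U \<inter> W) e \<in> L (U \<inter> W)" using module_sheafD(5)[OF module O(1) UW _ frame_section[OF W]] by simp
  have "restr (U \<inter> W) s = smul (frame_coeff X W e U s) (restr (U \<inter> W) e)"
    using frame_coeff_at[OF W s] frame_coeff_outside[OF W s] by (auto simp: fun_eq_iff restr_def smul_def)
  then have "frame_coeff X W' e' (U \<inter> W) (restr (U \<inter> W) s) q = frame_coeff X W e U s q * frame_coeff X W' e' (U \<inter> W) (restr (U \<inter> W) e) q"
    using frame_coeff_smul[OF W' e f] by simp
  then show ?thesis using q frame_coeff_restr[OF W' s UW] frame_coeff_restr[OF W' frame_section[OF W] UW] by (simp add: restr_def)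
qed

lemma frame_coeff_self:
  assumes W: "frame1 X L W e" and q: "q \<in> W" shows "frame_coeff X W e W e q = 1"
proof -
  have O: "openin (zariski X) W" by (rule openin_frame[OF W])
  have WX: "W \<subseteq> X" using openin_subset[OF O] by simp
  have "restr W (\<lambda>_. 1) \<in> reg X W" by (rule restr_reg[OF O]) (use reg_at_const WX in auto)
  moreover have "restr W e = smul (restr W (\<lambda>_. 1)) e" by (auto simp: fun_eq_iff restr_def smul_def)
  ultimately have "frame_coeff X W e W e = restr W (\<lambda>_. 1)" using frame_coeff_unique[OF W frame_section[OF W], of "restr W (\<lambda>_. 1)"] by simp
  then show ?thesis using q by (simp add: restr_def)
qed

lemma frame_coeff_transition_nonzero:
  assumes W: "frame1 X L W e" and W': "frame1 X L W' e'" and q: "q \<in> W" "q \<in> W'"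
  shows "frame_coeff X W' e' W e q \<noteq> 0"
proof -
  have "frame_coeff X W e W e q = frame_coeff X W' e' W e q * frame_coeff X W e W' e' q"
    by (rule frame_coeff_change[OF W' W frame_section[OF W] q(1) q(2) q(1)])
  then show ?thesis using frame_coeff_self[OF W q(1)] by auto
qed

definition chosen_frame :: "point \<Rightarrow> point set \<times> 'i sec" where
  "chosen_frame p = (SOME We. p \<in> fst We \<and> frame1 X L (fst We) (snd We))"

abbreviation "Wf p \<equiv> fst (chosen_frame p)"
abbreviation "ef p \<equiv> snd (chosen_frame p)"

lemma chosen_frame: assumes "p \<in> X" shows "p \<in> Wf p" "frame1 X L (Wf p) (ef p)"
proof -
  obtain W e where W: "openin (zariski X) W" "p \<in> W" "frame_on X L 1 W e"
    using vb assms unfolding vector_bundle_def by blast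
  have "\<exists>We. p \<in> fst We \<and> frame1 X L (fst We) (snd We)"
    by (rule exI[of _ "(W, e 0)"]) (use W(2) W(3)[unfolded frame_on_1[OF W(1)]] in simp)
  from someI_ex[OF this] show "p \<in> Wf p" "frame1 X L (Wf p) (ef p)"
    unfolding chosen_frame_def by auto
qed

definition germ_coeff :: "point \<Rightarrow> point set \<Rightarrow> 'i sec \<Rightarrow> point \<Rightarrow> complex" where
  "germ_coeff p U s = frame_coeff X (Wf p) (ef p) U s"

lemma germ_coeff_reg: "s \<in> L U \<Longrightarrow> p \<in> U \<Longrightarrow> germ_coeff p U s \<in> reg_at X p"
  unfolding germ_coeff_def using frame_coeff_reg_at[OF chosen_frame(2)] chosen_frame(1) module_sheaf_open[OF module] openin_subset[of "zariski X" U] by auto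

lemma section_in_X: "s \<in> L U \<Longrightarrow> q \<in> U \<Longrightarrow> q \<in> X"
  using module_sheaf_open[OF module] openin_subset[of "zariski X" U] by auto

lemma germ_coeff_at: "s \<in> L U \<Longrightarrow> q \<in> U \<Longrightarrow> s q i = germ_coeff q U s q * ef q q i"
  unfolding germ_coeff_def using frame_coeff_at[OF chosen_frame(2)] chosen_frame(1) section_in_X by auto

lemma germ_coeff_add: "p \<in> X \<Longrightarrow> s \<in> L U \<Longrightarrow> t \<in> L U \<Longrightarrow> germ_coeff p U (s + t) q = germ_coeff p U s q + germ_coeff p U t q"
  unfolding germ_coeff_def using frame_coeff_add[OF chosen_frame(2)] by simp

lemma germ_coeff_smul: "p \<in> X \<Longrightarrow> f \<in> reg X U \<Longrightarrow> s \<in> L U \<Longrightarrow> germ_coeff p U (smul f s) q = f q * germ_coeff p U s q"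
  unfolding germ_coeff_def using frame_coeff_smul[OF chosen_frame(2)] by simp

lemma germ_coeff_restr: "s \<in> L U \<Longrightarrow> openin (zariski X) V \<Longrightarrow> V \<subseteq> U \<Longrightarrow> q \<in> V \<Longrightarrow> germ_coeff q V (restr V s) q = germ_coeff q U s q"
  unfolding germ_coeff_def using frame_coeff_restr[OF chosen_frame(2), of q s U V] chosen_frame(1)[of q] section_in_X[of s U q] by (auto simp: restr_def)

text \<open>Coefficients in the frame chosen at q itself need not depend regularly on q. The
  transition factor is the same for all sections, however, so it cancels in quotients of two
  sections and does not affect where a section vanishes.\<close>

definition transition :: "point \<Rightarrow> point \<Rightarrow> complex" where
  "transition p q = frame_coeff X (Wf q) (ef q) (Wf p) (ef p) q"

lemma germ_coeff_change:
  "p \<in> X \<Longrightarrow> q \<in> Wf p \<Longrightarrow> s \<in> L U \<Longrightarrow> q \<in> U \<Longrightarrow> germ_coeff q U s q = germ_coeff p U s q * transition p q"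
  unfolding germ_coeff_def transition_def using section_in_X chosen_frame by (intro frame_coeff_change) auto

lemma transition_nonzero: "p \<in> X \<Longrightarrow> q \<in> Wf p \<Longrightarrow> q \<in> X \<Longrightarrow> transition p q \<noteq> 0"
  unfolding transition_def using chosen_frame by (intro frame_coeff_transition_nonzero) auto

lemma eventually_Wf: "p \<in> X \<Longrightarrow> \<forall>\<^sub>F q in nz p. q \<in> Wf p"
  using chosen_frame openin_frame by (intro eventually_nz_openin) auto

lemma eventually_cf_change:
  assumes p: "p \<in> X"
  shows "\<forall>\<^sub>F q in nz p. q \<in> X \<and> transition p q \<noteq> 0 \<and> (\<forall>U s. s \<in> L U \<longrightarrow> q \<in> U \<longrightarrow> germ_coeff q U s q = germ_coeff p U s q * transition p q)"
  using eventually_Wf[OF p] eventually_nz_in[OF p]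
  by eventually_elim (use germ_coeff_change[OF p] transition_nonzero[OF p] in blast)

definition zero_order :: "'i sec \<Rightarrow> point \<Rightarrow> nat" where
  "zero_order s p = (THE n. has_ord (\<lambda>z. germ_coeff p X s (arc p z)) (int n))"

text \<open>Identity theorem: the open set where a nonzero section does not vanish would meet the
  neighbourhood of p on which it vanishes.\<close>

lemma section_zero_near:
  assumes s: "s \<in> L X" and p: "p \<in> X" and ev: "\<forall>\<^sub>F q in nz p. germ_coeff p X s q = 0"
  shows "s = 0"
proof (rule ccontr)
  assume "s \<noteq> 0"
  then obtain q i where qi: "s q i \<noteq> 0" by (auto simp: fun_eq_iff)
  have q: "q \<in> X"
  proof (rule ccontr)
    assume "q \<notin> X"
    then have "s q = 0" using module_sheafD(4)[OF module openin_X_self s] by blast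
    then show False using qi by simp
  qed
  have "germ_coeff q X s q \<noteq> 0" using germ_coeff_at[OF s q, of i] qi by auto
  then have "\<forall>\<^sub>F x in nz q. germ_coeff q X s x \<noteq> 0" by (rule reg_at_inverse(2)[OF q germ_coeff_reg[OF s q]])
  then have A: "\<forall>\<^sub>F x in nz q. x \<in> X \<and> germ_coeff x X s x \<noteq> 0" using eventually_cf_change[OF q]
    by eventually_elim (use s in auto)
  have B: "\<forall>\<^sub>F x in nz p. x \<in> X \<longrightarrow> germ_coeff x X s x = 0" using eventually_cf_change[OF p] ev
    by eventually_elim (use s in auto)
  from eventually_nz_meet[OF q p A B] show False by blast
qed

lemma zero_order:
  assumes s: "s \<in> L X" "s \<noteq> 0" and p: "p \<in> X"
  shows "has_ord (\<lambda>z. germ_coeff p X s (arc p z)) (int (zero_order s p))"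
proof -
  have "\<not> (\<forall>\<^sub>F q in nz p. germ_coeff p X s q = 0)" using section_zero_near[OF s(1) p] s(2) by blast
  from reg_has_ord[OF p germ_coeff_reg[OF s(1) p] this] obtain n where n: "has_ord (\<lambda>z. germ_coeff p X s (arc p z)) (int n)" by blast
  have "zero_order s p = n" unfolding zero_order_def
  proof (rule the_equality[where P = "\<lambda>n. has_ord (\<lambda>z. germ_coeff p X s (arc p z)) (int n)", OF n])
    fix m assume "has_ord (\<lambda>z. germ_coeff p X s (arc p z)) (int m)"
    from has_ord_unique[OF this n] show "m = n" by simp
  qed
  then show ?thesis using n by simp
qed

lemma nonvanishing_open:
  assumes s: "s \<in> L X"
  shows "openin (zariski X) {q \<in> X. germ_coeff q X s q \<noteq> 0}"
proof (subst openin_subopen, intro ballI)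
  fix q assume "q \<in> {q \<in> X. germ_coeff q X s q \<noteq> 0}"
  then have q: "q \<in> X" "germ_coeff q X s q \<noteq> 0" by auto
  have "\<forall>\<^sub>F x in nz q. germ_coeff q X s x \<noteq> 0" by (rule reg_at_inverse(2)[OF q(1) germ_coeff_reg[OF s q(1)] q(2)])
  then have "\<forall>\<^sub>F x in nz q. x \<in> {q \<in> X. germ_coeff q X s q \<noteq> 0}" using eventually_cf_change[OF q(1)]
    by eventually_elim (use s in auto)
  then show "\<exists>T. openin (zariski X) T \<and> q \<in> T \<and> T \<subseteq> {q \<in> X. germ_coeff q X s q \<noteq> 0}"
    unfolding eventually_nz_open[OF q(1)] by blast
qed

lemma nonvanishing_frame:
  assumes s: "s \<in> L X"
  defines "U \<equiv> {q \<in> X. germ_coeff q X s q \<noteq> 0}"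
  shows "frame1 X L U (restr U s)"
  unfolding frame1_def
proof (intro conjI allI impI)
  show U: "openin (zariski X) U" unfolding U_def by (rule nonvanishing_open[OF s])
  have UX: "U \<subseteq> X" by (auto simp: U_def)
  show "restr U s \<in> L U" by (rule module_sheafD(5)[OF module openin_X_self U UX s])
  fix V t assume *: "openin (zariski X) V \<and> V \<subseteq> U \<and> t \<in> L V"
  then have V: "openin (zariski X) V" "V \<subseteq> U" and t: "t \<in> L V" by auto
  define f where "f = restr V (\<lambda>q. germ_coeff q V t q / germ_coeff q X s q)"
  have nz: "germ_coeff q X s q \<noteq> 0" "q \<in> X" if "q \<in> V" for q using that V(2) by (auto simp: U_def)
  have "(\<lambda>q. germ_coeff q V t q / germ_coeff q X s q) \<in> reg_at X p" if p: "p \<in> V" for p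
  proof (rule reg_at_cong[OF nz(2)[OF p] reg_at_divide])
    show "germ_coeff p V t \<in> reg_at X p" "germ_coeff p X s \<in> reg_at X p" "germ_coeff p X s p \<noteq> 0" "p \<in> X"
      using germ_coeff_reg[OF t p] germ_coeff_reg[OF s nz(2)[OF p]] nz[OF p] by auto
    show "\<forall>\<^sub>F q in nz p. germ_coeff p V t q / germ_coeff p X s q = germ_coeff q V t q / germ_coeff q X s q"
      using eventually_cf_change[OF nz(2)[OF p]] eventually_nz_openin[OF V(1) p]
      by eventually_elim (use s t in auto)
  qed
  then have f: "f \<in> reg X V" unfolding f_def by (rule restr_reg[OF V(1)])
  have tf: "t = smul f (restr U s)"
  proof (intro ext)
    fix q i
    show "t q i = smul f (restr U s) q i"
    proof (cases "q \<in> V")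
      case True
      then show ?thesis using germ_coeff_at[OF t True, of i] germ_coeff_at[OF s nz(2)[OF True], of i] nz[OF True] V(2)
        by (auto simp: smul_def restr_def f_def)
    next
      case False
      then show ?thesis using module_sheafD(4)[OF module V(1) t] by (simp add: smul_def f_def restr_def)
    qed
  qed
  show "\<exists>!f. f \<in> reg X V \<and> t = smul f (restr U s)"
  proof (rule ex1I[of _ f])
    fix g assume g: "g \<in> reg X V \<and> t = smul g (restr U s)"
    have sV: "restr V s \<in> L V" by (rule module_sheafD(5)[OF module openin_X_self V(1) _ s]) (use V UX in auto)
    have tg: "t = smul g (restr V s)" using g V(2) by (auto simp: fun_eq_iff smul_def restr_def reg_def)
    show "g = f"
    proof
      fix q
      show "g q = f q"
      proof (cases "q \<in> V")
        case True
        have "germ_coeff q V t q = g q * germ_coeff q V (restr V s) q" using g tg germ_coeff_smul[OF nz(2)[OF True] _ sV, of g] by simp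
        also have "germ_coeff q V (restr V s) q = germ_coeff q X s q" using germ_coeff_restr[OF s V(1) _ True] V UX by auto
        finally show ?thesis using True nz[OF True] by (simp add: f_def restr_def)
      qed (use g f in \<open>auto simp: reg_def\<close>)
    qed
  qed (use f tf in blast)
qed

section \<open>The degree of a line bundle as the number of zeros of a section\<close>

lemma det_order_1:
  "det_order X 1 L U s p k \<longleftrightarrow> (\<exists>W e a. p \<in> W \<and> frame1 X L W e \<and>
     a \<in> reg X (U \<inter> W) \<and> restr (U \<inter> W) (s 0) = smul a e \<and> has_order X p a k)" (is "?l \<longleftrightarrow> ?r")
proof -
  have d: "(\<lambda>q. Determinant.det (Matrix.mat 1 1 (\<lambda>(i, j). a i j q))) = a 0 0" for a :: "nat \<Rightarrow> nat \<Rightarrow> point \<Rightarrow> complex"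
    by (rule ext, subst det_single) auto
  have "?l \<longleftrightarrow> (\<exists>W e (a :: nat \<Rightarrow> nat \<Rightarrow> point \<Rightarrow> complex). openin (zariski X) W \<and> p \<in> W \<and> frame_on X L 1 W e \<and>
        a 0 0 \<in> reg X (U \<inter> W) \<and>
        restr (U \<inter> W) (s 0) = smul (a 0 0) (e 0) \<and>
        has_order X p (a 0 0) k)" (is "_ = ?m") unfolding det_order_def d by simp
  also have "?m \<longleftrightarrow> ?r"
  proof
    assume ?m
    then obtain W e a where m: "openin (zariski X) W" "p \<in> W" "frame_on X L 1 W e"
        "a 0 0 \<in> reg X (U \<inter> W)" "restr (U \<inter> W) (s 0) = smul (a 0 0) (e 0)"
        "has_order X p (a 0 0) k" by (elim exE conjE) (rule that)
    show ?r using m frame_on_1[OF m(1)] by (intro exI[of _ W] exI[of _ "e 0"] exI[of _ "a 0 0"]) auto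
  next
    assume ?r
    then obtain W e a where m: "p \<in> W" "frame1 X L W e"
        "a \<in> reg X (U \<inter> W)" "restr (U \<inter> W) (s 0) = smul a e"
        "has_order X p a k" by (elim exE conjE) (rule that)
    show ?m using m openin_frame[OF m(2)] m(2)[folded frame_on_1[OF openin_frame[OF m(2)], of L "\<lambda>_. e"]]
      by (intro exI[of _ W] exI[of _ "\<lambda>_. e"] exI[of _ "\<lambda>_ _. a"] conjI)
  qed
  finally show ?thesis .
qed

text \<open>The ratio of two rational sections is a rational function, whose divisor has degree zero.\<close>

lemma degree_unique:
  assumes s0: "s0 \<in> L X" "s0 \<noteq> 0" and U: "openin (zariski X) U" "U \<noteq> {}" "frame_on X L 1 U s"
    and k: "\<And>p. p \<in> X \<Longrightarrow> det_order X 1 L U s p (k p)"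
  shows "finite {p \<in> X. zero_order s0 p \<noteq> 0}"
    "(\<Sum>p | p \<in> X \<and> k p \<noteq> 0. k p) = (\<Sum>p | p \<in> X \<and> zero_order s0 p \<noteq> 0. int (zero_order s0 p))"
proof -
  let ?D = "zero_order s0"
  have F: "frame1 X L U (s 0)" using U(3) unfolding frame_on_1[OF U(1)] .
  have UX: "U \<subseteq> X" using openin_subset[OF U(1)] by simp
  define f where "f = frame_coeff X U (s 0) X s0"
  have fU: "s0 q i = f q * s 0 q i" if "q \<in> U" for q i
    unfolding f_def using frame_coeff_at[OF F s0(1) _ that] UX that by auto
  have local: "\<exists>g a. g \<in> reg_at X p \<and> has_ord (\<lambda>z. g (arc p z)) (int (?D p)) \<and> has_order X p a (k p) \<and>
      (\<forall>\<^sub>F q in nz p. q \<noteq> p \<longrightarrow> g q = f q * a q)" if p: "p \<in> X" for p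
  proof -
    obtain W e a where m: "p \<in> W" "frame1 X L W e" "a \<in> reg X (U \<inter> W)" "restr (U \<inter> W) (s 0) = smul a e"
        "has_order X p a (k p)" using k[OF p] unfolding det_order_1 by (elim exE conjE) (rule that)
    note O = openin_frame[OF m(2)]
    have a: "a = frame_coeff X W e U (s 0)" using frame_coeff_unique[OF m(2) frame_section[OF F] m(3,4)] by simp
    define g where "g = frame_coeff X W e X s0"
    have gr: "g \<in> reg_at X p" unfolding g_def by (rule frame_coeff_reg_at[OF m(2) s0(1) p m(1)])
    have "finite (X - (U \<inter> W))"
    proof (rule openin_cofinite)
      show "openin (zariski X) (U \<inter> W)" using U(1) O by blast
      show "U \<inter> W \<noteq> {}" using openin_meet[OF U(1) O U(2)] m(1) by blast
    qed
    from eventually_nz_finite[OF p this] eventually_nz_in[OF p]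
    have "\<forall>\<^sub>F q in nz p. q \<noteq> p \<longrightarrow> g q = f q * a q"
    proof eventually_elim
      case (elim q)
      show ?case
      proof
        assume "q \<noteq> p"
        then have "q \<in> U" "q \<in> W" "q \<in> X" using elim by auto
        then show "g q = f q * a q" using frame_coeff_change[OF F m(2) s0(1), of q] by (simp add: g_def f_def a)
      qed
    qed
    moreover have "has_ord (\<lambda>z. g (arc p z)) (int (?D p))"
    proof -
      define c where "c = frame_coeff X W e (Wf p) (ef p)"
      have cr: "c \<in> reg_at X p" unfolding c_def using frame_coeff_reg_at[OF m(2) frame_section[OF chosen_frame(2)[OF p]] chosen_frame(1)[OF p] m(1)] .
      have c0: "c p \<noteq> 0" unfolding c_def by (rule frame_coeff_transition_nonzero[OF chosen_frame(2)[OF p] m(2) chosen_frame(1)[OF p] m(1)])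
      have "has_ord (\<lambda>z. c (arc p z)) 0"
        by (rule has_ord_analytic_0) (use reg_along_0[OF p cr] c0 arc_0[OF p] in auto)
      from has_ord_mult[OF zero_order[OF s0 p] this]
      have "has_ord (\<lambda>z. germ_coeff p X s0 (arc p z) * c (arc p z)) (int (?D p))" by simp
      then show ?thesis
      proof (rule has_ord_cong)
        have "\<forall>\<^sub>F q in nz p. germ_coeff p X s0 q * c q = g q"
          using eventually_Wf[OF p] eventually_nz_openin[OF O m(1)] eventually_nz_in[OF p]
          by eventually_elim (simp add: germ_coeff_def c_def g_def frame_coeff_change[OF chosen_frame(2)[OF p] m(2) s0(1)])
        from eventually_nz_along_0[OF p this]
        show "\<forall>\<^sub>F z in at 0. germ_coeff p X s0 (arc p z) * c (arc p z) = g (arc p z)" by eventually_elim simp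
      qed
    qed
    ultimately show ?thesis using gr m(5) by blast
  qed
  have rat: "rational f" unfolding rational_def using local ratio_has_order by meson
  have ord: "has_ord (\<lambda>z. f (arc p z)) (int (?D p) - k p)" if p: "p \<in> X" for p
  proof -
    obtain g a where ga: "has_ord (\<lambda>z. g (arc p z)) (int (?D p))" "has_order X p a (k p)"
      "\<forall>\<^sub>F q in nz p. q \<noteq> p \<longrightarrow> g q = f q * a q" using local[OF p] by blast
    note h = has_order_imp_has_ord[OF p ga(2)]
    from has_ord_divide[OF ga(1) h] show ?thesis
    proof (rule has_ord_cong)
      show "\<forall>\<^sub>F z in at 0. g (arc p z) / a (arc p z) = f (arc p z)"
        using eventually_nz_along_0[OF p ga(3)] has_ord_eventually_nz[OF h] eventually_at_0_ball[OF cr_pos[OF p]]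
      proof eventually_elim
        case (elim z)
        then have "arc p z \<noteq> p" using arc_neq[OF p] by auto
        then show ?case using elim by simp
      qed
    qed
  qed
  then have ordf: "ord_at f p = int (?D p) - k p" if "p \<in> X" for p using ord_at_eq that by blast
  define U0 where "U0 = {q \<in> X. germ_coeff q X s0 q \<noteq> 0}"
  have U0: "openin (zariski X) U0" unfolding U0_def by (rule nonvanishing_open[OF s0(1)])
  have "U0 \<noteq> {}"
  proof
    assume "U0 = {}"
    then have "germ_coeff q X s0 q = 0" if "q \<in> X" for q using that by (auto simp: U0_def)
    then have "s0 q i = 0" for q i using germ_coeff_at[OF s0(1), of q i] module_sheafD(4)[OF module openin_X_self s0(1), of q] by (cases "q \<in> X") auto
    then show False using s0(2) by (auto simp: fun_eq_iff)
  qed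
  then have fin0: "finite (X - U0)" by (rule openin_cofinite[OF U0])
  have D0: "?D q = 0" if q: "q \<in> U0" for q
  proof -
    have qX: "q \<in> X" "germ_coeff q X s0 q \<noteq> 0" using q by (auto simp: U0_def)
    have "has_ord (\<lambda>z. germ_coeff q X s0 (arc q z)) 0"
      by (rule has_ord_analytic_0) (use reg_along_0[OF qX(1) germ_coeff_reg[OF s0(1) qX(1)]] qX arc_0 in auto)
    then show ?thesis using has_ord_unique[OF zero_order[OF s0 qX(1)]] by fastforce
  qed
  have "{p \<in> X. ?D p \<noteq> 0} \<subseteq> X - U0" using D0 by auto
  then show finD: "finite {p \<in> X. ?D p \<noteq> 0}" using fin0 finite_subset by blast
  have f0: "f q \<noteq> 0" if "q \<in> U \<inter> U0" for q
  proof
    assume "f q = 0"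
    have qX: "q \<in> X" using that by (auto simp: U0_def)
    have "germ_coeff q X s0 q = f q * frame_coeff X (Wf q) (ef q) U (s 0) q"
      unfolding germ_coeff_def f_def by (rule frame_coeff_change[OF F chosen_frame(2)[OF qX] s0(1) qX]) (use that chosen_frame(1)[OF qX] in auto)
    then show False using that \<open>f q = 0\<close> by (simp add: U0_def)
  qed
  have inf: "infinite {q \<in> X. f q \<noteq> 0}"
  proof
    assume fin: "finite {q \<in> X. f q \<noteq> 0}"
    have "X \<subseteq> {q \<in> X. f q \<noteq> 0} \<union> (X - U) \<union> (X - U0)" using f0 by auto
    moreover have "finite (X - U)" by (rule openin_cofinite[OF U(1,2)])
    ultimately have "finite X" using fin fin0 finite_subset by blast
    then show False using infinite_X by simp
  qed
  \<comment> \<open>The three sums have different supports. Over this common finite set they are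
    related termwise by \<open>ordf\<close>.\<close>
  let ?S = "{p \<in> X. ?D p \<noteq> 0} \<union> {p \<in> X. ord_at f p \<noteq> 0}"
  have fo: "finite {p \<in> X. ord_at f p \<noteq> 0}" by (rule finite_ord_at[OF rat inf])
  then have fS: "finite ?S" using finD by simp
  have "(\<Sum>p | p \<in> X \<and> k p \<noteq> 0. k p) = (\<Sum>p\<in>?S. k p)"
    by (rule sum.mono_neutral_left[OF fS]) (use ordf in auto)
  also have "\<dots> = (\<Sum>p\<in>?S. int (?D p) - ord_at f p)" by (rule sum.cong) (use ordf in auto)
  also have "\<dots> = (\<Sum>p\<in>?S. int (?D p)) - (\<Sum>p\<in>?S. ord_at f p)" by (rule sum_subtractf)
  also have "(\<Sum>p\<in>?S. ord_at f p) = (\<Sum>p | p \<in> X \<and> ord_at f p \<noteq> 0. ord_at f p)"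
    by (rule sum.mono_neutral_right[OF fS]) auto
  also have "\<dots> = 0" by (rule degree_principal[OF rat inf])
  also have "(\<Sum>p\<in>?S. int (?D p)) = (\<Sum>p | p \<in> X \<and> ?D p \<noteq> 0. int (?D p))"
    by (rule sum.mono_neutral_right[OF fS]) auto
  finally show "(\<Sum>p | p \<in> X \<and> k p \<noteq> 0. k p) = (\<Sum>p | p \<in> X \<and> ?D p \<noteq> 0. int (?D p))" by simp
qed

text \<open>Off its zeros a nonzero section is itself a frame, and for this frame the orders in the
  definition of \<open>degree\<close> are its zero orders. This is the existence part of the
  definite description.\<close>

lemma degree_exists:
  assumes s0: "s0 \<in> L X" "s0 \<noteq> 0"
  defines "U \<equiv> {q \<in> X. germ_coeff q X s0 q \<noteq> 0}"
  shows "openin (zariski X) U" "U \<noteq> {}" "frame_on X L 1 U (\<lambda>_. restr U s0)"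
    "p \<in> X \<Longrightarrow> det_order X 1 L U (\<lambda>_. restr U s0) p (int (zero_order s0 p))"
proof -
  show U: "openin (zariski X) U" unfolding U_def by (rule nonvanishing_open[OF s0(1)])
  have UX: "U \<subseteq> X" by (auto simp: U_def)
  show "U \<noteq> {}"
  proof
    assume "U = {}"
    then have "germ_coeff q X s0 q = 0" if "q \<in> X" for q using that by (auto simp: U_def)
    then have "s0 q i = 0" for q i using germ_coeff_at[OF s0(1), of q i] module_sheafD(4)[OF module openin_X_self s0(1), of q] by (cases "q \<in> X") auto
    then show False using s0(2) by (auto simp: fun_eq_iff)
  qed
  have F: "frame1 X L U (restr U s0)" unfolding U_def by (rule nonvanishing_frame[OF s0(1)])
  then show "frame_on X L 1 U (\<lambda>_. restr U s0)" unfolding frame_on_1[OF U] .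
  assume p: "p \<in> X"
  let ?W = "Wf p" and ?e = "ef p"
  note W = chosen_frame(2)[OF p] and O = openin_frame[OF chosen_frame(2)[OF p]]
  define a where "a = frame_coeff X ?W ?e U (restr U s0)"
  have sU: "restr U s0 \<in> L U" by (rule frame_section[OF F])
  have ar: "a \<in> reg X (U \<inter> ?W)" "restr (U \<inter> ?W) (restr U s0) = smul a ?e"
    unfolding a_def using frame_coeff_reg[OF W sU] frame_coeff_eq[OF W sU] by auto
  have aeq: "a = restr (U \<inter> ?W) (germ_coeff p X s0)" unfolding a_def germ_coeff_def by (rule frame_coeff_restr[OF W s0(1) U UX])
  \<comment> \<open>If p is a zero of s0, it lies outside U and a is cut off to 0 there;
    \<open>has_order\<close> only looks at a punctured neighbourhood of p.\<close>
  have "has_order X p a (int (zero_order s0 p))"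
  proof (rule has_order_regular[OF p germ_coeff_reg[OF s0(1) p] zero_order[OF s0 p]])
    show "\<forall>\<^sub>F q in nz p. q \<noteq> p \<longrightarrow> a q = germ_coeff p X s0 q"
      using eventually_cf_change[OF p] eventually_Wf[OF p]
      by eventually_elim (use s0(1) in \<open>auto simp: aeq restr_def U_def\<close>)
  qed
  then show "det_order X 1 L U (\<lambda>_. restr U s0) p (int (zero_order s0 p))"
    unfolding det_order_1 using ar W chosen_frame(1)[OF p] by (intro exI[of _ ?W] exI[of _ ?e] exI[of _ a]) auto
qed

theorem degree_eq:
  assumes s0: "s0 \<in> L X" "s0 \<noteq> 0"
  shows "degree X 1 L = (\<Sum>p | p \<in> X \<and> zero_order s0 p \<noteq> 0. int (zero_order s0 p))"
  unfolding degree_def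
proof (rule the_equality)
  note e = degree_exists[OF s0]
  show "\<exists>U s k. openin (zariski X) U \<and> U \<noteq> {} \<and> frame_on X L 1 U s \<and> (\<forall>p\<in>X. det_order X 1 L U s p (k p)) \<and>
      (\<Sum>p | p \<in> X \<and> zero_order s0 p \<noteq> 0. int (zero_order s0 p)) = (\<Sum>p | p \<in> X \<and> k p \<noteq> 0. k p)"
    by (rule exI, rule exI, rule exI[of _ "\<lambda>p. int (zero_order s0 p)"], intro conjI ballI, rule e(1), rule e(2), rule e(3), rule e(4)) auto
  fix d assume "\<exists>U s k. openin (zariski X) U \<and> U \<noteq> {} \<and> frame_on X L 1 U s \<and> (\<forall>p\<in>X. det_order X 1 L U s p (k p)) \<and>
      d = (\<Sum>p | p \<in> X \<and> k p \<noteq> 0. k p)"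
  then obtain U s k where "openin (zariski X) U" "U \<noteq> {}" "frame_on X L 1 U s" "\<forall>p\<in>X. det_order X 1 L U s p (k p)"
      "d = (\<Sum>p | p \<in> X \<and> k p \<noteq> 0. k p)" by (elim exE conjE) (rule that)
  then show "d = (\<Sum>p | p \<in> X \<and> zero_order s0 p \<noteq> 0. int (zero_order s0 p))"
    using degree_unique(2)[OF s0, of U s k] by simp
qed

lemma finite_supp_order:
  assumes "s0 \<in> L X" "s0 \<noteq> 0" shows "finite {p \<in> X. zero_order s0 p \<noteq> 0}"
  by (rule degree_unique(1)[OF assms degree_exists(1-3)[OF assms]]) (rule degree_exists(4)[OF assms])

end

section \<open>Dimensions of spaces of sections\<close>

lemma dim_mono_finite:
  fixes S T :: "'i sec set"
  assumes "T \<subseteq> S" "finite C" "S \<subseteq> sec.span C" shows "sec.dim T \<le> sec.dim S"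
proof -
  obtain B where B: "B \<subseteq> S" "sec.independent B" "S \<subseteq> sec.span B" "card B = sec.dim S" by (rule sec.basis_exists)
  have "finite B" using sec.independent_span_bound[OF assms(2) B(2)] B(1) assms(3) by blast
  then show ?thesis using sec.dim_le_card[of T B] B assms(1) by auto
qed

text \<open>Codimension at most 1 without quotient spaces: any one element outside T, added to a
  basis of T, spans S. The finite spanning set excludes infinite-dimensional spaces, whose
  \<open>sec.dim\<close> is 0 by default.\<close>

lemma dim_step:
  fixes S T :: "'i sec set"
  assumes T: "sec.subspace T" "T \<subseteq> S" and fin: "finite C" "S \<subseteq> sec.span C"
    and comb: "\<And>x y. x \<in> S \<Longrightarrow> y \<in> S \<Longrightarrow> \<exists>a b. (a \<noteq> 0 \<or> b \<noteq> 0) \<and> scale_sec a x + scale_sec b y \<in> T"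
  shows "sec.dim S \<le> sec.dim T + 1"
proof (cases "S \<subseteq> T")
  case True
  then show ?thesis using T by simp
next
  case False
  then obtain b where b: "b \<in> S" "b \<notin> T" by blast
  obtain B where B: "B \<subseteq> T" "sec.independent B" "T \<subseteq> sec.span B" "card B = sec.dim T" by (rule sec.basis_exists)
  have "B \<subseteq> sec.span C" using B(1) T(2) fin(2) by blast
  then have fB: "finite B" using sec.independent_span_bound[OF fin(1) B(2)] by blast
  have "S \<subseteq> sec.span (insert b B)"
  proof
    fix x assume "x \<in> S"
    then obtain \<alpha> \<beta> where ab: "\<alpha> \<noteq> 0 \<or> \<beta> \<noteq> 0" "scale_sec \<alpha> x + scale_sec \<beta> b \<in> T" using comb b(1) by blast
    have "\<alpha> \<noteq> 0"
    proof
      assume 0: "\<alpha> = 0"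
      then have "scale_sec \<beta> b \<in> T" using ab(2) by simp
      then have "scale_sec (1 / \<beta>) (scale_sec \<beta> b) \<in> T" using sec.subspace_scale[OF T(1)] by blast
      then show False using b(2) ab(1) 0 by simp
    qed
    have "scale_sec \<alpha> x + scale_sec \<beta> b \<in> sec.span (insert b B)"
      using ab(2) B(3) sec.span_mono[of B "insert b B"] by blast
    moreover have "scale_sec \<beta> b \<in> sec.span (insert b B)" by (intro sec.span_scale sec.span_base) simp
    ultimately have "scale_sec \<alpha> x + scale_sec \<beta> b - scale_sec \<beta> b \<in> sec.span (insert b B)" by (rule sec.span_diff)
    then have "scale_sec \<alpha> x \<in> sec.span (insert b B)" by simp
    then have "scale_sec (1 / \<alpha>) (scale_sec \<alpha> x) \<in> sec.span (insert b B)" by (rule sec.span_scale)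
    moreover have "scale_sec (1 / \<alpha>) (scale_sec \<alpha> x) = x" using \<open>\<alpha> \<noteq> 0\<close> by simp
    ultimately show "x \<in> sec.span (insert b B)" by (simp only:)
  qed
  then have "sec.dim S \<le> card (insert b B)" using fB by (intro sec.dim_le_card) auto
  then show ?thesis using card_insert_le_m1 B(4) fB by (metis Suc_eq_plus1 card_insert_if le_SucI le_trans)
qed

text \<open>Independence of a family says more than independence of its image as a set: injectivity
  is what later makes the number of products equal to the product of two dimensions.\<close>

lemma independent_family:
  fixes v :: "'a \<Rightarrow> 'i sec"
  assumes "finite I" and 0: "\<And>c i. (\<Sum>i\<in>I. scale_sec (c i) (v i)) = 0 \<Longrightarrow> i \<in> I \<Longrightarrow> c i = 0"
  shows "inj_on v I" "sec.independent (v ` I)"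
proof -
  show inj: "inj_on v I"
  proof
    fix i j assume ij: "i \<in> I" "j \<in> I" "v i = v j"
    show "i = j"
    proof (rule ccontr)
      assume "i \<noteq> j"
      define c where "c = (\<lambda>k. if k = i then 1 else if k = j then - 1 else (0::complex))"
      have "(\<Sum>k\<in>I. scale_sec (c k) (v k)) = (\<Sum>k\<in>{i, j}. scale_sec (c k) (v k))"
        by (rule sum.mono_neutral_right) (use assms(1) ij in \<open>auto simp: c_def\<close>)
      also have "\<dots> = 0" using \<open>i \<noteq> j\<close> ij(3) by (simp add: c_def)
      finally have "c i = 0" using 0[OF _ ij(1), of c] by simp
      then show False by (simp add: c_def)
    qed
  qed
  show "sec.independent (v ` I)"
  proof (rule sec.independent_if_scalars_zero)
    fix f x assume s: "(\<Sum>x\<in>v ` I. scale_sec (f x) x) = 0" and "x \<in> v ` I"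
    then obtain i where i: "i \<in> I" "x = v i" by blast
    have "(\<Sum>i\<in>I. scale_sec (f (v i)) (v i)) = 0" using s by (simp add: sum.reindex[OF inj])
    from 0[OF this i(1)] show "f x = 0" using i(2) by simp
  qed (use assms(1) in simp)
qed

section \<open>Tensor products\<close>

text \<open>The additive extension of T from the generators to the free abelian group.\<close>

definition eval_frag :: "('a \<Rightarrow> complex) \<Rightarrow> ('a \<Rightarrow>\<^sub>0 int) \<Rightarrow> complex" where
  "eval_frag T x = (\<Sum>z\<in>Poly_Mapping.keys x. of_int (Poly_Mapping.lookup x z) * T z)"

lemma eval_frag_superset:
  "finite S \<Longrightarrow> Poly_Mapping.keys x \<subseteq> S \<Longrightarrow> eval_frag T x = (\<Sum>z\<in>S. of_int (Poly_Mapping.lookup x z) * T z)"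
  unfolding eval_frag_def by (rule sum.mono_neutral_left) (auto simp: in_keys_iff)

lemma eval_frag_add: "eval_frag T (x + y) = eval_frag T x + eval_frag T y"
proof -
  let ?S = "Poly_Mapping.keys x \<union> Poly_Mapping.keys y"
  have "eval_frag T (x + y) = (\<Sum>z\<in>?S. of_int (Poly_Mapping.lookup (x + y) z) * T z)"
    by (rule eval_frag_superset) (use Poly_Mapping.keys_add[of x y] in auto)
  moreover have "eval_frag T x = (\<Sum>z\<in>?S. of_int (Poly_Mapping.lookup x z) * T z)" by (rule eval_frag_superset) auto
  moreover have "eval_frag T y = (\<Sum>z\<in>?S. of_int (Poly_Mapping.lookup y z) * T z)" by (rule eval_frag_superset) auto
  ultimately show ?thesis by (simp add: lookup_add distrib_right sum.distrib)
qed

lemma eval_frag_0: "eval_frag T 0 = 0" by (simp add: eval_frag_def)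

lemma eval_frag_diff: "eval_frag T (x - y) = eval_frag T x - eval_frag T y"
  using eval_frag_add[of T "x - y" y] by simp

lemma eval_frag_frag_of: "eval_frag T (frag_of z) = T z" by (simp add: eval_frag_def)

lemma eval_frag_sum: "eval_frag T (\<Sum>i\<in>I. frag_of (z i)) = (\<Sum>i\<in>I. T (z i))"
  by (induction I rule: infinite_finite_induct) (auto simp: eval_frag_0 eval_frag_add eval_frag_frag_of)

text \<open>The product of two linear functionals is bilinear, so its additive extension kills all
  generators of the relations.\<close>

lemma eval_frag_tensor_rel:
  assumes \<alpha>: "\<And>a b. \<alpha> (a + b) = \<alpha> a + \<alpha> b" "\<And>c a. \<alpha> (sA c a) = c * \<alpha> a"
    and \<beta>: "\<And>a b. \<beta> (a + b) = \<beta> a + \<beta> b" "\<And>c a. \<beta> (sB c a) = c * \<beta> a"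
    and x: "x \<in> tensor_rel sA sB A B"
  shows "eval_frag (\<lambda>(a, b). \<alpha> a * \<beta> b) x = 0"
  using x
proof induction
  case zero show ?case by (rule eval_frag_0)
qed (simp_all add: eval_frag_diff eval_frag_add eval_frag_frag_of \<alpha> \<beta> algebra_simps)

lemma sum_sec_at: "(\<Sum>i\<in>I. f i) p j = (\<Sum>i\<in>I. (f i :: 'i sec) p j)"
  by (induction I rule: infinite_finite_induct) auto

text \<open>
  Linear functionals that isolate one coefficient vanish on \<^const>\<open>tensor_rel\<close>, so an injective
  multiplication map takes products of linearly independent families to independent families.
\<close>

lemma tensor_injective_independent:
  fixes A0 :: "'i sec set" and \<Omega> :: "'j sec set" and h :: "'j sec \<Rightarrow> point set \<Rightarrow> 'i sec \<Rightarrow> 'j sec"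
  assumes inj: "tensor_injective scale_sec scale_hom A B (\<lambda>s \<phi>. \<phi> X s)"
    and A0: "finite A0" "sec.independent A0" "\<And>a c. a \<in> A0 \<Longrightarrow> scale_sec c a \<in> A"
    and \<Omega>: "finite \<Omega>" "sec.independent \<Omega>" and h: "\<And>\<omega>. \<omega> \<in> \<Omega> \<Longrightarrow> h \<omega> \<in> B" "\<And>\<omega>. \<omega> \<in> \<Omega> \<Longrightarrow> h \<omega> X s0 = \<omega>"
    and lin: "\<And>\<omega> c a. \<omega> \<in> \<Omega> \<Longrightarrow> a \<in> A0 \<Longrightarrow> h \<omega> X (scale_sec c a) = scale_sec c (h \<omega> X a)"
    and 0: "(\<Sum>(a, \<omega>)\<in>A0 \<times> \<Omega>. scale_sec (c (a, \<omega>)) (h \<omega> X a)) = 0"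
    and i: "(a0, \<omega>0) \<in> A0 \<times> \<Omega>"
  shows "c (a0, \<omega>0) = 0"
proof -
  obtain \<alpha> where \<alpha>: "\<And>x y. \<alpha> (x + y) = \<alpha> x + \<alpha> y" "\<And>c x. \<alpha> (scale_sec c x) = c * \<alpha> x"
    "\<And>a. a \<in> A0 \<Longrightarrow> \<alpha> a = (if a = a0 then 1 else (0::complex))"
    using linear_functional_extend[OF sec.vector_space_axioms A0(2), of "\<lambda>a. if a = a0 then 1 else 0"] by blast
  obtain \<beta> where \<beta>: "\<And>x y. \<beta> (x + y) = \<beta> x + \<beta> y" "\<And>c x. \<beta> (scale_sec c x) = c * \<beta> x"
    "\<And>a. a \<in> \<Omega> \<Longrightarrow> \<beta> a = (if a = \<omega>0 then 1 else (0::complex))"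
    using linear_functional_extend[OF sec.vector_space_axioms \<Omega>(2), of "\<lambda>a. if a = \<omega>0 then 1 else 0"] by blast
  \<comment> \<open>Formal sums have integer coefficients, so each complex coefficient is moved into
    the first factor of its tensor.\<close>
  define z where "z = (\<lambda>(a, \<omega>). (scale_sec (c (a, \<omega>)) a, h \<omega>))"
  define x where "x = (\<Sum>i\<in>A0 \<times> \<Omega>. frag_of (z i))"
  have "Poly_Mapping.keys x \<subseteq> A \<times> B"
    unfolding x_def using keys_sum[of "\<lambda>i. frag_of (z i)" "A0 \<times> \<Omega>"] A0(3) h(1) by (auto simp: z_def)
  moreover have "(\<Sum>(a, b)\<in>Poly_Mapping.keys x. scale_sec (of_int (Poly_Mapping.lookup x (a, b))) (b X a)) = 0"
  proof (intro ext)
    fix p j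
    have "(\<Sum>(a, b)\<in>Poly_Mapping.keys x. scale_sec (of_int (Poly_Mapping.lookup x (a, b))) (b X a)) p j
      = eval_frag (\<lambda>(a, b). b X a p j) x"
      unfolding eval_frag_def sum_sec_at by (rule sum.cong) (auto simp: scale_sec_def smul_def)
    also have "\<dots> = (\<Sum>(a, \<omega>)\<in>A0 \<times> \<Omega>. scale_sec (c (a, \<omega>)) (h \<omega> X a)) p j"
      unfolding x_def eval_frag_sum sum_sec_at by (rule sum.cong) (auto simp: z_def lin)
    finally show "(\<Sum>(a, b)\<in>Poly_Mapping.keys x. scale_sec (of_int (Poly_Mapping.lookup x (a, b))) (b X a)) p j = 0 p j"
      using 0 by simp
  qed
  ultimately have "x \<in> tensor_rel scale_sec scale_hom A B" using inj unfolding tensor_injective_def by blast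
  \<comment> \<open>Homomorphisms are tested by their value at s0. As \<open>h \<omega>\<close>
    takes the value \<omega> there, \<beta> after evaluation at s0 isolates the index
    \<omega>0.\<close>
  then have "eval_frag (\<lambda>(a, b). \<alpha> a * \<beta> (b X s0)) x = 0"
    by (rule eval_frag_tensor_rel[rotated 4]) (simp_all add: \<alpha> \<beta> scale_hom_def)
  then have "(\<Sum>i\<in>A0 \<times> \<Omega>. (\<lambda>(a, b). \<alpha> a * \<beta> (b X s0)) (z i)) = 0" by (simp add: x_def eval_frag_sum)
  moreover have "(\<Sum>i\<in>A0 \<times> \<Omega>. (\<lambda>(a, b). \<alpha> a * \<beta> (b X s0)) (z i)) = (\<Sum>i\<in>A0 \<times> \<Omega>. if i = (a0, \<omega>0) then c i else 0)"
    by (rule sum.cong) (auto simp: z_def \<alpha> \<beta> h(2) split: if_splits)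
  ultimately show ?thesis using A0(1) \<Omega>(1) i by simp
qed

section \<open>Duality\<close>

lemma vanish_has_ord_le:
  assumes "vanish f m" "has_ord f (int n)" shows "m \<le> n"
proof -
  obtain h where h: "h analytic_on {0}" "\<forall>\<^sub>F z in at 0. f z = z ^ m * h z" using assms(1) unfolding vanish_def by blast
  have "\<not> (\<forall>\<^sub>F z in at 0. h z = 0)"
  proof
    assume "\<forall>\<^sub>F z in at 0. h z = 0"
    with h(2) has_ord_eventually_nz[OF assms(2)] have "\<forall>\<^sub>F z in at (0::complex). False" by eventually_elim auto
    then show False by simp
  qed
  then obtain j where j: "has_ord h (int j)" using analytic_has_ord[OF h(1)] by blast
  have "has_ord f (int m + int j)"
    by (rule has_ord_cong[OF has_ord_mult[OF has_ord_power j]]) (use h(2) in \<open>auto elim: eventually_mono\<close>)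
  from has_ord_unique[OF this assms(2)] show ?thesis by simp
qed

context projective_curve begin

lemma canonical_subspace: "sec.subspace (canonical X X)"
proof (rule sec.subspaceI)
  show "0 \<in> canonical X X"
    unfolding canonical_iff[OF openin_X_self] using regular_form_at_sum[of _ 0] by (auto simp: zero_fun_def)
next
  fix \<omega> \<psi> assume "\<omega> \<in> canonical X X" "\<psi> \<in> canonical X X"
  then show "\<omega> + \<psi> \<in> canonical X X"
    unfolding canonical_iff[OF openin_X_self] using regular_form_at_add[of _ \<omega> \<psi>] by (auto simp: plus_fun_def)
next
  fix c \<omega> assume "\<omega> \<in> canonical X X"
  then show "scale_sec c \<omega> \<in> canonical X X"
    unfolding canonical_iff[OF openin_X_self] using regular_form_at_smul[OF _ reg_at_const, of _ \<omega> c]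
    by (auto simp: scale_sec_def smul_def)
qed

text \<open>The space H^0(K(-E)). The effective divisor E is a multiset, so that induction adds one
  point at a time.\<close>

definition differentials_zeros :: "point multiset \<Rightarrow> tangent sec set" where
  "differentials_zeros E = {\<omega> \<in> canonical X X. \<forall>p\<in>X. vanish (along \<omega> p) (count E p)}"

lemma along_add: "along (\<omega> + \<psi>) p = (\<lambda>z. along \<omega> p z + along \<psi> p z)"
  by (simp add: along_def fun_eq_iff)

lemma along_scale: "along (scale_sec c \<omega>) p = (\<lambda>z. c * along \<omega> p z)"
  by (simp add: along_def scale_sec_def smul_def fun_eq_iff)

lemma differentials_zeros_subspace: "sec.subspace (differentials_zeros E)"
proof (rule sec.subspaceI)
  have "along 0 p = (\<lambda>_. 0)" for p by (simp add: along_def fun_eq_iff)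
  then show "0 \<in> differentials_zeros E" using sec.subspace_0[OF canonical_subspace] vanish_zero by (simp add: differentials_zeros_def)
  fix \<omega> \<psi> assume "\<omega> \<in> differentials_zeros E" "\<psi> \<in> differentials_zeros E"
  then show "\<omega> + \<psi> \<in> differentials_zeros E" using sec.subspace_add[OF canonical_subspace] vanish_add by (simp add: differentials_zeros_def along_add)
next
  fix c \<omega> assume "\<omega> \<in> differentials_zeros E"
  then show "scale_sec c \<omega> \<in> differentials_zeros E" using sec.subspace_scale[OF canonical_subspace] vanish_scale by (simp add: differentials_zeros_def along_scale)
qed

lemma differentials_zeros_empty: "differentials_zeros {#} = canonical X X"
  unfolding differentials_zeros_def using along_analytic canonical_iff[OF openin_X_self] by (auto intro!: vanish_0)

lemma differentials_zeros_mono: "differentials_zeros (add_mset p E) \<subseteq> differentials_zeros E"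
proof
  fix \<omega> assume \<omega>: "\<omega> \<in> differentials_zeros (add_mset p E)"
  have "vanish (along \<omega> q) (count E q)" if "q \<in> X" for q
    by (rule vanish_antimono[of _ "count (add_mset p E) q"]) (use \<omega> that in \<open>simp_all add: differentials_zeros_def\<close>)
  then show "\<omega> \<in> differentials_zeros E" using \<omega> by (simp add: differentials_zeros_def)
qed

lemma differentials_zeros_comb:
  assumes "p \<in> X" "x \<in> differentials_zeros E" "y \<in> differentials_zeros E"
  shows "\<exists>a b. (a \<noteq> 0 \<or> b \<noteq> 0) \<and> scale_sec a x + scale_sec b y \<in> differentials_zeros (add_mset p E)"
proof -
  have v: "vanish (along x p) (count E p)" "vanish (along y p) (count E p)" using assms by (auto simp: differentials_zeros_def)
  obtain a b where ab: "a \<noteq> 0 \<or> b \<noteq> 0" "vanish (\<lambda>z. a * along x p z + b * along y p z) (Suc (count E p))"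
    using vanish_combination[OF v] by blast
  have "scale_sec a x + scale_sec b y \<in> differentials_zeros E"
    by (intro sec.subspace_add[OF differentials_zeros_subspace] sec.subspace_scale[OF differentials_zeros_subspace] assms)
  moreover have "vanish (along (scale_sec a x + scale_sec b y) p) (Suc (count E p))"
    unfolding along_add along_scale by (rule ab(2))
  ultimately have "scale_sec a x + scale_sec b y \<in> differentials_zeros (add_mset p E)"
    by (simp add: differentials_zeros_def)
  then show ?thesis using ab(1) by blast
qed

end

context line_bundle begin

text \<open>Elements of \<open>reg X U\<close> vanish outside U, so a constant has to be cut off
  before it can act as a regular function.\<close>

lemma scale_sec_restr: "s \<in> L U \<Longrightarrow> scale_sec c s = smul (restr U (\<lambda>_. c)) s"
  using module_sheafD(4)[OF module module_sheaf_open[OF module], of s U] by (auto simp: scale_sec_def smul_def restr_def fun_eq_iff)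

lemma restr_const_reg: "s \<in> L U \<Longrightarrow> restr U (\<lambda>_. c) \<in> reg X U"
  using restr_reg[OF module_sheaf_open[OF module]] reg_at_const section_in_X by blast

lemma section_scale: "s \<in> L U \<Longrightarrow> scale_sec c s \<in> L U"
  unfolding scale_sec_restr using module_sheafD(3)[OF module module_sheaf_open[OF module] restr_const_reg] by blast

lemma germ_coeff_outside: "p \<in> X \<Longrightarrow> s \<in> L U \<Longrightarrow> q \<notin> U \<Longrightarrow> germ_coeff p U s q = 0"
  unfolding germ_coeff_def using frame_coeff_outside[OF chosen_frame(2)] by auto

lemma germ_coeff_scale: assumes "p \<in> X" "s \<in> L U" shows "germ_coeff p U (scale_sec c s) q = c * germ_coeff p U s q"
proof -
  have "germ_coeff p U (smul (restr U (\<lambda>_. c)) s) q = restr U (\<lambda>_. c) q * germ_coeff p U s q"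
    by (rule germ_coeff_smul[OF assms(1) restr_const_reg[OF assms(2)] assms(2)])
  then show ?thesis
    by (cases "q \<in> U") (simp_all add: scale_sec_restr[OF assms(2)] restr_def germ_coeff_outside assms)
qed

text \<open>
  For \<open>E\<close> at most the divisor of \<open>s\<^sub>0\<close>, this says that \<open>s/s\<^sub>0\<close> has poles at most \<open>E\<close>; beyond
  that, the truncated subtraction makes the condition void.
\<close>

definition sections_poles :: "'i sec set \<Rightarrow> 'i sec \<Rightarrow> point multiset \<Rightarrow> 'i sec set" where
  "sections_poles V s0 E = {s \<in> V. \<forall>p\<in>X. vanish (\<lambda>z. germ_coeff p X s (arc p z)) (zero_order s0 p - count E p)}"

lemma sections_poles_subspace:
  assumes "sec.subspace V" "V \<subseteq> L X" shows "sec.subspace (sections_poles V s0 E)"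
proof (rule sec.subspaceI)
  have "germ_coeff p X 0 q = 0" if "p \<in> X" for p q
    using germ_coeff_scale[OF that module_sheafD(1)[OF module openin_X_self], of 0 q] by simp
  then show "0 \<in> sections_poles V s0 E" using sec.subspace_0[OF assms(1)] vanish_zero by (simp add: sections_poles_def)
  fix s t assume st: "s \<in> sections_poles V s0 E" "t \<in> sections_poles V s0 E"
  then have "s \<in> L X" "t \<in> L X" using assms(2) by (auto simp: sections_poles_def)
  then show "s + t \<in> sections_poles V s0 E" using st sec.subspace_add[OF assms(1)] vanish_add by (simp add: sections_poles_def germ_coeff_add)
next
  fix c s assume st: "s \<in> sections_poles V s0 E"
  then have "s \<in> L X" using assms(2) by (auto simp: sections_poles_def)
  then show "scale_sec c s \<in> sections_poles V s0 E" using st sec.subspace_scale[OF assms(1)] vanish_scale by (simp add: sections_poles_def germ_coeff_scale)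
qed

lemma sections_poles_mono: "sections_poles V s0 E \<subseteq> sections_poles V s0 (add_mset p E)"
  unfolding sections_poles_def by (auto intro: vanish_antimono)

lemma sections_poles_comb:
  assumes V: "sec.subspace V" "V \<subseteq> L X" and p: "p \<in> X" "count E p < zero_order s0 p"
    and xy: "x \<in> sections_poles V s0 (add_mset p E)" "y \<in> sections_poles V s0 (add_mset p E)"
  shows "\<exists>a b. (a \<noteq> 0 \<or> b \<noteq> 0) \<and> scale_sec a x + scale_sec b y \<in> sections_poles V s0 E"
proof -
  define n where "n = zero_order s0 p - Suc (count E p)"
  \<comment> \<open>As E is still below the divisor of s0 at p, the subtraction is exact and the two
    exponents differ by one.\<close>
  have n: "zero_order s0 p - count E p = Suc n" "zero_order s0 p - count (add_mset p E) p = n" using p(2) by (auto simp: n_def)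
  have L: "x \<in> L X" "y \<in> L X" using xy V by (auto simp: sections_poles_def)
  have v: "vanish (\<lambda>z. germ_coeff p X x (arc p z)) n" "vanish (\<lambda>z. germ_coeff p X y (arc p z)) n"
    using xy p(1) n(2) unfolding sections_poles_def by force+
  obtain a b where ab: "a \<noteq> 0 \<or> b \<noteq> 0" "vanish (\<lambda>z. a * germ_coeff p X x (arc p z) + b * germ_coeff p X y (arc p z)) (Suc n)"
    using vanish_combination[OF v] by blast
  define t where "t = scale_sec a x + scale_sec b y"
  have "t \<in> sections_poles V s0 (add_mset p E)" unfolding t_def
    by (intro sec.subspace_add[OF sections_poles_subspace[OF V]] sec.subspace_scale[OF sections_poles_subspace[OF V]] xy)
  moreover have "vanish (\<lambda>z. germ_coeff p X t (arc p z)) (zero_order s0 p - count E p)"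
    using ab(2) n(1) by (simp add: t_def germ_coeff_add[OF p(1) section_scale section_scale] germ_coeff_scale[OF p(1)] L)
  ultimately have "t \<in> sections_poles V s0 E" unfolding sections_poles_def by (auto split: if_splits)
  then show ?thesis using ab(1) unfolding t_def by blast
qed

lemma nonvanishing_ex: "s \<in> L X \<Longrightarrow> s \<noteq> 0 \<Longrightarrow> \<exists>q\<in>X. germ_coeff q X s q \<noteq> 0"
  using degree_exists(2) by blast

text \<open>A quotient s/s0 without poles is constant. Some combination t = s + c s0 vanishes at a
  point where s0 does not; if t were nonzero, it would have all zeros of s0 and at least one more,
  although both sections have as many zeros as the degree says.\<close>

lemma sections_poles_empty:
  assumes V: "sec.subspace V" "V \<subseteq> L X" and s0: "s0 \<in> V" "s0 \<noteq> 0"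
  shows "sections_poles V s0 {#} \<subseteq> sec.span {s0}"
proof
  fix s assume s: "s \<in> sections_poles V s0 {#}"
  have s0L: "s0 \<in> L X" and sL: "s \<in> L X" using s0 s V by (auto simp: sections_poles_def)
  obtain q where q: "q \<in> X" "germ_coeff q X s0 q \<noteq> 0" using nonvanishing_ex[OF s0L s0(2)] by blast
  have q0: "zero_order s0 q = 0"
  proof -
    have "has_ord (\<lambda>z. germ_coeff q X s0 (arc q z)) 0"
      by (rule has_ord_analytic_0) (use reg_along_0[OF q(1) germ_coeff_reg[OF s0L q(1)]] q arc_0 in auto)
    then show ?thesis using has_ord_unique[OF zero_order[OF s0L s0(2) q(1)]] by fastforce
  qed
  define c where "c = - germ_coeff q X s q / germ_coeff q X s0 q"
  define t where "t = s + scale_sec c s0"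
  have tL: "t \<in> L X" unfolding t_def by (intro module_sheafD(2)[OF module openin_X_self] sL section_scale s0L)
  have tE: "vanish (\<lambda>z. germ_coeff p X t (arc p z)) (zero_order s0 p)" if p: "p \<in> X" for p
  proof -
    have "vanish (\<lambda>z. germ_coeff p X s (arc p z)) (zero_order s0 p)" using s p by (simp add: sections_poles_def)
    moreover have "vanish (\<lambda>z. c * germ_coeff p X s0 (arc p z)) (zero_order s0 p)"
      by (rule vanish_scale[OF has_ord_vanish[OF zero_order[OF s0L s0(2) p] order_refl]])
    ultimately show ?thesis using vanish_add unfolding t_def by (simp add: germ_coeff_add[OF p sL section_scale] germ_coeff_scale[OF p] s0L)
  qed
  have "t = 0"
  proof (rule ccontr)
    assume t0: "t \<noteq> 0"
    note ord = zero_order[OF tL t0]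
    have le: "zero_order s0 p \<le> zero_order t p" if "p \<in> X" for p
      by (rule vanish_has_ord_le[OF tE[OF that] ord[OF that]])
    have "germ_coeff q X t q = germ_coeff q X s q + c * germ_coeff q X s0 q"
      unfolding t_def germ_coeff_add[OF q(1) sL section_scale[OF s0L]] germ_coeff_scale[OF q(1) s0L] by simp
    then have "germ_coeff q X t q = 0" using q by (simp add: c_def)
    then have z: "((\<lambda>z. germ_coeff q X t (arc q z)) \<longlongrightarrow> 0) (at 0)" using reg_along_tendsto[OF q(1) germ_coeff_reg[OF tL q(1)]] by simp
    have tq: "zero_order t q \<noteq> 0"
    proof
      assume "zero_order t q = 0"
      then obtain c where "c \<noteq> 0" "((\<lambda>z. germ_coeff q X t (arc q z)) \<longlongrightarrow> c) (at 0)" using has_ord_limit_nz ord[OF q(1)] by auto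
      then show False using tendsto_unique[OF _ z] by auto
    qed
    let ?S = "{p \<in> X. zero_order s0 p \<noteq> 0} \<union> {p \<in> X. zero_order t p \<noteq> 0}"
    have fS: "finite ?S" using finite_supp_order[OF s0L s0(2)] finite_supp_order[OF tL t0] by simp
    have "(\<Sum>p\<in>?S. int (zero_order s0 p)) < (\<Sum>p\<in>?S. int (zero_order t p))"
    proof (rule sum_strict_mono_ex1[OF fS])
      show "\<exists>a\<in>?S. int (zero_order s0 a) < int (zero_order t a)"
        by (rule bexI[of _ q]) (use q(1) q0 tq in auto)
    qed (use le in auto)
    moreover have "(\<Sum>p\<in>?S. int (zero_order s0 p)) = degree X 1 L"
      unfolding degree_eq[OF s0L s0(2)] by (rule sum.mono_neutral_right[OF fS]) auto
    moreover have "(\<Sum>p\<in>?S. int (zero_order t p)) = degree X 1 L"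
      unfolding degree_eq[OF tL t0] by (rule sum.mono_neutral_right[OF fS]) auto
    ultimately show False by simp
  qed
  then have "s = scale_sec (- c) s0"
    by (auto simp: t_def scale_sec_def smul_def fun_eq_iff eq_neg_iff_add_eq_0)
  then show "s \<in> sec.span {s0}" using sec.span_scale[OF sec.span_base, of s0 "{s0}" "- c"] by simp
qed

lemma germ_coeff_isolated_zeros:
  assumes s0: "s0 \<in> L X" "s0 \<noteq> 0" and p: "p \<in> X"
  shows "\<exists>u\<in>reg_at X p. u p \<noteq> 0 \<and> (\<forall>\<^sub>F q in nz p. germ_coeff p X s0 q = up p q ^ zero_order s0 p * u q)"
    and "\<forall>\<^sub>F q in nz p. q \<noteq> p \<longrightarrow> germ_coeff p X s0 q \<noteq> 0"
proof -
  show ex: "\<exists>u\<in>reg_at X p. u p \<noteq> 0 \<and> (\<forall>\<^sub>F q in nz p. germ_coeff p X s0 q = up p q ^ zero_order s0 p * u q)"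
    by (rule reg_factor[OF p germ_coeff_reg[OF s0(1) p] zero_order[OF s0 p]])
  then obtain u where u: "u \<in> reg_at X p" "u p \<noteq> 0" "\<forall>\<^sub>F q in nz p. germ_coeff p X s0 q = up p q ^ zero_order s0 p * u q" by blast
  show "\<forall>\<^sub>F q in nz p. q \<noteq> p \<longrightarrow> germ_coeff p X s0 q \<noteq> 0"
    using u(3) reg_at_inverse(2)[OF p u(1,2)] up_nonzero[OF p] by eventually_elim auto
qed

lemma quotient_rational:
  assumes s0: "s0 \<in> L X" "s0 \<noteq> 0" and s: "s \<in> L X"
  shows "rational (\<lambda>q. germ_coeff q X s q / germ_coeff q X s0 q)"
  unfolding rational_def
proof
  fix p assume p: "p \<in> X"
  have "\<not> (\<forall>\<^sub>F q in nz p. germ_coeff p X s0 q = 0)" using section_zero_near[OF s0(1) p] s0(2) by blast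
  moreover have "\<forall>\<^sub>F q in nz p. q \<noteq> p \<longrightarrow> germ_coeff p X s0 q \<noteq> 0 \<and> germ_coeff q X s q / germ_coeff q X s0 q = germ_coeff p X s q / germ_coeff p X s0 q"
    using germ_coeff_isolated_zeros(2)[OF s0 p] eventually_cf_change[OF p]
    by eventually_elim (use s s0 in auto)
  ultimately show "\<exists>g\<in>reg_at X p. \<exists>h\<in>reg_at X p. \<not> (\<forall>\<^sub>F q in nz p. h q = 0) \<and>
      (\<forall>\<^sub>F q in nz p. q \<noteq> p \<longrightarrow> h q \<noteq> 0 \<and> germ_coeff q X s q / germ_coeff q X s0 q = g q / h q)"
    using germ_coeff_reg[OF s p] germ_coeff_reg[OF s0(1) p] by blast
qed

lemma quotient_along:
  assumes "s0 \<in> L X" "s \<in> L X" "p \<in> X"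
  shows "\<forall>\<^sub>F z in at 0. germ_coeff p X s (arc p z) / germ_coeff p X s0 (arc p z) = germ_coeff (arc p z) X s (arc p z) / germ_coeff (arc p z) X s0 (arc p z)"
proof -
  have "\<forall>\<^sub>F q in nz p. germ_coeff p X s q / germ_coeff p X s0 q = germ_coeff q X s q / germ_coeff q X s0 q"
    using eventually_cf_change[OF assms(3)] by eventually_elim (use assms in auto)
  from eventually_nz_along_0[OF assms(3) this] show ?thesis by eventually_elim simp
qed

text \<open>
  If allowing one more pole at \<open>p\<close> gave a new quotient \<open>s/s\<^sub>0\<close> and requiring one more zero at
  \<open>p\<close> lost a differential \<open>\<omega>\<close>, then \<open>(s/s\<^sub>0) \<omega>\<close> would have exactly one simple pole.
\<close>

lemma not_both_jump:
  assumes V: "V \<subseteq> L X" and s0: "s0 \<in> L X" "s0 \<noteq> 0" and p: "p \<in> X" "count E p < zero_order s0 p"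
    and E: "\<And>q. count E q \<le> zero_order s0 q"
    and s: "s \<in> sections_poles V s0 (add_mset p E)" "s \<notin> sections_poles V s0 E"
    and \<omega>: "\<omega> \<in> differentials_zeros E" "\<omega> \<notin> differentials_zeros (add_mset p E)"
  shows False
proof -
  let ?D = "zero_order s0"
  define f where "f = (\<lambda>q. germ_coeff q X s q / germ_coeff q X s0 q)"
  define n where "n = ?D p - Suc (count E p)"
  have n: "?D p - count E p = Suc n" "?D p - count (add_mset p E) p = n" using p(2) by (auto simp: n_def)
  have sL: "s \<in> L X" using s V by (auto simp: sections_poles_def)
  have can: "\<omega> \<in> canonical X X" using \<omega> by (simp add: differentials_zeros_def)
  have sv: "vanish (\<lambda>z. germ_coeff q X s (arc q z)) (?D q - count E q)" if "q \<in> X" "q \<noteq> p" for q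
  proof -
    have "vanish (\<lambda>z. germ_coeff q X s (arc q z)) (?D q - count (add_mset p E) q)"
      using s(1) that(1) unfolding sections_poles_def by blast
    then show ?thesis using that(2) by simp
  qed
  have "vanish (\<lambda>z. germ_coeff p X s (arc p z)) n" using s(1) p(1) n(2) unfolding sections_poles_def by force
  moreover have "\<not> vanish (\<lambda>z. germ_coeff p X s (arc p z)) (Suc n)" 
  proof
    assume *: "vanish (\<lambda>z. germ_coeff p X s (arc p z)) (Suc n)"
    have "vanish (\<lambda>z. germ_coeff q X s (arc q z)) (?D q - count E q)" if "q \<in> X" for q
      using sv[OF that] * n(1) by (cases "q = p") simp_all
    then show False using s by (simp add: sections_poles_def)
  qed
  ultimately have so: "has_ord (\<lambda>z. germ_coeff p X s (arc p z)) (int n)" by (rule vanish_exact)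
  have wv: "vanish (along \<omega> q) (count E q)" if "q \<in> X" for q using \<omega>(1) that by (simp add: differentials_zeros_def)
  have "\<not> vanish (along \<omega> p) (Suc (count E p))" using \<omega> wv by (auto simp: differentials_zeros_def split: if_splits)
  from vanish_exact[OF wv[OF p(1)] this] have wo: "has_ord (along \<omega> p) (int (count E p))" .
  note so0 = zero_order[OF s0]
  \<comment> \<open>With D the zero order of s0 at p and e the multiplicity of p in E, the orders of
    s, s0 and \<omega> are D - e - 1, D and e, so the quotient form has order exactly -1.\<close>
  have "has_ord (\<lambda>z. z * (germ_coeff p X s (arc p z) / germ_coeff p X s0 (arc p z) * along \<omega> p z)) (1 + (int n - int (?D p) + int (count E p)))"
    by (intro has_ord_mult has_ord_id has_ord_divide so wo so0 p)
  moreover have "1 + (int n - int (?D p) + int (count E p)) = 0" using p(2) by (simp add: n_def)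
  ultimately have "has_ord (\<lambda>z. z * (germ_coeff p X s (arc p z) / germ_coeff p X s0 (arc p z) * along \<omega> p z)) 0" by simp
  then have "has_ord (\<lambda>z. z * (f (arc p z) * along \<omega> p z)) 0"
  proof (rule has_ord_cong)
    show "\<forall>\<^sub>F z in at 0. z * (germ_coeff p X s (arc p z) / germ_coeff p X s0 (arc p z) * along \<omega> p z) = z * (f (arc p z) * along \<omega> p z)"
      using quotient_along[OF s0(1) sL p(1)] by eventually_elim (simp add: f_def)
  qed
  then obtain R where R: "R \<noteq> 0" "((\<lambda>z. z * (f (arc p z) * along \<omega> p z)) \<longlongrightarrow> R) (at 0)" by (rule has_ord_limit_nz)
  have "((\<lambda>z. z * (f (arc q z) * along \<omega> q z)) \<longlongrightarrow> 0) (at 0)" if q: "q \<in> X" "q \<noteq> p" for q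
  proof -
    obtain h1 where h1: "h1 analytic_on {0}" "\<forall>\<^sub>F z in at 0. germ_coeff q X s (arc q z) = z ^ (?D q - count E q) * h1 z"
      using sv[OF q] unfolding vanish_def by blast
    obtain h2 where h2: "h2 analytic_on {0}" "\<forall>\<^sub>F z in at 0. along \<omega> q z = z ^ count E q * h2 z"
      using wv[OF q(1)] unfolding vanish_def by blast
    obtain u where u: "u analytic_on {0}" "u 0 \<noteq> 0" "\<forall>\<^sub>F z in at 0. germ_coeff q X s0 (arc q z) = z powi int (?D q) * u z"
      using so0[OF q(1)] unfolding has_ord_def by blast
    \<comment> \<open>E is below the divisor of s0, so the subtraction is exact and the zeros of s
      and \<omega> together compensate those of s0.\<close>
    have D: "z ^ ?D q = z ^ (?D q - count E q) * z ^ count E q" for z :: complex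
      using E[of q] by (simp flip: power_add)
    have "(\<lambda>z. z * (h1 z * h2 z / u z)) analytic_on {0}" using h1 h2 u by (auto intro!: analytic_intros)
    from analytic_at_imp_isCont[OF this] have "((\<lambda>z. z * (h1 z * h2 z / u z)) \<longlongrightarrow> 0) (at 0)" by (simp add: isCont_def)
    moreover have "\<forall>\<^sub>F z in at 0. z * (h1 z * h2 z / u z) = z * (f (arc q z) * along \<omega> q z)"
      using h1(2) h2(2) u(3) quotient_along[OF s0(1) sL q(1)] eventually_at_0_ball[OF cr_pos[OF q(1)]]
    proof eventually_elim
      case (elim z)
      have "f (arc q z) * along \<omega> q z = (z ^ (?D q - count E q) * h1 z) / (z ^ ?D q * u z) * (z ^ count E q * h2 z)"
        using elim(1,2,3,4) by (simp add: f_def)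
      also have "\<dots> = h1 z * h2 z / u z" using elim(5) by (simp add: D)
      finally show ?case by simp
    qed
    ultimately show ?thesis by (rule Lim_transform_eventually)
  qed
  from no_single_simple_pole[OF p(1) quotient_rational[OF s0 sL] can, of R] this R show False by (simp add: f_def)
qed

text \<open>With g for the dimension of the space of differentials this is the Riemann-Roch
  inequality l(E) - i(E) <= deg E + 1 - g for quotients s/s0 with s in V. For E = 0 it reads l <= 1
  because i(0) = g. The finite spanning sets keep \<open>sec.dim\<close> away from its default
  value.\<close>

lemma filtration_bound:
  assumes V: "sec.subspace V" "V \<subseteq> L X" and s0: "s0 \<in> V" "s0 \<noteq> 0"
    and fV: "finite C" "V \<subseteq> sec.span C" and fK: "finite C'" "canonical X X \<subseteq> sec.span C'"
  shows "set_mset E \<subseteq> X \<Longrightarrow> (\<And>p. count E p \<le> zero_order s0 p) \<Longrightarrow>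
    sec.dim (sections_poles V s0 E) + sec.dim (canonical X X) \<le> 1 + size E + sec.dim (differentials_zeros E)"
proof (induction E)
  case empty
  have "sec.dim (sections_poles V s0 {#}) \<le> card {s0}" by (rule sec.dim_le_card[OF sections_poles_empty[OF V s0]]) simp
  then show ?case by (simp add: differentials_zeros_empty)
next
  case (add p E)
  have p: "p \<in> X" using add.prems(1) by simp
  have lt: "count E p < zero_order s0 p" using add.prems(2)[of p] by simp
  have E: "count E q \<le> zero_order s0 q" for q using add.prems(2)[of q] by (auto split: if_splits)
  have IH: "sec.dim (sections_poles V s0 E) + sec.dim (canonical X X) \<le> 1 + size E + sec.dim (differentials_zeros E)"
    using add.IH add.prems(1) E by simp
  have s0L: "s0 \<in> L X" using s0 V by blast
  have sub: "sections_poles V s0 (add_mset p E) \<subseteq> sec.span C" "differentials_zeros E \<subseteq> sec.span C'"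
    using fV(2) fK(2) by (auto simp: sections_poles_def differentials_zeros_def)
  consider "sections_poles V s0 (add_mset p E) = sections_poles V s0 E" | "differentials_zeros (add_mset p E) = differentials_zeros E"
    using not_both_jump[OF V(2) s0L s0(2) p lt E] sections_poles_mono[of V s0 E p] differentials_zeros_mono[of p E] by blast
  then show ?case
  proof cases
    case 1
    have "sec.dim (differentials_zeros E) \<le> sec.dim (differentials_zeros (add_mset p E)) + 1"
      by (rule dim_step[OF differentials_zeros_subspace differentials_zeros_mono fK(1) sub(2) differentials_zeros_comb[OF p]])
    then show ?thesis using IH 1 by simp
  next
    case 2
    have "sec.dim (sections_poles V s0 (add_mset p E)) \<le> sec.dim (sections_poles V s0 E) + 1"
      by (rule dim_step[OF sections_poles_subspace[OF V] sections_poles_mono fV(1) sub(1) sections_poles_comb[OF V p lt]])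
    then show ?thesis using IH 2 by simp
  qed
qed

end

section \<open>Homomorphisms from a line bundle to the canonical bundle\<close>

context line_bundle begin

text \<open>
  A differential \<open>\<omega>\<close> vanishing on the divisor of \<open>s\<^sub>0\<close> defines the homomorphism
  \<open>s \<mapsto> (s/s\<^sub>0) \<omega>\<close>. At \<open>p\<close> it is computed with \<open>theta\<close>, the quotient of \<open>\<omega>\<close> by the
  coefficient of \<open>s\<^sub>0\<close>.
\<close>

definition theta :: "'i sec \<Rightarrow> tangent sec \<Rightarrow> point \<Rightarrow> tangent sec" where
  "theta s0 \<omega> p = (SOME \<chi>'. regular_form_at p \<chi>' \<and>
     (\<forall>\<^sub>F q in nz p. \<forall>D\<in>tangent_space X q. \<omega> q D = germ_coeff p X s0 q * \<chi>' q D))"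

definition quot_hom :: "'i sec \<Rightarrow> tangent sec \<Rightarrow> point set \<Rightarrow> 'i sec \<Rightarrow> tangent sec" where
  "quot_hom s0 \<omega> U s = (\<lambda>q D. if s \<in> L U \<and> q \<in> U \<and> D \<in> tangent_space X q
     then germ_coeff q U s q * theta s0 \<omega> q q D else 0)"

lemma theta:
  assumes s0: "s0 \<in> L X" "s0 \<noteq> 0" and p: "p \<in> X" and \<omega>: "\<omega> \<in> canonical X X"
    and v: "vanish (along \<omega> p) (zero_order s0 p)"
  shows "regular_form_at p (theta s0 \<omega> p)"
    "\<forall>\<^sub>F q in nz p. \<forall>D\<in>tangent_space X q. \<omega> q D = germ_coeff p X s0 q * theta s0 \<omega> p q D"
proof -
  let ?n = "zero_order s0 p"
  have can: "regular_form_at p \<omega>" using \<omega> p unfolding canonical_iff[OF openin_X_self] by blast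
  obtain \<psi> where \<psi>: "regular_form_at p \<psi>" "\<forall>\<^sub>F q in nz p. \<forall>D\<in>tangent_space X q. \<omega> q D = up p q ^ ?n * \<psi> q D"
    using regular_form_at_factor[OF p can v] by blast
  obtain u where u: "u \<in> reg_at X p" "u p \<noteq> 0" "\<forall>\<^sub>F q in nz p. germ_coeff p X s0 q = up p q ^ ?n * u q"
    using germ_coeff_isolated_zeros(1)[OF s0 p] by blast
  have "regular_form_at p (\<lambda>q D. 1 / u q * \<psi> q D)" by (rule regular_form_at_smul[OF p reg_at_inverse(1)[OF p u(1,2)] \<psi>(1)])
  moreover have "\<forall>\<^sub>F q in nz p. \<forall>D\<in>tangent_space X q. \<omega> q D = germ_coeff p X s0 q * (1 / u q * \<psi> q D)"
    using \<psi>(2) u(3) reg_at_inverse(2)[OF p u(1,2)] by eventually_elim simp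
  ultimately have "\<exists>\<chi>'. regular_form_at p \<chi>' \<and> (\<forall>\<^sub>F q in nz p. \<forall>D\<in>tangent_space X q. \<omega> q D = germ_coeff p X s0 q * \<chi>' q D)" by blast
  from someI_ex[OF this] show "regular_form_at p (theta s0 \<omega> p)"
    "\<forall>\<^sub>F q in nz p. \<forall>D\<in>tangent_space X q. \<omega> q D = germ_coeff p X s0 q * theta s0 \<omega> p q D"
    unfolding theta_def by auto
qed

lemma quot_hom:
  assumes s0: "s0 \<in> L X" "s0 \<noteq> 0" and \<omega>: "\<omega> \<in> canonical X X"
    and v: "\<And>p. p \<in> X \<Longrightarrow> vanish (along \<omega> p) (zero_order s0 p)"
  shows "quot_hom s0 \<omega> \<in> sheaf_hom X L (canonical X)" and "quot_hom s0 \<omega> X s0 = \<omega>"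
proof -
  have th: "regular_form_at p (theta s0 \<omega> p)"
    "\<forall>\<^sub>F q in nz p. \<forall>D\<in>tangent_space X q. \<omega> q D = germ_coeff p X s0 q * theta s0 \<omega> p q D" if "p \<in> X" for p
    using theta[OF s0 that \<omega> v[OF that]] by auto
  have self: "\<omega> q D = germ_coeff q X s0 q * theta s0 \<omega> q q D" if "q \<in> X" "D \<in> tangent_space X q" for q D
    using eventually_nz_self[OF that(1) th(2)[OF that(1)]] that(2) by blast
  have "quot_hom s0 \<omega> U s \<in> canonical X U" if U: "openin (zariski X) U" and s: "s \<in> L U" for U s
    unfolding canonical_iff[OF U]
  proof (intro conjI ballI allI impI)
    fix p D assume "p \<notin> U \<or> D \<notin> tangent_space X p"
    then show "quot_hom s0 \<omega> U s p D = 0" by (auto simp: quot_hom_def)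
  next
    fix p assume pU: "p \<in> U"
    then have p: "p \<in> X" using section_in_X[OF s] by blast
    have "\<forall>\<^sub>F q in nz p. \<forall>D\<in>tangent_space X q. germ_coeff p U s q * theta s0 \<omega> p q D = quot_hom s0 \<omega> U s q D"
      using th(2)[OF p] eventually_cf_change[OF p] germ_coeff_isolated_zeros(2)[OF s0 p] eventually_nz_openin[OF U pU]
    proof eventually_elim
      case (elim q)
      show ?case
      proof
        fix D assume D: "D \<in> tangent_space X q"
        have q: "q \<in> X" "transition p q \<noteq> 0" and c: "germ_coeff q U s q = germ_coeff p U s q * transition p q" "germ_coeff q X s0 q = germ_coeff p X s0 q * transition p q"
          using elim s s0 by auto
        have h: "quot_hom s0 \<omega> U s q D = germ_coeff q U s q * theta s0 \<omega> q q D"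
          using s D elim(4) by (simp add: quot_hom_def)
        show "germ_coeff p U s q * theta s0 \<omega> p q D = quot_hom s0 \<omega> U s q D"
        \<comment> \<open>Away from p the coefficient of s0 is nonzero and can be cancelled from the
          two expressions for \<omega> at q; at p both sides use the same frame and the same
          \<open>theta\<close>.\<close>
        proof (cases "q = p")
          case False
          then have nz: "germ_coeff p X s0 q \<noteq> 0" using elim by blast
          have a: "\<omega> q D = germ_coeff p X s0 q * theta s0 \<omega> p q D" using elim(1) D by blast
          from trans[OF self[OF q(1) D, symmetric] a]
          have "germ_coeff p X s0 q * transition p q * theta s0 \<omega> q q D = germ_coeff p X s0 q * theta s0 \<omega> p q D"
            unfolding c(2) .
          then have "transition p q * theta s0 \<omega> q q D = theta s0 \<omega> p q D" using nz by simp
          then show ?thesis unfolding h c(1) by (simp add: mult.assoc)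
        qed (use h in simp)
      qed
    qed
    from regular_form_at_cong[OF regular_form_at_smul[OF p germ_coeff_reg[OF s pU] th(1)[OF p]] this] show "regular_form_at p (quot_hom s0 \<omega> U s)" .
  qed
  moreover have "quot_hom s0 \<omega> U (s + t) = quot_hom s0 \<omega> U s + quot_hom s0 \<omega> U t"
    if U: "openin (zariski X) U" and s: "s \<in> L U" "t \<in> L U" for U s t
    using module_sheafD(2)[OF module U s] s germ_coeff_add[OF section_in_X[OF s(1)] s]
    by (auto simp: quot_hom_def fun_eq_iff distrib_right)
  moreover have "quot_hom s0 \<omega> U (smul f s) = smul f (quot_hom s0 \<omega> U s)"
    if U: "openin (zariski X) U" and f: "f \<in> reg X U" and s: "s \<in> L U" for U f s
    using module_sheafD(3)[OF module U f s] s germ_coeff_smul[OF section_in_X[OF s] f s]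
    by (auto simp: quot_hom_def fun_eq_iff smul_def)
  moreover have "quot_hom s0 \<omega> V (restr V s) = restr V (quot_hom s0 \<omega> U s)"
    if U: "openin (zariski X) U" and V: "openin (zariski X) V" "V \<subseteq> U" and s: "s \<in> L U" for U V s
  proof -
    have c: "germ_coeff q V (restr V s) q = germ_coeff q U s q" if "q \<in> V" for q by (rule germ_coeff_restr[OF s V that])
    have "quot_hom s0 \<omega> V (restr V s) q D = restr V (quot_hom s0 \<omega> U s) q D" for q D
      using module_sheafD(5)[OF module U V s] s V(2) c by (auto simp: quot_hom_def restr_def)
    then show ?thesis by (simp add: fun_eq_iff)
  qed
  ultimately show "quot_hom s0 \<omega> \<in> sheaf_hom X L (canonical X)"
    unfolding sheaf_hom_def by (auto simp: quot_hom_def fun_eq_iff)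
  have "quot_hom s0 \<omega> X s0 q D = \<omega> q D" for q D
    using self[of q D] s0(1) \<omega> unfolding canonical_iff[OF openin_X_self] by (auto simp: quot_hom_def)
  then show "quot_hom s0 \<omega> X s0 = \<omega>" by (simp add: fun_eq_iff)
qed

lemma quot_hom_scale:
  "s \<in> L X \<Longrightarrow> quot_hom s0 \<omega> X (scale_sec c s) = scale_sec c (quot_hom s0 \<omega> X s)"
  using section_scale[of s X c] germ_coeff_scale[of _ s X c] by (auto simp: quot_hom_def fun_eq_iff scale_sec_def smul_def)

end

text \<open>E is the full divisor of s0: then no element of V is excluded, the size of E is the
  degree of L, and differentials vanishing on E become homomorphisms. The genus on the left comes
  from \<open>filtration_bound\<close>; the one on the right is the dimension of the target of the
  multiplication map.\<close>

lemma (in projective_curve) petri_bound: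
  fixes L :: "nat sheaf"
  assumes L: "vector_bundle X 1 L" and petri: "petri X" and g: "genus X > 0"
    and V: "sec.subspace V" "V \<subseteq> L X" "sec.dim V > 0"
  shows "int (sec.dim V) * (int (sec.dim V) - 1 - degree X 1 L + int (genus X)) \<le> int (genus X)"
proof -
  interpret line_bundle X N L by standard (rule L)
  obtain A0 where A0: "A0 \<subseteq> V" "sec.independent A0" "V \<subseteq> sec.span A0" "card A0 = sec.dim V" by (rule sec.basis_exists)
  have fA: "finite A0" using A0(4) V(3) by (simp add: card_ge_0_finite)
  obtain C where C: "C \<subseteq> canonical X X" "sec.independent C" "canonical X X \<subseteq> sec.span C" "card C = sec.dim (canonical X X)"
    by (rule sec.basis_exists)
  \<comment> \<open>The genus is the cardinality of the basis C, and a positive cardinality means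
    that C is finite.\<close>
  have fC: "finite C" using C(4) g by (simp add: genus_def card_ge_0_finite)
  obtain s0 where s0: "s0 \<in> A0" using A0(4) V(3) by (metis all_not_in_conv card.empty less_irrefl)
  have s0V: "s0 \<in> V" and s0n: "s0 \<noteq> 0" using s0 A0(1,2) sec.dependent_zero[of A0] by auto
  then have s0L: "s0 \<in> L X" using V(2) by blast
  let ?D = "zero_order s0"
  define S where "S = {p \<in> X. ?D p \<noteq> 0}"
  have fS: "finite S" unfolding S_def by (rule finite_supp_order[OF s0L s0n])
  define E where "E = (\<Sum>p\<in>S. replicate_mset (?D p) p)"
  have cE: "count E p = (if p \<in> S then ?D p else 0)" for p
  proof -
    have "count E p = (\<Sum>q\<in>S. if q = p then ?D p else 0)" unfolding E_def count_sum by (rule sum.cong) auto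
    then show ?thesis using fS by simp
  qed
  have cX: "count E p = ?D p" if "p \<in> X" for p using that by (simp add: cE S_def)
  have sE: "int (size E) = degree X 1 L"
    unfolding degree_eq[OF s0L s0n] E_def by (simp add: size_multiset_sum S_def)
  have EX: "set_mset E \<subseteq> X" using cE by (auto simp: S_def simp flip: count_greater_zero_iff split: if_splits)
  have "sections_poles V s0 E = V"
    unfolding sections_poles_def using cX V(2) reg_along_0 germ_coeff_reg by (auto intro!: vanish_0)
  with filtration_bound[OF V(1,2) s0V s0n fA A0(3) fC C(3) EX] cE
  have dim: "sec.dim V + genus X \<le> 1 + size E + sec.dim (differentials_zeros E)" by (auto simp: genus_def)
  obtain \<Omega> where \<Omega>: "\<Omega> \<subseteq> differentials_zeros E" "sec.independent \<Omega>" "card \<Omega> = sec.dim (differentials_zeros E)" by (rule sec.basis_exists)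
  have \<Omega>K: "\<Omega> \<subseteq> canonical X X" using \<Omega>(1) by (auto simp: differentials_zeros_def)
  have f\<Omega>: "finite \<Omega>" using sec.independent_span_bound[OF fC \<Omega>(2)] \<Omega>K C(3) by blast
  have hom: "quot_hom s0 \<omega> \<in> sheaf_hom X L (canonical X)" "quot_hom s0 \<omega> X s0 = \<omega>" if "\<omega> \<in> \<Omega>" for \<omega>
  proof -
    have "\<omega> \<in> differentials_zeros E" using \<Omega>(1) that by blast
    then have w: "\<omega> \<in> canonical X X" "\<And>p. p \<in> X \<Longrightarrow> vanish (along \<omega> p) (?D p)" by (auto simp: differentials_zeros_def cX)
    show "quot_hom s0 \<omega> \<in> sheaf_hom X L (canonical X)" "quot_hom s0 \<omega> X s0 = \<omega>"
      using quot_hom[OF s0L s0n w] by auto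
  qed
  have A0L: "a \<in> A0 \<Longrightarrow> a \<in> L X" for a using A0(1) V(2) by blast
  define v where "v = (\<lambda>(a, \<omega>). quot_hom s0 \<omega> X a)"
  have inj: "tensor_injective scale_sec scale_hom (L X) (sheaf_hom X L (canonical X)) (\<lambda>s \<phi>. \<phi> X s)"
    using petri L unfolding petri_def by blast
  have ind: "c i = 0" if c: "(\<Sum>i\<in>A0 \<times> \<Omega>. scale_sec (c i) (v i)) = 0" and i: "i \<in> A0 \<times> \<Omega>" for c i
  proof -
    obtain a \<omega> where i': "i = (a, \<omega>)" by (cases i)
    have "(\<Sum>(a, \<omega>)\<in>A0 \<times> \<Omega>. scale_sec (c (a, \<omega>)) (quot_hom s0 \<omega> X a)) = (\<Sum>i\<in>A0 \<times> \<Omega>. scale_sec (c i) (v i))"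
      by (rule sum.cong) (auto simp: v_def)
    then have 0: "(\<Sum>(a, \<omega>)\<in>A0 \<times> \<Omega>. scale_sec (c (a, \<omega>)) (quot_hom s0 \<omega> X a)) = 0" using c by simp
    show ?thesis unfolding i'
      by (rule tensor_injective_independent[OF inj fA A0(2) section_scale[OF A0L] f\<Omega> \<Omega>(2) hom quot_hom_scale[OF A0L] 0])
        (use i i' in auto)
  qed
  have fin: "finite (A0 \<times> \<Omega>)" using fA f\<Omega> by simp
  have fam: "inj_on v (A0 \<times> \<Omega>)" "sec.independent (v ` (A0 \<times> \<Omega>))"
    using independent_family[of "A0 \<times> \<Omega>" v] fin ind by (fastforce, fastforce)
  have "v ` (A0 \<times> \<Omega>) \<subseteq> canonical X X"
    using hom(1) A0L openin_X_self by (auto simp: v_def sheaf_hom_def)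
  then have "card (v ` (A0 \<times> \<Omega>)) \<le> card C"
    using sec.independent_span_bound[OF fC fam(2)] C(3) by blast
  then have "sec.dim V * sec.dim (differentials_zeros E) \<le> genus X"
    using card_image[OF fam(1)] A0(4) \<Omega>(3) C(4) by (simp add: card_cartesian_product genus_def)
  then have "int (sec.dim V) * int (sec.dim (differentials_zeros E)) \<le> int (genus X)" by (metis of_nat_le_iff of_nat_mult)
  moreover have "int (sec.dim V) - 1 - degree X 1 L + int (genus X) \<le> int (sec.dim (differentials_zeros E))"
    using dim sE by linarith
  ultimately show ?thesis by (meson mult_left_mono of_nat_0_le_iff order_trans)
qed

section \<open>Coherent systems of rank two\<close>

text \<open>Frames are defined by unique coordinates, so independence is uniqueness applied to the
  zero section.\<close>

lemma frame_independent:
  assumes "module_sheaf X E" "frame_on X E n U e" "openin (zariski X) V" "V \<subseteq> U"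
    and b: "\<And>i. i < n \<Longrightarrow> b i \<in> reg X V" "(\<Sum>i<n. smul (b i) (e i)) = 0" and z: "(\<lambda>_. 0) \<in> reg X V" and i: "i < n"
  shows "b i = (\<lambda>_. 0)"
proof -
  have z': "smul (\<lambda>_. 0) s = 0" for s :: "'a sec" by (simp add: smul_def zero_fun_def)
  from assms(2) have fr: "\<forall>V s. openin (zariski X) V \<and> V \<subseteq> U \<and> s \<in> E V \<longrightarrow>
      (\<exists>!a. a \<in> {..<n} \<rightarrow>\<^sub>E reg X V \<and> s = (\<Sum>i<n. smul (a i) (e i)))"
    unfolding frame_on_def by (rule conjunct2)
  have "\<exists>!a. a \<in> {..<n} \<rightarrow>\<^sub>E reg X V \<and> 0 = (\<Sum>i<n. smul (a i) (e i))"
    by (rule fr[rule_format]) (use assms(3,4) module_sheafD(1)[OF assms(1,3)] in blast)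
  then obtain a where a: "\<forall>b. b \<in> {..<n} \<rightarrow>\<^sub>E reg X V \<and> 0 = (\<Sum>i<n. smul (b i) (e i)) \<longrightarrow> b = a"
    by (rule ex1E)
  have B: "(\<lambda>i\<in>{..<n}. b i) \<in> {..<n} \<rightarrow>\<^sub>E reg X V \<and> 0 = (\<Sum>i<n. smul ((\<lambda>i\<in>{..<n}. b i) i) (e i))"
    using b by auto
  have C: "(\<lambda>i\<in>{..<n}. \<lambda>_. 0) \<in> {..<n} \<rightarrow>\<^sub>E reg X V \<and> 0 = (\<Sum>i<n. smul ((\<lambda>i\<in>{..<n}. \<lambda>_. 0) i) (e i))"
    using z by (simp add: z')
  have "(\<lambda>i\<in>{..<n}. b i) = (\<lambda>i\<in>{..<n}. \<lambda>_. 0)"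
    using a[THEN spec, THEN mp, OF B] a[THEN spec, THEN mp, OF C] by (rule trans[OF _ sym])
  then show ?thesis using i by (metis lessThan_iff restrict_apply')
qed

text \<open>Three frame sections of F would be combinations of two sections of E. Every relation
  between their coordinates is trivial by independence of the frame of F: the relation by minors
  shows that the minors vanish, this gives relations that make the coordinates of one section
  vanish, and a zero section cannot belong to a frame.\<close>

lemma (in projective_curve) rank_subsheaf_le_2:
  fixes E F :: "'i sheaf"
  assumes E: "vector_bundle X 2 E" and F: "vector_bundle X n F" and sub: "\<And>U. F U \<subseteq> E U"
  shows "n \<le> 2"
proof (rule ccontr)
  assume n: "\<not> n \<le> 2"
  obtain p where p: "p \<in> X" using infinite_X by (metis all_not_in_conv finite.emptyI)
  obtain U f where U: "openin (zariski X) U" "p \<in> U" "frame_on X F n U f"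
    using F p unfolding vector_bundle_def by blast
  obtain W e where W: "openin (zariski X) W" "p \<in> W" "frame_on X E 2 W e"
    using E p unfolding vector_bundle_def by blast
  have mE: "module_sheaf X E" and mF: "module_sheaf X F" using E F by (auto simp: vector_bundle_def)
  define V where "V = U \<inter> W"
  have V: "openin (zariski X) V" "V \<subseteq> U" "V \<subseteq> W" "p \<in> V" using U W by (auto simp: V_def)
  have VX: "V \<subseteq> X" using openin_subset[OF V(1)] by simp
  have "\<exists>x y. x \<in> reg X V \<and> y \<in> reg X V \<and> restr V (f i) = smul x (e 0) + smul y (e 1)" if "i < n" for i
  proof -
    have "f i \<in> F U" using U(3) that by (simp add: frame_on_def)
    then have "restr V (f i) \<in> E V" using module_sheafD(5)[OF mF U(1) V(1,2)] sub by blast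
    note rE = this
    from W(3) have fr: "\<forall>V s. openin (zariski X) V \<and> V \<subseteq> W \<and> s \<in> E V \<longrightarrow>
        (\<exists>!a. a \<in> {..<2} \<rightarrow>\<^sub>E reg X V \<and> s = (\<Sum>i<2. smul (a i) (e i)))"
      unfolding frame_on_def by (rule conjunct2)
    have "\<exists>!a. a \<in> {..<2} \<rightarrow>\<^sub>E reg X V \<and> restr V (f i) = (\<Sum>i<2. smul (a i) (e i))"
      by (rule fr[rule_format]) (use V(1,3) rE in blast)
    then obtain a where a: "a \<in> {..<2::nat} \<rightarrow>\<^sub>E reg X V" "restr V (f i) = (\<Sum>i<2. smul (a i) (e i))" by (elim ex1E conjE)
    have "a 0 \<in> reg X V" "a 1 \<in> reg X V" using PiE_mem[OF a(1)] by simp_all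
    moreover have "(\<Sum>i<2. smul (a i) (e i)) = smul (a 0) (e 0) + smul (a 1) (e 1)" by (simp add: numeral_2_eq_2)
    ultimately show ?thesis using a(2) by (intro exI[of _ "a 0"] exI[of _ "a 1"]) simp
  qed
  then have "\<forall>i. \<exists>xy. i < n \<longrightarrow> fst xy \<in> reg X V \<and> snd xy \<in> reg X V \<and> restr V (f i) = smul (fst xy) (e 0) + smul (snd xy) (e 1)"
    by (metis fst_conv snd_conv)
  then obtain xy where xy: "\<forall>i. i < n \<longrightarrow> fst (xy i) \<in> reg X V \<and> snd (xy i) \<in> reg X V \<and> restr V (f i) = smul (fst (xy i)) (e 0) + smul (snd (xy i)) (e 1)"
    by (rule choice[THEN exE])
  define x y where "x = (\<lambda>i. fst (xy i))" and "y = (\<lambda>i. snd (xy i))"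
  from xy have x: "\<And>i. i < n \<Longrightarrow> x i \<in> reg X V" and y: "\<And>i. i < n \<Longrightarrow> y i \<in> reg X V"
    and f: "\<And>i. i < n \<Longrightarrow> restr V (f i) = smul (x i) (e 0) + smul (y i) (e 1)"
    by (simp_all add: x_def y_def)
  have z: "(\<lambda>_. 0) \<in> reg X V" and one: "restr V (\<lambda>_. 1) \<in> reg X V"
    using restr_reg[OF V(1), of "\<lambda>_. 0"] restr_reg[OF V(1), of "\<lambda>_. 1"] reg_at_const VX by (auto simp: restr_def subset_iff)
  have r: "(\<lambda>q. a q * b q - c q * d q) \<in> reg X V" if "a \<in> reg X V" "b \<in> reg X V" "c \<in> reg X V" "d \<in> reg X V" for a b c d
    using that VX unfolding reg_iff[OF V(1)] by (auto intro!: reg_at_diff reg_at_mult)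
  have neg: "(\<lambda>q. - a q) \<in> reg X V" if "a \<in> reg X V" for a
  proof -
    have "(\<lambda>q. - a q) = (\<lambda>q. 0 * 0 - a q * restr V (\<lambda>_. 1) q)"
      using that by (auto simp: fun_eq_iff restr_def reg_def)
    then show ?thesis using r[OF z z that one] by (simp only:)
  qed
  \<comment> \<open>A relation between the coordinate pairs (x i, y i) for i = 0, 1, 2 is a relation
    between the sections f i; the remaining members of the frame get the coefficient 0.\<close>
  have key: "b0 = (\<lambda>_. 0) \<and> b1 = (\<lambda>_. 0) \<and> b2 = (\<lambda>_. 0)"
    if b: "b0 \<in> reg X V" "b1 \<in> reg X V" "b2 \<in> reg X V"
      and 1: "\<And>q. b0 q * x 0 q + b1 q * x 1 q + b2 q * x 2 q = 0"
      and 2: "\<And>q. b0 q * y 0 q + b1 q * y 1 q + b2 q * y 2 q = 0" for b0 b1 b2 :: "point \<Rightarrow> complex"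
  proof -
    define b' where "b' = (\<lambda>i::nat. if i = 0 then b0 else if i = 1 then b1 else if i = 2 then b2 else (\<lambda>_. 0))"
    have b'r: "b' i \<in> reg X V" for i using b z by (auto simp: b'_def)
    have "(\<Sum>i<n. smul (b' i) (f i)) = (\<Sum>i<3. smul (b' i) (f i))"
      by (rule sum.mono_neutral_right) (use n in \<open>auto simp: b'_def smul_def zero_fun_def\<close>)
    also have "\<dots> = smul b0 (f 0) + smul b1 (f 1) + smul b2 (f 2)"
      by (simp add: b'_def numeral_3_eq_3 numeral_2_eq_2)
    also have "\<dots> = 0"
    proof (intro ext)
      fix q j
      show "(smul b0 (f 0) + smul b1 (f 1) + smul b2 (f 2)) q j = 0 q j"
      proof (cases "q \<in> V")
        case True
        have fq: "f i q j = x i q * e 0 q j + y i q * e 1 q j" if "i < n" for i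
        proof -
          have "restr V (f i) q j = (smul (x i) (e 0) + smul (y i) (e 1)) q j" by (simp only: f[OF that])
          then show ?thesis using True by (simp add: restr_def smul_def)
        qed
        have "(smul b0 (f 0) + smul b1 (f 1) + smul b2 (f 2)) q j =
          (b0 q * x 0 q + b1 q * x 1 q + b2 q * x 2 q) * e 0 q j + (b0 q * y 0 q + b1 q * y 1 q + b2 q * y 2 q) * e 1 q j"
          using fq[of 0] fq[of 1] fq[of 2] n by (simp add: smul_def algebra_simps)
        then show ?thesis using 1[of q] 2[of q] by simp
      next
        case False
        then show ?thesis using b by (simp add: smul_def reg_def)
      qed
    qed
    finally have "b' i = (\<lambda>_. 0)" if "i < n" for i
      by (rule frame_independent[OF mF U(3) V(1,2) b'r _ z that])
    from this[of 0] this[of 1] this[of 2] show ?thesis using n by (simp add: b'_def)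
  qed
  \<comment> \<open>The minors are the coefficients of the Cramer relation between three vectors in
    a plane.\<close>
  define m where "m = (\<lambda>i j q. x i q * y j q - x j q * y i q)"
  have n': "0 < n" "1 < n" "2 < n" using n by auto
  have mr: "m i j \<in> reg X V" if "i < n" "j < n" for i j unfolding m_def by (intro r x y that)
  have "m 1 2 q * x 0 q + m 2 0 q * x 1 q + m 0 1 q * x 2 q = 0" "m 1 2 q * y 0 q + m 2 0 q * y 1 q + m 0 1 q * y 2 q = 0" for q
    by (simp_all add: m_def algebra_simps)
  from key[OF mr mr mr this] n' have "m 0 1 = (\<lambda>_. 0)" by blast
  then have m01: "x 0 q * y 1 q = x 1 q * y 0 q" for q by (simp add: m_def fun_eq_iff)
  have "x 1 q * x 0 q + - x 0 q * x 1 q + 0 * x 2 q = 0" "x 1 q * y 0 q + - x 0 q * y 1 q + 0 * y 2 q = 0" for q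
    using m01[of q] by simp_all
  from key[OF x neg[OF x] z this] n' have "(\<lambda>q. - x 0 q) = (\<lambda>_. 0)" by blast
  then have x0: "x 0 q = 0" for q by (simp add: fun_eq_iff)
  have "y 1 q * x 0 q + - y 0 q * x 1 q + 0 * x 2 q = 0" "y 1 q * y 0 q + - y 0 q * y 1 q + 0 * y 2 q = 0" for q
    using m01[of q] by (simp_all add: mult.commute)
  from key[OF y neg[OF y] z this] n' have "(\<lambda>q. - y 0 q) = (\<lambda>_. 0)" by blast
  then have y0: "y 0 q = 0" for q by (simp add: fun_eq_iff)
  have "restr V (\<lambda>_. 1) q * x 0 q + 0 * x 1 q + 0 * x 2 q = 0" "restr V (\<lambda>_. 1) q * y 0 q + 0 * y 1 q + 0 * y 2 q = 0" for q
    by (simp_all add: x0 y0)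
  from key[OF one z z this] have "restr V (\<lambda>_. 1) = (\<lambda>_. 0::complex)" by blast
  then show False using V(4) by (metis restr_def zero_neq_one)
qed

lemma slope_transfer:
  fixes \<alpha> \<alpha>0 :: real
  assumes "n' = 1 \<or> n' = (2::nat)" "k' \<le> k" and \<alpha>0: "\<alpha>0 > 0" "\<alpha>0 * (real k + 1) < 1" and \<alpha>: "\<alpha> > 0"
    and lt: "slope \<alpha>0 n' d' k' < slope \<alpha>0 2 d k"
    and dest: "n' = 1 \<Longrightarrow> \<alpha> * (real k + 1) < 1 \<or> 2 * k' \<le> k \<or> d \<le> 2 * d'"
  shows "slope \<alpha> n' d' k' < slope \<alpha> 2 d k"
proof -
  have kk: "\<alpha> * real k' \<le> \<alpha> * real k" "0 \<le> \<alpha>0 * real k'" "0 \<le> \<alpha>0 * real k" "0 \<le> \<alpha> * real k"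
    using assms by (auto intro: mult_left_mono)
  have a: "\<alpha>0 * real k + \<alpha>0 < 1" using \<alpha>0(2) by (simp add: distrib_left)
  from assms(1) show ?thesis
  proof
    assume n: "n' = 2"
    have lt': "of_int d' + \<alpha>0 * real k' < of_int d + \<alpha>0 * real k" using lt by (simp add: slope_def n field_simps)
    have "d' \<le> d"
    proof (rule ccontr)
      assume "\<not> d' \<le> d"
      then have "real_of_int d' \<ge> of_int d + 1" by linarith
      then show False using lt' kk a \<alpha>0 by linarith
    qed
    then consider "d' = d" | "real_of_int d' \<le> of_int d - 1" by linarith
    then have "of_int d' + \<alpha> * real k' < of_int d + \<alpha> * real k"
    proof cases
      case 1
      then have "k' < k" using lt' \<alpha>0(1) by simp
      then show ?thesis using 1 \<alpha> by simp
    next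
      case 2
      then show ?thesis using kk by linarith
    qed
    then show ?thesis by (simp add: slope_def n field_simps)
  next
    assume n: "n' = 1"
    have lt': "2 * of_int d' + \<alpha>0 * (2 * real k') < of_int d + \<alpha>0 * real k" using lt by (simp add: slope_def n field_simps)
    have "2 * d' \<le> d"
    proof (rule ccontr)
      assume "\<not> 2 * d' \<le> d"
      then have "2 * real_of_int d' \<ge> of_int d + 1" by linarith
      then show False using lt' kk a \<alpha>0 by linarith
    qed
    then consider "2 * d' = d" | "2 * real_of_int d' \<le> of_int d - 1" by linarith
    then have "2 * of_int d' + \<alpha> * (2 * real k') < of_int d + \<alpha> * real k"
    proof cases
      case 1
      then have d: "2 * real_of_int d' = of_int d" by linarith
      then have "\<alpha>0 * (2 * real k') < \<alpha>0 * real k" using lt' by linarith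
      then have "2 * real k' < real k" using \<alpha>0(1) by simp
      then have "\<alpha> * (2 * real k') < \<alpha> * real k" using \<alpha> by simp
      then show ?thesis using d by linarith
    next
      case 2
      then have "\<not> d \<le> 2 * d'" by linarith
      then consider "\<alpha> * (real k + 1) < 1" | "2 * k' \<le> k" using dest[OF n] by blast
      then show ?thesis
      proof cases
        case 1
        then have "\<alpha> * real k < 1" using \<alpha> by (simp add: distrib_left)
        moreover have "\<alpha> * (2 * real k') \<le> \<alpha> * real k + \<alpha> * real k" using kk(1) by simp
        ultimately show ?thesis using 2 by linarith
      next
        case 2
        then have "\<alpha> * (2 * real k') \<le> \<alpha> * real k" using \<alpha> by (intro mult_left_mono) linarith+
        then show ?thesis using \<open>2 * real_of_int d' \<le> of_int d - 1\<close> by linarith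
      qed
    qed
    then show ?thesis by (simp add: slope_def n field_simps)
  qed
qed

text \<open>The origin of 4g/(s + 2). With t = 2g/(s + 2) the hypotheses give k' >= (s + 3)/2 and k'
  - 1 - d' + g > 1/2 + t, while (s + 2)/2 times t is already g.\<close>

lemma degree_bound_contradiction:
  fixes d d' :: int
  assumes d: "real_of_int d < real s + 2 * real g - 4 * real g / (real s + 2)"
    and bound: "int k' * (int k' - 1 - d' + int g) \<le> int g"
    and k': "s + 2 < 2 * k'" and d': "2 * d' < d"
  shows False
proof -
  have 1: "2 * real k' \<ge> real s + 3" using k' by linarith
  have 2: "2 * real_of_int d' < real s + 2 * real g - 4 * real g / (real s + 2)" using d d' by linarith
  define t where "t = 2 * real g / (real s + 2)"
  have t: "t * (real s + 2) = 2 * real g" "t \<ge> 0" by (auto simp: t_def)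
  have 3: "real k' - 1 - real_of_int d' + real g > 1 / 2 + t" using 1 2 by (simp add: t_def)
  have "real_of_int (int k' * (int k' - 1 - d' + int g)) \<le> real g" using bound by (metis of_int_le_iff of_int_of_nat_eq)
  then have 4: "real k' * (real k' - 1 - real_of_int d' + real g) \<le> real g" by simp
  have "real k' * (1 / 2 + t) < real k' * (real k' - 1 - real_of_int d' + real g)"
    using 3 1 by (intro mult_strict_left_mono) auto
  moreover have "(real s + 2) / 2 * t \<le> real k' * (1 / 2 + t)"
    using 1 t(2) by (intro mult_mono) auto
  moreover have "(real s + 2) / 2 * t = real g" using t(1) by (simp add: field_simps)
  ultimately show False using 4 by linarith
qed

text \<open>A positive k shows that V is finite-dimensional, since \<open>sec.dim\<close> is 0 on
  infinite-dimensional spaces; dimensions are then monotone.\<close>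

lemma coherent_subsystem_dim_le:
  assumes "coherent_system X n d k (E, V)" "coherent_system X n' d' k' (F, W)" "W \<subseteq> V" "k > 0"
  shows "k' \<le> k"
proof -
  obtain B where B: "B \<subseteq> V" "sec.independent B" "V \<subseteq> sec.span B" "card B = sec.dim V" by (rule sec.basis_exists)
  have "finite B" using B(4) assms(1,4) by (simp add: coherent_system_def card_ge_0_finite)
  then show ?thesis using dim_mono_finite[OF assms(3) _ B(3)] assms(1,2) by (simp add: coherent_system_def)
qed

text \<open>The condition \<open>line\<close> concerns all rank one systems, whether or not they lie
  in (E, V), because the Petri bound does not refer to E.\<close>

lemma (in projective_curve) stable_transfer:
  fixes \<alpha> \<alpha>0 :: real
  assumes st: "stable X \<alpha>0 2 d k (E, V)" and k: "k > 0" and \<alpha>0: "\<alpha>0 > 0" "\<alpha>0 * (real k + 1) < 1" and \<alpha>: "\<alpha> > 0"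
    and line: "\<And>d' k' F W. coherent_system X 1 d' k' (F, W) \<Longrightarrow>
      \<alpha> * (real k + 1) < 1 \<or> 2 * k' \<le> k \<or> d \<le> 2 * d'"
  shows "stable X \<alpha> 2 d k (E, V)"
proof -
  have cs: "coherent_system X 2 d k (E, V)" using st by (simp add: stable_def)
  have "slope \<alpha> n' d' k' < slope \<alpha> 2 d k"
    if sub: "coherent_system X n' d' k' (F, W)" "n' \<noteq> 0" "\<forall>U. F U \<subseteq> E U" "W \<subseteq> V" "(F, W) \<noteq> (E, V)" for n' d' k' F W
  proof (rule slope_transfer[OF _ _ \<alpha>0 \<alpha>])
    have "vector_bundle X 2 E" "vector_bundle X n' F" using cs sub(1) by (auto simp: coherent_system_def)
    from rank_subsheaf_le_2[OF this] sub(2,3) show "n' = 1 \<or> n' = 2" by fastforce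
    show "k' \<le> k" by (rule coherent_subsystem_dim_le[OF cs sub(1,4) k])
    have "\<forall>n' d' k' F W. coherent_system X n' d' k' (F, W) \<and> n' \<noteq> 0 \<and>
        (\<forall>U. F U \<subseteq> E U) \<and> W \<subseteq> V \<and> (F, W) \<noteq> (E, V) \<longrightarrow> slope \<alpha>0 n' d' k' < slope \<alpha>0 2 d k"
      using st by (simp add: stable_def)
    then show "slope \<alpha>0 n' d' k' < slope \<alpha>0 2 d k" using sub by blast
    show "\<alpha> * (real k + 1) < 1 \<or> 2 * k' \<le> k \<or> d \<le> 2 * d'" if "n' = 1" using line sub(1) that by blast
  qed
  then have "\<forall>n' d' k' F W. coherent_system X n' d' k' (F, W) \<and> n' \<noteq> 0 \<and>
      (\<forall>U. F U \<subseteq> E U) \<and> W \<subseteq> V \<and> (F, W) \<noteq> (E, V) \<longrightarrow> slope \<alpha> n' d' k' < slope \<alpha> 2 d k" by blast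
  then show ?thesis using cs by (simp add: stable_def)
qed

text \<open>Between 0 and 1/(k + 1) stability does not depend on the parameter, so the definite
  description in \<open>moduli_0\<close> denotes the moduli space at any such \<alpha>.\<close>

lemma (in projective_curve) moduli_0_eq:
  assumes k: "k > 0" and \<alpha>: "\<alpha> > 0" "\<alpha> * (real k + 1) < 1"
  shows "moduli_0 X 2 d k = moduli X \<alpha> 2 d k"
proof -
  have st: "stable X \<beta> 2 d k A" if "stable X \<beta>' 2 d k A" "\<beta>' > 0" "\<beta>' * (real k + 1) < 1" "\<beta> > 0" "\<beta> * (real k + 1) < 1" for \<beta> \<beta>' A
    using stable_transfer[of \<beta>' d k "fst A" "snd A" \<beta>] that k by simp
  have eq: "moduli X \<beta> 2 d k = moduli X \<alpha> 2 d k" if "\<beta> > 0" "\<beta> * (real k + 1) < 1" for \<beta>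
  proof -
    have "stable X \<beta> 2 d k A \<longleftrightarrow> stable X \<alpha> 2 d k A" for A using st that \<alpha> by blast
    then show ?thesis by (simp add: moduli_def)
  qed
  have "\<forall>\<^sub>F \<beta> in at_right 0. \<beta> > 0 \<and> \<beta> * (real k + 1) < 1"
    unfolding eventually_at_right_field by (intro exI[of _ "1 / (real k + 1)"]) (auto simp: field_simps)
  then have ev: "\<forall>\<^sub>F \<beta> in at_right 0. moduli X \<beta> 2 d k = moduli X \<alpha> 2 d k"
    by eventually_elim (use eq in blast)
  show ?thesis unfolding moduli_0_def
  proof (rule the_equality[where P = "\<lambda>S. \<forall>\<^sub>F \<beta> in at_right 0. moduli X \<beta> 2 d k = S", OF ev])
    fix S assume "\<forall>\<^sub>F \<beta> in at_right 0. moduli X \<beta> 2 d k = S"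
    \<comment> \<open>\<open>at_right 0\<close> is a proper filter, so two values that are both
      attained eventually must agree.\<close>
    with ev have "\<forall>\<^sub>F \<beta> in at_right (0::real). S = moduli X \<alpha> 2 d k" by eventually_elim simp
    then show "S = moduli X \<alpha> 2 d k" by simp
  qed
qed

lemma moduli_nonempty_iff: "moduli X \<alpha> n d k \<noteq> {} \<longleftrightarrow> (\<exists>A. stable X \<alpha> n d k A)"
  unfolding moduli_def by (auto simp: quotient_is_empty)

theorem theorem8:
  fixes X :: "point set" and g s :: nat and d :: int
  assumes "smooth_projective_curve X" and "genus X = g" and "g \<ge> 2" and "petri X"
    and "s \<ge> 3"
    and "real_of_int d < real s + 2 * real g - 4 * real g / (real s + 2)"
    and "moduli_0 X 2 d (2 + s) \<noteq> {}"
  shows "(\<forall>\<alpha>>0. moduli X \<alpha> 2 d (2 + s) \<noteq> {}) \<and> stable_all X 2 d (2 + s) \<noteq> {}"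
proof -
  obtain N where "projective_curve X N"
    using assms(1) unfolding smooth_projective_curve_def projective_variety_def projective_curve_def by blast
  then interpret projective_curve X N .
  \<comment> \<open>Any positive value below 1/(k + 1) with k = s + 2 would serve.\<close>
  define \<alpha>0 where "\<alpha>0 = 1 / (real (2 + s) + 2)"
  have \<alpha>0: "\<alpha>0 > 0" "\<alpha>0 * (real (2 + s) + 1) < 1" by (auto simp: \<alpha>0_def field_simps)
  have "moduli_0 X 2 d (2 + s) = moduli X \<alpha>0 2 d (2 + s)" by (rule moduli_0_eq[OF _ \<alpha>0]) simp
  then have "moduli X \<alpha>0 2 d (2 + s) \<noteq> {}" using assms(7) by metis
  then obtain E V where st: "stable X \<alpha>0 2 d (2 + s) (E, V)" by (auto simp: moduli_nonempty_iff)
  have line: "2 * k' \<le> 2 + s \<or> d \<le> 2 * d'" if c: "coherent_system X 1 d' k' (F, W)" for d' k' F W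
  proof (rule ccontr)
    assume neg: "\<not> (2 * k' \<le> 2 + s \<or> d \<le> 2 * d')"
    have W: "vector_bundle X 1 F" "degree X 1 F = d'" "sec.subspace W" "W \<subseteq> F X" "sec.dim W = k'"
      using c by (auto simp: coherent_system_def)
    \<comment> \<open>The Petri bound is applied to a nonzero space of sections; the assumption 2 k'
      > s + 2 provides this.\<close>
    have "int (sec.dim W) * (int (sec.dim W) - 1 - degree X 1 F + int (genus X)) \<le> int (genus X)"
      by (rule petri_bound[OF W(1) assms(4) _ W(3,4)]) (use assms(2,3) W(5) neg in auto)
    then have "int k' * (int k' - 1 - d' + int g) \<le> int g" unfolding W(2,5) assms(2) .
    from degree_bound_contradiction[OF assms(6) this] neg show False by simp
  qed
  \<comment> \<open>The system (E, V) was fixed before \<alpha>, so the same one serves every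
    \<alpha> and both conclusions follow.\<close>
  have "stable X \<alpha> 2 d (2 + s) (E, V)" if "\<alpha> > 0" for \<alpha>
    by (rule stable_transfer[OF st _ \<alpha>0 that]) (use line in auto)
  then show ?thesis by (auto simp: moduli_nonempty_iff stable_all_def)
qed

end
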